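(* Assume that $X$ has a continuous distribution (no atoms), that $f_1,\dots,f_d$ are bounded, and that $\operatorname{Var}(Y^k)>0$ for $k=1,\dots,d$. Define for $k=1,\dots,d$ $$\Delta_n(f_k):=\mathbb E\left[\left(\varphi_k(X_1)-\varphi_k(X_{N_n(1)})\right)^2\right]=\frac1n\,\mathbb E\left[\sum_{i=1}^n\left(\varphi_k(X_{\sigma_n(i-1)})-\varphi_k(X_{\sigma_n(i)})\right)^2\right].$$ Then the following convergence in law to a Gaussian vector holds: $$\left(\sqrt n\left[\widehat\rho_n^{\mathrm{Sobol'}}(f_k)-\left(\rho^{\mathrm{Sobol'}}(f_k)-\frac{\Delta_n(f_k)}{2\operatorname{Var}(Y^k)}\right)\right]\right)_{k=1,\dots,d}\xrightarrow{\ \mathcal L\ }\mathcal N(0,\Gamma^d),$$ where $\Gamma^d=(\Gamma^d_{k,\ell})_{1\le k,\ell\le d}$ with $$\Gamma^d_{k,\ell}:=v(f_k)^\top\left[\Sigma_0(f_k,f_\ell)+\Sigma_1(f_k,f_\ell)\right]v(f_\ell),$$ $$v(f_j):=\frac1{\operatorname{Var}(f_j(X,\varepsilon))}\begin{pmatrix}1\\ 2\,\mathbb E[f_j(X,\varepsilon)](\rho^{\mathrm{Sobol'}}(f_j)-1)\\ -\rho^{\mathrm{Sobol'}}(f_j)\end{pmatrix}.$$ In particular, if $\lim_{n\to\infty}\sqrt n\,\Delta_n(f_k)=0$ for all $k=1,\dots,d$, then $$\left(\sqrt n\left[\widehat\rho_n^{\mathrm{Sobol'}}(f_k)-\rho^{\mathrm{Sobol'}}(f_k)\right]\right)_{k=1,\dots,d}\xrightarrow{\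 \mathcal L\ }\mathcal N(0,\Gamma^d).$$ The condition $\lim_{n\to\infty}\sqrt n\,\Delta_n(f_k)=0$ for all $k$ is implied, for example, by $\varphi_k$ having bounded $2$-variation for all $k=1,\dots,d$.
   Context: Model: $X$ and $\varepsilon$ are independent real random variables, $f_1,\dots,f_d:\mathbb R\times\mathbb R\to\mathbb R$ are measurable, and $Y=(Y^1,\dots,Y^d)=(f_1(X,\varepsilon),\dots,f_d(X,\varepsilon))$. Let $(X_i)_{i\ge1}$ be i.i.d. copies of $X$ and $(\varepsilon_i)_{i\ge1}$ i.i.d. copies of $\varepsilon$, the two sequences being independent, and $Y_i^k=f_k(X_i,\varepsilon_i)$. $\mathbb E_\varepsilon$ and $\operatorname{Cov}_\varepsilon$ denote expectation and covariance with respect to $\varepsilon$ only, with $X$ (or $x$) held fixed. Set $\varphi_k(x):=\mathbb E_\varepsilon[f_k(x,\varepsilon)]=\mathbb E[Y^k\mid X=x]$. Ranks: almost surely there is a unique permutation $\sigma_n$ of $\{1,\dots,n\}$ with $X_{\sigma_n(1)}<\cdots<X_{\sigma_n(n)}$. It is extended $n$-periodically, so $\sigma_n(0)=\sigma_n(n)$ and $\sigma_n(n+1)=\sigma_n(1)$. For $j\in\{1,\dots,n\}$, $N_n(j):=\sigma_n(\sigma_n^{-1}(j)+1)$ where $\sigma_n^{-1}(j)\in\{1,\dots,n\}$: the index of the right neighbour of $X_j$, the successor of the largest observation being the smallest one. Sobol' indices and rank estimators: for $k=1,\dots,d$, $$\rho^{\mathrm{Sobol'}}(f_k):=\frac{\mathbb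 E\left[\mathbb E[f_k(X,\varepsilon)\mid X]^2\right]-\mathbb E[f_k(X,\varepsilon)]^2}{\mathbb E[f_k^2(X,\varepsilon)]-\mathbb E[f_k(X,\varepsilon)]^2},\qquad \widehat\rho_n^{\mathrm{Sobol'}}(f_k):=\frac{\frac1n\sum_{i=1}^nY_i^kY_{N_n(i)}^k-\left(\frac1n\sum_{i=1}^nY_i^k\right)^2}{\frac1n\sum_{i=1}^n(Y_i^k)^2-\left(\frac1n\sum_{i=1}^nY_i^k\right)^2}.$$ Matrices: for bounded measurable $f,g:\mathbb R\times\mathbb R\to\mathbb R$ define the $3\times3$ matrices $$\Sigma_0(f,g):=\operatorname{Cov}\left(\begin{pmatrix}\mathbb E_\varepsilon[f(X,\varepsilon)]^2\\ \mathbb E_\varepsilon[f(X,\varepsilon)]\\ \mathbb E_\varepsilon[f^2(X,\varepsilon)]\end{pmatrix},\begin{pmatrix}\mathbb E_\varepsilon[g(X,\varepsilon)]^2\\ \mathbb E_\varepsilon[g(X,\varepsilon)]\\ \mathbb E_\varepsilon[g^2(X,\varepsilon)]\end{pmatrix}\right),$$ $$\Sigma_a(X,f,g):=\begin{pmatrix}2\mathbb E_\varepsilon[f(X,\varepsilon)]\\ 1\\ 1\end{pmatrix}\begin{pmatrix}2\mathbb E_\varepsilon[g(X,\varepsilon)]\\ 1\\ 1\end{pmatrix}^\top+\operatorname{Cov}_\varepsilon[f(X,\varepsilon),g(X,\varepsilon)]\begin{pmatrix}1\\ 0\\ 0\end{pmatrix}\begin{pmatrix}1\\ 0\\ 0\end{pmatrix}^\top,$$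 $$\Sigma_b(X,f,g):=\operatorname{Cov}_\varepsilon\left(\begin{pmatrix} f(X,\varepsilon)\\ f(X,\varepsilon)\\ f^2(X,\varepsilon)\end{pmatrix},\begin{pmatrix} g(X,\varepsilon)\\ g(X,\varepsilon)\\ g^2(X,\varepsilon)\end{pmatrix}\right),\qquad \Sigma_1(f,g):=\mathbb E\left[\Sigma_a(X,f,g)\odot\Sigma_b(X,f,g)\right],$$ where $\odot$ is the entrywise (Hadamard) product and $\operatorname{Cov}(U,V)$ of two vectors is the matrix $(\operatorname{Cov}(U_i,V_j))_{i,j}$. A function $\varphi:\mathbb R\to\mathbb R$ has bounded $2$-variation if $\sup\sum_{i}(\varphi(x_{i+1})-\varphi(x_i))^2<\infty$, the supremum being over all finite increasing sequences $x_1<\cdots<x_m$. $\xrightarrow{\mathcal L}$ denotes convergence in law; Gaussian laws may be degenerate. *)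

theory Defs
  imports "HOL-Probability.Probability"
begin

definition cov :: "'a measure \<Rightarrow> ('a \<Rightarrow> real) \<Rightarrow> ('a \<Rightarrow> real) \<Rightarrow> real" where
  "cov M U V =
    (\<integral>\<omega>. (U \<omega> - (\<integral>\<omega>'. U \<omega>' \<partial>M)) * (V \<omega> - (\<integral>\<omega>'. V \<omega>' \<partial>M)) \<partial>M)"

definition var :: "'a measure \<Rightarrow> ('a \<Rightarrow> real) \<Rightarrow> real" where
  "var M U = (\<integral>\<omega>. (U \<omega> - (\<integral>\<omega>'. U \<omega>' \<partial>M))\<^sup>2 \<partial>M)"

definition cov_matrix ::
  "'a measure \<Rightarrow> ('a \<Rightarrow> real ^ 'm) \<Rightarrow> ('a \<Rightarrow> real ^ 'n) \<Rightarrow> real ^ 'n ^ 'm" where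
  "cov_matrix M U V = (\<chi> i j. cov M (\<lambda>\<omega>. U \<omega> $ i) (\<lambda>\<omega>. V \<omega> $ j))"

definition outer :: "real ^ 'm \<Rightarrow> real ^ 'n \<Rightarrow> real ^ 'n ^ 'm" where
  "outer u v = (\<chi> i j. u $ i * v $ j)"

definition hadamard :: "real ^ 'n ^ 'm \<Rightarrow> real ^ 'n ^ 'm \<Rightarrow> real ^ 'n ^ 'm" where
  "hadamard A B = (\<chi> i j. A $ i $ j * B $ i $ j)"

text \<open>
  The normal law with mean \<open>m\<close> and covariance matrix \<open>C\<close>, given by its characteristic function.
  \<open>C\<close> may be singular, so degenerate laws are included; positive semidefiniteness of \<open>C\<close> is
  forced because a characteristic function is bounded by 1, whereas symmetry has to be required,
  since only the symmetric part of \<open>C\<close> enters the formula.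
\<close>

definition gaussian_law :: "(real ^ 'd) measure \<Rightarrow> real ^ 'd \<Rightarrow> real ^ 'd ^ 'd \<Rightarrow> bool" where
  "gaussian_law N m C \<longleftrightarrow>
     prob_space N \<and> sets N = sets borel \<and> transpose C = C \<and>
     (\<forall>t. (CLINT y|N. exp (\<i> * complex_of_real (t \<bullet> y))) =
        exp (\<i> * complex_of_real (t \<bullet> m) - complex_of_real (t \<bullet> (C *v t)) / 2))"

definition conv_in_law ::
  "'a measure \<Rightarrow> (nat \<Rightarrow> 'a \<Rightarrow> 'b::topological_space) \<Rightarrow> 'b measure \<Rightarrow> bool" where
  "conv_in_law M Z N \<longleftrightarrow>
     (\<forall>n. Z n \<in> borel_measurable M) \<and>
     (\<forall>g::'b \<Rightarrow> real. continuous_on UNIV g \<and> bounded (range g) \<longrightarrow>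
        (\<lambda>n. \<integral>\<omega>. g (Z n \<omega>) \<partial>M) \<longlonglongrightarrow> (\<integral>y. g y \<partial>N))"

definition bounded_2_variation :: "(real \<Rightarrow> real) \<Rightarrow> bool" where
  "bounded_2_variation \<phi> \<longleftrightarrow>
     bdd_above {\<Sum>i=1..<m. (\<phi> (x (Suc i)) - \<phi> (x i))\<^sup>2 | (m::nat) (x::nat \<Rightarrow> real).
       strict_mono_on {1..m} x}"

text \<open>
  Samples are functions on \<open>nat\<close>, of which the values at \<open>1, \<dots>, n\<close> are used.
  If there is a tie among them, no permutation sorts the sample strictly, and \<open>rank_perm\<close> is
  set to the identity.
\<close>

definition sorts :: "nat \<Rightarrow> (nat \<Rightarrow> real) \<Rightarrow> (nat \<Rightarrow> nat) \<Rightarrow> bool" where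
  "sorts n x \<sigma> \<longleftrightarrow> \<sigma> permutes {1..n} \<and> (\<forall>i\<in>{1..<n}. x (\<sigma> i) < x (\<sigma> (Suc i)))"

definition rank_perm :: "nat \<Rightarrow> (nat \<Rightarrow> real) \<Rightarrow> nat \<Rightarrow> nat" where
  "rank_perm n x = (if \<exists>\<sigma>. sorts n x \<sigma> then (THE \<sigma>. sorts n x \<sigma>) else id)"

text \<open>The \<open>n\<close>-periodic extension to all indices, with \<open>1, \<dots>, n\<close> as the base period.\<close>

definition periodic_ext :: "nat \<Rightarrow> (nat \<Rightarrow> nat) \<Rightarrow> nat \<Rightarrow> nat" where
  "periodic_ext n \<sigma> i = \<sigma> (Suc ((i + n - 1) mod n))"

lemma periodic_ext_base: "i \<in> {1..n} \<Longrightarrow> periodic_ext n \<sigma> i = \<sigma> i"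
  by (cases i) (auto simp: periodic_ext_def)

lemma periodic_ext_ends:
  assumes "n \<ge> 1"
  shows "periodic_ext n \<sigma> 0 = \<sigma> n" "periodic_ext n \<sigma> (n + 1) = \<sigma> 1"
  using assms by (auto simp: periodic_ext_def)

definition right_nb :: "nat \<Rightarrow> (nat \<Rightarrow> real) \<Rightarrow> nat \<Rightarrow> nat" where
  "right_nb n x j = periodic_ext n (rank_perm n x) (inv (rank_perm n x) j + 1)"

definition sobol ::
  "'a measure \<Rightarrow> ('a \<Rightarrow> real) \<Rightarrow> ('a \<Rightarrow> real) \<Rightarrow> (real \<Rightarrow> real \<Rightarrow> real) \<Rightarrow> real" where
  "sobol M X \<epsilon> f =
     ((\<integral>\<omega>. (real_cond_exp M (vimage_algebra (space M) X borel)
                (\<lambda>\<omega>. f (X \<omega>) (\<epsilon> \<omega>)) \<omega>)\<^sup>2 \<partial>M)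
        - (\<integral>\<omega>. f (X \<omega>) (\<epsilon> \<omega>) \<partial>M)\<^sup>2)
     / ((\<integral>\<omega>. (f (X \<omega>) (\<epsilon> \<omega>))\<^sup>2 \<partial>M) - (\<integral>\<omega>. f (X \<omega>) (\<epsilon> \<omega>) \<partial>M)\<^sup>2)"

text \<open>The estimator as a function of realised samples \<open>x\<close> and \<open>e\<close> of the two inputs.\<close>

definition sobol_hat ::
  "nat \<Rightarrow> (real \<Rightarrow> real \<Rightarrow> real) \<Rightarrow> (nat \<Rightarrow> real) \<Rightarrow> (nat \<Rightarrow> real) \<Rightarrow> real" where
  "sobol_hat n f x e =
     (let y = (\<lambda>i. f (x i) (e i)) in
       (1 / real n * (\<Sum>i=1..n. y i * y (right_nb n x i)) - (1 / real n * (\<Sum>i=1..n. y i))\<^sup>2)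
       / (1 / real n * (\<Sum>i=1..n. (y i)\<^sup>2) - (1 / real n * (\<Sum>i=1..n. y i))\<^sup>2))"

text \<open>Expectation over \<open>\<epsilon>\<close> only, the first argument of \<open>f\<close> being held fixed.\<close>

definition mean_eps :: "'a measure \<Rightarrow> ('a \<Rightarrow> real) \<Rightarrow> (real \<Rightarrow> real \<Rightarrow> real) \<Rightarrow> real \<Rightarrow> real" where
  "mean_eps M \<epsilon> f x = (\<integral>\<omega>. f x (\<epsilon> \<omega>) \<partial>M)"

definition Delta :: "'a measure \<Rightarrow> (nat \<Rightarrow> 'a \<Rightarrow> real) \<Rightarrow> (real \<Rightarrow> real) \<Rightarrow> nat \<Rightarrow> real" where
  "Delta M Xs \<phi> n =
     (\<integral>\<omega>. (\<phi> (Xs 1 \<omega>) - \<phi> (Xs (right_nb n (\<lambda>i. Xs i \<omega>) 1) \<omega>))\<^sup>2 \<partial>M)"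

definition Sigma0 ::
  "'a measure \<Rightarrow> ('a \<Rightarrow> real) \<Rightarrow> ('a \<Rightarrow> real) \<Rightarrow>
     (real \<Rightarrow> real \<Rightarrow> real) \<Rightarrow> (real \<Rightarrow> real \<Rightarrow> real) \<Rightarrow> real ^ 3 ^ 3" where
  "Sigma0 M X \<epsilon> f g =
     (let u = (\<lambda>h \<omega>. vector [(mean_eps M \<epsilon> h (X \<omega>))\<^sup>2, mean_eps M \<epsilon> h (X \<omega>),
                          mean_eps M \<epsilon> (\<lambda>x e. (h x e)\<^sup>2) (X \<omega>)])
      in cov_matrix M (u f) (u g))"

definition Sigma_a ::
  "'a measure \<Rightarrow> ('a \<Rightarrow> real) \<Rightarrow> real \<Rightarrow>
     (real \<Rightarrow> real \<Rightarrow> real) \<Rightarrow> (real \<Rightarrow> real \<Rightarrow> real) \<Rightarrow> real ^ 3 ^ 3" where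
  "Sigma_a M \<epsilon> x f g =
     outer (vector [2 * mean_eps M \<epsilon> f x, 1, 1]) (vector [2 * mean_eps M \<epsilon> g x, 1, 1])
     + cov M (\<lambda>\<omega>. f x (\<epsilon> \<omega>)) (\<lambda>\<omega>. g x (\<epsilon> \<omega>)) *\<^sub>R outer (vector [1, 0, 0]) (vector [1, 0, 0])"

definition Sigma_b ::
  "'a measure \<Rightarrow> ('a \<Rightarrow> real) \<Rightarrow> real \<Rightarrow>
     (real \<Rightarrow> real \<Rightarrow> real) \<Rightarrow> (real \<Rightarrow> real \<Rightarrow> real) \<Rightarrow> real ^ 3 ^ 3" where
  "Sigma_b M \<epsilon> x f g =
     (let u = (\<lambda>h \<omega>. vector [h x (\<epsilon> \<omega>), h x (\<epsilon> \<omega>), (h x (\<epsilon> \<omega>))\<^sup>2])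
      in cov_matrix M (u f) (u g))"

definition Sigma1 ::
  "'a measure \<Rightarrow> ('a \<Rightarrow> real) \<Rightarrow> ('a \<Rightarrow> real) \<Rightarrow>
     (real \<Rightarrow> real \<Rightarrow> real) \<Rightarrow> (real \<Rightarrow> real \<Rightarrow> real) \<Rightarrow> real ^ 3 ^ 3" where
  "Sigma1 M X \<epsilon> f g =
     (\<chi> i j. \<integral>\<omega>. hadamard (Sigma_a M \<epsilon> (X \<omega>) f g) (Sigma_b M \<epsilon> (X \<omega>) f g) $ i $ j \<partial>M)"

definition v_vec ::
  "'a measure \<Rightarrow> ('a \<Rightarrow> real) \<Rightarrow> ('a \<Rightarrow> real) \<Rightarrow> (real \<Rightarrow> real \<Rightarrow> real) \<Rightarrow> real ^ 3" where
  "v_vec M X \<epsilon> f =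
     (1 / var M (\<lambda>\<omega>. f (X \<omega>) (\<epsilon> \<omega>))) *\<^sub>R
       vector [1,
               2 * (\<integral>\<omega>. f (X \<omega>) (\<epsilon> \<omega>) \<partial>M) * (sobol M X \<epsilon> f - 1),
               - sobol M X \<epsilon> f]"

definition Gamma_mat ::
  "'a measure \<Rightarrow> ('a \<Rightarrow> real) \<Rightarrow> ('a \<Rightarrow> real) \<Rightarrow> ('d \<Rightarrow> real \<Rightarrow> real \<Rightarrow> real) \<Rightarrow>
     real ^ 'd ^ 'd" where
  "Gamma_mat M X \<epsilon> f =
     (\<chi> k l. v_vec M X \<epsilon> (f k) \<bullet>
        ((Sigma0 M X \<epsilon> (f k) (f l) + Sigma1 M X \<epsilon> (f k) (f l)) *v v_vec M X \<epsilon> (f l)))"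

end

(* Write phi for the conditional mean and c = f - phi for the centred noise.  The product of two
   neighbouring outputs is 2 phi f - phi^2 at the left point, plus the product of the two noises, minus
   half of the squared increment of phi, up to terms whose sum is negligible in L2.  The sum of squared
   increments concentrates around n Delta_n by the Efron-Stein inequality, since removing one point
   changes it boundedly, and Delta_n tends to 0 by approximating phi in L2 by combinations of indicators.  The
   estimator is thus, by the delta method, a sum of an i.i.d. part and of products of neighbouring noises.

   Given all X_i, the noises are independent and each summand involves two consecutive points of the
   cycle of right neighbours, so the centred sum is a martingale along the cycle, cut open at an error
   O(1 / sqrt n).  Its characteristic function is compared with the exponential of the predictable
   variance, which converges in L2 by a law of large numbers.  The remaining sum of functions of X_i
   is treated in the same way, and the two limits multiply because the conditional one is constant. *)
theory Submission
  imports Defs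
begin

section \<open>The Efron-Stein inequality\<close>

text \<open>The gap tends to 0 without a rate, so its mean cannot be discarded and stays as the
  bias; only its fluctuation has to vanish. Deleting a point of the cycle changes the sum of squared
  increments by twice a product of two adjacent increments, whose square is at most a constant times
  one squared increment. The variance is therefore of the order of the mean,
  \<open>n * nb_gap\<close>, which is o(n) with no rate at all; the cross terms between noise and
  increments of phi obey the same bound.

  The noise of each point is charged to the step that enters it: given the noise on the left, a step
  is centred in the noise on the right, and its conditional variance involves only the left noise
  and the two inputs. As neighbouring inputs merge, a product of two neighbouring noises contributes
  a squared conditional covariance, the corner entry of \<open>Sigma_a\<close>; it is asymptotically
  uncorrelated with the additive part because its left factor has mean zero.

  Linear combinations reduce joint normality to one scalar statistic, and the semidefiniteness of
  Gamma, needed for the limit law to exist, is read off from that scalar limit.\<close>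

lemma integrable_bdd:
  fixes f :: "'a \<Rightarrow> 'b::{banach, second_countable_topology}"
  assumes "prob_space M" "f \<in> borel_measurable M" "\<And>x. norm (f x) \<le> B"
  shows "integrable M f"
proof -
  interpret prob_space M by fact
  show ?thesis by (rule integrable_const_bound[where B=B]) (use assms in auto)
qed

lemma integral_abs_le:
  fixes f :: "'a \<Rightarrow> 'b::{banach, second_countable_topology}"
  assumes "prob_space M" "\<And>x. norm (f x) \<le> B"
  shows "norm (\<integral>x. f x \<partial>M) \<le> B"
proof -
  interpret prob_space M by fact
  have B: "0 \<le> B" using assms(2) norm_ge_zero order_trans by blast
  show ?thesis
  proof (cases "integrable M f")
    case True
    have "norm (\<integral>x. f x \<partial>M) \<le> (\<integral>x. norm (f x) \<partial>M)" by simp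
    also have "\<dots> \<le> (\<integral>x. B \<partial>M)" using True assms by (intro integral_mono) auto
    finally show ?thesis by (simp add: prob_space)
  next
    \<comment> \<open>A non-integrable function has Bochner integral 0, and \<open>B\<close> is
      nonnegative as a bound of a norm.\<close>
    case False then show ?thesis using B by (simp add: not_integrable_integral_eq)
  qed
qed

lemma square_le_of_abs_le: "\<bar>a\<bar> \<le> B \<Longrightarrow> a\<^sup>2 \<le> B\<^sup>2" for a B :: real
  by (metis abs_ge_zero power2_abs power_mono)

text \<open>The mean is the best constant in mean square. This is what allows any function blind to
  a coordinate to replace the conditional mean in the Efron-Stein inequality.\<close>

lemma variance_le_second_moment_about:
  assumes "prob_space M" "f \<in> borel_measurable M" "\<And>x. \<bar>f x\<bar> \<le> (B::real)"
  shows "(\<integral>x. (f x - (\<integral>x. f x \<partial>M))\<^sup>2 \<partial>M) \<le> (\<integral>x. (f x - c)\<^sup>2 \<partial>M)"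
proof -
  interpret prob_space M by fact
  have i[simp]: "integrable M f" using assms by (intro integrable_bdd[where B=B]) auto
  have i2[simp]: "integrable M (\<lambda>x. (f x)\<^sup>2)"
    using assms by (intro integrable_bdd[where B="B\<^sup>2"]) (auto intro: square_le_of_abs_le)
  let ?m = "\<integral>x. f x \<partial>M"
  have e: "(\<integral>x. (f x - c)\<^sup>2 \<partial>M) = (\<integral>x. (f x)\<^sup>2 \<partial>M) - 2 * c * ?m + c\<^sup>2" for c
    by (simp add: power2_diff prob_space)
  have "0 \<le> (?m - c)\<^sup>2" by simp
  then show ?thesis unfolding e by (simp add: power2_eq_square algebra_simps)
qed

text \<open>Jensen's inequality for the square, read off from a nonnegative variance.\<close>

lemma square_integral_le:
  assumes "prob_space M" "f \<in> borel_measurable M" "\<And>x. \<bar>f x\<bar> \<le> (B::real)"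
  shows "(\<integral>x. f x \<partial>M)\<^sup>2 \<le> (\<integral>x. (f x)\<^sup>2 \<partial>M)"
proof -
  interpret prob_space M by fact
  have i[simp]: "integrable M f" using assms by (intro integrable_bdd[where B=B]) auto
  have i2[simp]: "integrable M (\<lambda>x. (f x)\<^sup>2)"
    using assms by (intro integrable_bdd[where B="B\<^sup>2"]) (auto intro: square_le_of_abs_le)
  let ?m = "\<integral>x. f x \<partial>M"
  have "0 \<le> (\<integral>x. (f x - ?m)\<^sup>2 \<partial>M)" by simp
  also have "\<dots> = (\<integral>x. (f x)\<^sup>2 \<partial>M) - ?m\<^sup>2"
    by (simp add: power2_diff prob_space) (simp add: power2_eq_square)
  finally show ?thesis by simp
qed

lemma square_diff_le: "\<bar>a\<bar> \<le> B \<Longrightarrow> \<bar>b\<bar> \<le> B \<Longrightarrow> (a - b)\<^sup>2 \<le> (2*B)\<^sup>2" for a b B :: real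
  by (rule square_le_of_abs_le) linarith

text \<open>Adding a coordinate splits the variance into the expected variance in that coordinate
  and the variance of the partial mean \<open>f'\<close>. The first is at most the second moment of
  \<open>f - g i\<close>, since \<open>g i\<close> is a constant once the other coordinates are
  fixed; the second is bounded by induction, Jensen's inequality carrying \<open>f' - g' j\<close>
  back to \<open>f - g j\<close>. The competitors \<open>g i\<close> are left free so that the
  statistic with one observation deleted may serve.\<close>

theorem efron_stein:
  fixes f :: "('i \<Rightarrow> 'a) \<Rightarrow> real"
  assumes "prob_space \<nu>" "finite I"
    and "f \<in> borel_measurable (PiM I (\<lambda>_. \<nu>))" "\<And>x. \<bar>f x\<bar> \<le> B"
    and "\<And>i. i \<in> I \<Longrightarrow> g i \<in> borel_measurable (PiM I (\<lambda>_. \<nu>))" "\<And>i x. \<bar>g i x\<bar> \<le> B"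
    and "\<And>i x a. i \<in> I \<Longrightarrow> g i (x(i := a)) = g i x"
  shows "(\<integral>x. (f x - (\<integral>x. f x \<partial>PiM I (\<lambda>_. \<nu>)))\<^sup>2 \<partial>PiM I (\<lambda>_. \<nu>))
    \<le> (\<Sum>i\<in>I. \<integral>x. (f x - g i x)\<^sup>2 \<partial>PiM I (\<lambda>_. \<nu>))"
  using assms(2-)
proof (induction I arbitrary: f g rule: finite_induct)
  case empty
  interpret prob_space "PiM ({}::'i set) (\<lambda>_. \<nu>)" by (rule prob_space_PiM) (use assms in auto)
  show ?case by (simp add: PiM_empty lebesgue_integral_count_space_finite)
next
  case (insert i I f g)
  note [measurable] = insert.prems(1)
  interpret N: prob_space \<nu> by fact
  interpret PP: product_prob_space "\<lambda>_. \<nu>" UNIV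
    by standard
  define P where "P = PiM I (\<lambda>_. \<nu>)"
  define Q where "Q = PiM (insert i I) (\<lambda>_. \<nu>)"
  interpret P: prob_space P unfolding P_def by (rule prob_space_PiM) (use assms in auto)
  interpret Q: prob_space Q unfolding Q_def by (rule prob_space_PiM) (use assms in auto)
  have fQ[measurable]: "f \<in> borel_measurable Q" using insert.prems(1) by (simp add: Q_def)
  have gQ: "j \<in> insert i I \<Longrightarrow> g j \<in> borel_measurable Q" for j using insert.prems(3) by (simp add: Q_def)
  have upd[measurable]: "(\<lambda>(x, y). x(i := y)) \<in> measurable (P \<Otimes>\<^sub>M \<nu>) Q"
    unfolding P_def Q_def by (rule measurable_add_dim)
  have updh: "(\<lambda>(x, y). h (x(i := y))) \<in> borel_measurable (P \<Otimes>\<^sub>M \<nu>)"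
    if "h \<in> borel_measurable Q" for h :: "_ \<Rightarrow> real"
    using measurable_compose[OF upd that] by (simp add: case_prod_beta)
  have updx: "(\<lambda>y. h (x(i := y))) \<in> borel_measurable \<nu>"
    if "h \<in> borel_measurable Q" "x \<in> space P" for h :: "_ \<Rightarrow> real" and x
    using measurable_compose[OF measurable_Pair1'[OF that(2)] updh[OF that(1)]] by simp
  have updI: "(\<lambda>x. \<integral>y. h (x(i := y)) \<partial>\<nu>) \<in> borel_measurable P"
    if "h \<in> borel_measurable Q" for h :: "_ \<Rightarrow> real"
    using N.borel_measurable_lebesgue_integral[OF updh[OF that]] by simp
  have fubini: "(\<integral>x. h x \<partial>Q) = (\<integral>x. (\<integral>y. h (x(i := y)) \<partial>\<nu>) \<partial>P)"
    if "h \<in> borel_measurable Q" "\<And>x. \<bar>h x\<bar> \<le> D" for h :: "_ \<Rightarrow> real" and D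
    unfolding P_def Q_def
    using that insert.hyps
    by (intro PP.product_integral_insert integrable_bdd[where B=D])
       (auto simp: Q_def[symmetric] intro: Q.prob_space_axioms)
  define f' where "f' = (\<lambda>x. \<integral>y. f (x(i := y)) \<partial>\<nu>)"
  define g' where "g' = (\<lambda>j x. \<integral>y. g j (x(i := y)) \<partial>\<nu>)"
  have f'P[measurable]: "f' \<in> borel_measurable P" unfolding f'_def by (rule updI) simp
  have g'P: "j \<in> I \<Longrightarrow> g' j \<in> borel_measurable P" for j unfolding g'_def by (rule updI) (use gQ in auto)
  have f'B: "\<bar>f' x\<bar> \<le> B" for x unfolding f'_def
    using integral_abs_le[OF assms(1), of "\<lambda>y. f (x(i := y))" B] insert.prems by auto
  have g'B: "\<bar>g' j x\<bar> \<le> B" for j x unfolding g'_def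
    using integral_abs_le[OF assms(1), of "\<lambda>y. g j (x(i := y))" B] insert.prems by auto
  have IH: "(\<integral>x. (f' x - (\<integral>x. f' x \<partial>P))\<^sup>2 \<partial>P) \<le> (\<Sum>j\<in>I. \<integral>x. (f' x - g' j x)\<^sup>2 \<partial>P)"
    unfolding P_def
  proof (rule insert.IH)
    show "g' j (x(j := a)) = g' j x" if "j \<in> I" for j x a
    proof -
      \<comment> \<open>The two updates commute, so averaging over coordinate \<open>i\<close> keeps
        \<open>g' j\<close> blind to coordinate \<open>j\<close>.\<close>
      have ji: "j \<noteq> i" using that insert.hyps by auto
      have "g j ((x(i := y))(j := a)) = g j (x(i := y))" for y using insert.prems(5) that by blast
      then show ?thesis unfolding g'_def fun_upd_twist[OF ji] by simp
    qed
  qed (use f'P g'P f'B g'B in \<open>auto simp: P_def\<close>)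
  have m: "(\<integral>x. f x \<partial>Q) = (\<integral>x. f' x \<partial>P)"
    unfolding f'_def by (rule fubini[of _ B]) (use insert.prems in auto)
  define c where "c = (\<integral>x. f' x \<partial>P)"
  have cB: "\<bar>c\<bar> \<le> B" unfolding c_def using integral_abs_le[OF P.prob_space_axioms, of f' B] f'B by auto
  have B0: "0 \<le> B" using f'B[of undefined] by linarith
  have sqB: "\<bar>(f x - a)\<^sup>2\<bar> \<le> (2*B)\<^sup>2" if "\<bar>a\<bar> \<le> B" for x a
    using square_diff_le[OF insert.prems(2) that] by simp
  \<comment> \<open>Bias-variance decomposition in coordinate \<open>i\<close> about the overall
    mean \<open>c\<close>.\<close>
  have vf: "(\<integral>y. (f (x(i:=y)) - c)\<^sup>2 \<partial>\<nu>)
      = (\<integral>y. (f (x(i:=y)) - f' x)\<^sup>2 \<partial>\<nu>) + (f' x - c)\<^sup>2" if "x \<in> space P" for x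
  proof -
    have i1: "integrable \<nu> (\<lambda>y. f (x(i:=y)))"
      by (rule integrable_bdd[where B=B]) (use updx[OF fQ that] insert.prems assms in auto)
    have i2: "integrable \<nu> (\<lambda>y. (f (x(i:=y)))\<^sup>2)"
      by (rule integrable_bdd[where B="(2*B)\<^sup>2"])
        (use updx[OF fQ that] sqB[of 0] B0 assms in auto)
    have "(\<integral>y. (f (x(i:=y)) - a)\<^sup>2 \<partial>\<nu>) = (\<integral>y. (f (x(i:=y)))\<^sup>2 \<partial>\<nu>) - 2 * a * f' x + a\<^sup>2" for a
      using i1 i2 by (simp add: power2_diff f'_def N.prob_space)
    note this[of c] this[of "f' x"]
    then show ?thesis by (simp only:) (simp add: power2_eq_square algebra_simps)
  qed
  have b1: "(\<lambda>x. \<integral>y. (f (x(i:=y)) - f' x)\<^sup>2 \<partial>\<nu>) \<in> borel_measurable P"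
    using updh[OF fQ] by (intro N.borel_measurable_lebesgue_integral) (auto simp: case_prod_beta)
  have b2: "norm (\<integral>y. (f (x(i:=y)) - f' x)\<^sup>2 \<partial>\<nu>) \<le> (2*B)\<^sup>2" for x
    by (rule integral_abs_le[OF assms(1)]) (use sqB f'B in auto)
  have "(\<integral>x. (f x - (\<integral>x. f x \<partial>Q))\<^sup>2 \<partial>Q) = (\<integral>x. (\<integral>y. (f (x(i:=y)) - c)\<^sup>2 \<partial>\<nu>) \<partial>P)"
    unfolding m c_def[symmetric] by (rule fubini[of _ "(2*B)\<^sup>2"]) (use sqB cB in auto)
  also have "\<dots> = (\<integral>x. (\<integral>y. (f (x(i:=y)) - f' x)\<^sup>2 \<partial>\<nu>) + (f' x - c)\<^sup>2 \<partial>P)"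
    by (rule Bochner_Integration.integral_cong) (use vf in auto)
  also have "\<dots> = (\<integral>x. (\<integral>y. (f (x(i:=y)) - f' x)\<^sup>2 \<partial>\<nu>) \<partial>P) + (\<integral>x. (f' x - c)\<^sup>2 \<partial>P)"
    using b1 b2 square_diff_le[OF f'B cB]
    by (intro Bochner_Integration.integral_add integrable_bdd[where B="(2*B)\<^sup>2"] P.prob_space_axioms) auto
  also have "\<dots> \<le> (\<integral>x. (f x - g i x)\<^sup>2 \<partial>Q) + (\<Sum>j\<in>I. \<integral>x. (f x - g j x)\<^sup>2 \<partial>Q)"
  proof (rule add_mono)
    have gi: "g i (x(i:=y)) = g i x" for x y using insert.prems(5)[of i] by blast
    have gif[measurable]: "g i \<in> borel_measurable Q" using gQ by auto
    have "(\<integral>x. (f x - g i x)\<^sup>2 \<partial>Q) = (\<integral>x. (\<integral>y. (f (x(i:=y)) - g i (x(i:=y)))\<^sup>2 \<partial>\<nu>) \<partial>P)"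
      by (rule fubini[of _ "(2*B)\<^sup>2"]) (use sqB insert.prems in auto)
    moreover have "(\<integral>x. (\<integral>y. (f (x(i:=y)) - f' x)\<^sup>2 \<partial>\<nu>) \<partial>P)
        \<le> (\<integral>x. (\<integral>y. (f (x(i:=y)) - g i (x(i:=y)))\<^sup>2 \<partial>\<nu>) \<partial>P)"
    proof (rule integral_mono)
      show "integrable P (\<lambda>x. \<integral>y. (f (x(i:=y)) - f' x)\<^sup>2 \<partial>\<nu>)"
        using b1 b2 by (intro integrable_bdd[where B="(2*B)\<^sup>2"] P.prob_space_axioms) auto
      show "integrable P (\<lambda>x. \<integral>y. (f (x(i:=y)) - g i (x(i:=y)))\<^sup>2 \<partial>\<nu>)"
        using updI[of "\<lambda>x. (f x - g i x)\<^sup>2"]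
        by (intro integrable_bdd[where B="(2*B)\<^sup>2"] P.prob_space_axioms integral_abs_le[OF assms(1)])
           (use sqB insert.prems in auto)
      fix x assume "x \<in> space P"
      then show "(\<integral>y. (f (x(i:=y)) - f' x)\<^sup>2 \<partial>\<nu>) \<le> (\<integral>y. (f (x(i:=y)) - g i (x(i:=y)))\<^sup>2 \<partial>\<nu>)"
        unfolding gi f'_def
        by (intro variance_le_second_moment_about[OF assms(1), where B=B] updx fQ) (use insert.prems in auto)
    qed
    ultimately show "(\<integral>x. (\<integral>y. (f (x(i:=y)) - f' x)\<^sup>2 \<partial>\<nu>) \<partial>P) \<le> (\<integral>x. (f x - g i x)\<^sup>2 \<partial>Q)" by simp
  next
    have "(\<integral>x. (f' x - g' j x)\<^sup>2 \<partial>P) \<le> (\<integral>x. (f x - g j x)\<^sup>2 \<partial>Q)" if j: "j \<in> I" for j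
    proof -
      have gj[measurable]: "g j \<in> borel_measurable Q" using gQ j by auto
      have "(\<integral>x. (f' x - g' j x)\<^sup>2 \<partial>P) \<le> (\<integral>x. (\<integral>y. (f (x(i:=y)) - g j (x(i:=y)))\<^sup>2 \<partial>\<nu>) \<partial>P)"
      proof (rule integral_mono)
        show "integrable P (\<lambda>x. (f' x - g' j x)\<^sup>2)"
          using f'P g'P[OF j] square_diff_le[OF f'B g'B]
          by (intro integrable_bdd[where B="(2*B)\<^sup>2"] P.prob_space_axioms) auto
        show "integrable P (\<lambda>x. \<integral>y. (f (x(i:=y)) - g j (x(i:=y)))\<^sup>2 \<partial>\<nu>)"
          using updI[of "\<lambda>x. (f x - g j x)\<^sup>2"]
          by (intro integrable_bdd[where B="(2*B)\<^sup>2"] P.prob_space_axioms integral_abs_le[OF assms(1)])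
             (use sqB insert.prems in auto)
        fix x assume x: "x \<in> space P"
        have m1: "(\<lambda>y. f (x(i:=y))) \<in> borel_measurable \<nu>" "(\<lambda>y. g j (x(i:=y))) \<in> borel_measurable \<nu>"
          using updx[OF _ x] by auto
        \<comment> \<open>The difference of the partial means is the partial mean of the difference,
          so Jensen's inequality applies.\<close>
        have "f' x - g' j x = (\<integral>y. f (x(i:=y)) - g j (x(i:=y)) \<partial>\<nu>)"
          unfolding f'_def g'_def
          by (rule Bochner_Integration.integral_diff[symmetric])
             (use m1 insert.prems assms in \<open>auto intro!: integrable_bdd[where B=B]\<close>)
        moreover have "\<bar>f y - g j y\<bar> \<le> 2 * B" for y
          using insert.prems(2)[of y] insert.prems(4)[of j y] by linarith
        ultimately show "(f' x - g' j x)\<^sup>2 \<le> (\<integral>y. (f (x(i:=y)) - g j (x(i:=y)))\<^sup>2 \<partial>\<nu>)"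
          using m1 by (auto intro!: square_integral_le[OF assms(1), of _ "2*B"])
      qed
      also have "\<dots> = (\<integral>x. (f x - g j x)\<^sup>2 \<partial>Q)"
        by (rule fubini[of _ "(2*B)\<^sup>2", symmetric]) (use sqB insert.prems in auto)
      finally show ?thesis .
    qed
    then have "(\<Sum>j\<in>I. \<integral>x. (f' x - g' j x)\<^sup>2 \<partial>P) \<le> (\<Sum>j\<in>I. \<integral>x. (f x - g j x)\<^sup>2 \<partial>Q)" by (rule sum_mono)
    with IH show "(\<integral>x. (f' x - c)\<^sup>2 \<partial>P) \<le> (\<Sum>j\<in>I. \<integral>x. (f x - g j x)\<^sup>2 \<partial>Q)" by (simp add: c_def)
  qed
  also have "\<dots> = (\<Sum>j\<in>insert i I. \<integral>x. (f x - g j x)\<^sup>2 \<partial>Q)" using insert.hyps by simp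
  finally show ?case unfolding Q_def .
qed

section \<open>Characteristic functions of martingale sums\<close>

text \<open>Put s = tau^2 v / 2. A centred bounded variable has characteristic function 1 - s up to
  |tau|^3 K^3, and exp (-s) equals 1 - s up to s^2, which is at most tau^4 K^4. Multiplying the
  difference by exp s, at most exp (tau^2 K^2 / 2), gives the bound.\<close>

lemma exp_martingale_step:
  fixes w :: "'a \<Rightarrow> real"
  assumes "prob_space \<nu>" "w \<in> borel_measurable \<nu>" "\<And>e. \<bar>w e\<bar> \<le> K" "(\<integral>e. w e \<partial>\<nu>) = 0"
    and "v = (\<integral>e. (w e)\<^sup>2 \<partial>\<nu>)"
  shows "cmod ((\<integral>e. exp (\<i> * complex_of_real (\<tau> * w e)) \<partial>\<nu>) * complex_of_real (exp (\<tau>\<^sup>2 * v / 2)) - 1)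
    \<le> exp (\<tau>\<^sup>2 * K\<^sup>2 / 2) * (\<bar>\<tau>\<bar>^3 * K^3 + \<tau>^4 * K^4)"
proof -
  interpret prob_space \<nu> by fact
  note [measurable] = assms(2)
  have K: "0 \<le> K" using assms(3)[of undefined] by linarith
  have v0: "0 \<le> v" unfolding assms by simp
  have wi[simp]: "integrable \<nu> w" by (rule integrable_bdd[where B=K]) (use assms in auto)
  have w2i[simp]: "integrable \<nu> (\<lambda>e. (w e)\<^sup>2)"
    by (rule integrable_bdd[where B="K\<^sup>2"]) (use assms square_le_of_abs_le in auto)
  have ei: "integrable \<nu> (\<lambda>e. exp (\<i> * complex_of_real (\<tau> * w e)))"
    by (rule integrable_bdd[where B=1]) (use assms in auto)
  have "norm v \<le> K\<^sup>2" unfolding assms(5)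
    by (rule integral_abs_le) (use assms square_le_of_abs_le in auto)
  then have vK: "v \<le> K\<^sup>2" by simp
  define s where "s = \<tau>\<^sup>2 * v / 2"
  have s0: "0 \<le> s" and sK: "s \<le> \<tau>\<^sup>2 * K\<^sup>2 / 2" using v0 vK by (auto simp: s_def mult_left_mono)
  define c where "c = (\<integral>e. exp (\<i> * complex_of_real (\<tau> * w e)) \<partial>\<nu>)"
  have si: "integrable \<nu> (\<lambda>e. complex_of_real ((\<tau> * w e)\<^sup>2 / 2))"
    by (intro integrable_of_real) (simp_all add: power_mult_distrib)
  have pi: "integrable \<nu> (\<lambda>e. 1 + \<i> * complex_of_real (\<tau> * w e) - complex_of_real ((\<tau> * w e)\<^sup>2 / 2))"
    by (intro Bochner_Integration.integrable_diff Bochner_Integration.integrable_add si) simp_all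
  have q: "(\<integral>e. 1 + \<i> * complex_of_real (\<tau> * w e) - complex_of_real ((\<tau> * w e)\<^sup>2 / 2) \<partial>\<nu>) = 1 - complex_of_real s"
  proof -
    have "(\<integral>e. complex_of_real ((\<tau> * w e)\<^sup>2 / 2) \<partial>\<nu>) = complex_of_real s"
      unfolding integral_complex_of_real s_def assms(5) by (simp add: power_mult_distrib)
    moreover have "(\<integral>e. \<i> * complex_of_real (\<tau> * w e) \<partial>\<nu>) = 0"
      using assms(4) by simp
    moreover have "integrable \<nu> (\<lambda>e. complex_of_real ((\<tau> * w e)\<^sup>2 / 2))"
      "integrable \<nu> (\<lambda>e. \<i> * complex_of_real (\<tau> * w e))"
      by (intro integrable_of_real) (simp_all add: power_mult_distrib)
    ultimately show ?thesis by (simp add: prob_space del: of_real_mult of_real_power of_real_divide)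
  qed
  have b: "cmod (exp (\<i> * complex_of_real y) - (1 + \<i> * complex_of_real y - complex_of_real (y\<^sup>2/2))) \<le> \<bar>y\<bar>^3" for y
  proof -
    have "cmod (exp (\<i> * complex_of_real y) - (\<Sum>k\<le>2. (\<i> * y)^k / fact k)) \<le> \<bar>y\<bar>^Suc 2 / fact (Suc 2)"
      by (rule iexp_approx1)
    moreover have "(\<Sum>k\<le>2. (\<i> * y)^k / fact k) = 1 + \<i> * complex_of_real y - complex_of_real (y\<^sup>2/2)"
      by (simp add: numeral_2_eq_2 power_mult_distrib fact_numeral)
    moreover have "\<bar>y\<bar>^Suc 2 / fact (Suc 2) \<le> \<bar>y\<bar>^3"
    proof -
      have "fact (Suc 2) = (6::real)" by (simp add: fact_numeral flip: numeral_3_eq_3)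
      then show ?thesis using zero_le_power[of "\<bar>y\<bar>" 3] by simp
    qed
    ultimately show ?thesis by simp
  qed
  have "cmod (c - (1 - complex_of_real s)) =
    cmod (\<integral>e. exp (\<i> * complex_of_real (\<tau> * w e)) - (1 + \<i> * complex_of_real (\<tau> * w e) - complex_of_real ((\<tau> * w e)\<^sup>2 / 2)) \<partial>\<nu>)"
    unfolding c_def q[symmetric]
    by (subst Bochner_Integration.integral_diff[OF ei pi]) (rule refl)
  also have "\<dots> \<le> \<bar>\<tau>\<bar>^3 * K^3"
  proof (rule integral_abs_le[OF assms(1)])
    fix e
    have "\<bar>\<tau> * w e\<bar>^3 \<le> (\<bar>\<tau>\<bar> * K)^3" using assms(3)
      by (intro power_mono) (auto simp: abs_mult mult_left_mono)
    with b[of "\<tau> * w e"] show "cmod (exp (\<i> * complex_of_real (\<tau> * w e)) - (1 + \<i> * complex_of_real (\<tau> * w e) - complex_of_real ((\<tau> * w e)\<^sup>2 / 2))) \<le> \<bar>\<tau>\<bar>^3 * K^3"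
      by (simp add: power_mult_distrib)
  qed
  finally have 1: "cmod (c - (1 - complex_of_real s)) \<le> \<bar>\<tau>\<bar>^3 * K^3" .
  have 2: "\<bar>exp (-s) - (1 - s)\<bar> \<le> s\<^sup>2"
  proof -
    have "1 - s \<le> exp (-s)" using exp_ge_add_one_self[of "-s"] by simp
    moreover have "exp (-s) \<le> 1 - s + s\<^sup>2"
    proof (cases "s \<le> 1")
      case True
      have "(1 + s) * exp (-s) \<le> 1"
        using exp_ge_add_one_self[of s] by (simp add: exp_minus field_simps)
      then have "exp (-s) \<le> 1 / (1 + s)" using s0 by (simp add: field_simps)
      \<comment> \<open>Since (1 + s) (1 - s + s^2) = 1 + s^3.\<close>
      also have "\<dots> \<le> 1 - s + s\<^sup>2" using s0
        by (simp add: field_simps power2_eq_square)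
      finally show ?thesis .
    next
      case False
      then have "exp (-s) \<le> 1" "s \<le> s\<^sup>2" by (auto simp: power2_eq_square)
      then show ?thesis by linarith
    qed
    ultimately show ?thesis by simp
  qed
  have "cmod (c * complex_of_real (exp s) - 1) = exp s * cmod (c - complex_of_real (exp (-s)))"
  proof -
    have "c * complex_of_real (exp s) - 1 = complex_of_real (exp s) * (c - complex_of_real (exp (-s)))"
      by (simp add: algebra_simps exp_minus flip: of_real_mult)
    then show ?thesis by (simp only: norm_mult norm_of_real abs_exp_cancel)
  qed
  also have "\<dots> \<le> exp (\<tau>\<^sup>2 * K\<^sup>2 / 2) * (\<bar>\<tau>\<bar>^3 * K^3 + \<tau>^4 * K^4)"
  proof (rule mult_mono)
    have "c - complex_of_real (exp (-s)) = (c - (1 - complex_of_real s)) - complex_of_real (exp (-s) - (1 - s))"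
      by simp
    then have "cmod (c - complex_of_real (exp (-s))) \<le> cmod (c - (1 - complex_of_real s)) + \<bar>exp (-s) - (1 - s)\<bar>"
      by (metis norm_of_real norm_triangle_ineq4)
    also have "s\<^sup>2 \<le> (\<tau>\<^sup>2 * K\<^sup>2)\<^sup>2" using s0 sK by (intro power_mono) auto
    with 1 2 have "cmod (c - (1 - complex_of_real s)) + \<bar>exp (-s) - (1 - s)\<bar> \<le> \<bar>\<tau>\<bar>^3 * K^3 + \<tau>^4 * K^4"
      by (simp add: power_mult_distrib flip: power_mult)
    finally show "cmod (c - complex_of_real (exp (-s))) \<le> \<bar>\<tau>\<bar>^3 * K^3 + \<tau>^4 * K^4" .
  qed (use sK in auto)
  finally show ?thesis unfolding c_def s_def .
qed

lemma measurable_lebesgue_integral_kernel: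
  assumes "sigma_finite_measure \<nu>"
    "case_prod h \<in> borel_measurable (N \<Otimes>\<^sub>M \<nu>)"
  shows "(\<lambda>a. \<integral>e. (h a e :: real) \<partial>\<nu>) \<in> borel_measurable N"
proof -
  interpret sigma_finite_measure \<nu> by fact
  show ?thesis using borel_measurable_lebesgue_integral[OF assms(2)] .
qed

text \<open>Multiplying by the exponential of half the predictable variance makes every factor \<open>1 + O(n\<^sup>-\<^sup>3\<^sup>/\<^sup>2)\<close>, so the
  steps of the chain can be integrated out from the last one backwards.\<close>

theorem exp_martingale:
  fixes w :: "nat \<Rightarrow> 'a \<Rightarrow> 'a \<Rightarrow> real"
  assumes "prob_space \<nu>" and sp: "space \<nu> = UNIV"
    and w: "\<And>j. (\<lambda>(a, e). w j a e) \<in> borel_measurable (\<nu> \<Otimes>\<^sub>M \<nu>)" "\<And>j a e. \<bar>w j a e\<bar> \<le> K"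
    and w0: "\<And>j a. (\<integral>e. w j a e \<partial>\<nu>) = 0"
    and v: "\<And>j a. v j a = (\<integral>e. (w j a e)\<^sup>2 \<partial>\<nu>)"
    and C: "C = exp (K\<^sup>2 / 2) * (exp (K\<^sup>2 / 2) * (K^3 + K^4))"
    and n: "n \<ge> 1" "m \<in> {1..n}" and \<tau>: "\<tau> = 1 / sqrt (real n)"
  shows "cmod ((\<integral>e. exp (\<i> * complex_of_real (\<tau> * (\<Sum>j=1..<m. w j (e j) (e (Suc j))))
       + complex_of_real (\<tau>\<^sup>2 / 2 * (\<Sum>j=1..<m. v j (e j)))) \<partial>PiM {1..m} (\<lambda>_. \<nu>)) - 1)
     \<le> real m * (C * \<tau>^3)"
  using n(2)
proof (induction m)
  case 0 then show ?case by simp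
next
  case (Suc m)
  interpret N: prob_space \<nu> by fact
  interpret PP: product_prob_space "\<lambda>_. \<nu>" UNIV
    by standard
  have K: "0 \<le> K" using w(2)[of undefined undefined undefined] by linarith
  have \<tau>0: "0 < \<tau>" "\<tau> \<le> 1" "\<tau>\<^sup>2 = 1 / real n" using n unfolding \<tau> by (auto simp: power_divide)
  have C0: "0 \<le> C" using K unfolding C by simp
  have vK: "0 \<le> v j a" "v j a \<le> K\<^sup>2" for j a
  proof -
    show "0 \<le> v j a" unfolding v by simp
    have "norm (v j a) \<le> K\<^sup>2" unfolding v by (rule integral_abs_le) (use assms square_le_of_abs_le in auto)
    then show "v j a \<le> K\<^sup>2" by simp
  qed
  show ?case
  proof (cases "m = 0")
    case True
    interpret P: prob_space "PiM {1..Suc 0} (\<lambda>_. \<nu>)" by (rule prob_space_PiM) (use assms in auto)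
    \<comment> \<open>A chain of one point has no step: both sums are empty and the integral is
      1.\<close>
    show ?thesis using True C0 \<tau>0 P.prob_space by simp
  next
    case False
    then have m: "m \<in> {1..n}" using Suc.prems by auto
    define P where "P = PiM {1..m} (\<lambda>_. \<nu>)"
    define Q where "Q = PiM {1..Suc m} (\<lambda>_. \<nu>)"
    interpret P: prob_space P unfolding P_def by (rule prob_space_PiM) (use assms in auto)
    interpret Q: prob_space Q unfolding Q_def by (rule prob_space_PiM) (use assms in auto)
    define G where "G = (\<lambda>m e. exp (\<i> * complex_of_real (\<tau> * (\<Sum>j=1..<m. w j (e j) (e (Suc j))))
       + complex_of_real (\<tau>\<^sup>2 / 2 * (\<Sum>j=1..<m. v j (e j)))))"
    have wm: "(\<lambda>x. w j (f x) (g x)) \<in> borel_measurable N"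
      if "f \<in> measurable N \<nu>" "g \<in> measurable N \<nu>" for j f g and N :: "(nat \<Rightarrow> 'a) measure"
      using measurable_compose[OF measurable_Pair[OF that] w(1)[of j]] by simp
    have vm: "v j \<in> borel_measurable \<nu>" for j
    proof -
      have "(\<lambda>(a, e). (w j a e)\<^sup>2) \<in> borel_measurable (\<nu> \<Otimes>\<^sub>M \<nu>)" using w(1)[of j] by (auto simp: case_prod_beta)
      from measurable_lebesgue_integral_kernel[OF N.sigma_finite_measure_axioms this] show ?thesis
        by (simp add: v[abs_def])
    qed
    have Gm: "G k \<in> borel_measurable (PiM {1..k} (\<lambda>_. \<nu>))" for k
    proof -
      have [measurable]: "(\<lambda>e. \<Sum>j=1..<k. w j (e j) (e (Suc j))) \<in> borel_measurable (PiM {1..k} (\<lambda>_. \<nu>))"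
        by (intro borel_measurable_sum wm measurable_component_singleton) auto
      have [measurable]: "(\<lambda>e. \<Sum>j=1..<k. v j (e j)) \<in> borel_measurable (PiM {1..k} (\<lambda>_. \<nu>))"
        by (intro borel_measurable_sum measurable_compose[OF _ vm] measurable_component_singleton) auto
      show ?thesis unfolding G_def by measurable
    qed
    \<comment> \<open>At most \<open>n\<close> conditional variances, each at most K^2, weighted by
      1 / (2 n): the compensator stays bounded along the whole chain.\<close>
    have Gb: "cmod (G k e) \<le> exp (K\<^sup>2/2)" if "k \<in> {1..n}" for k e
    proof -
      have "(\<Sum>j=1..<k. v j (e j)) \<le> real (k - 1) * K\<^sup>2"
        using sum_bounded_above[of "{1..<k}" "\<lambda>j. v j (e j)" "K\<^sup>2"] vK by auto
      also have "\<dots> \<le> real n * K\<^sup>2" using that by (intro mult_right_mono) auto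
      finally have "\<tau>\<^sup>2 / 2 * (\<Sum>j=1..<k. v j (e j)) \<le> K\<^sup>2/2"
        using mult_left_mono[of _ "real n * K\<^sup>2" "\<tau>\<^sup>2 / 2"] \<tau>0(3) n by fastforce
      then show ?thesis unfolding G_def by (simp add: norm_exp_eq_Re)
    qed
    have ins: "insert (Suc m) {1..m} = {1..Suc m}" by auto
    have "(\<integral>e. G (Suc m) e \<partial>Q) = (\<integral>e. (\<integral>a. G (Suc m) (e(Suc m := a)) \<partial>\<nu>) \<partial>P)"
    proof -
      have "integrable (PiM (insert (Suc m) {1..m}) (\<lambda>_. \<nu>)) (G (Suc m))"
        unfolding ins by (rule integrable_bdd[OF Q.prob_space_axioms[unfolded Q_def] Gm Gb[OF Suc.prems]])
      from PP.product_integral_insert[OF _ _ this] show ?thesis unfolding ins P_def Q_def by simp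
    qed
    \<comment> \<open>Coordinate \<open>Suc m\<close> occurs in the last step only, and
      \<open>v m\<close> does not read it, so the new factor separates.\<close>
    also have "\<dots> = (\<integral>e. G m e * ((\<integral>a. exp (\<i> * complex_of_real (\<tau> * w m (e m) a)) \<partial>\<nu>)
        * complex_of_real (exp (\<tau>\<^sup>2 * v m (e m) / 2))) \<partial>P)"
    proof (rule Bochner_Integration.integral_cong[OF refl])
      fix e
      have "G (Suc m) (e(Suc m := a)) = exp (\<i> * complex_of_real (\<tau> * w m (e m) a)) *
          (G m e * complex_of_real (exp (\<tau>\<^sup>2 * v m (e m) / 2)))" for a
      proof -
        have s: "{1..<Suc m} = insert m {1..<m}" using False by auto
        have "(\<Sum>j=1..<Suc m. w j ((e(Suc m := a)) j) ((e(Suc m := a)) (Suc j)))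
           = w m (e m) a + (\<Sum>j=1..<m. w j (e j) (e (Suc j)))"
          unfolding s by (auto intro!: sum.cong)
        moreover have "(\<Sum>j=1..<Suc m. v j ((e(Suc m := a)) j)) = v m (e m) + (\<Sum>j=1..<m. v j (e j))"
          unfolding s by (auto intro!: sum.cong)
        ultimately show ?thesis unfolding G_def
          by (simp add: exp_add[symmetric] exp_of_real[symmetric] algebra_simps del: exp_of_real)
      qed
      then show "(\<integral>a. G (Suc m) (e(Suc m := a)) \<partial>\<nu>) = G m e * ((\<integral>a. exp (\<i> * complex_of_real (\<tau> * w m (e m) a)) \<partial>\<nu>)
        * complex_of_real (exp (\<tau>\<^sup>2 * v m (e m) / 2)))"
        by simp
    qed
    finally have e1: "(\<integral>e. G (Suc m) e \<partial>Q) = (\<integral>e. G m e * ((\<integral>a. exp (\<i> * complex_of_real (\<tau> * w m (e m) a)) \<partial>\<nu>)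
        * complex_of_real (exp (\<tau>\<^sup>2 * v m (e m) / 2))) \<partial>P)" .
    define R where "R = (\<lambda>e. (\<integral>a. exp (\<i> * complex_of_real (\<tau> * w m (e m) a)) \<partial>\<nu>)
        * complex_of_real (exp (\<tau>\<^sup>2 * v m (e m) / 2)) - 1)"
    have Rb: "cmod (R e) \<le> exp (K\<^sup>2 / 2) * (K^3 + K^4) * \<tau>^3" for e
    proof -
      have "w m (e m) \<in> borel_measurable \<nu>"
        using measurable_compose[OF measurable_Pair1' w(1)[of m]] sp by simp
      then have "cmod (R e) \<le> exp (\<tau>\<^sup>2 * K\<^sup>2 / 2) * (\<bar>\<tau>\<bar>^3 * K^3 + \<tau>^4 * K^4)"
        unfolding R_def by (intro exp_martingale_step[OF assms(1)]) (use w w0 v in auto)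
      \<comment> \<open>\<open>\<tau> \<le> 1\<close> absorbs the fourth power into the
        third.\<close>
      also have "\<dots> \<le> exp (K\<^sup>2 / 2) * (\<tau>^3 * K^3 + \<tau>^3 * K^4)"
      proof (intro mult_mono add_mono)
        show "exp (\<tau>\<^sup>2 * K\<^sup>2 / 2) \<le> exp (K\<^sup>2 / 2)"
          using \<tau>0(1,2) by (simp add: mult_left_le_one_le power_le_one)
        show "\<tau>^4 \<le> \<tau>^3" using \<tau>0 by (intro power_decreasing) auto
      qed (use \<tau>0 K in auto)
      finally show ?thesis by (simp add: algebra_simps)
    qed
    have Pm: "G m \<in> borel_measurable P" unfolding P_def by (rule Gm)
    have cm: "(\<lambda>e. e m) \<in> measurable P \<nu>" unfolding P_def by (rule measurable_component_singleton) (use m in auto)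
    have Rm: "R \<in> borel_measurable P"
    proof -
      have "(\<lambda>(a, e). exp (\<i> * complex_of_real (\<tau> * w m a e))) \<in> borel_measurable (\<nu> \<Otimes>\<^sub>M \<nu>)"
        using w(1)[of m] by (auto simp: case_prod_beta)
      from N.borel_measurable_lebesgue_integral[OF this]
      have "(\<lambda>a. \<integral>e. exp (\<i> * complex_of_real (\<tau> * w m a e)) \<partial>\<nu>) \<in> borel_measurable \<nu>" by simp
      from measurable_compose[OF cm this] measurable_compose[OF cm vm[of m]] show ?thesis
        unfolding R_def by measurable
    qed
    have "(\<integral>e. G (Suc m) e \<partial>Q) - 1 = (\<integral>e. G m e + G m e * R e \<partial>P) - 1"
      unfolding e1 R_def by (simp add: algebra_simps)
    also have "\<dots> = ((\<integral>e. G m e \<partial>P) - 1) + (\<integral>e. G m e * R e \<partial>P)"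
    proof -
      have "integrable P (G m)" by (rule integrable_bdd[OF P.prob_space_axioms Pm Gb[OF m]])
      moreover have "integrable P (\<lambda>e. G m e * R e)"
        using Pm Rm
        by (intro integrable_bdd[where B="exp (K\<^sup>2/2) * (exp (K\<^sup>2 / 2) * (K^3 + K^4) * \<tau>^3)"] P.prob_space_axioms)
           (auto simp: norm_mult intro!: mult_mono Gb[OF m] Rb)
      ultimately show ?thesis by simp
    qed
    finally have "cmod ((\<integral>e. G (Suc m) e \<partial>Q) - 1) \<le> cmod ((\<integral>e. G m e \<partial>P) - 1) + cmod (\<integral>e. G m e * R e \<partial>P)"
      by (simp only: norm_triangle_ineq)
    \<comment> \<open>The two exponentials in \<open>C\<close>: one bounds the product of the
      previous factors, the other comes from the single step.\<close>
    also have "cmod (\<integral>e. G m e * R e \<partial>P) \<le> C * \<tau>^3"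
    proof (rule integral_abs_le[OF P.prob_space_axioms])
      fix e
      have "cmod (G m e * R e) \<le> exp (K\<^sup>2/2) * (exp (K\<^sup>2 / 2) * (K^3 + K^4) * \<tau>^3)"
        unfolding norm_mult by (intro mult_mono Gb[OF m] Rb) auto
      then show "cmod (G m e * R e) \<le> C * \<tau>^3" by (simp add: C algebra_simps)
    qed
    also have "cmod ((\<integral>e. G m e \<partial>P) - 1) \<le> real m * (C * \<tau>^3)"
      using Suc.IH[OF m] unfolding G_def P_def .
    finally have "cmod ((\<integral>e. G (Suc m) e \<partial>Q) - 1) \<le> real (Suc m) * (C * \<tau>^3)"
      by (simp add: algebra_simps)
    then show ?thesis unfolding G_def Q_def .
  qed
qed

section \<open>Ranks and right neighbours\<close>

lemma sorts_less_iff: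
  assumes "sorts n x \<sigma>" "i \<in> {1..n}" "j \<in> {1..n}"
  shows "x (\<sigma> i) < x (\<sigma> j) \<longleftrightarrow> i < j"
proof -
  have lt: "x (\<sigma> i) < x (\<sigma> j)" if "1 \<le> i" "i < j" "j \<le> n" for i j
    using that(2,3)
  proof (induction j)
    case (Suc j)
    have s: "x (\<sigma> j) < x (\<sigma> (Suc j))" using Suc.prems that(1) assms(1) by (auto simp: sorts_def)
    show ?case
    proof (cases "i = j")
      case True then show ?thesis using s by simp
    next
      case False then show ?thesis using Suc s by force
    qed
  qed simp
  show ?thesis using lt[of i j] lt[of j i] assms by (cases i j rule: linorder_cases) auto
qed

text \<open>The position is a count that mentions only the values, which forces two sorting
  permutations to agree.\<close>

lemma sorts_position:
  assumes "sorts n x \<sigma>" "i \<in> {1..n}"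
  shows "card {b\<in>{1..n}. x b \<le> x (\<sigma> i)} = i"
proof -
  have p: "\<sigma> permutes {1..n}" using assms by (simp add: sorts_def)
  have "{b\<in>{1..n}. x b \<le> x (\<sigma> i)} = \<sigma> ` {1..i}"
  proof (intro set_eqI iffI)
    fix b assume b: "b \<in> {b\<in>{1..n}. x b \<le> x (\<sigma> i)}"
    then have "b \<in> \<sigma> ` {1..n}" using permutes_image[OF p] by auto
    then obtain j where j: "j \<in> {1..n}" "b = \<sigma> j" by auto
    then have "\<not> i < j" using b sorts_less_iff[OF assms j(1)] by auto
    then show "b \<in> \<sigma> ` {1..i}" using j by auto
  next
    fix b assume "b \<in> \<sigma> ` {1..i}"
    then obtain j where j: "j \<in> {1..i}" "b = \<sigma> j" by auto
    then have jn: "j \<in> {1..n}" using assms by auto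
    have "\<not> x (\<sigma> i) < x (\<sigma> j)" using sorts_less_iff[OF assms jn] j by auto
    moreover have "b \<in> {1..n}" using j jn permutes_in_image[OF p] by auto
    ultimately show "b \<in> {b\<in>{1..n}. x b \<le> x (\<sigma> i)}" using j by auto
  qed
  moreover have "inj_on \<sigma> {1..i}" using permutes_inj[OF p] by (meson inj_on_subset subset_UNIV)
  ultimately show ?thesis by (simp add: card_image)
qed

lemma sorts_unique:
  assumes "sorts n x \<sigma>" "sorts n x \<tau>"
  shows "\<sigma> = \<tau>"
proof
  fix i
  have p: "\<sigma> permutes {1..n}" "\<tau> permutes {1..n}" using assms by (auto simp: sorts_def)
  show "\<sigma> i = \<tau> i"
  proof (cases "i \<in> {1..n}")
    case True
    then have "\<sigma> i \<in> {1..n}" using permutes_in_image[OF p(1)] by simp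
    then obtain j where j: "j \<in> {1..n}" "\<sigma> i = \<tau> j" using permutes_image[OF p(2)] by (metis imageE)
    have "i = j" using sorts_position[OF assms(1) True] sorts_position[OF assms(2) j(1)] j(2) by simp
    then show ?thesis using j by simp
  next
    case False then show ?thesis using p by (simp add: permutes_not_in)
  qed
qed

text \<open>The rank map \<open>r\<close>, counting the observations not above a given one, is
  strictly increasing in the value, hence a bijection of \<open>{1..n}\<close>; its inverse
  sorts.\<close>

lemma sorts_exists:
  assumes "inj_on x {1..n}"
  shows "\<exists>\<sigma>. sorts n x \<sigma>"
proof -
  \<comment> \<open>Outside \<open>{1..n}\<close> it is the identity, as \<open>permutes\<close>
    demands.\<close>
  define r where "r = (\<lambda>a. if a \<in> {1..n} then card {b\<in>{1..n}. x b \<le> x a} else a)"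
  have mono: "r a < r b" if "a \<in> {1..n}" "b \<in> {1..n}" "x a < x b" for a b
  proof -
    have "b \<in> {c\<in>{1..n}. x c \<le> x b}" "b \<notin> {c\<in>{1..n}. x c \<le> x a}"
      "{c\<in>{1..n}. x c \<le> x a} \<subseteq> {c\<in>{1..n}. x c \<le> x b}" using that by auto
    then have "{c\<in>{1..n}. x c \<le> x a} \<subset> {c\<in>{1..n}. x c \<le> x b}" by blast
    from psubset_card_mono[OF _ this] show ?thesis using that by (simp add: r_def)
  qed
  have inj: "inj_on r {1..n}"
  proof (rule inj_onI)
    fix a b assume ab: "a \<in> {1..n}" "b \<in> {1..n}" "r a = r b"
    then have "x a = x b" using mono[of a b] mono[of b a] by (cases "x a" "x b" rule: linorder_cases) auto
    then show "a = b" using assms ab by (auto dest: inj_onD)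
  qed
  have sub: "r ` {1..n} \<subseteq> {1..n}"
  proof
    fix c assume "c \<in> r ` {1..n}"
    then obtain a where a: "a \<in> {1..n}" "c = card {b\<in>{1..n}. x b \<le> x a}" by (auto simp: r_def)
    have "c \<le> card {1..n}" unfolding a(2) by (rule card_mono) auto
    moreover have "c \<noteq> 0" unfolding a(2) using a(1) by auto
    ultimately show "c \<in> {1..n}" by auto
  qed
  have "bij_betw r {1..n} {1..n}"
    using inj endo_inj_surj[OF _ sub inj] by (auto simp: bij_betw_def)
  then have rp: "r permutes {1..n}" by (rule bij_imp_permutes) (auto simp: r_def)
  let ?s = "inv r"
  have "sorts n x ?s" unfolding sorts_def
  proof (intro conjI ballI)
    show sp: "?s permutes {1..n}" using rp by (rule permutes_inv)
    fix i assume i: "i \<in> {1..<n}"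
    have in1: "?s i \<in> {1..n}" "?s (Suc i) \<in> {1..n}" using permutes_in_image[OF sp] i by auto
    have "r (?s i) = i" "r (?s (Suc i)) = Suc i" using permutes_inverses[OF rp] by auto
    then show "x (?s i) < x (?s (Suc i))"
      using mono[of "?s (Suc i)" "?s i"] in1 inj_onD[OF assms, of "?s i" "?s (Suc i)"] by force
  qed
  then show ?thesis by blast
qed

lemma rank_perm_eq:
  assumes "sorts n x \<sigma>" shows "rank_perm n x = \<sigma>"
proof -
  have "(THE \<sigma>. sorts n x \<sigma>) = \<sigma>"
  proof (rule the_equality)
    show "\<tau> = \<sigma>" if "sorts n x \<tau>" for \<tau> using sorts_unique[OF that assms] .
  qed fact
  then show ?thesis using assms by (auto simp: rank_perm_def)
qed

lemma sorts_rank_perm: "inj_on x {1..n} \<Longrightarrow> sorts n x (rank_perm n x)"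
  using sorts_exists[of x n] rank_perm_eq by metis

text \<open>With ties the default identity is still a permutation, so right neighbours form a single
  cycle for every sample and sums around the cycle can be rearranged without an exceptional
  set.\<close>

lemma rank_perm_permutes: "rank_perm n x permutes {1..n}"
proof (cases "\<exists>\<sigma>. sorts n x \<sigma>")
  case True then show ?thesis using rank_perm_eq by (auto simp: sorts_def)
next
  case False then show ?thesis by (simp add: rank_perm_def permutes_id)
qed

lemma rank_perm_cong:
  assumes "\<And>i. i \<in> {1..n} \<Longrightarrow> x i = y i"
  shows "rank_perm n x = rank_perm n y"
proof -
  have "sorts n x = sorts n y"
  proof
    fix \<sigma>
    have "x (\<sigma> i) = y (\<sigma> i)" if "\<sigma> permutes {1..n}" "i \<in> {1..n}" for i
      using that permutes_in_image[OF that(1)] assms by auto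
    then show "sorts n x \<sigma> = sorts n y \<sigma>" unfolding sorts_def by (auto; force)
  qed
  then show ?thesis by (simp add: rank_perm_def)
qed

lemma right_nb_cong:
  assumes "\<And>i. i \<in> {1..n} \<Longrightarrow> x i = y i"
  shows "right_nb n x = right_nb n y"
proof -
  have "rank_perm n x = rank_perm n y" by (rule rank_perm_cong) fact
  then show ?thesis unfolding right_nb_def[abs_def] by simp
qed

lemma right_nb_alt: "right_nb n x j = rank_perm n x (Suc (inv (rank_perm n x) j mod n))"
  by (simp add: right_nb_def periodic_ext_def)

lemma right_nb_rank_perm: "right_nb n x (rank_perm n x j) = rank_perm n x (Suc (j mod n))"
  by (simp add: right_nb_alt permutes_inverses[OF rank_perm_permutes])

text \<open>\<open>Suc (j mod n)\<close> is the cyclic successor on positions: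
  \<open>n mod n = 0\<close> sends \<open>n\<close> to 1.\<close>

lemma Suc_mod_bij: "bij_betw (\<lambda>j. Suc (j mod n)) {1..n} {1..n}"
proof -
  have "inj_on (\<lambda>j. Suc (j mod n)) {1..n}"
  proof (rule inj_onI)
    fix a b assume "a \<in> {1..n}" "b \<in> {1..n}" "Suc (a mod n) = Suc (b mod n)"
    then show "a = b" by (cases "a = n"; cases "b = n") auto
  qed
  moreover have "(\<lambda>j. Suc (j mod n)) ` {1..n} \<subseteq> {1..n}" by (auto simp: Suc_le_eq)
  ultimately show ?thesis by (simp add: bij_betw_def endo_inj_surj)
qed

lemma right_nb_bij: "bij_betw (right_nb n x) {1..n} {1..n}"
proof -
  let ?s = "rank_perm n x"
  have 1: "bij_betw ?s {1..n} {1..n}" "bij_betw (inv ?s) {1..n} {1..n}"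
    using rank_perm_permutes permutes_inv permutes_imp_bij by blast+
  have "right_nb n x = ?s \<circ> ((\<lambda>j. Suc (j mod n)) \<circ> inv ?s)"
    by (auto simp: right_nb_alt)
  then show ?thesis using bij_betw_trans[OF bij_betw_trans[OF 1(2) Suc_mod_bij] 1(1)] by simp
qed

lemma right_nb_in: "i \<in> {1..n} \<Longrightarrow> right_nb n x i \<in> {1..n}"
  using right_nb_bij bij_betwE by blast

text \<open>A single point is its own neighbour; from \<open>n = 2\<close> on, a point and its
  neighbour carry distinct noise coordinates, hence independent noises.\<close>

lemma right_nb_neq:
  assumes "n \<ge> 2" "i \<in> {1..n}" shows "right_nb n x i \<noteq> i"
proof
  assume "right_nb n x i = i"
  let ?s = "rank_perm n x"
  obtain j where j: "j \<in> {1..n}" "i = ?s j"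
    using assms permutes_image[OF rank_perm_permutes] by (metis imageE)
  then have "Suc (j mod n) = j"
    using \<open>right_nb n x i = i\<close> permutes_inj[OF rank_perm_permutes, of n x]
    by (simp add: right_nb_rank_perm inj_eq)
  then show False using j assms by (cases "j = n") auto
qed

lemma sum_right_nb:
  fixes F :: "nat \<Rightarrow> nat \<Rightarrow> 'b::comm_monoid_add"
  shows "(\<Sum>i=1..n. F i (right_nb n x i)) = (\<Sum>j=1..n. F (rank_perm n x j) (rank_perm n x (Suc (j mod n))))"
proof -
  have "bij_betw (rank_perm n x) {1..n} {1..n}" using rank_perm_permutes permutes_imp_bij by blast
  from sum.reindex_bij_betw[OF this, of "\<lambda>i. F i (right_nb n x i)"]
  show ?thesis by (simp add: right_nb_rank_perm)
qed

text \<open>Cuts the cycle open at the edge from the last position back to the first, leaving a path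
  to which monotonicity or the martingale estimate applies.\<close>

lemma sum_right_nb_sorted:
  fixes F :: "nat \<Rightarrow> nat \<Rightarrow> 'b::comm_monoid_add"
  assumes "n \<ge> 1"
  shows "(\<Sum>i=1..n. F i (right_nb n x i)) =
    (\<Sum>j=1..<n. F (rank_perm n x j) (rank_perm n x (Suc j))) + F (rank_perm n x n) (rank_perm n x 1)"
proof -
  have "{1..n} = insert n {1..<n}" using assms by auto
  then have "(\<Sum>j=1..n. F (rank_perm n x j) (rank_perm n x (Suc (j mod n))))
    = F (rank_perm n x n) (rank_perm n x 1) + (\<Sum>j=1..<n. F (rank_perm n x j) (rank_perm n x (Suc (j mod n))))"
    by simp
  also have "(\<Sum>j=1..<n. F (rank_perm n x j) (rank_perm n x (Suc (j mod n)))) = (\<Sum>j=1..<n. F (rank_perm n x j) (rank_perm n x (Suc j)))"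
    by (rule sum.cong) auto
  finally show ?thesis unfolding sum_right_nb by (simp add: add.commute)
qed

lemma sum_right_nb_component:
  "(\<Sum>i=1..n. h (right_nb n x i)) = (\<Sum>i=1..n. h i)"
  using sum.reindex_bij_betw[OF right_nb_bij] .

text \<open>Shifting the index by one around the cycle turns pairs (left neighbour, point) into
  pairs (point, right neighbour); position 0 is \<open>n\<close> by periodicity. This reconciles the
  two forms of Delta_n.\<close>

lemma sum_periodic_ext:
  fixes F :: "nat \<Rightarrow> nat \<Rightarrow> 'b::comm_monoid_add"
  shows "(\<Sum>i=1..n. F (periodic_ext n (rank_perm n x) (i - 1)) (periodic_ext n (rank_perm n x) i))
    = (\<Sum>i=1..n. F i (right_nb n x i))"
proof (cases "n \<ge> 1")
  case True
  let ?s = "rank_perm n x"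
  have "(\<Sum>i=1..n. F (periodic_ext n ?s (i - 1)) (periodic_ext n ?s i))
    = (\<Sum>j=1..n. F (periodic_ext n ?s (j mod n)) (periodic_ext n ?s (Suc (j mod n))))"
    using sum.reindex_bij_betw[OF Suc_mod_bij, of "\<lambda>i. F (periodic_ext n ?s (i - 1)) (periodic_ext n ?s i)" n] by simp
  also have "\<dots> = (\<Sum>j=1..n. F (?s j) (?s (Suc (j mod n))))"
  proof (rule sum.cong[OF refl])
    fix j assume j: "j \<in> {1..n}"
    have 1: "periodic_ext n ?s (j mod n) = ?s j"
      using j periodic_ext_ends(1)[OF True, of ?s] periodic_ext_base[of j n ?s] by (cases "j = n") auto
    have 2: "periodic_ext n ?s (Suc (j mod n)) = ?s (Suc (j mod n))"
      by (rule periodic_ext_base) (use True in \<open>auto simp: Suc_le_eq\<close>)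
    show "F (periodic_ext n ?s (j mod n)) (periodic_ext n ?s (Suc (j mod n))) = F (?s j) (?s (Suc (j mod n)))"
      unfolding 1 2 ..
  qed
  finally show ?thesis by (simp only: sum_right_nb)
qed simp

text \<open>Relabelling by \<open>\<pi>\<close> changes the sorting permutation
  \<open>\<sigma>\<close> to \<open>inv \<pi> \<circ> \<sigma>\<close>, so the neighbour relation is
  carried along; this is the source of exchangeability.\<close>

lemma right_nb_permute:
  assumes "inj_on x {1..n}" "\<pi> permutes {1..n}"
  shows "\<pi> (right_nb n (x \<circ> \<pi>) i) = right_nb n x (\<pi> i)"
proof -
  let ?s = "rank_perm n x"
  have s: "sorts n x ?s" by (rule sorts_rank_perm) fact
  then have sp: "?s permutes {1..n}" by (simp add: sorts_def)
  have ip: "inv \<pi> permutes {1..n}" by (rule permutes_inv) fact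
  have "sorts n (x \<circ> \<pi>) (inv \<pi> \<circ> ?s)"
    using s permutes_compose[OF sp ip] by (simp add: sorts_def permutes_inverses[OF assms(2)])
  then have e: "rank_perm n (x \<circ> \<pi>) = inv \<pi> \<circ> ?s" by (rule rank_perm_eq)
  have "inv (inv \<pi> \<circ> ?s) = inv ?s \<circ> \<pi>"
    using permutes_bij[OF sp] permutes_bij[OF ip] permutes_inv_inv[OF assms(2)] by (simp add: o_inv_distrib)
  then show ?thesis unfolding right_nb_alt e
    by (simp add: permutes_inverses[OF assms(2)])
qed

section \<open>Measurability of ranks and right neighbours\<close>

lemma measurable_rank_perm:
  assumes [measurable]: "\<And>i. i \<in> {1..n} \<Longrightarrow> (\<lambda>\<omega>. x \<omega> i) \<in> borel_measurable N"
  shows "(\<lambda>\<omega>. rank_perm n (x \<omega>)) \<in> measurable N (count_space {\<sigma>. \<sigma> permutes {1..n}})"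
proof -
  let ?P = "{\<sigma>. \<sigma> permutes {1..n}}"
  have fin: "finite ?P" by (rule finite_permutations) simp
  have ms: "{\<omega> \<in> space N. sorts n (x \<omega>) \<sigma>} \<in> sets N" if "\<sigma> \<in> ?P" for \<sigma>
  proof -
    have xm: "(\<lambda>\<omega>. x \<omega> (\<sigma> i)) \<in> borel_measurable N" if "i \<in> {1..n}" for i
      using assms permutes_in_image[of \<sigma> "{1..n}" i] \<open>\<sigma> \<in> ?P\<close> that by auto
    have [measurable]: "i \<in> {1..<n} \<Longrightarrow> {\<omega> \<in> space N. x \<omega> (\<sigma> i) < x \<omega> (\<sigma> (Suc i))} \<in> sets N" for i
      by (rule borel_measurable_less[OF xm xm]) auto
    have "{\<omega> \<in> space N. \<forall>i\<in>{1..<n}. x \<omega> (\<sigma> i) < x \<omega> (\<sigma> (Suc i))} \<in> sets N"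
      by (rule sets.sets_Collect_finite_All) auto
    then show ?thesis using that by (simp add: sorts_def)
  qed
  have mE: "{\<omega> \<in> space N. \<exists>\<sigma>. sorts n (x \<omega>) \<sigma>} \<in> sets N"
  proof -
    have "{\<omega> \<in> space N. \<exists>\<sigma>. sorts n (x \<omega>) \<sigma>} = (\<Union>\<sigma>\<in>?P. {\<omega> \<in> space N. sorts n (x \<omega>) \<sigma>})"
      by (auto simp: sorts_def)
    also have "\<dots> \<in> sets N" using fin ms by (intro sets.finite_UN) auto
    finally show ?thesis .
  qed
  show ?thesis
  proof (subst measurable_count_space_eq2[OF fin], intro conjI ballI)
    show "(\<lambda>\<omega>. rank_perm n (x \<omega>)) \<in> space N \<rightarrow> ?P" using rank_perm_permutes by auto
    fix \<sigma> assume \<sigma>: "\<sigma> \<in> ?P"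
    \<comment> \<open>The fibre of the identity also contains every sample that cannot be sorted
      strictly.\<close>
    have "(\<lambda>\<omega>. rank_perm n (x \<omega>)) -` {\<sigma>} \<inter> space N =
      {\<omega> \<in> space N. sorts n (x \<omega>) \<sigma>} \<union> (if \<sigma> = id then space N - {\<omega> \<in> space N. \<exists>\<sigma>. sorts n (x \<omega>) \<sigma>} else {})"
    proof -
      have "rank_perm n (x \<omega>) = \<sigma> \<longleftrightarrow> sorts n (x \<omega>) \<sigma> \<or> (\<sigma> = id \<and> \<not> (\<exists>\<sigma>. sorts n (x \<omega>) \<sigma>))" for \<omega>
        using rank_perm_eq[of n "x \<omega>"] by (cases "\<exists>\<sigma>. sorts n (x \<omega>) \<sigma>") (auto simp: rank_perm_def)
      then show ?thesis by auto
    qed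
    also have "\<dots> \<in> sets N" using ms[OF \<sigma>] mE by auto
    finally show "(\<lambda>\<omega>. rank_perm n (x \<omega>)) -` {\<sigma>} \<inter> space N \<in> sets N" .
  qed
qed

lemma measurable_right_nb:
  assumes "\<And>i. i \<in> {1..n} \<Longrightarrow> (\<lambda>\<omega>. x \<omega> i) \<in> borel_measurable N" and i: "i \<in> {1..n}"
  shows "(\<lambda>\<omega>. right_nb n (x \<omega>) i) \<in> measurable N (count_space {1..n})"
proof -
  let ?P = "{\<sigma>. \<sigma> permutes {1..n}}"
  have "(\<lambda>\<sigma>. \<sigma> (Suc (inv \<sigma> i mod n))) \<in> measurable (count_space ?P) (count_space {1..n})"
  proof (intro measurable_count_space_eq1[THEN iffD2] funcsetI)
    fix \<sigma> assume \<sigma>: "\<sigma> \<in> ?P"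
    have "Suc (inv \<sigma> i mod n) \<in> {1..n}" using i by (auto simp: Suc_le_eq)
    then show "\<sigma> (Suc (inv \<sigma> i mod n)) \<in> space (count_space {1..n})" by (simp only: space_count_space permutes_in_image[OF \<sigma>[unfolded mem_Collect_eq]])
  qed
  moreover have "(\<lambda>\<omega>. rank_perm n (x \<omega>)) \<in> measurable N (count_space ?P)"
    by (rule measurable_rank_perm) (rule assms(1))
  ultimately show ?thesis unfolding right_nb_alt by (rule measurable_compose[rotated])
qed

lemma measurable_at_right_nb:
  assumes "\<And>i. i \<in> {1..n} \<Longrightarrow> (\<lambda>\<omega>. x \<omega> i) \<in> borel_measurable N" "i \<in> {1..n}"
    and "\<And>j. j \<in> {1..n} \<Longrightarrow> (\<lambda>\<omega>. F j \<omega>) \<in> measurable N L"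
  shows "(\<lambda>\<omega>. F (right_nb n (x \<omega>) i) \<omega>) \<in> measurable N L"
  by (rule measurable_compose_countable'[OF assms(3) measurable_right_nb[OF assms(1,2)]]) auto

section \<open>Squared increments between neighbours\<close>

text \<open>Unlike \<^const>\<open>right_nb\<close>, this makes sense on every finite index set, so one observation can be removed, as
  the Efron-Stein inequality requires.\<close>

definition cyc_succ :: "'i set \<Rightarrow> ('i \<Rightarrow> real) \<Rightarrow> 'i \<Rightarrow> 'i \<Rightarrow> bool" where
  "cyc_succ I x i j \<longleftrightarrow>
     (x i < x j \<and> (\<forall>k\<in>I. \<not> (x i < x k \<and> x k < x j))) \<or> (\<forall>k\<in>I. x k \<le> x i \<and> x j \<le> x k)"

text \<open>Of two successors neither lies strictly between the point and the other, and a point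
  below another one cannot wrap around; so the two values coincide.\<close>

lemma cyc_succ_unique:
  assumes "inj_on x I" "i \<in> I" "j \<in> I" "k \<in> I" "cyc_succ I x i j" "cyc_succ I x i k"
  shows "j = k"
proof -
  have "(x i < x j \<and> \<not> (x i < x k \<and> x k < x j)) \<or> (x k \<le> x i \<and> x j \<le> x k)"
    "(x i < x k \<and> \<not> (x i < x j \<and> x j < x k)) \<or> (x j \<le> x i \<and> x k \<le> x j)"
    using assms(3-) unfolding cyc_succ_def by blast+
  then have "x j = x k" by linarith
  then show ?thesis using assms by (auto dest: inj_onD)
qed

lemma cyc_succ_exists:
  assumes "finite I" "i \<in> I"
  shows "\<exists>j\<in>I. cyc_succ I x i j"
proof (cases "{k\<in>I. x i < x k} = {}")
  case True
  obtain j where j: "j \<in> I" "\<And>k. k \<in> I \<Longrightarrow> \<not> x k < x j"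
    using ex_min_if_finite[of "x ` I"] assms by auto
  have "cyc_succ I x i j" unfolding cyc_succ_def using True j by (auto simp: not_less)
  then show ?thesis using j by blast
next
  case False
  then obtain j where j: "j \<in> I" "x i < x j" "\<And>k. k \<in> I \<Longrightarrow> x i < x k \<Longrightarrow> \<not> x k < x j"
    using ex_min_if_finite[of "x ` {k\<in>I. x i < x k}"] assms by auto
  then show ?thesis unfolding cyc_succ_def by blast
qed

text \<open>Negating the values reverses the cycle, so uniqueness and existence of predecessors
  follow from those of successors.\<close>

lemma cyc_succ_reverse: "cyc_succ I x i j \<longleftrightarrow> cyc_succ I (\<lambda>k. - x k) j i"
  unfolding cyc_succ_def neg_less_iff_less neg_le_iff_le by (simp only: conj_commute)

lemma cyc_pred_unique:
  assumes "inj_on x I" "i \<in> I" "j \<in> I" "k \<in> I" "cyc_succ I x j i" "cyc_succ I x k i"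
  shows "j = k"
proof (rule cyc_succ_unique[of "\<lambda>k. - x k" I i])
  show "inj_on (\<lambda>k. - x k) I" using assms(1) unfolding inj_on_def neg_equal_iff_equal .
  show "cyc_succ I (\<lambda>k. - x k) i j" "cyc_succ I (\<lambda>k. - x k) i k"
    using assms(5,6) unfolding cyc_succ_reverse[of I x] .
qed fact+

lemma cyc_pred_exists:
  assumes "finite I" "i \<in> I"
  shows "\<exists>j\<in>I. cyc_succ I x j i"
  using cyc_succ_exists[OF assms, of "\<lambda>k. - x k"] unfolding cyc_succ_reverse[of I x] .

text \<open>Indicators replace a successor function: the sum is then defined for every sample, is
  measurable term by term, and reads only coordinates in \<open>I\<close>.\<close>

definition cyc_sum :: "('i \<Rightarrow> 'i \<Rightarrow> real) \<Rightarrow> 'i set \<Rightarrow> ('i \<Rightarrow> real) \<Rightarrow> real" where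
  "cyc_sum d I x = (\<Sum>i\<in>I. \<Sum>j\<in>I. of_bool (cyc_succ I x i j) * d i j)"

lemma sum_of_bool_unique:
  fixes d :: "'i \<Rightarrow> real"
  assumes "finite I" "s \<in> I" "P s" "\<And>j. j \<in> I \<Longrightarrow> P j \<Longrightarrow> j = s"
  shows "(\<Sum>j\<in>I. of_bool (P j) * d j) = d s"
proof -
  have "(\<Sum>j\<in>I. of_bool (P j) * d j) = (\<Sum>j\<in>{s}. of_bool (P j) * d j)"
  proof (rule sum.mono_neutral_right)
    show "\<forall>j\<in>I - {s}. of_bool (P j) * d j = 0"
    proof
      fix j assume "j \<in> I - {s}"
      then have "\<not> P j" using assms(4) by blast
      then show "of_bool (P j) * d j = 0" by simp
    qed
  qed (use assms(1,2) in auto)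
  then show ?thesis using assms(3) by simp
qed

lemma cyc_sum_eq:
  assumes "finite I" "inj_on x I" "\<And>i. i \<in> I \<Longrightarrow> s i \<in> I" "\<And>i. i \<in> I \<Longrightarrow> cyc_succ I x i (s i)"
  shows "cyc_sum d I x = (\<Sum>i\<in>I. d i (s i))"
  unfolding cyc_sum_def
proof (rule sum.cong[OF refl])
  fix i assume i: "i \<in> I"
  show "(\<Sum>j\<in>I. of_bool (cyc_succ I x i j) * d i j) = d i (s i)"
  proof (rule sum_of_bool_unique)
    show "j = s i" if "j \<in> I" "cyc_succ I x i j" for j
      by (rule cyc_succ_unique[OF assms(2) i that(1) assms(3)[OF i] that(2) assms(4)[OF i]])
  qed (fact assms(1) assms(3)[OF i] assms(4)[OF i])+
qed

text \<open>Deleting \<open>i\<close> replaces the edges p -> i -> s by the single edge p -> s and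
  leaves every other successor in place. If \<open>I\<close> has two points, \<open>p = s\<close>
  and the new edge is a loop.\<close>

lemma cyc_sum_remove:
  assumes fin: "finite I" and inj: "inj_on x I" and i: "i \<in> I" "p \<in> I" "s \<in> I"
    and ps: "cyc_succ I x p i" "cyc_succ I x i s" and ne: "I \<noteq> {i}"
  shows "cyc_sum d I x = cyc_sum d (I - {i}) x - d p s + d p i + d i s"
proof -
  define N where "N = (\<lambda>j. SOME k. k \<in> I \<and> cyc_succ I x j k)"
  have N: "N j \<in> I \<and> cyc_succ I x j (N j)" if "j \<in> I" for j
  proof -
    have "\<exists>k. k \<in> I \<and> cyc_succ I x j k" using cyc_succ_exists[OF fin that] by blast
    then show ?thesis unfolding N_def by (rule someI_ex)
  qed
  \<comment> \<open>A point that succeeds itself is both largest and smallest, so all values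
    coincide and \<open>I\<close> is a singleton.\<close>
  have nsucc: "\<not> cyc_succ I x i i"
  proof
    assume "cyc_succ I x i i"
    then have "x k = x i" if "k \<in> I" for k using that unfolding cyc_succ_def by (meson antisym less_irrefl)
    then have "k = i" if "k \<in> I" for k using that i(1) inj by (meson inj_onD)
    then show False using ne i(1) by blast
  qed
  have pi: "p \<noteq> i" "s \<noteq> i" using ps nsucc by auto
  let ?J = "I - {i}"
  have injJ: "inj_on x ?J" using inj by (rule inj_on_subset) auto
  have Ni: "N i = s" "N p = i"
    using cyc_succ_unique[OF inj i(1) _ i(3) _ ps(2), of "N i"] cyc_succ_unique[OF inj i(2) _ i(1) _ ps(1), of "N p"]
      N[OF i(1)] N[OF i(2)] by blast+
  define N' where "N' = (\<lambda>j. if j = p then s else N j)"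
  have N': "N' j \<in> ?J \<and> cyc_succ ?J x j (N' j)" if j: "j \<in> ?J" for j
  proof (cases "j = p")
    case True
    have nx: "x k \<noteq> x i" if "k \<in> ?J" for k using that i(1) inj_onD[OF inj, of k i] by blast
    have "x p \<noteq> x i" using nx i pi by blast
    \<comment> \<open>The deleted point is interior, or the largest (its successor is the smallest),
      or the smallest (its predecessor is the largest); \<open>eq\<close> would make it
      both.\<close>
    consider (inner) "x p < x i" "\<forall>k\<in>I. \<not> (x p < x k \<and> x k < x i)" "x i < x s" "\<forall>k\<in>I. \<not> (x i < x k \<and> x k < x s)"
      | (top) "x p < x i" "\<forall>k\<in>I. \<not> (x p < x k \<and> x k < x i)" "\<forall>k\<in>I. x k \<le> x i \<and> x s \<le> x k"
      | (bot) "\<forall>k\<in>I. x k \<le> x p \<and> x i \<le> x k" "x i < x s" "\<forall>k\<in>I. \<not> (x i < x k \<and> x k < x s)"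
      | (eq) "\<forall>k\<in>I. x k \<le> x p \<and> x i \<le> x k" "\<forall>k\<in>I. x k \<le> x i \<and> x s \<le> x k"
      using ps unfolding cyc_succ_def by blast
    then have "cyc_succ ?J x p s"
    proof cases
      case inner
      have "\<not> (x p < x k \<and> x k < x s)" if "k \<in> ?J" for k
        using inner(2,4)[THEN bspec, OF DiffD1[OF that]] nx[OF that] by linarith
      then show ?thesis using inner(1,3) unfolding cyc_succ_def by (blast intro: less_trans)
    next
      case top
      have "x k \<le> x p \<and> x s \<le> x k" if "k \<in> ?J" for k
        using top(2,3)[THEN bspec, OF DiffD1[OF that]] nx[OF that] by linarith
      then show ?thesis unfolding cyc_succ_def by blast
    next
      case bot
      have "x k \<le> x p \<and> x s \<le> x k" if "k \<in> ?J" for k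
        using bot(1,3)[THEN bspec, OF DiffD1[OF that]] nx[OF that] by linarith
      then show ?thesis unfolding cyc_succ_def by blast
    next
      case eq
      then have "x p = x i" using i by (meson antisym)
      then show ?thesis using \<open>x p \<noteq> x i\<close> by blast
    qed
    then show ?thesis using True N'_def pi i by auto
  next
    case False
    have jI: "j \<in> I" using j by blast
    \<comment> \<open>Only \<open>p\<close> precedes \<open>i\<close>, so the other successors
      survive the deletion.\<close>
    have "N j \<noteq> i" using cyc_pred_unique[OF inj i(1) jI i(2) _ ps(1)] N[OF jI] False by metis
    then have "N j \<in> ?J" "cyc_succ ?J x j (N j)" using N[OF jI] unfolding cyc_succ_def by blast+
    then show ?thesis using False by (simp add: N'_def)
  qed
  have e1: "cyc_sum d I x = (\<Sum>j\<in>I. d j (N j))" by (rule cyc_sum_eq[OF fin inj]) (use N in blast)+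
  have e2: "cyc_sum d ?J x = (\<Sum>j\<in>?J. d j (N' j))" by (rule cyc_sum_eq[OF finite_Diff[OF fin] injJ]) (use N' in blast)+
  have "(\<Sum>j\<in>I. d j (N j)) = d i s + (d p i + (\<Sum>j\<in>?J - {p}. d j (N j)))"
    using fin i pi Ni by (simp add: sum.remove[of I i] sum.remove[of ?J p])
  moreover have "(\<Sum>j\<in>?J. d j (N' j)) = d p s + (\<Sum>j\<in>?J - {p}. d j (N' j))"
    using fin i pi by (simp add: sum.remove[of ?J p] N'_def)
  moreover have "(\<Sum>j\<in>?J - {p}. d j (N' j)) = (\<Sum>j\<in>?J - {p}. d j (N j))"
    by (rule sum.cong) (auto simp: N'_def)
  ultimately show ?thesis unfolding e1 e2 by simp
qed

text \<open>With adjacent increments a and b the change is a^2 + b^2 - (a + b)^2 = -2 a b. Bounding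
  b^2 by (2 B)^2 and keeping a^2, the edge entering \<open>i\<close>, yields a bound that sums over
  \<open>i\<close> to a multiple of the statistic itself.\<close>

lemma cyc_sum_remove_sq:
  assumes fin: "finite I" and inj: "inj_on x I" and i: "i \<in> I" and B: "\<And>a. \<bar>h a\<bar> \<le> B"
    and d: "d = (\<lambda>i j. (h (x i) - h (x j))\<^sup>2)"
  shows "(cyc_sum d I x - cyc_sum d (I - {i}) x)\<^sup>2
    \<le> 16 * B\<^sup>2 * (\<Sum>j\<in>I. of_bool (cyc_succ I x j i) * d j i)"
proof (cases "I = {i}")
  case True
  then show ?thesis by (simp add: cyc_sum_def d)
next
  case False
  obtain p s where ps: "p \<in> I" "s \<in> I" "cyc_succ I x p i" "cyc_succ I x i s"
    using cyc_succ_exists[OF fin i] cyc_pred_exists[OF fin i] by blast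
  define a where "a = h (x p) - h (x i)"
  define b where "b = h (x i) - h (x s)"
  have "cyc_sum d I x - cyc_sum d (I - {i}) x = - d p s + d p i + d i s"
    using cyc_sum_remove[OF fin inj i ps(1,2,3,4) False, of d] by simp
  also have "\<dots> = - (2 * a * b)" unfolding d a_def b_def by (simp add: power2_eq_square algebra_simps)
  finally have "(cyc_sum d I x - cyc_sum d (I - {i}) x)\<^sup>2 = 4 * a\<^sup>2 * b\<^sup>2" by (simp add: power_mult_distrib)
  also have "\<dots> \<le> 4 * a\<^sup>2 * (2*B)\<^sup>2"
    unfolding b_def by (intro mult_left_mono square_diff_le B) auto
  also have "\<dots> = 16 * B\<^sup>2 * d p i" by (simp add: d a_def power_mult_distrib)
  also have "d p i = (\<Sum>j\<in>I. of_bool (cyc_succ I x j i) * d j i)"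
  proof (rule sum_of_bool_unique[symmetric])
    show "j = p" if "j \<in> I" "cyc_succ I x j i" for j
      by (rule cyc_pred_unique[OF inj i that(1) ps(1) that(2) ps(3)])
  qed fact+
  finally show ?thesis .
qed

lemma cyc_succ_right_nb:
  assumes "inj_on x {1..n}" "i \<in> {1..n}"
  shows "cyc_succ {1..n} x i (right_nb n x i)"
proof -
  define \<sigma> where "\<sigma> = rank_perm n x"
  have s: "sorts n x \<sigma>" unfolding \<sigma>_def by (rule sorts_rank_perm) fact
  have p: "\<sigma> permutes {1..n}" using s by (simp add: sorts_def)
  have im: "\<sigma> ` {1..n} = {1..n}" using permutes_image[OF p] .
  obtain j where j: "j \<in> {1..n}" "i = \<sigma> j" using im assms by (metis imageE)
  have N: "right_nb n x i = \<sigma> (Suc (j mod n))" unfolding j(2) \<sigma>_def by (rule right_nb_rank_perm)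
  show ?thesis
  proof (cases "j = n")
    case True
    have "\<forall>m\<in>{1..n}. x (\<sigma> m) \<le> x (\<sigma> n) \<and> x (\<sigma> 1) \<le> x (\<sigma> m)"
    proof
      fix m assume m: "m \<in> {1..n}"
      have "\<not> x (\<sigma> n) < x (\<sigma> m)" "\<not> x (\<sigma> m) < x (\<sigma> 1)"
        using sorts_less_iff[OF s _ m, of n] sorts_less_iff[OF s m, of 1] m by auto
      then show "x (\<sigma> m) \<le> x (\<sigma> n) \<and> x (\<sigma> 1) \<le> x (\<sigma> m)" by simp
    qed
    then have "\<forall>k\<in>\<sigma> ` {1..n}. x k \<le> x (\<sigma> n) \<and> x (\<sigma> 1) \<le> x k" by blast
    then show ?thesis unfolding N cyc_succ_def im using True j by simp
  next
    case False
    then have jn: "Suc j \<in> {1..n}" "j mod n = j" using j by auto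
    have "x (\<sigma> j) < x (\<sigma> (Suc j))" using sorts_less_iff[OF s j(1) jn(1)] by simp
    moreover have "\<forall>m\<in>{1..n}. \<not> (x (\<sigma> j) < x (\<sigma> m) \<and> x (\<sigma> m) < x (\<sigma> (Suc j)))"
    proof
      fix m assume m: "m \<in> {1..n}"
      show "\<not> (x (\<sigma> j) < x (\<sigma> m) \<and> x (\<sigma> m) < x (\<sigma> (Suc j)))"
        using sorts_less_iff[OF s j(1) m] sorts_less_iff[OF s m jn(1)] by simp
    qed
    then have "\<forall>k\<in>\<sigma> ` {1..n}. \<not> (x (\<sigma> j) < x k \<and> x k < x (\<sigma> (Suc j)))" by blast
    ultimately show ?thesis unfolding N cyc_succ_def im using jn j by simp
  qed
qed

lemma cyc_sum_right_nb:
  assumes "inj_on x {1..n}"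
  shows "cyc_sum d {1..n} x = (\<Sum>i=1..n. d i (right_nb n x i))"
  by (rule cyc_sum_eq[OF finite_atLeastAtMost assms right_nb_in cyc_succ_right_nb[OF assms]])

section \<open>Samples from an atomless law\<close>

locale atomless_law =
  fixes \<mu> :: "real measure"
  assumes prob: "prob_space \<mu>" and sets_borel[measurable_cong, simp]: "sets \<mu> = sets borel"
    and no_atoms: "\<And>x. measure \<mu> {x} = 0"
begin

sublocale prob_space \<mu> by (rule prob)

lemma space_UNIV[simp]: "space \<mu> = UNIV"
  using sets_eq_imp_space_eq[OF sets_borel] by simp

definition sample :: "nat \<Rightarrow> (nat \<Rightarrow> real) measure" where
  "sample n = PiM {1..n} (\<lambda>_. \<mu>)"

lemma prob_sample: "prob_space (sample n)"
  unfolding sample_def by (rule prob_space_PiM) (rule prob)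

lemma sample_component[measurable]: "i \<in> {1..n} \<Longrightarrow> (\<lambda>x. x i) \<in> borel_measurable (sample n)"
  unfolding sample_def using measurable_component_singleton[of i "{1..n}" "\<lambda>_. \<mu>"] measurable_cong_sets[OF refl sets_borel]
  by blast

lemma distr_sample_component: "i \<in> {1..n} \<Longrightarrow> distr (sample n) \<mu> (\<lambda>x. x i) = \<mu>"
  unfolding sample_def by (rule distr_PiM_component) (use prob in auto)

lemma integral_sample_component:
  fixes h :: "real \<Rightarrow> 'b::{banach,second_countable_topology}"
  assumes "i \<in> {1..n}" "h \<in> borel_measurable borel"
  shows "(\<integral>x. h (x i) \<partial>sample n) = (\<integral>a. h a \<partial>\<mu>)"
proof -
  have "(\<integral>a. h a \<partial>\<mu>) = (\<integral>a. h a \<partial>distr (sample n) \<mu> (\<lambda>x. x i))" using distr_sample_component[OF assms(1)] by simp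
  also have "\<dots> = (\<integral>x. h (x i) \<partial>sample n)"
  proof (rule integral_distr)
    show "(\<lambda>x. x i) \<in> measurable (sample n) \<mu>"
      using sample_component[OF assms(1)] measurable_cong_sets[OF refl sets_borel] by blast
    show "h \<in> borel_measurable \<mu>"
      using assms(2) measurable_cong_sets[OF sets_borel refl] by blast
  qed
  finally show ?thesis by simp
qed

text \<open>With the other coordinates fixed, the event of a tie is that coordinate \<open>j\<close>
  hits the single point \<open>x i\<close>, which has mass 0; Fubini's theorem concludes.\<close>

lemma AE_sample_neq:
  assumes ij: "i \<in> {1..n}" "j \<in> {1..n}" "i \<noteq> j"
  shows "AE x in sample n. x i \<noteq> x j"
proof -
  interpret S: prob_space "sample n" by (rule prob_sample)
  interpret PP: product_prob_space "\<lambda>_. \<mu>" UNIV by standard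
  have [measurable]: "(\<lambda>x. x i) \<in> borel_measurable (sample n)" "(\<lambda>x. x j) \<in> borel_measurable (sample n)"
    using ij by (auto intro: sample_component)
  define F where "F = (\<lambda>x::nat\<Rightarrow>real. of_bool (x i = x j) :: real)"
  have Fi: "integrable (sample n) F" unfolding F_def
    by (rule integrable_bdd[OF prob_sample, where B=1]) (auto simp: of_bool_def)
  have ins: "insert j ({1..n} - {j}) = {1..n}" using ij by auto
  have "(\<integral>x. F x \<partial>sample n) = (\<integral>x. (\<integral>y. F (x(j:=y)) \<partial>\<mu>) \<partial>PiM ({1..n}-{j}) (\<lambda>_. \<mu>))"
    using PP.product_integral_insert[of "{1..n}-{j}" j F] Fi unfolding ins sample_def by auto
  also have "\<dots> = 0"
  proof -
    have "(\<integral>y. F (x(j:=y)) \<partial>\<mu>) = 0" for x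
    proof -
      have "(\<lambda>y. F (x(j:=y))) = indicator {x i}" using ij by (auto simp: F_def fun_eq_iff indicator_def)
      then show ?thesis using no_atoms[of "x i"] by simp
    qed
    then show ?thesis by simp
  qed
  finally have "(\<integral>x. F x \<partial>sample n) = 0" .
  then have "AE x in sample n. F x = 0"
    using integral_nonneg_eq_0_iff_AE[OF Fi] by (auto simp: F_def)
  then show ?thesis by (auto simp: F_def)
qed

lemma AE_sample_inj: "AE x in sample n. inj_on x {1..n}"
proof -
  have "AE x in sample n. \<forall>i\<in>{1..n}. \<forall>j\<in>{1..n}. i \<noteq> j \<longrightarrow> x i \<noteq> x j"
    by (intro AE_finite_allI) (use AE_sample_neq in auto)
  then show ?thesis by (rule AE_mp) (auto simp: inj_on_def)
qed

definition nb_sq :: "nat \<Rightarrow> (real \<Rightarrow> real) \<Rightarrow> (nat \<Rightarrow> real) \<Rightarrow> real" where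
  "nb_sq n h x = (\<Sum>i=1..n. (h (x i) - h (x (right_nb n x i)))\<^sup>2)"

lemma measurable_at_nb[measurable]:
  assumes "i \<in> {1..n}" shows "(\<lambda>x. x (right_nb n x i)) \<in> borel_measurable (sample n)"
  by (rule measurable_at_right_nb[where F="\<lambda>j x. x j" and x="\<lambda>x. x"]) (use assms sample_component in auto)

lemma nb_sq_measurable:
  assumes "h \<in> borel_measurable borel"
  shows "nb_sq n h \<in> borel_measurable (sample n)"
  unfolding nb_sq_def[abs_def]
  by (intro borel_measurable_sum borel_measurable_power borel_measurable_diff
        measurable_compose[OF _ assms] measurable_at_nb sample_component)

lemma nb_sq_nonneg: "0 \<le> nb_sq n h x"
  unfolding nb_sq_def by (intro sum_nonneg) auto

lemma nb_sq_bound: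
  assumes "\<And>a. \<bar>h a\<bar> \<le> B" shows "nb_sq n h x \<le> real n * (2*B)\<^sup>2"
  unfolding nb_sq_def
  using sum_bounded_above[of "{1..n}" "\<lambda>i. (h (x i) - h (x (right_nb n x i)))\<^sup>2" "(2*B)\<^sup>2"]
    square_diff_le[OF assms assms] by auto

lemma integrable_nb_sq:
  assumes "h \<in> borel_measurable borel" "\<And>a. \<bar>h a\<bar> \<le> B"
  shows "integrable (sample n) (nb_sq n h)"
  by (rule integrable_bdd[OF prob_sample nb_sq_measurable[OF assms(1)], where B="real n * (2*B)\<^sup>2"])
     (use nb_sq_nonneg nb_sq_bound[OF assms(2)] in auto)

text \<open>Efron-Stein with the deleted sums as competitors is self-bounding: the bounds for the
  single deletions add up to a multiple of the statistic, so the variance is controlled by the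
  mean.\<close>

lemma variance_nb_sq:
  assumes h: "h \<in> borel_measurable borel" and B: "\<And>a. \<bar>h a\<bar> \<le> B"
  shows "(\<integral>x. (nb_sq n h x - (\<integral>x. nb_sq n h x \<partial>sample n))\<^sup>2 \<partial>sample n)
    \<le> 16 * B\<^sup>2 * (\<integral>x. nb_sq n h x \<partial>sample n)"
proof -
  let ?I = "{1..n}"
  define d where "d = (\<lambda>(x::nat\<Rightarrow>real) (i::nat) j. (h (x i) - h (x j))\<^sup>2)"
  \<comment> \<open>Defined for every subset of indices, so that the sum over
    \<open>?I - {i}\<close> ignores coordinate \<open>i\<close>; its agreement with
    \<open>nb_sq\<close> is needed only off the null set of ties.\<close>
  define S where "S = (\<lambda>J (x::nat\<Rightarrow>real). cyc_sum (d x) J x)"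
  have B0: "0 \<le> B" using B[of 0] by linarith
  have dB: "0 \<le> d x i j" "d x i j \<le> (2*B)\<^sup>2" for x i j
    unfolding d_def using square_diff_le[OF B B] by auto
  have bm[measurable]: "Measurable.pred (sample n) (\<lambda>x. cyc_succ J x i j)" if "J \<subseteq> ?I" "i \<in> ?I" "j \<in> ?I" for J i j
  proof -
    have c: "k \<in> J \<Longrightarrow> (\<lambda>x. x k) \<in> borel_measurable (sample n)" for k using that sample_component by auto
    have [measurable]: "(\<lambda>x. x i) \<in> borel_measurable (sample n)" "(\<lambda>x. x j) \<in> borel_measurable (sample n)"
      using that sample_component by auto
    have fin: "finite J" using that finite_subset by blast
    have "Measurable.pred (sample n) (\<lambda>x. \<forall>k\<in>J. \<not> (x i < x k \<and> x k < x j))"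
    proof (rule pred_intros_finite(3)[OF fin])
      fix k assume "k \<in> J"
      note [measurable] = c[OF this]
      show "Measurable.pred (sample n) (\<lambda>x. \<not> (x i < x k \<and> x k < x j))" by measurable
    qed
    moreover have "Measurable.pred (sample n) (\<lambda>x. \<forall>k\<in>J. x k \<le> x i \<and> x j \<le> x k)"
    proof (rule pred_intros_finite(3)[OF fin])
      fix k assume "k \<in> J"
      note [measurable] = c[OF this]
      have "Measurable.pred (sample n) (\<lambda>x. \<not> (x i < x k) \<and> \<not> (x k < x j))" by measurable
      then show "Measurable.pred (sample n) (\<lambda>x. x k \<le> x i \<and> x j \<le> x k)" by (simp add: not_less)
    qed
    ultimately show ?thesis unfolding cyc_succ_def by measurable
  qed
  have dm: "(\<lambda>x. d x i j) \<in> borel_measurable (sample n)" if "i \<in> ?I" "j \<in> ?I" for i j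
    unfolding d_def using that
    by (intro borel_measurable_power borel_measurable_diff measurable_compose[OF _ h] sample_component)
  have tm: "(\<lambda>x. of_bool (cyc_succ J x i j) * d x i j) \<in> borel_measurable (sample n)"
    if "J \<subseteq> ?I" "i \<in> ?I" "j \<in> ?I" for J i j
    using bm[OF that] dm[OF that(2,3)] unfolding of_bool_def by measurable
  have Sm: "S J \<in> borel_measurable (sample n)" if "J \<subseteq> ?I" for J
    unfolding S_def cyc_sum_def by (intro borel_measurable_sum tm) (use that in auto)
  define C where "C = real n * (real n * (2*B)\<^sup>2)"
  have tB: "of_bool b * d x i j \<le> (2*B)\<^sup>2" "0 \<le> of_bool b * d x i j" for b x i j
    using dB[of x i j] by (auto simp: of_bool_def)
  have SB: "\<bar>S J x\<bar> \<le> C" if "J \<subseteq> ?I" for J x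
  proof -
    have c: "real (card J) \<le> real n" using card_mono[OF _ that] by simp
    have 1: "(\<Sum>j\<in>J. of_bool (cyc_succ J x i j) * d x i j) \<le> real n * (2*B)\<^sup>2" for i
    proof -
      have "(\<Sum>j\<in>J. of_bool (cyc_succ J x i j) * d x i j) \<le> of_nat (card J) * (2*B)\<^sup>2"
        by (rule sum_bounded_above) (rule tB)
      also have "\<dots> \<le> real n * (2*B)\<^sup>2" using c by (intro mult_right_mono) auto
      finally show ?thesis .
    qed
    have "S J x \<le> of_nat (card J) * (real n * (2*B)\<^sup>2)" unfolding S_def cyc_sum_def
      by (rule sum_bounded_above) (rule 1)
    also have "\<dots> \<le> C" unfolding C_def using c by (intro mult_right_mono) auto
    finally have "S J x \<le> C" .
    moreover have "0 \<le> S J x" unfolding S_def cyc_sum_def by (intro sum_nonneg tB)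
    ultimately show ?thesis by simp
  qed
  have ti: "integrable (sample n) (\<lambda>x. 16 * B\<^sup>2 * (\<Sum>j\<in>?I. of_bool (cyc_succ ?I x j i) * d x j i))"
    if i: "i \<in> ?I" for i
  proof (intro integrable_mult_right Bochner_Integration.integrable_sum integrable_bdd[OF prob_sample, where B="(2*B)\<^sup>2"])
    fix j x assume "j \<in> ?I"
    then show "(\<lambda>x. of_bool (cyc_succ ?I x j i) * d x j i) \<in> borel_measurable (sample n)"
      by (intro tm[OF subset_refl] i)
    show "norm (of_bool (cyc_succ ?I x j i) * d x j i) \<le> (2*B)\<^sup>2"
      using tB[of "cyc_succ ?I x j i" x j i] unfolding real_norm_def by linarith
  qed
  have eqAE: "AE x in sample n. S ?I x = nb_sq n h x"
    using AE_sample_inj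
  proof (rule AE_mp, intro AE_I2 impI)
    show "S ?I x = nb_sq n h x" if "inj_on x ?I" for x
      unfolding S_def nb_sq_def d_def by (rule cyc_sum_right_nb[OF that])
  qed
  have e1: "(\<integral>x. S ?I x \<partial>sample n) = (\<integral>x. nb_sq n h x \<partial>sample n)"
    by (rule integral_cong_AE) (use Sm nb_sq_measurable[OF h] eqAE in auto)
  have es: "(\<integral>x. (S ?I x - (\<integral>x. S ?I x \<partial>sample n))\<^sup>2 \<partial>sample n)
     \<le> (\<Sum>i\<in>?I. \<integral>x. (S ?I x - S (?I - {i}) x)\<^sup>2 \<partial>sample n)"
    unfolding sample_def
  proof (rule efron_stein[OF prob, where B=C])
    show "S (?I - {i}) (x(i := a)) = S (?I - {i}) x" for i x a
      unfolding S_def cyc_sum_def cyc_succ_def d_def by (intro sum.cong refl) auto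
  qed (use Sm SB in \<open>auto simp: sample_def\<close>)
  have "(\<Sum>i\<in>?I. \<integral>x. (S ?I x - S (?I - {i}) x)\<^sup>2 \<partial>sample n)
    \<le> (\<Sum>i\<in>?I. \<integral>x. 16 * B\<^sup>2 * (\<Sum>j\<in>?I. of_bool (cyc_succ ?I x j i) * d x j i) \<partial>sample n)"
  proof (rule sum_mono)
    fix i assume i: "i \<in> ?I"
    show "(\<integral>x. (S ?I x - S (?I - {i}) x)\<^sup>2 \<partial>sample n) \<le>
      (\<integral>x. 16 * B\<^sup>2 * (\<Sum>j\<in>?I. of_bool (cyc_succ ?I x j i) * d x j i) \<partial>sample n)"
    proof (rule integral_mono_AE)
      show "integrable (sample n) (\<lambda>x. (S ?I x - S (?I - {i}) x)\<^sup>2)"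
        using Sm[of ?I] Sm[of "?I - {i}"] square_diff_le[OF SB SB]
        by (intro integrable_bdd[OF prob_sample, where B="(2*C)\<^sup>2"]) auto
      show "integrable (sample n) (\<lambda>x. 16 * B\<^sup>2 * (\<Sum>j\<in>?I. of_bool (cyc_succ ?I x j i) * d x j i))"
        by (rule ti[OF i])
      show "AE x in sample n. (S ?I x - S (?I - {i}) x)\<^sup>2 \<le> 16 * B\<^sup>2 * (\<Sum>j\<in>?I. of_bool (cyc_succ ?I x j i) * d x j i)"
        using AE_sample_inj
      proof (rule AE_mp, intro AE_I2 impI)
        fix x :: "nat \<Rightarrow> real" assume "inj_on x ?I"
        then show "(S ?I x - S (?I - {i}) x)\<^sup>2 \<le> 16 * B\<^sup>2 * (\<Sum>j\<in>?I. of_bool (cyc_succ ?I x j i) * d x j i)"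
          unfolding S_def by (intro cyc_sum_remove_sq[where h=h]) (use i B in \<open>auto simp: d_def\<close>)
      qed
    qed
  qed
  also have "\<dots> = (\<integral>x. (\<Sum>i\<in>?I. 16 * B\<^sup>2 * (\<Sum>j\<in>?I. of_bool (cyc_succ ?I x j i) * d x j i)) \<partial>sample n)"
    by (rule Bochner_Integration.integral_sum[symmetric]) (rule ti)
  \<comment> \<open>Edges entering \<open>i\<close>, summed over \<open>i\<close>, are all
    edges.\<close>
  also have "\<dots> = (\<integral>x. 16 * B\<^sup>2 * S ?I x \<partial>sample n)"
    unfolding S_def cyc_sum_def sum_distrib_left[symmetric] by (subst sum.swap) (rule refl)
  finally have "(\<integral>x. (S ?I x - (\<integral>x. S ?I x \<partial>sample n))\<^sup>2 \<partial>sample n) \<le> 16 * B\<^sup>2 * (\<integral>x. S ?I x \<partial>sample n)"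
    using es by simp
  moreover have "(\<integral>x. (S ?I x - (\<integral>x. S ?I x \<partial>sample n))\<^sup>2 \<partial>sample n)
     = (\<integral>x. (nb_sq n h x - (\<integral>x. nb_sq n h x \<partial>sample n))\<^sup>2 \<partial>sample n)"
    unfolding e1 by (rule integral_cong_AE) (use Sm nb_sq_measurable[OF h] eqAE in auto)
  ultimately show ?thesis unfolding e1 by simp
qed

end

section \<open>The neighbour gap vanishes\<close>

context atomless_law
begin

text \<open>This is \<open>\<Delta>\<^sub>n\<close> in its symmetrised form; the one-neighbour form is equal to it by exchangeability.\<close>

definition nb_gap :: "(real \<Rightarrow> real) \<Rightarrow> nat \<Rightarrow> real" where
  "nb_gap h n = 1 / real n * (\<integral>x. nb_sq n h x \<partial>sample n)"

lemma nb_gap_nonneg: "0 \<le> nb_gap h n"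
  unfolding nb_gap_def by (intro mult_nonneg_nonneg Bochner_Integration.integral_nonneg nb_sq_nonneg) simp

lemma nb_gap_squeeze:
  assumes "\<And>n. nb_gap h n \<le> u n" "u \<longlonglongrightarrow> 0"
  shows "nb_gap h \<longlonglongrightarrow> 0"
proof (rule tendsto_sandwich[OF _ _ tendsto_const assms(2)])
  show "\<forall>\<^sub>F n in sequentially. 0 \<le> nb_gap h n" by (rule always_eventually) (simp add: nb_gap_nonneg)
  show "\<forall>\<^sub>F n in sequentially. nb_gap h n \<le> u n" by (rule always_eventually) (simp add: assms(1))
qed

lemma nb_gap_mono:
  assumes "h \<in> borel_measurable borel" "\<And>a. \<bar>h a\<bar> \<le> B"
    and "integrable (sample n) u" "AE x in sample n. nb_sq n h x \<le> u x"
  shows "nb_gap h n \<le> 1 / real n * (\<integral>x. u x \<partial>sample n)"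
  unfolding nb_gap_def
  by (intro mult_left_mono integral_mono_AE integrable_nb_sq[OF assms(1,2)] assms(3,4)) simp

text \<open>In sorted order the sample is an increasing sequence, so the path part is at most the
  2-variation; the closing edge costs at most (2 B)^2.\<close>

lemma nb_sq_le_two_variation:
  assumes "inj_on x {1..n}" "n \<ge> 1" "\<And>a. \<bar>h a\<bar> \<le> B"
    and C: "\<And>m z. strict_mono_on {1..m} z \<Longrightarrow> (\<Sum>i=1..<m. (h (z (Suc i)) - h (z i))\<^sup>2) \<le> C"
  shows "nb_sq n h x \<le> C + (2*B)\<^sup>2"
proof -
  let ?s = "rank_perm n x"
  have s: "sorts n x ?s" by (rule sorts_rank_perm) fact
  have "strict_mono_on {1..n} (\<lambda>i. x (?s i))"
    using sorts_less_iff[OF s] by (intro strict_mono_onI) blast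
  from C[OF this] have "(\<Sum>j=1..<n. (h (x (?s j)) - h (x (?s (Suc j))))\<^sup>2) \<le> C"
    by (simp add: power2_commute)
  moreover have "(h (x (?s n)) - h (x (?s 1)))\<^sup>2 \<le> (2*B)\<^sup>2" by (rule square_diff_le assms)+
  ultimately show ?thesis unfolding nb_sq_def
    using sum_right_nb_sorted[OF assms(2), of "\<lambda>i j. (h (x i) - h (x j))\<^sup>2" x] by linarith
qed

lemma nb_gap_two_variation:
  assumes h: "h \<in> borel_measurable borel" and B: "\<And>a. \<bar>h a\<bar> \<le> B" and "bounded_2_variation h"
  obtains C where "\<And>n. nb_gap h n \<le> C / real n"
proof -
  obtain C where C: "\<And>m z. strict_mono_on {1..m} z \<Longrightarrow> (\<Sum>i=1..<m. (h (z (Suc i)) - h (z i))\<^sup>2) \<le> C"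
    using assms(3) unfolding bounded_2_variation_def bdd_above_def by blast
  have "nb_gap h n \<le> (C + (2*B)\<^sup>2) / real n" for n
  proof (cases "n \<ge> 1")
    case True
    interpret S: prob_space "sample n" by (rule prob_sample)
    have "nb_gap h n \<le> 1 / real n * (\<integral>x. C + (2*B)\<^sup>2 \<partial>sample n)"
    proof (rule nb_gap_mono[OF h B])
      show "AE x in sample n. nb_sq n h x \<le> C + (2*B)\<^sup>2"
        using AE_sample_inj
      proof (rule AE_mp, intro AE_I2 impI)
        show "nb_sq n h x \<le> C + (2*B)\<^sup>2" if "inj_on x {1..n}" for x
          by (rule nb_sq_le_two_variation[OF that True B C])
      qed
    qed auto
    then show ?thesis by (simp add: S.prob_space)
  next
    \<comment> \<open>At \<open>n = 0\<close> both sides vanish, as division by 0 gives 0.\<close>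
    case False
    then have "n = 0" by simp
    then show ?thesis by (simp add: nb_gap_def)
  qed
  then show thesis by (rule that)
qed

lemma nb_gap_add:
  assumes h: "h \<in> borel_measurable borel" "\<And>a. \<bar>h a\<bar> \<le> B"
    and g: "g \<in> borel_measurable borel" "\<And>a. \<bar>g a\<bar> \<le> C"
  shows "nb_gap (\<lambda>a. h a + g a) n \<le> 2 * nb_gap h n + 2 * nb_gap g n"
proof -
  have "nb_gap (\<lambda>a. h a + g a) n \<le> 1 / real n * (\<integral>x. 2 * nb_sq n h x + 2 * nb_sq n g x \<partial>sample n)"
  proof (rule nb_gap_mono[where B="B+C"])
    show "\<bar>h a + g a\<bar> \<le> B + C" for a using h(2)[of a] g(2)[of a] by linarith
    show "AE x in sample n. nb_sq n (\<lambda>a. h a + g a) x \<le> 2 * nb_sq n h x + 2 * nb_sq n g x"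
    proof (rule AE_I2)
      fix x
      have e: "(a + b - (c + d))\<^sup>2 \<le> 2 * (a - c)\<^sup>2 + 2 * (b - d)\<^sup>2" for a b c d :: real
      proof -
        have "0 \<le> ((a - c) - (b - d))\<^sup>2" by simp
        then show ?thesis by (simp add: power2_eq_square algebra_simps)
      qed
      show "nb_sq n (\<lambda>a. h a + g a) x \<le> 2 * nb_sq n h x + 2 * nb_sq n g x"
        unfolding nb_sq_def sum_distrib_left sum.distrib[symmetric] by (rule sum_mono) (rule e)
    qed
    show "(\<lambda>a. h a + g a) \<in> borel_measurable borel" using h(1) g(1) by simp
    show "integrable (sample n) (\<lambda>x. 2 * nb_sq n h x + 2 * nb_sq n g x)"
      by (intro Bochner_Integration.integrable_add integrable_mult_right integrable_nb_sq[OF h] integrable_nb_sq[OF g])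
  qed
  also have "\<dots> = 2 * nb_gap h n + 2 * nb_gap g n"
    using integrable_nb_sq[OF h, of n] integrable_nb_sq[OF g, of n] by (simp add: nb_gap_def algebra_simps)
  finally show ?thesis .
qed

lemma nb_gap_scale: "nb_gap (\<lambda>a. c * h a) n = c\<^sup>2 * nb_gap h n"
proof -
  have "nb_sq n (\<lambda>a. c * h a) x = c\<^sup>2 * nb_sq n h x" for x
    unfolding nb_sq_def sum_distrib_left
    by (rule sum.cong) (auto simp: power_mult_distrib[symmetric] right_diff_distrib)
  then show ?thesis by (simp add: nb_gap_def)
qed

text \<open>(a - b)^2 is at most 2 a^2 + 2 b^2, and every point is a right neighbour exactly once: a
  total weight of 4 per point. The gap is thus controlled by the L2 norm uniformly in
  \<open>n\<close>, which is what passing to L2 limits needs.\<close>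

lemma nb_gap_le_L2:
  assumes h: "h \<in> borel_measurable borel" "\<And>a. \<bar>h a\<bar> \<le> B"
  shows "nb_gap h n \<le> 4 * (\<integral>a. (h a)\<^sup>2 \<partial>\<mu>)"
proof (cases "n = 0")
  case True then show ?thesis by (simp add: nb_gap_def)
next
  case False
  have hm: "(\<lambda>x. (h (x i))\<^sup>2) \<in> borel_measurable (sample n)" if "i \<in> {1..n}" for i
    by (intro borel_measurable_power measurable_compose[OF _ h(1)] sample_component that)
  have hi: "integrable (sample n) (\<lambda>x. (h (x i))\<^sup>2)" if "i \<in> {1..n}" for i
    by (rule integrable_bdd[OF prob_sample hm[OF that], where B="B\<^sup>2"]) (use h square_le_of_abs_le in auto)
  have "nb_gap h n \<le> 1 / real n * (\<integral>x. 4 * (\<Sum>i=1..n. (h (x i))\<^sup>2) \<partial>sample n)"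
  proof (rule nb_gap_mono[OF h])
    show "integrable (sample n) (\<lambda>x. 4 * (\<Sum>i=1..n. (h (x i))\<^sup>2))"
      by (intro integrable_mult_right Bochner_Integration.integrable_sum hi)
    show "AE x in sample n. nb_sq n h x \<le> 4 * (\<Sum>i=1..n. (h (x i))\<^sup>2)"
    proof (rule AE_I2)
      fix x
      have e: "(a - b)\<^sup>2 \<le> 2 * a\<^sup>2 + 2 * b\<^sup>2" for a b :: real
      proof -
        have "0 \<le> (a + b)\<^sup>2" by simp
        then show ?thesis by (simp add: power2_eq_square algebra_simps)
      qed
      have "nb_sq n h x \<le> (\<Sum>i=1..n. 2 * (h (x i))\<^sup>2 + 2 * (h (x (right_nb n x i)))\<^sup>2)"
        unfolding nb_sq_def by (rule sum_mono) (rule e)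
      also have "\<dots> = 4 * (\<Sum>i=1..n. (h (x i))\<^sup>2)"
        unfolding sum.distrib sum_distrib_left[symmetric]
        using sum_right_nb_component[of "\<lambda>i. (h (x i))\<^sup>2" n x] by simp
      finally show "nb_sq n h x \<le> 4 * (\<Sum>i=1..n. (h (x i))\<^sup>2)" .
    qed
  qed
  also have "(\<integral>x. 4 * (\<Sum>i=1..n. (h (x i))\<^sup>2) \<partial>sample n) = 4 * (\<Sum>i=1..n. \<integral>x. (h (x i))\<^sup>2 \<partial>sample n)"
    using hi by simp
  also have "(\<Sum>i=1..n. \<integral>x. (h (x i))\<^sup>2 \<partial>sample n) = (\<Sum>i=1..n. \<integral>a. (h a)\<^sup>2 \<partial>\<mu>)"
    by (rule sum.cong[OF refl], rule integral_sample_component) (use h in auto)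
  finally show ?thesis using False by simp
qed

text \<open>A linear class closed under bounded L2 limits, as the next lemmas show; that is enough
  to reach every bounded Borel function from indicators of half-lines.\<close>

definition smooth_gap :: "(real \<Rightarrow> real) \<Rightarrow> bool" where
  "smooth_gap h \<longleftrightarrow> h \<in> borel_measurable borel \<and> (\<exists>B. \<forall>a. \<bar>h a\<bar> \<le> B) \<and> nb_gap h \<longlonglongrightarrow> 0"

lemma smooth_gap_add: "smooth_gap h \<Longrightarrow> smooth_gap g \<Longrightarrow> smooth_gap (\<lambda>a. h a + g a)"
proof -
  assume hg: "smooth_gap h" "smooth_gap g"
  then obtain B C where h: "h \<in> borel_measurable borel" "\<And>a. \<bar>h a\<bar> \<le> B" and hl: "nb_gap h \<longlonglongrightarrow> 0"
    and g: "g \<in> borel_measurable borel" "\<And>a. \<bar>g a\<bar> \<le> C" and gl: "nb_gap g \<longlonglongrightarrow> 0"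
    unfolding smooth_gap_def by auto
  have "(\<lambda>n. 2 * nb_gap h n + 2 * nb_gap g n) \<longlonglongrightarrow> 2 * 0 + 2 * 0" by (intro tendsto_intros hl gl)
  then have "nb_gap (\<lambda>a. h a + g a) \<longlonglongrightarrow> 0"
    by (intro nb_gap_squeeze[OF nb_gap_add[OF h g]]) simp
  moreover have "\<forall>a. \<bar>h a + g a\<bar> \<le> B + C"
    using abs_triangle_ineq h(2) g(2) add_mono order_trans by blast
  moreover have "(\<lambda>a. h a + g a) \<in> borel_measurable borel" using h(1) g(1) by simp
  ultimately show ?thesis unfolding smooth_gap_def by blast
qed

lemma smooth_gap_scale: "smooth_gap h \<Longrightarrow> smooth_gap (\<lambda>a. c * h a)"
proof -
  assume "smooth_gap h"
  then obtain B where h: "h \<in> borel_measurable borel" "\<And>a. \<bar>h a\<bar> \<le> B" and hl: "nb_gap h \<longlonglongrightarrow> 0"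
    unfolding smooth_gap_def by auto
  have "\<forall>a. \<bar>c * h a\<bar> \<le> \<bar>c\<bar> * B" using h(2) by (simp add: abs_mult mult_left_mono)
  moreover have "(\<lambda>a. c * h a) \<in> borel_measurable borel" using h(1) by simp
  moreover have "nb_gap (\<lambda>a. c * h a) \<longlonglongrightarrow> 0"
    unfolding nb_gap_scale[abs_def] using tendsto_mult_left[OF hl, of "c\<^sup>2"] by simp
  ultimately show ?thesis unfolding smooth_gap_def by blast
qed

lemma smooth_gap_const: "smooth_gap (\<lambda>a. c)"
  unfolding smooth_gap_def nb_gap_def[abs_def] nb_sq_def by auto

lemma smooth_gap_sum: "finite K \<Longrightarrow> (\<And>k. k \<in> K \<Longrightarrow> smooth_gap (h k)) \<Longrightarrow> smooth_gap (\<lambda>a. \<Sum>k\<in>K. h k a)"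
  by (induction K rule: finite_induct) (auto intro: smooth_gap_add smooth_gap_const)

lemma smooth_gap_L2_limit:
  assumes h: "h \<in> borel_measurable borel" "\<And>a. \<bar>h a\<bar> \<le> B"
    and app: "\<And>e. e > 0 \<Longrightarrow> \<exists>g. smooth_gap g \<and> (\<integral>a. (h a - g a)\<^sup>2 \<partial>\<mu>) \<le> e"
  shows "smooth_gap h"
proof -
  have "nb_gap h \<longlonglongrightarrow> 0"
  proof (rule LIMSEQ_I)
    fix e :: real assume e: "e > 0"
    \<comment> \<open>Twice 4 e / 32 for the difference and twice e / 4 for \<open>g\<close> add up
      to 3 e / 4.\<close>
    obtain g where g: "smooth_gap g" "(\<integral>a. (h a - g a)\<^sup>2 \<partial>\<mu>) \<le> e / 32" using app[of "e/32"] e by auto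
    then obtain C where gm: "g \<in> borel_measurable borel" "\<And>a. \<bar>g a\<bar> \<le> C" and gl: "nb_gap g \<longlonglongrightarrow> 0"
      unfolding smooth_gap_def by auto
    have d: "(\<lambda>a. h a - g a) \<in> borel_measurable borel" "\<And>a. \<bar>h a - g a\<bar> \<le> B + C"
    proof -
      show "(\<lambda>a. h a - g a) \<in> borel_measurable borel" using h(1) gm(1) by simp
      show "\<bar>h a - g a\<bar> \<le> B + C" for a using h(2)[of a] gm(2)[of a] by linarith
    qed
    obtain N where N: "\<And>n. n \<ge> N \<Longrightarrow> nb_gap g n < e / 4"
      using LIMSEQ_D[OF gl, of "e/4"] e nb_gap_nonneg by auto
    have "norm (nb_gap h n - 0) < e" if "n \<ge> N" for n
    proof -
      have "nb_gap h n = nb_gap (\<lambda>a. g a + (h a - g a)) n" by simp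
      also have "\<dots> \<le> 2 * nb_gap g n + 2 * nb_gap (\<lambda>a. h a - g a) n" by (rule nb_gap_add[OF gm d])
      also have "nb_gap (\<lambda>a. h a - g a) n \<le> 4 * (e / 32)"
        using nb_gap_le_L2[OF d, of n] g(2) by linarith
      finally show ?thesis using N[OF that] nb_gap_nonneg[of h n] e by simp
    qed
    then show "\<exists>no. \<forall>n\<ge>no. norm (nb_gap h n - 0) < e" by blast
  qed
  then show ?thesis using h unfolding smooth_gap_def by blast
qed

text \<open>Along an increasing sequence the indicator drops at most once and never rises, so each
  squared increment equals the drop itself and the sum telescopes.\<close>

lemma bounded_2_variation_atMost: "bounded_2_variation (indicator {..a})"
  unfolding bounded_2_variation_def
proof (rule bdd_aboveI[where M=1])
  fix y :: real assume "y \<in> {\<Sum>i=1..<m. (indicator {..a} (x (Suc i)) - indicator {..a} (x i))\<^sup>2 |(m::nat) (x::nat\<Rightarrow>real). strict_mono_on {1..m} x}"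
  then obtain m x where y: "y = (\<Sum>i=1..<m. (indicator {..a} (x (Suc i)) - indicator {..a} (x i))\<^sup>2)"
    and x: "strict_mono_on {1..m::nat} (x::nat\<Rightarrow>real)" by blast
  have "y = (\<Sum>i=1..<m. (- indicator {..a} (x (Suc i))) - (- indicator {..a} (x i)) :: real)"
    unfolding y
  proof (rule sum.cong[OF refl])
    fix i assume i: "i \<in> {1..<m}"
    then have "x i < x (Suc i)" using strict_mono_onD[OF x, of i "Suc i"] by auto
    then show "(indicator {..a} (x (Suc i)) - indicator {..a} (x i))\<^sup>2
      = (- indicator {..a} (x (Suc i))) - (- indicator {..a} (x i) :: real)"
      by (auto simp: indicator_def)
  qed
  also have "\<dots> \<le> 1"
  proof (cases "1 \<le> m")
    case True
    then show ?thesis using sum_Suc_diff'[OF True, of "\<lambda>i. - indicator {..a} (x i) :: real"]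
      by (auto simp: indicator_def)
  qed simp
  finally show "y \<le> 1" .
qed

text \<open>Dynkin's argument: half-lines form a generating pi-system and their indicators have
  finite 2-variation; complements follow by linearity, countable disjoint unions as L2 limits of
  finite ones.\<close>

lemma smooth_gap_indicator:
  assumes "A \<in> sets borel" shows "smooth_gap (indicator A)"
proof -
  have ib: "\<bar>indicator A a :: real\<bar> \<le> 1" for A :: "real set" and a by (auto simp: indicator_def)
  have st: "Int_stable (range (\<lambda>a::real. {..a}))"
    by (auto simp: Int_stable_def)
  have cl: "range (\<lambda>a::real. {..a}) \<subseteq> Pow UNIV" by simp
  have "A \<in> sigma_sets UNIV (range (\<lambda>a::real. {..a}))"
    using assms unfolding borel_eq_atMost by simp
  with st cl show ?thesis
  proof (induction rule: sigma_sets_induct_disjoint)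
    case (basic A)
    then obtain a where A: "A = {..a}" by auto
    obtain C where C: "\<And>n. nb_gap (indicator A) n \<le> C / real n"
    proof -
      have 1: "(indicator A :: real \<Rightarrow> real) \<in> borel_measurable borel" unfolding A by simp
      have 2: "bounded_2_variation (indicator A)" unfolding A by (rule bounded_2_variation_atMost)
      show thesis by (rule nb_gap_two_variation[OF 1 ib 2]) (rule that)
    qed
    have "nb_gap (indicator A) \<longlonglongrightarrow> 0"
      by (rule nb_gap_squeeze[OF C lim_const_over_n])
    moreover have "(indicator A :: real \<Rightarrow> real) \<in> borel_measurable borel" unfolding A by simp
    ultimately show ?case using ib unfolding smooth_gap_def by blast
  next
    case empty show ?case using smooth_gap_const[of 0] by (simp add: indicator_def[abs_def])
  next
    case (compl A)
    have "smooth_gap (\<lambda>a. 1 + (-1) * indicator A a)"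
      by (intro smooth_gap_add smooth_gap_const smooth_gap_scale compl)
    moreover have "(\<lambda>a. 1 + (-1) * indicator A a) = (indicator (UNIV - A) :: real \<Rightarrow> real)"
      by (auto simp: indicator_def)
    ultimately show ?case by simp
  next
    case (union A)
    have Am: "A i \<in> sets borel" for i
      using union(2) unfolding borel_eq_atMost by auto
    have sg: "smooth_gap (indicator (\<Union>i<m. A i))" for m
    proof -
      have "smooth_gap (\<lambda>a. \<Sum>i<m. indicator (A i) a)" by (intro smooth_gap_sum union) auto
      moreover have "(\<lambda>a. \<Sum>i<m. indicator (A i) a) = (indicator (\<Union>i<m. A i) :: real \<Rightarrow> real)"
        using union(1) by (intro ext indicator_UN_disjoint[symmetric]) (auto simp: disjoint_family_on_def)
      ultimately show ?thesis by simp
    qed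
    show ?case
    proof (rule smooth_gap_L2_limit[where B=1])
      show "indicator (\<Union>(range A)) \<in> borel_measurable borel" using Am by auto
      fix e :: real assume e: "e > 0"
      \<comment> \<open>Continuity from below: the measure of the part not yet covered is the mean
        square error of the finite union.\<close>
      have "(\<lambda>m. measure \<mu> (\<Union>i<m. A i)) \<longlonglongrightarrow> measure \<mu> (\<Union>m. \<Union>i<m. A i)"
      proof (rule finite_Lim_measure_incseq)
        show "incseq (\<lambda>m. \<Union>i<m. A i)" unfolding incseq_def by (intro allI impI UN_mono) auto
      qed (use Am in auto)
      moreover have "(\<Union>m. \<Union>i<m. A i) = \<Union>(range A)" by auto
      ultimately obtain m where m: "\<bar>measure \<mu> (\<Union>i<m. A i) - measure \<mu> (\<Union>(range A))\<bar> < e"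
        using e LIMSEQ_D[of "\<lambda>m. measure \<mu> (\<Union>i<m. A i)" "measure \<mu> (\<Union>(range A))" e] by auto
      have "(\<integral>a. (indicator (\<Union>(range A)) a - indicator (\<Union>i<m. A i) a)\<^sup>2 \<partial>\<mu>)
        = (\<integral>a. (indicator (\<Union>(range A) - (\<Union>i<m. A i)) a :: real) \<partial>\<mu>)"
        by (rule Bochner_Integration.integral_cong) (auto simp: indicator_def)
      also have "\<dots> = measure \<mu> (\<Union>(range A) - (\<Union>i<m. A i))" by simp
      also have "\<dots> = measure \<mu> (\<Union>(range A)) - measure \<mu> (\<Union>i<m. A i)"
        using Am by (intro finite_measure_Diff) auto
      finally have "(\<integral>a. (indicator (\<Union>(range A)) a - indicator (\<Union>i<m. A i) a)\<^sup>2 \<partial>\<mu>) \<le> e" using m by simp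
      then show "\<exists>g. smooth_gap g \<and> (\<integral>a. (indicator (\<Union>(range A)) a - g a)\<^sup>2 \<partial>\<mu>) \<le> e" using sg by blast
    qed (rule ib)
  qed
qed

text \<open>Rounding \<open>h\<close> down to a multiple of delta gives a finite combination of
  indicators of Borel sets, uniformly within delta of \<open>h\<close>.\<close>

theorem nb_gap_tendsto_0:
  assumes h: "h \<in> borel_measurable borel" "\<And>a. \<bar>h a\<bar> \<le> B"
  shows "nb_gap h \<longlonglongrightarrow> 0"
proof -
  have "smooth_gap h"
  proof (rule smooth_gap_L2_limit[OF h])
    fix e :: real assume e: "e > 0"
    \<comment> \<open>A uniform error of sqrt e is a mean square error of at most e.\<close>
    define \<delta> where "\<delta> = sqrt e"
    have \<delta>: "\<delta> > 0" "\<delta>\<^sup>2 = e" using e by (auto simp: \<delta>_def)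
    define K where "K = {\<lfloor>- B / \<delta>\<rfloor>..\<lfloor>B / \<delta>\<rfloor>}"
    define A where "A = (\<lambda>k. {a. \<lfloor>h a / \<delta>\<rfloor> = k})"
    define g where "g = (\<lambda>a. \<Sum>k\<in>K. (\<delta> * of_int k) * indicator (A k) a)"
    have Am: "A k \<in> sets borel" for k
    proof -
      have "A k = {a. of_int k \<le> h a / \<delta> \<and> h a / \<delta> < of_int k + 1}" unfolding A_def by (auto simp: floor_eq_iff)
      also have "\<dots> \<in> sets borel" using h(1) by measurable
      finally show ?thesis .
    qed
    have "smooth_gap g" unfolding g_def
      by (intro smooth_gap_sum smooth_gap_scale smooth_gap_indicator Am) (auto simp: K_def)
    moreover have ga: "g a = \<delta> * of_int \<lfloor>h a / \<delta>\<rfloor>" for a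
    proof -
      let ?k = "\<lfloor>h a / \<delta>\<rfloor>"
      have "- B / \<delta> \<le> h a / \<delta>" "h a / \<delta> \<le> B / \<delta>"
        using h(2)[of a] \<delta>(1) divide_right_mono[of "-B" "h a" \<delta>] divide_right_mono[of "h a" B \<delta>] by auto
      then have k: "?k \<in> K" unfolding K_def by (auto intro: floor_mono)
      have "g a = (\<Sum>k\<in>{?k}. (\<delta> * of_int k) * indicator (A k) a)" unfolding g_def
        by (rule sum.mono_neutral_right) (use k in \<open>auto simp: K_def A_def\<close>)
      then show ?thesis by (simp add: A_def)
    qed
    have "norm ((h a - g a)\<^sup>2) \<le> e" for a
    proof -
      have f: "of_int \<lfloor>h a / \<delta>\<rfloor> \<le> h a / \<delta>" "h a / \<delta> < of_int \<lfloor>h a / \<delta>\<rfloor> + 1" by linarith+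
      have "\<delta> * of_int \<lfloor>h a / \<delta>\<rfloor> \<le> h a" "h a \<le> \<delta> * of_int \<lfloor>h a / \<delta>\<rfloor> + \<delta>"
        using mult_left_mono[OF f(1), of \<delta>] mult_strict_left_mono[OF f(2) \<delta>(1)] \<delta>(1) by (auto simp: distrib_left)
      then have "\<bar>h a - g a\<bar> \<le> \<delta>" unfolding ga by linarith
      then show ?thesis using square_le_of_abs_le \<delta>(2) by fastforce
    qed
    then have "(\<integral>a. (h a - g a)\<^sup>2 \<partial>\<mu>) \<le> e" using integral_abs_le[OF prob, of "\<lambda>a. (h a - g a)\<^sup>2" e] by simp
    ultimately show "\<exists>g. smooth_gap g \<and> (\<integral>a. (h a - g a)\<^sup>2 \<partial>\<mu>) \<le> e" by blast
  qed
  then show ?thesis by (simp add: smooth_gap_def)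
qed

end

section \<open>Convergence in law and Gaussian vectors\<close>

text \<open>The span of the characters: convergence of characteristic functions extends to it by
  linearity, and it is closed under products, as polynomial approximation requires.\<close>

inductive trigpoly :: "(real ^ 'd \<Rightarrow> complex) \<Rightarrow> bool" where
  trigpoly_exp: "trigpoly (\<lambda>x. c * exp (\<i> * complex_of_real (t \<bullet> x)))"
| trigpoly_add: "trigpoly f \<Longrightarrow> trigpoly g \<Longrightarrow> trigpoly (\<lambda>x. f x + g x)"

lemma trigpoly_const: "trigpoly (\<lambda>x. c)"
  using trigpoly_exp[of c 0] by simp

lemma trigpoly_sum: "finite K \<Longrightarrow> (\<And>k. k \<in> K \<Longrightarrow> trigpoly (h k)) \<Longrightarrow> trigpoly (\<lambda>x. \<Sum>k\<in>K. h k x)"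
  by (induction K rule: finite_induct) (auto intro: trigpoly_add trigpoly_const)

lemma trigpoly_mult:
  assumes "trigpoly f" "trigpoly g"
  shows "trigpoly (\<lambda>x. f x * g x)"
  using assms(1)
proof induction
  case (trigpoly_exp c t)
  show ?case using assms(2)
  proof induction
    case (trigpoly_exp c' t')
    have "(\<lambda>x. c * exp (\<i> * complex_of_real (t \<bullet> x)) * (c' * exp (\<i> * complex_of_real (t' \<bullet> x))))
      = (\<lambda>x. (c * c') * exp (\<i> * complex_of_real ((t + t') \<bullet> x)))"
      by (simp add: inner_add_left distrib_left exp_add mult_ac)
    then show ?case using trigpoly.trigpoly_exp[of "c * c'" "t + t'"] by simp
  next
    case (trigpoly_add f g)
    then show ?case using trigpoly.trigpoly_add by (simp add: distrib_left)
  qed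
next
  case (trigpoly_add f g)
  then show ?case using trigpoly.trigpoly_add by (simp add: distrib_right)
qed

lemma trigpoly_measurable[measurable_dest]: "trigpoly f \<Longrightarrow> f \<in> borel_measurable borel"
  by (induction rule: trigpoly.induct) auto

lemma trigpoly_bounded: "trigpoly f \<Longrightarrow> \<exists>B. \<forall>x. cmod (f x) \<le> B"
proof (induction rule: trigpoly.induct)
  case (trigpoly_exp c t)
  show ?case by (rule exI[of _ "cmod c"]) (simp add: norm_mult)
next
  case (trigpoly_add f g)
  then obtain B C where "\<forall>x. cmod (f x) \<le> B" "\<forall>x. cmod (g x) \<le> C" by blast
  then have "\<forall>x. cmod (f x + g x) \<le> B + C" by (meson add_mono norm_triangle_ineq order_trans)
  then show ?case by blast
qed

lemma trigpoly_integrable: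
  assumes "prob_space M" "Z \<in> borel_measurable M" "trigpoly f"
  shows "integrable M (\<lambda>\<omega>. f (Z \<omega>))"
proof -
  obtain B where "\<forall>x. cmod (f x) \<le> B" using trigpoly_bounded[OF assms(3)] by blast
  then show ?thesis
    using measurable_compose[OF assms(2) trigpoly_measurable[OF assms(3)]]
    by (intro integrable_bdd[OF assms(1)]) auto
qed

lemma trigpoly_converges:
  assumes M: "prob_space M" "\<And>n. Z n \<in> borel_measurable M"
    and N: "prob_space N" "sets N = sets borel"
    and ch: "\<And>t. (\<lambda>n. \<integral>\<omega>. exp (\<i> * complex_of_real (t \<bullet> Z n \<omega>)) \<partial>M) \<longlonglongrightarrow> (\<integral>y. exp (\<i> * complex_of_real (t \<bullet> y)) \<partial>N)"
    and "trigpoly f"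
  shows "(\<lambda>n. \<integral>\<omega>. f (Z n \<omega>) \<partial>M) \<longlonglongrightarrow> (\<integral>y. f y \<partial>N)"
  using assms(6)
proof induction
  case (trigpoly_exp c t)
  show ?case using tendsto_mult_left[OF ch[of t], of c] by simp
next
  case (trigpoly_add f g)
  have id: "(\<lambda>y. y) \<in> borel_measurable N" using N(2) by (simp add: measurable_def space_borel sets_eq_imp_space_eq[OF N(2)])
  have "(\<integral>\<omega>. f (Z n \<omega>) + g (Z n \<omega>) \<partial>M) = (\<integral>\<omega>. f (Z n \<omega>) \<partial>M) + (\<integral>\<omega>. g (Z n \<omega>) \<partial>M)" for n
    by (intro Bochner_Integration.integral_add trigpoly_integrable M trigpoly_add)
  moreover have "(\<integral>y. f y + g y \<partial>N) = (\<integral>y. f y \<partial>N) + (\<integral>y. g y \<partial>N)"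
    by (intro Bochner_Integration.integral_add trigpoly_integrable[OF N(1) id] trigpoly_add)
  ultimately show ?case using tendsto_add[OF trigpoly_add.IH] by simp
qed

lemma trigpoly_sin:
  "trigpoly (\<lambda>x :: real ^ 'd. complex_of_real (sin (x $ j / L)))"
proof -
  have e: "complex_of_real (sin y) = (1 / (2 * \<i>)) * exp (\<i> * complex_of_real y) + (- 1 / (2 * \<i>)) * exp (\<i> * complex_of_real (- y))" for y
    unfolding sin_of_real[symmetric] sin_exp_eq by (simp add: field_simps)
  have "x $ j / L = axis j (1 / L) \<bullet> x" "- (x $ j / L) = axis j (- 1 / L) \<bullet> x" for x :: "real ^ 'd"
    by (simp_all add: inner_axis')
  then show ?thesis unfolding e by (simp only:) (intro trigpoly_add trigpoly_exp)
qed

text \<open>The sine of a coordinate is a combination of two characters, and the class is an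
  algebra; a linear map is first expanded in the coordinates.\<close>

lemma trigpoly_poly_sin:
  fixes p :: "real ^ 'd \<Rightarrow> real"
  assumes "real_polynomial_function p"
  shows "trigpoly (\<lambda>x. complex_of_real (p (\<chi> j. sin (x $ j / L))))"
  using assms
proof induction
  case (linear f)
  interpret bounded_linear f by fact
  have "f v = (\<Sum>j\<in>UNIV. v $ j * f (axis j 1))" for v :: "real ^ 'd"
  proof -
    have "f v = f (\<Sum>j\<in>UNIV. v $ j *\<^sub>R axis j 1)" using basis_expansion[of v] by (simp add: scalar_mult_eq_scaleR)
    then show ?thesis by (simp add: sum scaleR)
  qed
  then have "complex_of_real (f (\<chi> j. sin (x $ j / L)))
    = (\<Sum>j\<in>UNIV. complex_of_real (sin (x $ j / L)) * complex_of_real (f (axis j 1)))" for x :: "real ^ 'd"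
    by (metis (mono_tags, lifting) of_real_mult of_real_sum sum.cong vec_lambda_beta)
  moreover have "trigpoly (\<lambda>x :: real ^ 'd. \<Sum>j\<in>UNIV. complex_of_real (sin (x $ j / L)) * complex_of_real (f (axis j 1)))"
    by (intro trigpoly_sum trigpoly_mult trigpoly_sin trigpoly_const finite)
  ultimately show ?case by presburger
next
  case (const c) then show ?case by (rule trigpoly_const)
next
  case (add f g) then show ?case by (simp add: trigpoly_add)
next
  case (mult f g) then show ?case by (simp add: trigpoly_mult)
qed

text \<open>Markov's inequality with the test function left free.\<close>

lemma measure_le_integral:
  assumes "prob_space M" "integrable M u" "{\<omega>\<in>space M. P \<omega>} \<in> sets M"
    "\<And>\<omega>. 0 \<le> (u \<omega> :: real)" "\<And>\<omega>. P \<omega> \<Longrightarrow> 1 \<le> u \<omega>"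
  shows "measure M {\<omega>\<in>space M. P \<omega>} \<le> (\<integral>\<omega>. u \<omega> \<partial>M)"
proof -
  interpret prob_space M by fact
  have "measure M {\<omega>\<in>space M. P \<omega>} = (\<integral>\<omega>. indicator {\<omega>\<in>space M. P \<omega>} \<omega> \<partial>M)" using assms(3) by simp
  also have "\<dots> \<le> (\<integral>\<omega>. u \<omega> \<partial>M)"
  proof (rule integral_mono)
    show "integrable M (\<lambda>\<omega>. indicator {\<omega>\<in>space M. P \<omega>} \<omega> :: real)"
      by (rule integrable_real_indicator[OF assms(3)]) (simp add: less_top[symmetric])
    show "indicator {\<omega>\<in>space M. P \<omega>} \<omega> \<le> u \<omega>" for \<omega>
      using assms(4,5)[of \<omega>] by (auto simp: indicator_def)
  qed fact
  finally show ?thesis .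
qed

lemma integral_diff_le_bad:
  fixes g h :: "'b::topological_space \<Rightarrow> real"
  assumes "prob_space M" "Z \<in> borel_measurable M" "g \<in> borel_measurable borel" "h \<in> borel_measurable borel"
    "\<And>x. \<bar>g x\<bar> \<le> B" "\<And>x. \<bar>h x\<bar> \<le> H" "bad \<in> sets borel" "\<And>x. x \<notin> bad \<Longrightarrow> \<bar>g x - h x\<bar> \<le> e" "\<And>x. \<bar>g x - h x\<bar> \<le> e + 2 * B"
  shows "\<bar>(\<integral>\<omega>. g (Z \<omega>) \<partial>M) - (\<integral>\<omega>. h (Z \<omega>) \<partial>M)\<bar> \<le> e + 2 * B * measure M {\<omega>\<in>space M. Z \<omega> \<in> bad}"
proof -
  interpret prob_space M by fact
  note [measurable] = assms(2,3,4,7)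
  have i: "integrable M (\<lambda>\<omega>. g (Z \<omega>))" "integrable M (\<lambda>\<omega>. h (Z \<omega>))"
    by (rule integrable_bdd[where B=B], use assms in auto) (rule integrable_bdd[where B=H], use assms in auto)
  have bm: "{\<omega>\<in>space M. Z \<omega> \<in> bad} \<in> sets M" by measurable
  have B0: "0 \<le> B" using assms(5)[of undefined] by linarith
  have "\<bar>(\<integral>\<omega>. g (Z \<omega>) \<partial>M) - (\<integral>\<omega>. h (Z \<omega>) \<partial>M)\<bar> = \<bar>\<integral>\<omega>. g (Z \<omega>) - h (Z \<omega>) \<partial>M\<bar>" using i by simp
  also have "\<dots> \<le> (\<integral>\<omega>. \<bar>g (Z \<omega>) - h (Z \<omega>)\<bar> \<partial>M)" by (rule integral_abs_bound)
  also have "\<dots> \<le> (\<integral>\<omega>. e + 2 * B * indicator {\<omega>\<in>space M. Z \<omega> \<in> bad} \<omega> \<partial>M)"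
  proof (rule integral_mono)
    show "integrable M (\<lambda>\<omega>. \<bar>g (Z \<omega>) - h (Z \<omega>)\<bar>)" using i by simp
    show "integrable M (\<lambda>\<omega>. e + 2 * B * indicator {\<omega>\<in>space M. Z \<omega> \<in> bad} \<omega>)"
      by (intro Bochner_Integration.integrable_add integrable_mult_right integrable_real_indicator[OF bm])
        (simp_all add: less_top[symmetric])
    fix \<omega> assume "\<omega> \<in> space M"
    then show "\<bar>g (Z \<omega>) - h (Z \<omega>)\<bar> \<le> e + 2 * B * indicator {\<omega>\<in>space M. Z \<omega> \<in> bad} \<omega>"
      using assms(8,9)[of "Z \<omega>"] by (auto simp: indicator_def)
  qed
  also have "\<dots> = e + 2 * B * measure M {\<omega>\<in>space M. Z \<omega> \<in> bad}"
  proof -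
    define A where "A = {\<omega>\<in>space M. Z \<omega> \<in> bad}"
    have A: "A \<in> sets M" using bm by (simp add: A_def)
    have "integrable M (indicator A :: _ \<Rightarrow> real)"
      by (rule integrable_real_indicator[OF A]) (simp add: less_top[symmetric])
    then have "(\<integral>\<omega>. e + 2 * B * indicator A \<omega> \<partial>M) = e + 2 * B * measure M A"
      using A by (simp add: prob_space)
    then show ?thesis by (simp only: A_def)
  qed
  finally show ?thesis .
qed

text \<open>On a cube of half-width L the point x is recovered from sin (x / L), so there a bounded
  continuous g equals G (sin (x / L)) with G continuous on [-1, 1]^d. Stone-Weierstrass approximates
  G by a polynomial, and the resulting trigonometric polynomial stays within e of G (sin (x / L)) on
  the whole space. It is therefore bounded outside the cube too, where tightness makes the
  discrepancy negligible.\<close>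

theorem conv_in_law_char:
  fixes Z :: "nat \<Rightarrow> 'a \<Rightarrow> real ^ 'd"
  assumes M: "prob_space M" "\<And>n. Z n \<in> borel_measurable M"
    and N: "prob_space N" "sets N = sets borel"
    and ch: "\<And>t. (\<lambda>n. \<integral>\<omega>. exp (\<i> * complex_of_real (t \<bullet> Z n \<omega>)) \<partial>M) \<longlonglongrightarrow> (\<integral>y. exp (\<i> * complex_of_real (t \<bullet> y)) \<partial>N)"
    and tight: "\<And>e. e > 0 \<Longrightarrow> \<exists>K>0. \<forall>\<^sub>F n in sequentially. measure M {\<omega>\<in>space M. \<exists>k. K < \<bar>Z n \<omega> $ k\<bar>} < e"
  shows "conv_in_law M Z N"
  unfolding conv_in_law_def
proof (intro conjI allI impI M(2))
  fix g :: "real ^ 'd \<Rightarrow> real" assume g: "continuous_on UNIV g \<and> bounded (range g)"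
  then obtain B0 where B0: "\<And>x. \<bar>g x\<bar> \<le> B0" by (auto simp: bounded_iff)
  define B where "B = B0 + 1"
  have B: "\<bar>g x\<bar> \<le> B" "0 < B" for x using B0[of x] B0[of 0] unfolding B_def by linarith+
  have gm: "g \<in> borel_measurable borel" using g by (intro borel_measurable_continuous_onI) auto
  interpret N: prob_space N by fact
  have spN: "space N = UNIV" using sets_eq_imp_space_eq[OF N(2)] by simp
  have id: "(\<lambda>y. y) \<in> borel_measurable N" using N(2) by (simp add: measurable_def spN)
  define bad where "bad = (\<lambda>K::real. {x::real^'d. \<exists>k. K < \<bar>x $ k\<bar>})"
  have badm: "bad K \<in> sets borel" for K
  proof -
    have "bad K = (\<Union>k\<in>UNIV. {x. K < \<bar>x $ k\<bar>})" unfolding bad_def by auto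
    also have "\<dots> \<in> sets borel"
      by (intro sets.finite_UN borel_open open_Collect_less continuous_intros) auto
    finally show ?thesis .
  qed
  show "(\<lambda>n. \<integral>\<omega>. g (Z n \<omega>) \<partial>M) \<longlonglongrightarrow> (\<integral>y. g y \<partial>N)"
  proof (rule LIMSEQ_I)
    fix r :: real assume r: "r > 0"
    \<comment> \<open>The errors are e + 2 B e for each of the two laws and e for the convergence: 3
      e + 4 B e in total, against r = 8 e + 8 B e.\<close>
    define e where "e = r / (8 * (1 + B))"
    have e: "e > 0" "2 * (e + 2 * B * e) + e < r"
    proof -
      show e0: "e > 0" using r B(2) unfolding e_def by simp
      have "e * (8 * (1 + B)) = r" using B(2) unfolding e_def by simp
      then have "8 * e + 8 * (B * e) = r" by (simp add: algebra_simps)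
      moreover have "B * e > 0" using e0 B(2) by simp
      ultimately show "2 * (e + 2 * B * e) + e < r" using e0 by simp
    qed
    obtain K1 where K1: "K1 > 0" "\<forall>\<^sub>F n in sequentially. measure M {\<omega>\<in>space M. \<exists>k. K1 < \<bar>Z n \<omega> $ k\<bar>} < e"
      using tight[OF e(1)] by blast
    obtain K2 where K2: "K2 > 0" "measure N (bad K2) < e"
    proof -
      \<comment> \<open>A single law is tight: the sets \<open>bad\<close> decrease to the empty
        set.\<close>
      have "(\<lambda>i. measure N (bad (real i))) \<longlonglongrightarrow> measure N (\<Inter>i. bad (real i))"
      proof (rule N.finite_Lim_measure_decseq)
        show "range (\<lambda>i. bad (real i)) \<subseteq> sets N" using badm N(2) by auto
        show "decseq (\<lambda>i. bad (real i))"
        proof (rule decseq_SucI, rule subsetI)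
          fix i x assume "x \<in> bad (real (Suc i))"
          then obtain k where "real (Suc i) < \<bar>x $ k\<bar>" unfolding bad_def by blast
          then have "real i < \<bar>x $ k\<bar>" by simp
          then show "x \<in> bad (real i)" unfolding bad_def by blast
        qed
      qed
      moreover have "(\<Inter>i. bad (real i)) = {}"
      proof -
        have False if "x \<in> (\<Inter>i. bad (real i))" for x
        proof -
          obtain i where i: "norm x \<le> real i" using real_arch_simple by blast
          have "x \<in> bad (real i)" using that by blast
          then obtain k where "real i < \<bar>x $ k\<bar>" unfolding bad_def by blast
          then show False using i component_le_norm_cart[of x k] by linarith
        qed
        then show ?thesis by blast
      qed
      ultimately have "(\<lambda>i. measure N (bad (real i))) \<longlonglongrightarrow> 0" by simp
      from LIMSEQ_D[OF this e(1)] obtain i where i: "\<forall>j\<ge>i. norm (measure N (bad (real j)) - 0) < e" by blast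
      show thesis by (rule that[of "real (Suc i)"]) (use i[rule_format, of "Suc i"] in auto)
    qed
    define L where "L = max K1 K2"
    have L: "L > 0" using K1 by (simp add: L_def)
    define S where "S = cbox (-1) (1 :: real ^ 'd)"
    have Sin: "s \<in> S \<longleftrightarrow> (\<forall>j. \<bar>s $ j\<bar> \<le> 1)" for s
      unfolding S_def by (simp add: mem_box_cart abs_le_iff minus_le_iff conj_commute all_conj_distrib)
    define G where "G = (\<lambda>s :: real ^ 'd. g (\<chi> j. L * arcsin (s $ j)))"
    have Gc: "continuous_on S G" unfolding G_def
    proof (rule continuous_on_compose2[of UNIV g])
      show "continuous_on S (\<lambda>s. \<chi> j. L * arcsin (s $ j))"
        by (intro continuous_intros) (auto simp: Sin abs_le_iff minus_le_iff)
    qed (use g in auto)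
    obtain p where p: "real_polynomial_function p" "\<And>s. s \<in> S \<Longrightarrow> \<bar>G s - p s\<bar> < e"
      using Stone_Weierstrass_real_polynomial_function[OF _ Gc e(1)] unfolding S_def by (metis compact_cbox)
    define h where "h = (\<lambda>x :: real ^ 'd. p (\<chi> j. sin (x $ j / L)))"
    have tp: "trigpoly (\<lambda>x. complex_of_real (h x))" unfolding h_def by (rule trigpoly_poly_sin[OF p(1)])
    have hm: "h \<in> borel_measurable borel"
      using measurable_compose[OF trigpoly_measurable[OF tp] borel_measurable_Re] by simp
    have sS: "(\<chi> j. sin (x $ j / L)) \<in> S" for x :: "real ^ 'd" unfolding Sin by simp
    have gG: "\<bar>G (\<chi> j. sin (x $ j / L)) - h x\<bar> < e" for x using p(2)[OF sS] unfolding h_def .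
    have G_eq: "G (\<chi> j. sin (x $ j / L)) = g x" if "x \<notin> bad L" for x
    proof -
      have "L * arcsin (sin (x $ j / L)) = x $ j" for j
      proof -
        have "\<bar>x $ j\<bar> \<le> L" using that unfolding bad_def by (auto simp: not_less)
        then have "\<bar>x $ j / L\<bar> \<le> 1" using L by (simp add: abs_divide)
        \<comment> \<open>The scaled coordinates lie in [-1, 1], inside the interval on which
          \<open>arcsin\<close> inverts the sine.\<close>
        moreover have "1 \<le> pi / 2" using pi_ge_two by simp
        ultimately have "arcsin (sin (x $ j / L)) = x $ j / L" by (intro arcsin_sin) linarith+
        then show ?thesis using L by simp
      qed
      then have "(\<chi> j. L * arcsin ((\<chi> j. sin (x $ j / L)) $ j)) = x" by (simp add: vec_eq_iff)
      then show ?thesis unfolding G_def by simp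
    qed
    have GB: "\<bar>G s\<bar> \<le> B" for s unfolding G_def by (rule B)
    have c1: "\<bar>h x\<bar> \<le> B + e" for x using gG[of x] GB[of "\<chi> j. sin (x $ j / L)"] by linarith
    have c2: "\<bar>g x - h x\<bar> \<le> e" if "x \<notin> bad L" for x using gG[of x] G_eq[OF that] by simp
    have c3: "\<bar>g x - h x\<bar> \<le> e + 2 * B" for x
      using gG[of x] GB[of "\<chi> j. sin (x $ j / L)"] B(1)[of x] by linarith
    note bnd = integral_diff_le_bad[OF _ _ gm hm B(1) c1 badm[of L] c2 c3]
    have bL: "bad L \<subseteq> bad K1" "bad L \<subseteq> bad K2" unfolding bad_def L_def by auto
    have hlim: "(\<lambda>n. \<integral>\<omega>. h (Z n \<omega>) \<partial>M) \<longlonglongrightarrow> (\<integral>y. h y \<partial>N)"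
      using tendsto_Re[OF trigpoly_converges[OF M N ch tp]] by simp
    from LIMSEQ_D[OF this e(1)] have h1: "\<forall>\<^sub>F n in sequentially. \<bar>(\<integral>\<omega>. h (Z n \<omega>) \<partial>M) - (\<integral>y. h y \<partial>N)\<bar> < e"
      by (auto simp: eventually_sequentially)
    have n2: "\<bar>(\<integral>y. g y \<partial>N) - (\<integral>y. h y \<partial>N)\<bar> \<le> e + 2 * B * e"
    proof -
      have "measure N {y\<in>space N. y \<in> bad L} \<le> measure N (bad K2)"
        by (rule N.finite_measure_mono) (use bL badm N(2) in auto)
      then have "2 * B * measure N {y\<in>space N. y \<in> bad L} \<le> 2 * B * e"
        using K2(2) B(2) by (intro mult_left_mono) auto
      then show ?thesis using bnd[OF N(1) id] by linarith
    qed
    have "\<forall>\<^sub>F n in sequentially. norm ((\<integral>\<omega>. g (Z n \<omega>) \<partial>M) - (\<integral>y. g y \<partial>N)) < r"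
      using K1(2) h1
    proof eventually_elim
      case (elim n)
      interpret M: prob_space M by fact
      have eq: "{\<omega>\<in>space M. \<exists>k. K1 < \<bar>Z n \<omega> $ k\<bar>} = {\<omega>\<in>space M. Z n \<omega> \<in> bad K1}" by (auto simp: bad_def)
      have m: "{\<omega>\<in>space M. Z n \<omega> \<in> bad K} \<in> sets M" for K
        using measurable_sets[OF M(2) badm, of n K] by (simp add: vimage_def Int_def conj_commute)
      have "measure M {\<omega>\<in>space M. Z n \<omega> \<in> bad L} \<le> measure M {\<omega>\<in>space M. Z n \<omega> \<in> bad K1}"
        by (rule M.finite_measure_mono) (use bL m in auto)
      then have "2 * B * measure M {\<omega>\<in>space M. Z n \<omega> \<in> bad L} \<le> 2 * B * e"
        using elim(1) B(2) unfolding eq by (intro mult_left_mono) auto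
      then have "\<bar>(\<integral>\<omega>. g (Z n \<omega>) \<partial>M) - (\<integral>\<omega>. h (Z n \<omega>) \<partial>M)\<bar> \<le> e + 2 * B * e"
        using bnd[OF M(1) M(2), of n] by linarith
      then show ?case using n2 elim(2) e(2) by (simp add: abs_le_iff abs_less_iff)
    qed
    then show "\<exists>no. \<forall>n\<ge>no. norm ((\<integral>\<omega>. g (Z n \<omega>) \<partial>M) - (\<integral>y. g y \<partial>N)) < r"
      by (simp add: eventually_sequentially)
  qed
qed

section \<open>Slutsky's lemma in terms of characteristic functions\<close>

lemma exp_i_lipschitz: "cmod (exp (\<i> * complex_of_real a) - exp (\<i> * complex_of_real b)) \<le> \<bar>a - b\<bar>"
proof -
  have "exp (\<i> * complex_of_real a) - exp (\<i> * complex_of_real b)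
    = exp (\<i> * complex_of_real b) * (exp (\<i> * complex_of_real (a - b)) - 1)"
    by (simp add: algebra_simps exp_diff)
  moreover have "cmod (exp (\<i> * complex_of_real (a - b)) - 1) \<le> \<bar>a - b\<bar>"
    using iexp_approx1[of "a - b" 0] by simp
  ultimately show ?thesis by (simp add: norm_mult del: of_real_diff)
qed

lemma exp_i_dist_le_2: "cmod (exp (\<i> * complex_of_real a) - exp (\<i> * complex_of_real b)) \<le> 2"
  using norm_triangle_ineq4[of "exp (\<i> * complex_of_real a)" "exp (\<i> * complex_of_real b)"] by simp

lemma borel_measurable_nth: "(\<lambda>v :: real ^ 'd. v $ k) \<in> borel_measurable borel"
  by (intro borel_measurable_continuous_onI continuous_intros)

lemma borel_measurable_vec:
  fixes f :: "'a \<Rightarrow> real ^ 'd"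
  assumes "\<And>k. (\<lambda>x. f x $ k) \<in> borel_measurable M"
  shows "f \<in> borel_measurable M"
proof (subst borel_measurable_euclidean_space, rule ballI)
  fix i :: "real ^ 'd" assume "i \<in> Basis"
  then obtain k where "i = axis k 1" by (auto simp: Basis_vec_def)
  then show "(\<lambda>x. f x \<bullet> i) \<in> borel_measurable M" using assms[of k] by (simp add: inner_axis)
qed

text \<open>Characteristic functions see only truncated differences, |exp (i a) - exp (i b)| being
  at most 2 and at most |a - b|. Tightness of \<open>Z\<close> comes from Chebyshev's inequality for
  \<open>W\<close> and Markov's for the truncated difference, so a ratio estimator can be treated
  without any moment of it.\<close>

theorem conv_in_law_slutsky:
  fixes Z W :: "nat \<Rightarrow> 'a \<Rightarrow> real ^ 'd"
  assumes M: "prob_space M" "\<And>n. Z n \<in> borel_measurable M" "\<And>n. W n \<in> borel_measurable M"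
    and N: "prob_space N" "sets N = sets borel"
    and W2: "\<And>n k. integrable M (\<lambda>\<omega>. (W n \<omega> $ k)\<^sup>2)" "\<And>n k. (\<integral>\<omega>. (W n \<omega> $ k)\<^sup>2 \<partial>M) \<le> C"
    and ZW: "\<And>k. (\<lambda>n. \<integral>\<omega>. min 1 \<bar>Z n \<omega> $ k - W n \<omega> $ k\<bar> \<partial>M) \<longlonglongrightarrow> 0"
    and ch: "\<And>t. (\<lambda>n. \<integral>\<omega>. exp (\<i> * complex_of_real (t \<bullet> W n \<omega>)) \<partial>M) \<longlonglongrightarrow> (\<integral>y. exp (\<i> * complex_of_real (t \<bullet> y)) \<partial>N)"
  shows "conv_in_law M Z N"
proof (rule conv_in_law_char[OF M(1,2) N])
  interpret prob_space M by fact
  note [measurable] = M(2,3)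
  define D where "D = (\<lambda>n k \<omega>. min 1 \<bar>Z n \<omega> $ k - W n \<omega> $ k\<bar>)"
  have cm: "(\<lambda>\<omega>. V n \<omega> $ k) \<in> borel_measurable M" if "V n \<in> borel_measurable M" for V :: "nat \<Rightarrow> 'a \<Rightarrow> real ^ 'd" and n k
    by (rule measurable_compose[OF that borel_measurable_nth])
  have Dm: "D n k \<in> borel_measurable M" for n k
    unfolding D_def using cm[of Z, OF M(2)] cm[of W, OF M(3)] by measurable
  have D01: "0 \<le> D n k \<omega>" "D n k \<omega> \<le> 1" for n k \<omega> unfolding D_def by auto
  have Di: "integrable M (D n k)" for n k
    by (rule integrable_bdd[OF M(1) Dm, where B=1]) (use D01 in auto)
  have Dl: "(\<lambda>n. \<integral>\<omega>. D n k \<omega> \<partial>M) \<longlonglongrightarrow> 0" for k using ZW unfolding D_def .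
  {
    fix t :: "real ^ 'd"
    \<comment> \<open>Either some coordinate differs by at least 1, and the weight 2 suffices, or
      none is truncated and the Lipschitz bound gives the weights |t_k|.\<close>
    have bound: "cmod (exp (\<i> * complex_of_real (t \<bullet> Z n \<omega>)) - exp (\<i> * complex_of_real (t \<bullet> W n \<omega>)))
        \<le> (\<Sum>k\<in>UNIV. (2 + \<bar>t $ k\<bar>) * D n k \<omega>)" for n \<omega>
    proof (cases "\<exists>k. 1 \<le> \<bar>Z n \<omega> $ k - W n \<omega> $ k\<bar>")
      case True
      then obtain k where k: "D n k \<omega> = 1" unfolding D_def by (metis min.absorb1)
      have "2 \<le> (2 + \<bar>t $ k\<bar>) * D n k \<omega>" using k by simp
      also have "\<dots> \<le> (\<Sum>k\<in>UNIV. (2 + \<bar>t $ k\<bar>) * D n k \<omega>)"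
        by (rule member_le_sum) (use D01 in auto)
      finally show ?thesis using exp_i_dist_le_2 order_trans by blast
    next
      case False
      then have k: "D n k \<omega> = \<bar>Z n \<omega> $ k - W n \<omega> $ k\<bar>" for k unfolding D_def by (simp add: not_le min.absorb2 less_imp_le)
      have "cmod (exp (\<i> * complex_of_real (t \<bullet> Z n \<omega>)) - exp (\<i> * complex_of_real (t \<bullet> W n \<omega>))) \<le> \<bar>t \<bullet> Z n \<omega> - t \<bullet> W n \<omega>\<bar>"
        by (rule exp_i_lipschitz)
      also have "t \<bullet> Z n \<omega> - t \<bullet> W n \<omega> = (\<Sum>k\<in>UNIV. t $ k * (Z n \<omega> $ k - W n \<omega> $ k))"
        by (simp add: inner_vec_def sum_subtractf right_diff_distrib)
      also have "\<bar>\<dots>\<bar> \<le> (\<Sum>k\<in>UNIV. \<bar>t $ k * (Z n \<omega> $ k - W n \<omega> $ k)\<bar>)" by (rule sum_abs)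
      also have "\<dots> \<le> (\<Sum>k\<in>UNIV. (2 + \<bar>t $ k\<bar>) * D n k \<omega>)"
        by (rule sum_mono) (simp add: k abs_mult mult_right_mono)
      finally show ?thesis .
    qed
    have ei: "integrable M (\<lambda>\<omega>. exp (\<i> * complex_of_real (t \<bullet> V n \<omega>)))" if "V n \<in> borel_measurable M"
      for V :: "nat \<Rightarrow> 'a \<Rightarrow> real ^ 'd" and n
      by (rule integrable_bdd[OF M(1), where B=1]) (use that in auto)
    have "(\<lambda>n. (\<integral>\<omega>. exp (\<i> * complex_of_real (t \<bullet> Z n \<omega>)) \<partial>M) - (\<integral>\<omega>. exp (\<i> * complex_of_real (t \<bullet> W n \<omega>)) \<partial>M)) \<longlonglongrightarrow> 0"
    proof (rule Lim_null_comparison)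
      show "\<forall>\<^sub>F n in sequentially. norm ((\<integral>\<omega>. exp (\<i> * complex_of_real (t \<bullet> Z n \<omega>)) \<partial>M) - (\<integral>\<omega>. exp (\<i> * complex_of_real (t \<bullet> W n \<omega>)) \<partial>M))
        \<le> (\<Sum>k\<in>UNIV. (2 + \<bar>t $ k\<bar>) * (\<integral>\<omega>. D n k \<omega> \<partial>M))"
      proof (rule always_eventually, rule allI)
        fix n
        have "norm ((\<integral>\<omega>. exp (\<i> * complex_of_real (t \<bullet> Z n \<omega>)) \<partial>M) - (\<integral>\<omega>. exp (\<i> * complex_of_real (t \<bullet> W n \<omega>)) \<partial>M))
          = norm (\<integral>\<omega>. exp (\<i> * complex_of_real (t \<bullet> Z n \<omega>)) - exp (\<i> * complex_of_real (t \<bullet> W n \<omega>)) \<partial>M)"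
          by (subst Bochner_Integration.integral_diff) (auto intro: ei M)
        also have "\<dots> \<le> (\<integral>\<omega>. norm (exp (\<i> * complex_of_real (t \<bullet> Z n \<omega>)) - exp (\<i> * complex_of_real (t \<bullet> W n \<omega>))) \<partial>M)"
          by (rule integral_norm_bound)
        also have "\<dots> \<le> (\<integral>\<omega>. (\<Sum>k\<in>UNIV. (2 + \<bar>t $ k\<bar>) * D n k \<omega>) \<partial>M)"
          by (rule integral_mono[OF _ _ bound])
            (intro integrable_norm Bochner_Integration.integrable_diff Bochner_Integration.integrable_sum integrable_mult_right ei M Di)+
        also have "\<dots> = (\<Sum>k\<in>UNIV. (2 + \<bar>t $ k\<bar>) * (\<integral>\<omega>. D n k \<omega> \<partial>M))"
          using Di by (subst Bochner_Integration.integral_sum) auto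
        finally show "norm ((\<integral>\<omega>. exp (\<i> * complex_of_real (t \<bullet> Z n \<omega>)) \<partial>M) - (\<integral>\<omega>. exp (\<i> * complex_of_real (t \<bullet> W n \<omega>)) \<partial>M))
          \<le> (\<Sum>k\<in>UNIV. (2 + \<bar>t $ k\<bar>) * (\<integral>\<omega>. D n k \<omega> \<partial>M))" .
      qed
      have "(\<lambda>n. \<Sum>k\<in>UNIV. (2 + \<bar>t $ k\<bar>) * (\<integral>\<omega>. D n k \<omega> \<partial>M)) \<longlonglongrightarrow> (\<Sum>k\<in>(UNIV::'d set). (2 + \<bar>t $ k\<bar>) * 0)"
        by (intro tendsto_sum tendsto_mult_left Dl)
      then show "(\<lambda>n. \<Sum>k\<in>UNIV. (2 + \<bar>t $ k\<bar>) * (\<integral>\<omega>. D n k \<omega> \<partial>M)) \<longlonglongrightarrow> 0" by simp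
    qed
    from tendsto_add[OF this ch[of t]]
    show "(\<lambda>n. \<integral>\<omega>. exp (\<i> * complex_of_real (t \<bullet> Z n \<omega>)) \<partial>M) \<longlonglongrightarrow> (\<integral>y. exp (\<i> * complex_of_real (t \<bullet> y)) \<partial>N)" by simp
  }
  fix e :: real assume e: "e > 0"
  define c where "c = real CARD('d) * \<bar>C\<bar>"
  have c0: "0 \<le> c" unfolding c_def by simp
  \<comment> \<open>Then c < e K, and e K is at most e K^2.\<close>
  define K where "K = 1 + 2 * c / e"
  have K1: "1 \<le> K" and K0: "K > 0" using e c0 unfolding K_def by (auto intro: add_pos_nonneg)
  have Kc: "c / K\<^sup>2 < e"
  proof -
    have "c < e * K" using e c0 unfolding K_def by (simp add: distrib_left)
    also have "\<dots> \<le> e * K\<^sup>2" using e K1 by (simp add: power2_eq_square)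
    finally show ?thesis using K0 by (simp add: divide_less_eq)
  qed
  \<comment> \<open>If a coordinate of \<open>Z\<close> exceeds K + 1 in modulus, then that of
    \<open>W\<close> reaches K or the two differ by more than 1; either way \<open>u\<close> is at
    least 1.\<close>
  define u where "u = (\<lambda>n \<omega>. \<Sum>k\<in>UNIV. (W n \<omega> $ k)\<^sup>2 / K\<^sup>2 + D n k \<omega>)"
  have ui: "integrable M (u n)" for n unfolding u_def
    by (intro Bochner_Integration.integrable_sum Bochner_Integration.integrable_add Di integrable_divide_zero W2)
  have u_int: "(\<integral>\<omega>. u n \<omega> \<partial>M) \<le> c / K\<^sup>2 + (\<Sum>k\<in>UNIV. \<integral>\<omega>. D n k \<omega> \<partial>M)" for n
  proof -
    have "(\<integral>\<omega>. u n \<omega> \<partial>M) = (\<Sum>k\<in>UNIV. (\<integral>\<omega>. (W n \<omega> $ k)\<^sup>2 \<partial>M) / K\<^sup>2 + (\<integral>\<omega>. D n k \<omega> \<partial>M))"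
      unfolding u_def using W2 Di by (subst Bochner_Integration.integral_sum) auto
    also have "\<dots> = (\<Sum>k\<in>UNIV. (\<integral>\<omega>. (W n \<omega> $ k)\<^sup>2 \<partial>M) / K\<^sup>2) + (\<Sum>k\<in>UNIV. \<integral>\<omega>. D n k \<omega> \<partial>M)"
      by (rule sum.distrib)
    also have "(\<Sum>k\<in>UNIV. (\<integral>\<omega>. (W n \<omega> $ k)\<^sup>2 \<partial>M) / K\<^sup>2) \<le> of_nat (card (UNIV :: 'd set)) * (\<bar>C\<bar> / K\<^sup>2)"
      by (rule sum_bounded_above) (use W2(2)[of n] in \<open>auto intro!: divide_right_mono order_trans[OF _ abs_ge_self]\<close>)
    finally show ?thesis by (simp add: c_def)
  qed
  have lim: "(\<lambda>n. c / K\<^sup>2 + (\<Sum>k\<in>UNIV. \<integral>\<omega>. D n k \<omega> \<partial>M)) \<longlonglongrightarrow> c / K\<^sup>2 + (\<Sum>k\<in>(UNIV::'d set). 0)"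
    by (intro tendsto_intros Dl)
  then have "\<forall>\<^sub>F n in sequentially. c / K\<^sup>2 + (\<Sum>k\<in>UNIV. \<integral>\<omega>. D n k \<omega> \<partial>M) < e"
    using Kc by (intro order_tendstoD(2)[OF lim]) simp
  then have "\<forall>\<^sub>F n in sequentially. measure M {\<omega>\<in>space M. \<exists>k. K + 1 < \<bar>Z n \<omega> $ k\<bar>} < e"
  proof eventually_elim
    case (elim n)
    have "measure M {\<omega>\<in>space M. \<exists>k. K + 1 < \<bar>Z n \<omega> $ k\<bar>} \<le> (\<integral>\<omega>. u n \<omega> \<partial>M)"
    proof (rule measure_le_integral[OF M(1) ui])
      have "{\<omega>\<in>space M. K + 1 < \<bar>Z n \<omega> $ k\<bar>} \<in> sets M" for k
        using cm[of Z, OF M(2)] by measurable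
      then have "(\<Union>k\<in>UNIV. {\<omega>\<in>space M. K + 1 < \<bar>Z n \<omega> $ k\<bar>}) \<in> sets M" by (intro sets.finite_UN) auto
      moreover have "(\<Union>k\<in>UNIV. {\<omega>\<in>space M. K + 1 < \<bar>Z n \<omega> $ k\<bar>}) = {\<omega>\<in>space M. \<exists>k. K + 1 < \<bar>Z n \<omega> $ k\<bar>}" by auto
      ultimately show "{\<omega>\<in>space M. \<exists>k. K + 1 < \<bar>Z n \<omega> $ k\<bar>} \<in> sets M" by simp
      have t0: "0 \<le> (W n \<omega> $ k)\<^sup>2 / K\<^sup>2 + D n k \<omega>" for k \<omega> using D01 by (intro add_nonneg_nonneg) auto
      show "0 \<le> u n \<omega>" for \<omega> unfolding u_def using t0 by (intro sum_nonneg)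
      fix \<omega> assume "\<exists>k. K + 1 < \<bar>Z n \<omega> $ k\<bar>"
      then obtain k where k: "K + 1 < \<bar>Z n \<omega> $ k\<bar>" by blast
      have "1 \<le> (W n \<omega> $ k)\<^sup>2 / K\<^sup>2 + D n k \<omega>"
      proof (cases "K \<le> \<bar>W n \<omega> $ k\<bar>")
        case True
        then have "K\<^sup>2 \<le> (W n \<omega> $ k)\<^sup>2" using K0 abs_le_square_iff[of K "W n \<omega> $ k"] by simp
        then have "1 \<le> (W n \<omega> $ k)\<^sup>2 / K\<^sup>2" using K0 by simp
        then show ?thesis using D01(1)[of n k \<omega>] by linarith
      next
        case False
        then have "D n k \<omega> = 1" using k unfolding D_def by (intro min.absorb1) linarith
        then show ?thesis by simp
      qed
      also have "\<dots> \<le> u n \<omega>" unfolding u_def by (rule member_le_sum) (use t0 in auto)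
      finally show "1 \<le> u n \<omega>" .
    qed
    then show ?case using u_int[of n] elim by linarith
  qed
  then show "\<exists>K>0. \<forall>\<^sub>F n in sequentially. measure M {\<omega>\<in>space M. \<exists>k. K < \<bar>Z n \<omega> $ k\<bar>} < e"
    using K0 by (intro exI[of _ "K + 1"]) auto
qed

text \<open>Cholesky elimination for a possibly singular form: the pivot \<open>s\<close> is split
  off and the rest is the Schur complement, again positive semidefinite because the quadratic form
  may be minimised over the coefficient of \<open>s\<close>. A zero pivot has a zero row.\<close>

lemma gram_decomposition:
  fixes K :: "'i \<Rightarrow> 'i \<Rightarrow> real"
  assumes "finite S" "\<And>k l. k \<in> S \<Longrightarrow> l \<in> S \<Longrightarrow> K k l = K l k"
    and "\<And>c. 0 \<le> (\<Sum>k\<in>S. \<Sum>l\<in>S. c k * c l * K k l)"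
  shows "\<exists>a. \<forall>k\<in>S. \<forall>l\<in>S. K k l = (\<Sum>j\<in>S. a k j * a l j)"
  using assms
proof (induction S arbitrary: K rule: finite_induct)
  case (insert s S K)
  have expand: "(\<Sum>k\<in>insert s S. \<Sum>l\<in>insert s S. c k * c l * K k l)
     = (c s)\<^sup>2 * K s s + 2 * c s * (\<Sum>k\<in>S. c k * K k s) + (\<Sum>k\<in>S. \<Sum>l\<in>S. c k * c l * K k l)" for c
  proof -
    have "(\<Sum>l\<in>S. c s * c l * K s l) = c s * (\<Sum>k\<in>S. c k * K k s)"
      unfolding sum_distrib_left by (rule sum.cong) (use insert.prems(1) in auto)
    moreover have "(\<Sum>k\<in>S. c k * c s * K k s) = c s * (\<Sum>k\<in>S. c k * K k s)"
      unfolding sum_distrib_left by (rule sum.cong) auto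
    ultimately show ?thesis using insert.hyps
      by (simp add: sum.distrib power2_eq_square)
  qed
  have psd: "0 \<le> (c s)\<^sup>2 * K s s + 2 * c s * (\<Sum>k\<in>S. c k * K k s) + (\<Sum>k\<in>S. \<Sum>l\<in>S. c k * c l * K k l)" for c
    using insert.prems(2)[of c] unfolding expand .
  have upd: "(\<Sum>k\<in>S. (c(s:=x)) k * f k) = (\<Sum>k\<in>S. c k * f k)"
    "(\<Sum>k\<in>S. \<Sum>l\<in>S. (c(s:=x)) k * (c(s:=x)) l * K k l) = (\<Sum>k\<in>S. \<Sum>l\<in>S. c k * c l * K k l)" for c x f
    using insert.hyps by (auto intro!: sum.cong)
  have psd': "0 \<le> x\<^sup>2 * K s s + 2 * x * (\<Sum>k\<in>S. c k * K k s) + (\<Sum>k\<in>S. \<Sum>l\<in>S. c k * c l * K k l)" for c x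
    using psd[of "c(s := x)"] unfolding upd by simp
  have Kss: "0 \<le> K s s" using psd'[of 1 "\<lambda>_. 0"] by simp
  show ?case
  proof (cases "K s s = 0")
    case True
    \<comment> \<open>With a zero pivot the form is affine in the coefficient x of \<open>s\<close>;
      nonnegativity for all x forces slope 0.\<close>
    have z: "K k s = 0" if k: "k \<in> S" for k
    proof (rule ccontr)
      assume ne: "K k s \<noteq> 0"
      have s1: "(\<Sum>l\<in>S. of_bool (l = k) * K l s) = K k s"
        using insert.hyps k by (subst sum.remove[of S k]) auto
      define q where "q = (\<Sum>m\<in>S. \<Sum>l\<in>S. of_bool (m = k) * of_bool (l = k) * K m l)"
      have "0 \<le> 2 * x * K k s + q" for x
        using psd'[of x "\<lambda>l. of_bool (l = k)"] True unfolding s1 q_def by simp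
      moreover have "2 * ((- q - 1) / (2 * K k s)) * K k s = - q - 1" using ne by simp
      ultimately have "0 \<le> (- q - 1) + q" by metis
      then show False by simp
    qed
    obtain a where a: "\<forall>k\<in>S. \<forall>l\<in>S. K k l = (\<Sum>j\<in>S. a k j * a l j)"
      using insert.IH[of K] insert.prems(1) psd'[of 0] by auto
    define b where "b = (\<lambda>k j. if k = s \<or> j = s then 0 else a k j)"
    have "K k l = (\<Sum>j\<in>insert s S. b k j * b l j)" if "k \<in> insert s S" "l \<in> insert s S" for k l
    proof (cases "k = s \<or> l = s")
      case t: True
      then have "K k l = 0" using True z insert.prems(1)[of k l] that by auto
      moreover have "(\<Sum>j\<in>insert s S. b k j * b l j) = 0" by (rule sum.neutral) (use t in \<open>auto simp: b_def\<close>)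
      ultimately show ?thesis by simp
    next
      case False
      have "(\<Sum>j\<in>insert s S. b k j * b l j) = (\<Sum>j\<in>S. a k j * a l j)"
        using insert.hyps False by (auto simp: b_def intro!: sum.cong)
      then show ?thesis using a that False by auto
    qed
    then show ?thesis by blast
  next
    case False
    then have pos: "0 < K s s" using Kss by simp
    define K' where "K' = (\<lambda>k l. K k l - K k s * K l s / K s s)"
    have "0 \<le> (\<Sum>k\<in>S. \<Sum>l\<in>S. c k * c l * K' k l)" for c
    proof -
      let ?m = "\<Sum>k\<in>S. c k * K k s"
      have "(\<Sum>k\<in>S. \<Sum>l\<in>S. c k * c l * (K k s * K l s / K s s)) = ?m\<^sup>2 / K s s"
      proof -
        have "?m\<^sup>2 / K s s = (\<Sum>k\<in>S. \<Sum>l\<in>S. (c k * K k s) * (c l * K l s)) / K s s"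
          unfolding power2_eq_square sum_product ..
        also have "\<dots> = (\<Sum>k\<in>S. \<Sum>l\<in>S. c k * c l * (K k s * K l s / K s s))"
          unfolding sum_divide_distrib by (intro sum.cong refl) simp
        finally show ?thesis by simp
      qed
      then have "(\<Sum>k\<in>S. \<Sum>l\<in>S. c k * c l * K' k l) = (\<Sum>k\<in>S. \<Sum>l\<in>S. c k * c l * K k l) - ?m\<^sup>2 / K s s"
        unfolding K'_def right_diff_distrib sum_subtractf by simp
      \<comment> \<open>\<open>- ?m / K s s\<close> is the minimising coefficient of
        \<open>s\<close>.\<close>
      moreover have "(- ?m / K s s)\<^sup>2 * K s s + 2 * (- ?m / K s s) * ?m = - (?m\<^sup>2 / K s s)"
        using pos by (simp add: power2_eq_square field_simps)
      ultimately show ?thesis using psd'[of "- ?m / K s s" c] by simp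
    qed
    moreover have "K' k l = K' l k" if "k \<in> S" "l \<in> S" for k l
      using insert.prems(1)[of k l] that by (simp add: K'_def)
    ultimately obtain a where a: "\<forall>k\<in>S. \<forall>l\<in>S. K' k l = (\<Sum>j\<in>S. a k j * a l j)"
      using insert.IH[of K'] by blast
    \<comment> \<open>Column \<open>s\<close> carries the rank-one part K k s * K l s / K s s; the
      other columns factor the Schur complement and vanish in row \<open>s\<close>.\<close>
    define b where "b = (\<lambda>k j. if j = s then K k s / sqrt (K s s) else if k = s then 0 else a k j)"
    have bs: "b k s * b l s = K k s * K l s / K s s" for k l
      using pos by (simp add: b_def)
    have "K k l = (\<Sum>j\<in>insert s S. b k j * b l j)" if "k \<in> insert s S" "l \<in> insert s S" for k l
    proof -
      have e: "(\<Sum>j\<in>insert s S. b k j * b l j) = K k s * K l s / K s s + (\<Sum>j\<in>S. b k j * b l j)"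
        using insert.hyps bs by simp
      show ?thesis
      proof (cases "k = s \<or> l = s")
        case True
        have "(\<Sum>j\<in>S. b k j * b l j) = 0"
          by (rule sum.neutral) (use True insert.hyps in \<open>auto simp: b_def\<close>)
        moreover have "K k s * K l s / K s s = K k l"
          using True pos insert.prems(1)[of k l] that by auto
        ultimately show ?thesis unfolding e by simp
      next
        case False
        have "(\<Sum>j\<in>S. b k j * b l j) = (\<Sum>j\<in>S. a k j * a l j)"
          by (rule sum.cong) (use False insert.hyps in \<open>auto simp: b_def\<close>)
        moreover have "(\<Sum>j\<in>S. a k j * a l j) = K' k l" using a that False by auto
        ultimately show ?thesis unfolding e K'_def by simp
      qed
    qed
    then show ?thesis by blast
  qed
qed simp

lemma real_dist_std_normal: "real_distribution std_normal_distribution"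
  by (rule real_dist_normal_dist)

text \<open>The law is the image of independent standard normals under a Gram factor of
  \<open>C\<close>, which may be singular; independence turns the characteristic function into a
  product.\<close>

theorem gaussian_law_exists:
  fixes C :: "real ^ 'd ^ 'd"
  assumes sym: "\<And>k l. C $ k $ l = C $ l $ k"
    and psd: "\<And>t. 0 \<le> (\<Sum>k\<in>UNIV. \<Sum>l\<in>UNIV. t k * t l * C $ k $ l)"
  shows "\<exists>N. gaussian_law N 0 C"
proof -
  obtain a :: "'d \<Rightarrow> 'd \<Rightarrow> real" where a: "\<And>k l. C $ k $ l = (\<Sum>j\<in>UNIV. a k j * a l j)"
  proof -
    have "\<exists>a :: 'd \<Rightarrow> 'd \<Rightarrow> real. \<forall>k\<in>UNIV. \<forall>l\<in>UNIV. C $ k $ l = (\<Sum>j\<in>UNIV. a k j * a l j)"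
      by (rule gram_decomposition[of UNIV "\<lambda>k l. C $ k $ l"]) (rule finite, rule sym, rule psd)
    then show thesis using that by blast
  qed
  define P where "P = PiM (UNIV :: 'd set) (\<lambda>_. std_normal_distribution)"
  interpret R: real_distribution std_normal_distribution by (rule real_dist_std_normal)
  interpret PP: product_prob_space "\<lambda>_::'d. std_normal_distribution" UNIV by standard
  interpret P: prob_space P unfolding P_def by (rule prob_space_PiM) (rule R.prob_space_axioms)
  define T where "T = (\<lambda>\<xi> :: 'd \<Rightarrow> real. \<chi> k. \<Sum>j\<in>UNIV. a k j * \<xi> j)"
  have cm: "(\<lambda>\<xi>. \<xi> j) \<in> borel_measurable P" for j
    using measurable_component_singleton[of j UNIV "\<lambda>_. std_normal_distribution"] unfolding P_def by simp
  have Tm: "T \<in> borel_measurable P" unfolding T_def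
    by (rule borel_measurable_vec, unfold vec_lambda_beta, intro borel_measurable_sum borel_measurable_times cm) auto
  define N where "N = distr P borel T"
  have "gaussian_law N 0 C" unfolding gaussian_law_def
  proof (intro conjI allI)
    show "prob_space N" unfolding N_def by (rule P.prob_space_distr) (rule Tm)
    show "sets N = sets borel" by (simp add: N_def)
    show "transpose C = C" by (simp add: transpose_def vec_eq_iff sym)
    fix t :: "real ^ 'd"
    define b where "b = (\<lambda>j. \<Sum>k\<in>UNIV. t $ k * a k j)"
    have tT: "t \<bullet> T \<xi> = (\<Sum>j\<in>UNIV. b j * \<xi> j)" for \<xi>
    proof -
      have "t \<bullet> T \<xi> = (\<Sum>k\<in>UNIV. \<Sum>j\<in>UNIV. t $ k * a k j * \<xi> j)"
        by (simp add: T_def inner_vec_def sum_distrib_left mult.assoc)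
      also have "\<dots> = (\<Sum>j\<in>UNIV. b j * \<xi> j)"
        unfolding b_def sum_distrib_right by (rule sum.swap)
      finally show ?thesis .
    qed
    have "(CLINT y|N. exp (\<i> * complex_of_real (t \<bullet> y))) = (CLINT \<xi>|P. exp (\<i> * complex_of_real (t \<bullet> T \<xi>)))"
      unfolding N_def by (rule integral_distr[OF Tm]) measurable
    also have "\<dots> = (CLINT \<xi>|P. (\<Prod>j\<in>UNIV. exp (\<i> * complex_of_real (b j * \<xi> j))))"
      unfolding tT of_real_sum sum_distrib_left by (subst exp_sum) auto
    also have "\<dots> = (\<Prod>j\<in>UNIV. CLINT x|std_normal_distribution. exp (\<i> * complex_of_real (b j * x)))"
      unfolding P_def by (rule PP.product_integral_prod) (auto intro!: R.integrable_const_bound[where B=1])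
    also have "\<dots> = (\<Prod>j\<in>UNIV. complex_of_real (exp (- ((b j)\<^sup>2) / 2)))"
      using char_std_normal_distribution by (simp add: char_def fun_eq_iff)
    also have "\<dots> = complex_of_real (exp (\<Sum>j\<in>UNIV. - ((b j)\<^sup>2) / 2))"
      by (simp add: exp_sum)
    also have "(\<Sum>j\<in>UNIV. - ((b j)\<^sup>2) / 2) = - (\<Sum>j\<in>UNIV. (b j)\<^sup>2) / 2"
      by (simp add: sum_negf sum_divide_distrib)
    also have "(\<Sum>j\<in>UNIV. (b j)\<^sup>2) = t \<bullet> (C *v t)"
    proof -
      have "(\<Sum>j\<in>UNIV. (b j)\<^sup>2) = (\<Sum>j\<in>UNIV. \<Sum>k\<in>UNIV. \<Sum>l\<in>UNIV. (t $ k * a k j) * (t $ l * a l j))"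
        unfolding b_def power2_eq_square sum_product ..
      also have "\<dots> = (\<Sum>k\<in>UNIV. \<Sum>l\<in>UNIV. \<Sum>j\<in>UNIV. (t $ k * a k j) * (t $ l * a l j))"
        by (subst sum.swap) (intro sum.cong refl sum.swap)
      also have "\<dots> = t \<bullet> (C *v t)"
        by (simp add: inner_vec_def matrix_vector_mult_def a sum_distrib_left sum_distrib_right mult_ac)
      finally show ?thesis .
    qed
    finally show "(CLINT y|N. exp (\<i> * complex_of_real (t \<bullet> y))) =
        exp (\<i> * complex_of_real (t \<bullet> 0) - complex_of_real (t \<bullet> (C *v t)) / 2)"
      by (simp add: exp_of_real[symmetric] del: exp_of_real)
  qed
  then show ?thesis by blast
qed

section \<open>Sums of products of neighbouring outputs\<close>

lemma integral_PiM_component: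
  fixes g :: "'a \<Rightarrow> 'b::{banach,second_countable_topology}"
  assumes "prob_space \<nu>" "i \<in> I" "g \<in> borel_measurable \<nu>"
  shows "(\<integral>e. g (e i) \<partial>PiM I (\<lambda>_. \<nu>)) = (\<integral>a. g a \<partial>\<nu>)"
proof -
  have d: "distr (PiM I (\<lambda>_. \<nu>)) \<nu> (\<lambda>e. e i) = \<nu>"
    by (rule distr_PiM_component) (use assms in auto)
  have "(\<integral>a. g a \<partial>\<nu>) = (\<integral>a. g a \<partial>distr (PiM I (\<lambda>_. \<nu>)) \<nu> (\<lambda>e. e i))" unfolding d ..
  also have "\<dots> = (\<integral>e. g (e i) \<partial>PiM I (\<lambda>_. \<nu>))"
    by (rule integral_distr) (use assms in \<open>auto intro: measurable_component_singleton\<close>)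
  finally show ?thesis by simp
qed

lemma measurable_PiM_component:
  assumes "g \<in> measurable \<nu> L" "i \<in> I"
  shows "(\<lambda>e. g (e i)) \<in> measurable (PiM I (\<lambda>_. \<nu>)) L"
  using measurable_compose[OF measurable_component_singleton[of i I "\<lambda>_. \<nu>"] assms(1)] assms(2) by blast

lemma sum_abs_bound:
  fixes t :: "'i \<Rightarrow> real"
  assumes "\<And>j. j \<in> J \<Longrightarrow> \<bar>t j\<bar> \<le> B"
  shows "\<bar>\<Sum>j\<in>J. t j\<bar> \<le> real (card J) * B"
proof -
  have "\<bar>\<Sum>j\<in>J. t j\<bar> \<le> (\<Sum>j\<in>J. \<bar>t j\<bar>)" by (rule sum_abs)
  also have "\<dots> \<le> of_nat (card J) * B" by (rule sum_bounded_above) (rule assms)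
  finally show ?thesis by simp
qed

text \<open>Deleting the term of coordinate \<open>i\<close> changes the sum by
  \<open>g i (e i)\<close> alone, and the mean is 0, so the Efron-Stein bound is exactly the sum of
  the second moments.\<close>

lemma second_moment_additive:
  fixes g :: "'i \<Rightarrow> 'a \<Rightarrow> real"
  assumes \<nu>: "prob_space \<nu>" and fin: "finite I" and g: "\<And>i. i \<in> I \<Longrightarrow> g i \<in> borel_measurable \<nu>"
    and B: "\<And>i a. \<bar>g i a\<bar> \<le> B" and z: "\<And>i. i \<in> I \<Longrightarrow> (\<integral>a. g i a \<partial>\<nu>) = 0"
  shows "(\<integral>e. (\<Sum>i\<in>I. g i (e i))\<^sup>2 \<partial>PiM I (\<lambda>_. \<nu>)) \<le> (\<Sum>i\<in>I. \<integral>a. (g i a)\<^sup>2 \<partial>\<nu>)"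
proof -
  let ?P = "PiM I (\<lambda>_. \<nu>)"
  have P: "prob_space ?P" by (rule prob_space_PiM) (rule \<nu>)
  have cm: "(\<lambda>e. g j (e j)) \<in> borel_measurable ?P" if "j \<in> I" for j
    by (rule measurable_PiM_component[OF g[OF that] that])
  have B0: "0 \<le> B" using B[of undefined undefined] by linarith
  have bd: "\<bar>\<Sum>j\<in>J. g j (e j)\<bar> \<le> real (card I) * B" if "J \<subseteq> I" for J e
  proof -
    have "\<bar>\<Sum>j\<in>J. g j (e j)\<bar> \<le> real (card J) * B" by (rule sum_abs_bound) (rule B)
    also have "\<dots> \<le> real (card I) * B" using card_mono[OF fin that] B0 by (intro mult_right_mono) auto
    finally show ?thesis .
  qed
  have m0: "(\<integral>e. (\<Sum>i\<in>I. g i (e i)) \<partial>?P) = 0"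
  proof -
    have "(\<integral>e. (\<Sum>i\<in>I. g i (e i)) \<partial>?P) = (\<Sum>i\<in>I. \<integral>e. g i (e i) \<partial>?P)"
      by (rule Bochner_Integration.integral_sum) (rule integrable_bdd[OF P cm, where B=B], use B in auto)
    also have "\<dots> = 0" using z g by (simp add: integral_PiM_component[OF \<nu>])
    finally show ?thesis .
  qed
  have "(\<integral>e. ((\<Sum>i\<in>I. g i (e i)) - (\<integral>e. (\<Sum>i\<in>I. g i (e i)) \<partial>?P))\<^sup>2 \<partial>?P)
    \<le> (\<Sum>i\<in>I. \<integral>e. ((\<Sum>i\<in>I. g i (e i)) - (\<Sum>j\<in>I - {i}. g j (e j)))\<^sup>2 \<partial>?P)"
  proof (rule efron_stein[OF \<nu> fin, where B="real (card I) * B"])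
    show "(\<lambda>e. \<Sum>i\<in>I. g i (e i)) \<in> borel_measurable ?P" by (intro borel_measurable_sum cm)
    show "(\<lambda>e. \<Sum>j\<in>I - {i}. g j (e j)) \<in> borel_measurable ?P" for i by (intro borel_measurable_sum cm) auto
    show "\<bar>\<Sum>i\<in>I. g i (e i)\<bar> \<le> real (card I) * B" for e by (rule bd) simp
    show "\<bar>\<Sum>j\<in>I - {i}. g j (e j)\<bar> \<le> real (card I) * B" for e i by (rule bd) auto
    show "(\<Sum>j\<in>I - {i}. g j ((e(i := a)) j)) = (\<Sum>j\<in>I - {i}. g j (e j))" for e i a
      by (rule sum.cong) auto
  qed
  also have "\<dots> = (\<Sum>i\<in>I. \<integral>e. (g i (e i))\<^sup>2 \<partial>?P)"
    by (intro sum.cong refl Bochner_Integration.integral_cong) (simp add: sum.remove[OF fin])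
  also have "\<dots> = (\<Sum>i\<in>I. \<integral>a. (g i a)\<^sup>2 \<partial>\<nu>)"
    by (intro sum.cong refl integral_PiM_component[OF \<nu>] borel_measurable_power g)
  finally show ?thesis unfolding m0 by simp
qed

text \<open>Serves sums whose terms carry the noise of a neighbour: they are reindexed by the
  inverse of the neighbour map.\<close>

lemma second_moment_additive_perm:
  fixes g :: "'i \<Rightarrow> 'a \<Rightarrow> real"
  assumes \<nu>: "prob_space \<nu>" and fin: "finite I" and g: "\<And>i. i \<in> I \<Longrightarrow> g i \<in> borel_measurable \<nu>"
    and B: "\<And>i a. \<bar>g i a\<bar> \<le> B" and z: "\<And>i. i \<in> I \<Longrightarrow> (\<integral>a. g i a \<partial>\<nu>) = 0"
    and \<pi>: "bij_betw \<pi> I I"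
  shows "(\<integral>e. (\<Sum>i\<in>I. g i (e (\<pi> i)))\<^sup>2 \<partial>PiM I (\<lambda>_. \<nu>)) \<le> (\<Sum>i\<in>I. \<integral>a. (g i a)\<^sup>2 \<partial>\<nu>)"
proof -
  define r where "r = inv_into I \<pi>"
  have r: "bij_betw r I I" unfolding r_def by (rule bij_betw_inv_into[OF \<pi>])
  have r\<pi>: "r (\<pi> i) = i" if "i \<in> I" for i unfolding r_def using \<pi> that by (rule bij_betw_inv_into_left)
  have rI: "i \<in> I \<Longrightarrow> r i \<in> I" for i using r bij_betwE by blast
  have e: "(\<Sum>i\<in>I. g i (e (\<pi> i))) = (\<Sum>i\<in>I. g (r i) (e i))" for e
    using sum.reindex_bij_betw[OF \<pi>, of "\<lambda>i. g (r i) (e i)"] r\<pi> by simp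
  have "(\<integral>e. (\<Sum>i\<in>I. g (r i) (e i))\<^sup>2 \<partial>PiM I (\<lambda>_. \<nu>)) \<le> (\<Sum>i\<in>I. \<integral>a. (g (r i) a)\<^sup>2 \<partial>\<nu>)"
    by (rule second_moment_additive[OF \<nu> fin]) (use g B z rI in blast)+
  also have "\<dots> = (\<Sum>i\<in>I. \<integral>a. (g i a)\<^sup>2 \<partial>\<nu>)"
    by (rule sum.reindex_bij_betw[OF r])
  finally show ?thesis unfolding e .
qed

text \<open>Coordinate \<open>j\<close> is integrated out first, where the other factor is a
  constant.\<close>

lemma integral_PiM_cross:
  fixes u w :: "'a \<Rightarrow> real"
  assumes \<nu>: "prob_space \<nu>" and ij: "finite I" "i \<in> I" "j \<in> I" "i \<noteq> j"
    and m: "u \<in> borel_measurable \<nu>" "w \<in> borel_measurable \<nu>"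
    and B: "\<And>a. \<bar>u a\<bar> \<le> B" "\<And>a. \<bar>w a\<bar> \<le> B" and z: "(\<integral>a. w a \<partial>\<nu>) = 0"
  shows "(\<integral>e. u (e i) * w (e j) \<partial>PiM I (\<lambda>_. \<nu>)) = 0"
proof -
  interpret N: prob_space \<nu> by fact
  interpret PP: product_prob_space "\<lambda>_. \<nu>" UNIV by standard
  have ins: "insert j (I - {j}) = I" using ij by auto
  have "integrable (PiM (insert j (I - {j})) (\<lambda>_. \<nu>)) (\<lambda>e. u (e i) * w (e j))"
    unfolding ins
  proof (rule integrable_bdd[where B="B * B"])
    show "prob_space (PiM I (\<lambda>_. \<nu>))" by (rule prob_space_PiM) (rule \<nu>)
    show "(\<lambda>e. u (e i) * w (e j)) \<in> borel_measurable (PiM I (\<lambda>_. \<nu>))"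
      by (intro borel_measurable_times measurable_PiM_component[OF m(1)] measurable_PiM_component[OF m(2)] ij)
    show "norm (u (e i) * w (e j)) \<le> B * B" for e
      unfolding real_norm_def abs_mult by (intro mult_mono B) (use B[of "e i"] in auto)
  qed
  from PP.product_integral_insert[OF _ _ this]
  have "(\<integral>e. u (e i) * w (e j) \<partial>PiM I (\<lambda>_. \<nu>))
     = (\<integral>x. (\<integral>y. u (x i) * w y \<partial>\<nu>) \<partial>PiM (I - {j}) (\<lambda>_. \<nu>))"
    using ij unfolding ins by simp
  also have "\<dots> = 0" using z by simp
  finally show ?thesis .
qed

lemma measurable_pair_component:
  assumes "case_prod h \<in> borel_measurable (\<nu> \<Otimes>\<^sub>M \<nu>)" "i \<in> I" "j \<in> I"
  shows "(\<lambda>e. h (e i) (e j)) \<in> borel_measurable (PiM I (\<lambda>_. \<nu>))"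
  using measurable_compose[OF measurable_Pair[OF measurable_component_singleton[OF assms(2)] measurable_component_singleton[OF assms(3)]] assms(1)]
  by simp

text \<open>Each noise enters at most two terms, its own and that of its predecessor under
  \<open>\<pi>\<close>, so the Efron-Stein differences are at most 2 K whatever the number of
  terms.\<close>

lemma second_moment_neighbour:
  fixes h :: "'i \<Rightarrow> 'a \<Rightarrow> 'a \<Rightarrow> real"
  assumes \<nu>: "prob_space \<nu>" and fin: "finite I" and h: "\<And>i. i \<in> I \<Longrightarrow> case_prod (h i) \<in> borel_measurable (\<nu> \<Otimes>\<^sub>M \<nu>)"
    and K: "\<And>i a b. \<bar>h i a b\<bar> \<le> K" and \<pi>: "bij_betw \<pi> I I"
    and z: "(\<integral>e. (\<Sum>i\<in>I. h i (e i) (e (\<pi> i))) \<partial>PiM I (\<lambda>_. \<nu>)) = 0"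
  shows "(\<integral>e. (\<Sum>i\<in>I. h i (e i) (e (\<pi> i)))\<^sup>2 \<partial>PiM I (\<lambda>_. \<nu>)) \<le> real (card I) * (2 * K)\<^sup>2"
proof -
  let ?P = "PiM I (\<lambda>_. \<nu>)"
  have P: "prob_space ?P" by (rule prob_space_PiM) (rule \<nu>)
  have \<pi>I: "i \<in> I \<Longrightarrow> \<pi> i \<in> I" for i using \<pi> bij_betwE by blast
  have cm: "(\<lambda>e. h j (e j) (e (\<pi> j))) \<in> borel_measurable ?P" if "j \<in> I" for j
    by (rule measurable_pair_component[OF h]) (use that \<pi>I in auto)
  have K0: "0 \<le> K" using K[of undefined undefined undefined] by linarith
  let ?s = "\<lambda>J e. \<Sum>j\<in>J. h j (e j) (e (\<pi> j))"
  \<comment> \<open>The terms that do not read coordinate \<open>i\<close>.\<close>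
  define A where "A = (\<lambda>i. {j\<in>I. j \<noteq> i \<and> \<pi> j \<noteq> i})"
  have bd: "\<bar>?s J e\<bar> \<le> real (card I) * K" if "J \<subseteq> I" for J e
  proof -
    have "\<bar>?s J e\<bar> \<le> real (card J) * K" by (rule sum_abs_bound) (rule K)
    also have "\<dots> \<le> real (card I) * K" using card_mono[OF fin that] K0 by (intro mult_right_mono) auto
    finally show ?thesis .
  qed
  have sm: "?s J \<in> borel_measurable ?P" if "J \<subseteq> I" for J by (intro borel_measurable_sum cm) (use that in auto)
  have AI: "A i \<subseteq> I" for i unfolding A_def by auto
  have "(\<integral>e. (?s I e - (\<integral>e. ?s I e \<partial>?P))\<^sup>2 \<partial>?P) \<le> (\<Sum>i\<in>I. \<integral>e. (?s I e - ?s (A i) e)\<^sup>2 \<partial>?P)"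
  proof (rule efron_stein[OF \<nu> fin, where B="real (card I) * K"])
    show "?s (A i) (e(i := a)) = ?s (A i) e" for e i a
      by (rule sum.cong) (auto simp: A_def)
  qed (use sm bd AI in auto)
  also have "\<dots> \<le> (\<Sum>i\<in>I. (2 * K)\<^sup>2)"
  proof (rule sum_mono)
    fix i assume i: "i \<in> I"
    have "\<bar>?s I e - ?s (A i) e\<bar> \<le> 2 * K" for e
    proof -
      have "?s I e = ?s (I - A i) e + ?s (A i) e" using sum.subset_diff[OF AI fin] .
      then have "\<bar>?s I e - ?s (A i) e\<bar> = \<bar>?s (I - A i) e\<bar>" by simp
      also have "\<dots> \<le> real (card (I - A i)) * K" by (rule sum_abs_bound) (rule K)
      also have "card (I - A i) \<le> card {i, inv_into I \<pi> i}"
      proof (rule card_mono)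
        show "I - A i \<subseteq> {i, inv_into I \<pi> i}"
          unfolding A_def using bij_betw_inv_into_left[OF \<pi>] by auto
      qed simp
      then have "real (card (I - A i)) * K \<le> 2 * K"
        using card_insert_le_m1[of 2 "{inv_into I \<pi> i}" i] K0 by (intro mult_right_mono) (auto simp: card_insert_if split: if_splits)
      finally show ?thesis .
    qed
    then have "norm (\<integral>e. (?s I e - ?s (A i) e)\<^sup>2 \<partial>?P) \<le> (2 * K)\<^sup>2"
      by (intro integral_abs_le[OF P]) (simp add: square_le_of_abs_le[of _ "2 * K", simplified])
    then show "(\<integral>e. (?s I e - ?s (A i) e)\<^sup>2 \<partial>?P) \<le> (2 * K)\<^sup>2" by simp
  qed
  finally show ?thesis unfolding z by simp
qed

section \<open>Bounded measurable functions of the two inputs\<close>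

definition bdd2 :: "(real \<Rightarrow> real \<Rightarrow> real) \<Rightarrow> bool" where
  "bdd2 f \<longleftrightarrow> case_prod f \<in> borel_measurable (borel \<Otimes>\<^sub>M borel) \<and> (\<exists>B. \<forall>x e. \<bar>f x e\<bar> \<le> B)"

lemma bdd2_bound: assumes "bdd2 f" shows "\<exists>B\<ge>0. \<forall>x e. \<bar>f x e\<bar> \<le> B"
proof -
  obtain B where B: "\<And>x e. \<bar>f x e\<bar> \<le> B" using assms unfolding bdd2_def by blast
  have "0 \<le> B" using B[of 0 0] by linarith
  then show ?thesis using B by blast
qed

lemma bdd2_meas:
  assumes "bdd2 f" "u \<in> borel_measurable N" "v \<in> borel_measurable N"
  shows "(\<lambda>\<omega>. f (u \<omega>) (v \<omega>)) \<in> borel_measurable N"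
  using measurable_compose[OF measurable_Pair[OF assms(2,3)], of "case_prod f"] assms(1)
  by (simp add: bdd2_def)

lemma bdd2_const: "bdd2 (\<lambda>x e. c)" unfolding bdd2_def by auto

lemma bdd2I:
  assumes "(\<lambda>p. f (fst p) (snd p)) \<in> borel_measurable (borel \<Otimes>\<^sub>M borel)" "\<And>x e. \<bar>f x e\<bar> \<le> B"
  shows "bdd2 f"
  unfolding bdd2_def case_prod_beta' using assms by blast

lemma bdd2_meas_pair: "bdd2 f \<Longrightarrow> (\<lambda>p. f (fst p) (snd p)) \<in> borel_measurable (borel \<Otimes>\<^sub>M borel)"
  unfolding bdd2_def case_prod_beta' by blast

lemma bdd2_add: assumes "bdd2 f" "bdd2 g" shows "bdd2 (\<lambda>x e. f x e + g x e)"
proof -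
  obtain B where B: "\<And>x e. \<bar>f x e\<bar> \<le> B" using bdd2_bound[OF assms(1)] by blast
  obtain C where C: "\<And>x e. \<bar>g x e\<bar> \<le> C" using bdd2_bound[OF assms(2)] by blast
  show ?thesis
  proof (rule bdd2I)
    show "\<bar>f x e + g x e\<bar> \<le> B + C" for x e using B[of x e] C[of x e] by linarith
  qed (intro borel_measurable_add bdd2_meas_pair assms)
qed

lemma bdd2_mult: assumes "bdd2 f" "bdd2 g" shows "bdd2 (\<lambda>x e. f x e * g x e)"
proof -
  obtain B where B: "\<And>x e. \<bar>f x e\<bar> \<le> B" "0 \<le> B" using bdd2_bound[OF assms(1)] by blast
  obtain C where C: "\<And>x e. \<bar>g x e\<bar> \<le> C" using bdd2_bound[OF assms(2)] by blast
  show ?thesis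
  proof (rule bdd2I)
    show "\<bar>f x e * g x e\<bar> \<le> B * C" for x e
      unfolding abs_mult by (intro mult_mono B C) simp
  qed (intro borel_measurable_times bdd2_meas_pair assms)
qed

lemma bdd2_scale: "bdd2 f \<Longrightarrow> bdd2 (\<lambda>x e. c * f x e)"
  by (intro bdd2_mult bdd2_const)

lemma bdd2_diff: assumes "bdd2 f" "bdd2 g" shows "bdd2 (\<lambda>x e. f x e - g x e)"
  using bdd2_add[OF assms(1) bdd2_scale[OF assms(2), of "-1"]] by simp

lemma bdd2_square: "bdd2 f \<Longrightarrow> bdd2 (\<lambda>x e. (f x e)\<^sup>2)"
  unfolding power2_eq_square by (rule bdd2_mult)

lemma bdd2_sum: "finite K \<Longrightarrow> (\<And>k. k \<in> K \<Longrightarrow> bdd2 (f k)) \<Longrightarrow> bdd2 (\<lambda>x e. \<Sum>k\<in>K. f k x e)"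
proof (induction K rule: finite_induct)
  case empty then show ?case by (simp add: bdd2_const)
next
  case (insert k K)
  have "bdd2 (\<lambda>x e. f k x e + (\<Sum>k\<in>K. f k x e))"
    by (rule bdd2_add) (use insert in blast)+
  then show ?case using insert.hyps by simp
qed

lemma bdd2_fst_meas:
  assumes "bdd2 (\<lambda>x e. h x)" shows "h \<in> borel_measurable borel"
  using bdd2_meas[OF assms, of "\<lambda>x. x" borel "\<lambda>x. 0"] by simp

text \<open>\<open>\<mu>\<close> and \<open>\<nu>\<close> stand for the laws of X and of epsilon;
  the asymptotics are worked out in this product model and moved to the given sample at the
  end.\<close>

locale rank_model = atomless_law +
  fixes \<nu> :: "real measure"
  assumes prob_nu: "prob_space \<nu>" and sets_nu[measurable_cong, simp]: "sets \<nu> = sets borel"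
begin

sublocale nu: prob_space \<nu> by (rule prob_nu)

lemma space_nu[simp]: "space \<nu> = UNIV"
  using sets_eq_imp_space_eq[OF sets_nu] by simp

lemma borel_measurable_nu: "g \<in> borel_measurable \<nu> \<longleftrightarrow> g \<in> borel_measurable borel"
  by (rule arg_cong[where f="\<lambda>S. g \<in> S"], rule measurable_cong_sets) auto

lemma borel_measurable_mu: "g \<in> borel_measurable \<mu> \<longleftrightarrow> g \<in> borel_measurable borel"
  by (rule arg_cong[where f="\<lambda>S. g \<in> S"], rule measurable_cong_sets) auto

lemma bdd2_section: assumes "bdd2 f" shows "f x \<in> borel_measurable \<nu>"
  unfolding borel_measurable_nu by (rule bdd2_meas[OF assms borel_measurable_const measurable_ident_sets[OF refl]])

definition cmean :: "(real \<Rightarrow> real \<Rightarrow> real) \<Rightarrow> real \<Rightarrow> real" where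
  "cmean f x = (\<integral>e. f x e \<partial>\<nu>)"

lemma cmean_bound:
  assumes "\<And>x e. \<bar>f x e\<bar> \<le> B" shows "\<bar>cmean f x\<bar> \<le> B"
proof -
  have "norm (\<integral>e. f x e \<partial>\<nu>) \<le> B"
    by (rule integral_abs_le[OF prob_nu]) (simp only: real_norm_def assms)
  then show ?thesis unfolding cmean_def real_norm_def .
qed

lemma bdd2_integrable: assumes "bdd2 f" shows "integrable \<nu> (f x)"
proof -
  obtain B where B: "\<And>x e. \<bar>f x e\<bar> \<le> B" using bdd2_bound[OF assms] by blast
  show ?thesis by (rule integrable_bdd[OF prob_nu bdd2_section[OF assms], where B=B]) (simp add: B)
qed

lemma bdd2_cmean: assumes "bdd2 f" shows "bdd2 (\<lambda>x e. cmean f x)"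
proof -
  have "case_prod f \<in> borel_measurable (borel \<Otimes>\<^sub>M \<nu>)"
  proof -
    have "borel_measurable (borel \<Otimes>\<^sub>M \<nu>) = borel_measurable (borel \<Otimes>\<^sub>M borel)"
      by (rule measurable_cong_sets[OF sets_pair_measure_cong[OF refl sets_nu] refl])
    then show ?thesis using assms unfolding bdd2_def by blast
  qed
  then have [measurable]: "cmean f \<in> borel_measurable borel"
    unfolding cmean_def by (rule measurable_lebesgue_integral_kernel[OF nu.sigma_finite_measure_axioms])
  obtain B where B: "\<And>x e. \<bar>f x e\<bar> \<le> B" using bdd2_bound[OF assms] by blast
  show ?thesis
  proof (rule bdd2I)
    show "\<bar>cmean f x\<bar> \<le> B" for x by (rule cmean_bound) (rule B)
  qed measurable
qed

lemma cmean_centered: "bdd2 f \<Longrightarrow> cmean (\<lambda>x e. f x e - cmean f x) x = 0"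
  unfolding cmean_def using bdd2_integrable[of f x] nu.prob_space by simp

definition noise :: "nat \<Rightarrow> (nat \<Rightarrow> real) measure" where
  "noise n = PiM {1..n} (\<lambda>_. \<nu>)"

lemma prob_noise: "prob_space (noise n)"
  unfolding noise_def by (rule prob_space_PiM) (rule prob_nu)

text \<open>Inputs and noises are kept in separate factors, so that conditioning on all inputs is
  Fubini's theorem; ranks depend on the first factor only.\<close>

definition joint :: "nat \<Rightarrow> ((nat \<Rightarrow> real) \<times> (nat \<Rightarrow> real)) measure" where
  "joint n = sample n \<Otimes>\<^sub>M noise n"

lemma pair_prob_joint: "pair_prob_space (sample n) (noise n)"
  using prob_sample prob_noise
  by (simp add: pair_prob_space_def pair_sigma_finite_def prob_space_imp_sigma_finite)

lemma prob_joint: "prob_space (joint n)"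
proof -
  interpret pair_prob_space "sample n" "noise n" by (rule pair_prob_joint)
  show ?thesis unfolding joint_def by (rule prob_space_axioms)
qed

lemma noise_component: "i \<in> {1..n} \<Longrightarrow> (\<lambda>e. e i) \<in> borel_measurable (noise n)"
  unfolding noise_def using measurable_component_singleton[of i "{1..n}" "\<lambda>_. \<nu>"] measurable_cong_sets[OF refl sets_nu]
  by blast

lemma joint_fst: "i \<in> {1..n} \<Longrightarrow> (\<lambda>z. fst z i) \<in> borel_measurable (joint n)"
  unfolding joint_def by (rule measurable_compose[OF measurable_fst sample_component])

lemma joint_snd: "i \<in> {1..n} \<Longrightarrow> (\<lambda>z. snd z i) \<in> borel_measurable (joint n)"
  unfolding joint_def by (rule measurable_compose[OF measurable_snd noise_component])

lemma joint_nb_fst: "i \<in> {1..n} \<Longrightarrow> (\<lambda>z. fst z (right_nb n (fst z) i)) \<in> borel_measurable (joint n)"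
  by (rule measurable_at_right_nb[where F="\<lambda>j z. fst z j" and x=fst]) (simp_all add: joint_fst)

lemma joint_nb_snd: "i \<in> {1..n} \<Longrightarrow> (\<lambda>z. snd z (right_nb n (fst z) i)) \<in> borel_measurable (joint n)"
  by (rule measurable_at_right_nb[where F="\<lambda>j z. snd z j" and x=fst]) (simp_all add: joint_fst joint_snd)

lemmas joint_measurable = joint_fst joint_snd joint_nb_fst joint_nb_snd

lemma joint_sections:
  fixes F :: "(nat \<Rightarrow> real) \<Rightarrow> (nat \<Rightarrow> real) \<Rightarrow> 'b::{banach,second_countable_topology}"
  assumes F: "(\<lambda>z. F (fst z) (snd z)) \<in> borel_measurable (joint n)" and B: "\<And>x e. norm (F x e) \<le> B"
  shows "(\<integral>z. F (fst z) (snd z) \<partial>joint n) = (\<integral>x. (\<integral>e. F x e \<partial>noise n) \<partial>sample n)"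
    and "integrable (sample n) (\<lambda>x. \<integral>e. F x e \<partial>noise n)"
    and "x \<in> space (sample n) \<Longrightarrow> F x \<in> borel_measurable (noise n)"
proof -
  interpret pair_prob_space "sample n" "noise n" by (rule pair_prob_joint)
  have i: "integrable (sample n \<Otimes>\<^sub>M noise n) (\<lambda>z. F (fst z) (snd z))"
    using integrable_bdd[OF prob_joint F B] unfolding joint_def .
  show "(\<integral>z. F (fst z) (snd z) \<partial>joint n) = (\<integral>x. (\<integral>e. F x e \<partial>noise n) \<partial>sample n)"
    unfolding joint_def using integral_fst'[OF i] by simp
  show "integrable (sample n) (\<lambda>x. \<integral>e. F x e \<partial>noise n)"
    using integrable_fst'[OF i] by simp
  show "F x \<in> borel_measurable (noise n)" if "x \<in> space (sample n)"
    using measurable_compose[OF measurable_Pair1'[OF that] F[unfolded joint_def]] by simp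
qed

lemma joint_square_le:
  fixes F :: "(nat \<Rightarrow> real) \<Rightarrow> (nat \<Rightarrow> real) \<Rightarrow> real"
  assumes F: "(\<lambda>z. F (fst z) (snd z)) \<in> borel_measurable (joint n)" and B: "\<And>x e. \<bar>F x e\<bar> \<le> B"
    and b: "\<And>x. (\<integral>e. (F x e)\<^sup>2 \<partial>noise n) \<le> b x" "integrable (sample n) b"
  shows "(\<integral>z. (F (fst z) (snd z))\<^sup>2 \<partial>joint n) \<le> (\<integral>x. b x \<partial>sample n)"
proof -
  have m: "(\<lambda>z. (F (fst z) (snd z))\<^sup>2) \<in> borel_measurable (joint n)" using F by simp
  have bd: "norm ((F x e)\<^sup>2) \<le> B\<^sup>2" for x e using square_le_of_abs_le[OF B] by simp
  note s = joint_sections[of "\<lambda>x e. (F x e)\<^sup>2", OF m bd]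
  show ?thesis unfolding s(1) by (rule integral_mono[OF s(2) b(2) b(1)])
qed

lemma square_add3_le: "(a + b + c)\<^sup>2 \<le> 3 * a\<^sup>2 + 3 * b\<^sup>2 + 3 * c\<^sup>2" for a b c :: real
proof -
  have "0 \<le> (a - b)\<^sup>2 + (b - c)\<^sup>2 + (a - c)\<^sup>2" by simp
  then show ?thesis by (simp add: power2_eq_square algebra_simps)
qed

lemma square_add_le: "(a + b)\<^sup>2 \<le> 2 * a\<^sup>2 + 2 * b\<^sup>2" for a b :: real
  using sum_squares_bound[of a b] by (simp add: power2_sum)

lemma joint_sum_measurable:
  assumes "\<And>i. i \<in> {1..n} \<Longrightarrow> (\<lambda>z. t i (fst z) (snd z)) \<in> borel_measurable (joint n)"
  shows "(\<lambda>z. \<Sum>i=1..n. t i (fst z) (snd z) :: real) \<in> borel_measurable (joint n)"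
  by (intro borel_measurable_sum assms)

text \<open>Besides terms that cancel around the cycle, three errors remain: the fluctuation of half
  the squared increments, and the increments of phi weighted by the noise at either end. The first
  is controlled by \<open>variance_nb_sq\<close>; the other two are, given the inputs, sums of
  independent centred terms whose conditional variance is at most a multiple of
  \<open>nb_sq\<close>. All three have second moments of the order of the mean of
  \<open>nb_sq\<close>.\<close>

lemma neighbour_product_reduction:
  assumes f: "bdd2 f"
  defines "c \<equiv> \<lambda>x e. f x e - cmean f x" and "N \<equiv> right_nb"
  obtains C where "\<And>n::nat. (\<integral>z. ((\<Sum>i=1..n. f (fst z i) (snd z i) * f (fst z (N n (fst z) i)) (snd z (N n (fst z) i)))
      - (\<Sum>i=1..n. 2 * cmean f (fst z i) * f (fst z i) (snd z i) - (cmean f (fst z i))\<^sup>2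
           + c (fst z i) (snd z i) * c (fst z (N n (fst z) i)) (snd z (N n (fst z) i)))
      + (\<integral>x. nb_sq n (cmean f) x \<partial>sample n) / 2)\<^sup>2 \<partial>joint n) \<le> C * (\<integral>x. nb_sq n (cmean f) x \<partial>sample n)"
proof -
  obtain B where B: "\<And>x e. \<bar>f x e\<bar> \<le> B" and B0: "0 \<le> B" using bdd2_bound[OF f] by blast
  let ?\<phi> = "cmean f"
  have \<phi>B: "\<bar>?\<phi> x\<bar> \<le> B" for x by (rule cmean_bound) (rule B)
  have \<phi>2: "bdd2 (\<lambda>x e. ?\<phi> x)" by (rule bdd2_cmean[OF f])
  have \<phi>m: "?\<phi> \<in> borel_measurable borel" by (rule bdd2_fst_meas[OF \<phi>2])
  have c2: "bdd2 c" unfolding c_def by (intro bdd2_diff f \<phi>2)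
  have cB: "\<bar>c x e\<bar> \<le> 2 * B" for x e unfolding c_def using B[of x e] \<phi>B[of x] by linarith
  have c0: "(\<integral>e. c x e \<partial>\<nu>) = 0" for x
    using cmean_centered[OF f, of x] unfolding cmean_def c_def .
  have cm: "c x \<in> borel_measurable \<nu>" for x by (rule bdd2_section[OF c2])
  show thesis
  \<comment> \<open>Each of the three errors has second moment at most 4 B^2 times the mean, and
    squaring a sum of three costs a factor 3.\<close>
  proof (rule that[of "36 * B\<^sup>2"])
    fix n :: nat
    let ?I = "{1..n}"
    let ?E = "\<integral>x. nb_sq n ?\<phi> x \<partial>sample n"
    define F1 where "F1 = (\<lambda>x e::nat \<Rightarrow> real. - (nb_sq n ?\<phi> x - ?E) / 2)"
    define F2 where "F2 = (\<lambda>x (e::nat \<Rightarrow> real). \<Sum>i\<in>?I. c (x i) (e i) * (?\<phi> (x (N n x i)) - ?\<phi> (x i)))"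
    define F3 where "F3 = (\<lambda>x (e::nat \<Rightarrow> real). \<Sum>i\<in>?I. c (x (N n x i)) (e (N n x i)) * (?\<phi> (x i) - ?\<phi> (x (N n x i))))"
    have Nsum: "(\<Sum>i\<in>?I. g (N n x i)) = (\<Sum>i\<in>?I. g i)" for g :: "nat \<Rightarrow> real" and x
      unfolding N_def by (rule sum_right_nb_component)
    have decomp: "(\<Sum>i=1..n. f (x i) (e i) * f (x (N n x i)) (e (N n x i)))
      - (\<Sum>i=1..n. 2 * ?\<phi> (x i) * f (x i) (e i) - (?\<phi> (x i))\<^sup>2 + c (x i) (e i) * c (x (N n x i)) (e (N n x i)))
      + ?E / 2 = F1 x e + F2 x e + F3 x e" for x e :: "nat \<Rightarrow> real"
    proof -
      have 1: "(\<Sum>i\<in>?I. (?\<phi> (x (N n x i)))\<^sup>2) = (\<Sum>i\<in>?I. (?\<phi> (x i))\<^sup>2)" by (rule Nsum)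
      have 2: "(\<Sum>i\<in>?I. ?\<phi> (x (N n x i)) * c (x (N n x i)) (e (N n x i))) = (\<Sum>i\<in>?I. ?\<phi> (x i) * c (x i) (e i))" by (rule Nsum)
      \<comment> \<open>With f = phi + c; the last two brackets have the form u(j) - u(i) and cancel
        when summed around the cycle.\<close>
      have t: "f (x i) (e i) * f (x j) (e j) - (2 * ?\<phi> (x i) * f (x i) (e i) - (?\<phi> (x i))\<^sup>2 + c (x i) (e i) * c (x j) (e j))
        = (- ((?\<phi> (x i) - ?\<phi> (x j))\<^sup>2 / 2) + c (x i) (e i) * (?\<phi> (x j) - ?\<phi> (x i)) + c (x j) (e j) * (?\<phi> (x i) - ?\<phi> (x j)))
          + ((?\<phi> (x j))\<^sup>2 / 2 - (?\<phi> (x i))\<^sup>2 / 2) + (?\<phi> (x j) * c (x j) (e j) - ?\<phi> (x i) * c (x i) (e i))" for i j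
        unfolding c_def by (simp add: power2_eq_square field_simps)
      have "(\<Sum>i\<in>?I. f (x i) (e i) * f (x (N n x i)) (e (N n x i)))
        - (\<Sum>i\<in>?I. 2 * ?\<phi> (x i) * f (x i) (e i) - (?\<phi> (x i))\<^sup>2 + c (x i) (e i) * c (x (N n x i)) (e (N n x i)))
        = (\<Sum>i\<in>?I. (- ((?\<phi> (x i) - ?\<phi> (x (N n x i)))\<^sup>2 / 2) + c (x i) (e i) * (?\<phi> (x (N n x i)) - ?\<phi> (x i))
            + c (x (N n x i)) (e (N n x i)) * (?\<phi> (x i) - ?\<phi> (x (N n x i))))
          + ((?\<phi> (x (N n x i)))\<^sup>2 / 2 - (?\<phi> (x i))\<^sup>2 / 2)
          + (?\<phi> (x (N n x i)) * c (x (N n x i)) (e (N n x i)) - ?\<phi> (x i) * c (x i) (e i)))"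
        unfolding sum_subtractf[symmetric] by (rule sum.cong[OF refl]) (rule t)
      also have "\<dots> = - (nb_sq n ?\<phi> x / 2) + F2 x e + F3 x e"
        unfolding nb_sq_def F2_def F3_def N_def[symmetric]
        by (simp only: sum.distrib sum_negf sum_divide_distrib[symmetric] sum_subtractf[of "\<lambda>i. (?\<phi> (x (N n x i)))\<^sup>2 / 2"]
              sum_subtractf[of "\<lambda>i. ?\<phi> (x (N n x i)) * c (x (N n x i)) (e (N n x i))"] 1 2)
      finally show ?thesis unfolding F1_def by (simp only:) (simp add: diff_divide_distrib)
    qed
    have m2: "(\<lambda>z. F2 (fst z) (snd z)) \<in> borel_measurable (joint n)" unfolding F2_def N_def
      by (intro joint_sum_measurable borel_measurable_times borel_measurable_diff bdd2_meas[OF c2] measurable_compose[OF _ \<phi>m] joint_measurable)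
    have m3: "(\<lambda>z. F3 (fst z) (snd z)) \<in> borel_measurable (joint n)" unfolding F3_def N_def
      by (intro joint_sum_measurable borel_measurable_times borel_measurable_diff bdd2_meas[OF c2] measurable_compose[OF _ \<phi>m] joint_measurable)
    have m1: "(\<lambda>z. F1 (fst z) (snd z)) \<in> borel_measurable (joint n)"
      unfolding F1_def joint_def
      using measurable_compose[OF measurable_fst nb_sq_measurable[OF \<phi>m], of n "noise n"] by measurable
    have d: "\<bar>?\<phi> a - ?\<phi> b\<bar> \<le> 2 * B" for a b using \<phi>B[of a] \<phi>B[of b] by linarith
    have tb: "\<bar>c a e * (?\<phi> b - ?\<phi> b')\<bar> \<le> 2 * B * (2 * B)" for a e b b'
      unfolding abs_mult by (intro mult_mono cB d) (use B0 in auto)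
    have F23: "\<bar>F2 x e\<bar> \<le> real (card ?I) * (2 * B * (2 * B))" "\<bar>F3 x e\<bar> \<le> real (card ?I) * (2 * B * (2 * B))" for x e
      unfolding F2_def F3_def by (intro sum_abs_bound tb)+
    have E0: "0 \<le> ?E" by (intro Bochner_Integration.integral_nonneg nb_sq_nonneg)
    have inb: "integrable (sample n) (nb_sq n ?\<phi>)" by (rule integrable_nb_sq[OF \<phi>m \<phi>B])
    have tsq: "(\<Sum>i\<in>?I. \<integral>a. (c (y i) a * (?\<phi> (u i) - ?\<phi> (w i)))\<^sup>2 \<partial>\<nu>) \<le> (\<Sum>i\<in>?I. (2 * B)\<^sup>2 * (?\<phi> (u i) - ?\<phi> (w i))\<^sup>2)" for y u w
    proof (rule sum_mono)
      fix i
      have "norm (\<integral>a. (c (y i) a * (?\<phi> (u i) - ?\<phi> (w i)))\<^sup>2 \<partial>\<nu>) \<le> (2 * B)\<^sup>2 * (?\<phi> (u i) - ?\<phi> (w i))\<^sup>2"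
        by (rule integral_abs_le[OF prob_nu])
          (unfold power_mult_distrib[of "c _ _"] real_norm_def abs_mult abs_power2, intro mult_right_mono square_le_of_abs_le cB, simp)
      then show "(\<integral>a. (c (y i) a * (?\<phi> (u i) - ?\<phi> (w i)))\<^sup>2 \<partial>\<nu>) \<le> (2 * B)\<^sup>2 * (?\<phi> (u i) - ?\<phi> (w i))\<^sup>2" by simp
    qed
    have tm: "(\<lambda>a. c y a * r) \<in> borel_measurable \<nu>" "(\<integral>a. c y a * r \<partial>\<nu>) = 0" for y r
      using cm[of y] c0[of y] by simp_all
    have F2a: "(\<integral>e. (F2 x e)\<^sup>2 \<partial>noise n) \<le> (\<Sum>i\<in>?I. \<integral>a. (c (x i) a * (?\<phi> (x (N n x i)) - ?\<phi> (x i)))\<^sup>2 \<partial>\<nu>)" for x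
      unfolding F2_def noise_def
      by (rule second_moment_additive[OF prob_nu, where B="2 * B * (2 * B)" and g="\<lambda>i a. c (x i) a * (?\<phi> (x (N n x i)) - ?\<phi> (x i))"])
        (rule finite_atLeastAtMost tm tb)+
    have F2s: "(\<integral>e. (F2 x e)\<^sup>2 \<partial>noise n) \<le> (2 * B)\<^sup>2 * nb_sq n ?\<phi> x" for x
    proof -
      note F2a[of x]
      also note tsq[of x "\<lambda>i. x (N n x i)" x]
      also have "(\<Sum>i\<in>?I. (2 * B)\<^sup>2 * (?\<phi> (x (N n x i)) - ?\<phi> (x i))\<^sup>2) = (2 * B)\<^sup>2 * nb_sq n ?\<phi> x"
        unfolding nb_sq_def N_def[symmetric] sum_distrib_left
        by (intro sum.cong refl arg_cong[where f="\<lambda>r. (2 * B)\<^sup>2 * r"] power2_commute)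
      finally show ?thesis .
    qed
    have F3a: "(\<integral>e. (F3 x e)\<^sup>2 \<partial>noise n) \<le> (\<Sum>i\<in>?I. \<integral>a. (c (x (N n x i)) a * (?\<phi> (x i) - ?\<phi> (x (N n x i))))\<^sup>2 \<partial>\<nu>)" for x
      unfolding F3_def noise_def
      by (rule second_moment_additive_perm[OF prob_nu, where B="2 * B * (2 * B)" and \<pi>="N n x" and g="\<lambda>i a. c (x (N n x i)) a * (?\<phi> (x i) - ?\<phi> (x (N n x i)))"])
        (unfold N_def, (rule finite_atLeastAtMost tm tb right_nb_bij)+)
    have F3s: "(\<integral>e. (F3 x e)\<^sup>2 \<partial>noise n) \<le> (2 * B)\<^sup>2 * nb_sq n ?\<phi> x" for x
    proof -
      note F3a[of x]
      also note tsq[of "\<lambda>i. x (N n x i)" x "\<lambda>i. x (N n x i)"]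
      also have "(\<Sum>i\<in>?I. (2 * B)\<^sup>2 * (?\<phi> (x i) - ?\<phi> (x (N n x i)))\<^sup>2) = (2 * B)\<^sup>2 * nb_sq n ?\<phi> x"
        unfolding nb_sq_def N_def[symmetric] sum_distrib_left ..
      finally show ?thesis .
    qed
    have i4: "integrable (sample n) (\<lambda>x. (2 * B)\<^sup>2 * nb_sq n ?\<phi> x)" using inb by simp
    have S2: "(\<integral>z. (F2 (fst z) (snd z))\<^sup>2 \<partial>joint n) \<le> (2 * B)\<^sup>2 * ?E"
      using joint_square_le[OF m2 F23(1) F2s i4] by simp
    have S3: "(\<integral>z. (F3 (fst z) (snd z))\<^sup>2 \<partial>joint n) \<le> (2 * B)\<^sup>2 * ?E"
      using joint_square_le[OF m3 F23(2) F3s i4] by simp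
    have F1B: "\<bar>F1 x e\<bar> \<le> real n * (2 * B)\<^sup>2" for x e
    proof -
      have "nb_sq n ?\<phi> x \<le> real n * (2 * B)\<^sup>2" "0 \<le> nb_sq n ?\<phi> x" by (rule nb_sq_bound[OF \<phi>B], rule nb_sq_nonneg)
      moreover have "?E \<le> real n * (2 * B)\<^sup>2"
      proof -
        have "norm ?E \<le> real n * (2 * B)\<^sup>2"
          by (rule integral_abs_le[OF prob_sample]) (use nb_sq_bound[OF \<phi>B] nb_sq_nonneg in simp)
        then show ?thesis by simp
      qed
      moreover have "\<bar>- (a - b) / 2\<bar> \<le> m" if "0 \<le> a" "a \<le> m" "0 \<le> b" "b \<le> m" for a b m :: real
        using that unfolding abs_le_iff by (auto simp: field_simps)
      ultimately show ?thesis unfolding F1_def using E0 by blast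
    qed
    have S1: "(\<integral>z. (F1 (fst z) (snd z))\<^sup>2 \<partial>joint n) \<le> 4 * B\<^sup>2 * ?E"
    proof -
      have m1': "(\<lambda>z. (F1 (fst z) (snd z))\<^sup>2) \<in> borel_measurable (joint n)" using m1 by simp
      have bd: "norm ((F1 x e)\<^sup>2) \<le> (real n * (2 * B)\<^sup>2)\<^sup>2" for x e using square_le_of_abs_le[OF F1B] by simp
      interpret W: prob_space "noise n" by (rule prob_noise)
      have "(\<integral>z. (F1 (fst z) (snd z))\<^sup>2 \<partial>joint n) = (\<integral>x. (nb_sq n ?\<phi> x - ?E)\<^sup>2 / 4 \<partial>sample n)"
      proof -
        have sq: "(F1 x e)\<^sup>2 = (nb_sq n ?\<phi> x - ?E)\<^sup>2 / 4" for x e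
          unfolding F1_def power_divide power2_minus by simp
        note joint_sections(1)[of "\<lambda>x e. (F1 x e)\<^sup>2", OF m1' bd]
        also have "(\<integral>x. (\<integral>e. (F1 x e)\<^sup>2 \<partial>noise n) \<partial>sample n) = (\<integral>x. (nb_sq n ?\<phi> x - ?E)\<^sup>2 / 4 \<partial>sample n)"
          unfolding sq by (simp add: W.prob_space)
        finally show ?thesis .
      qed
      also have "\<dots> = (\<integral>x. (nb_sq n ?\<phi> x - ?E)\<^sup>2 \<partial>sample n) / 4" by simp
      also have "\<dots> \<le> 4 * B\<^sup>2 * ?E" using variance_nb_sq[OF \<phi>m \<phi>B, of n] by simp
      finally show ?thesis .
    qed
    have iF: "integrable (joint n) (\<lambda>z. (F1 (fst z) (snd z))\<^sup>2)" "integrable (joint n) (\<lambda>z. (F2 (fst z) (snd z))\<^sup>2)"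
      "integrable (joint n) (\<lambda>z. (F3 (fst z) (snd z))\<^sup>2)"
      using m1 m2 m3 square_le_of_abs_le[OF F1B] square_le_of_abs_le[OF F23(1)] square_le_of_abs_le[OF F23(2)]
      by (auto intro!: integrable_bdd[OF prob_joint])
    have "(\<integral>z. (F1 (fst z) (snd z) + F2 (fst z) (snd z) + F3 (fst z) (snd z))\<^sup>2 \<partial>joint n)
      \<le> (\<integral>z. 3 * (F1 (fst z) (snd z))\<^sup>2 + 3 * (F2 (fst z) (snd z))\<^sup>2 + 3 * (F3 (fst z) (snd z))\<^sup>2 \<partial>joint n)"
    proof (rule integral_mono[OF _ _ square_add3_le])
      have "\<bar>F1 x e + F2 x e + F3 x e\<bar> \<le> real n * (2 * B)\<^sup>2 + real (card ?I) * (2 * B * (2 * B)) + real (card ?I) * (2 * B * (2 * B))" for x e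
        using F1B[of x e] F23[of x e] by linarith
      from square_le_of_abs_le[OF this] show "integrable (joint n) (\<lambda>z. (F1 (fst z) (snd z) + F2 (fst z) (snd z) + F3 (fst z) (snd z))\<^sup>2)"
        using m1 m2 m3 by (auto intro!: integrable_bdd[OF prob_joint])
    qed (use iF in simp)
    also have "\<dots> \<le> 36 * B\<^sup>2 * ?E" using iF S1 S2 S3 by (simp add: power_mult_distrib)
    finally show "(\<integral>z. ((\<Sum>i=1..n. f (fst z i) (snd z i) * f (fst z (N n (fst z) i)) (snd z (N n (fst z) i)))
      - (\<Sum>i=1..n. 2 * cmean f (fst z i) * f (fst z i) (snd z i) - (cmean f (fst z i))\<^sup>2
           + c (fst z i) (snd z i) * c (fst z (N n (fst z) i)) (snd z (N n (fst z) i)))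
      + ?E / 2)\<^sup>2 \<partial>joint n) \<le> 36 * B\<^sup>2 * ?E"
      unfolding decomp .
  qed
qed

end

section \<open>The linearised statistic\<close>

lemma sum_sq_le: "finite I \<Longrightarrow> (\<Sum>i\<in>I. a i)\<^sup>2 \<le> real (card I) * (\<Sum>i\<in>I. (a i)\<^sup>2)" for a :: "'i \<Rightarrow> real"
  using Cauchy_Schwarz_ineq_sum[of a "\<lambda>_. 1" I] by (simp add: mult.commute)

lemma integral_PiM_permute:
  fixes F :: "('i \<Rightarrow> 'a) \<Rightarrow> 'b::{banach,second_countable_topology}"
  assumes "prob_space \<nu>" "\<sigma> permutes I" "F \<in> borel_measurable (PiM I (\<lambda>_. \<nu>))"
  shows "(\<integral>e. F (\<lambda>i\<in>I. e (\<sigma> i)) \<partial>PiM I (\<lambda>_. \<nu>)) = (\<integral>e. F e \<partial>PiM I (\<lambda>_. \<nu>))"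
proof -
  let ?P = "PiM I (\<lambda>_. \<nu>)"
  have \<sigma>I: "i \<in> I \<Longrightarrow> \<sigma> i \<in> I" for i using permutes_in_image[OF assms(2)] by blast
  have d: "distr ?P ?P (\<lambda>e. \<lambda>i\<in>I. e (\<sigma> i)) = ?P"
    by (rule distr_PiM_reindex[of I "\<lambda>_. \<nu>" \<sigma> I])
      (use assms \<sigma>I permutes_inj_on[OF assms(2)] in auto)
  have m: "(\<lambda>e. \<lambda>i\<in>I. e (\<sigma> i)) \<in> measurable ?P ?P"
    by (intro measurable_restrict measurable_component_singleton \<sigma>I)
  have "(\<integral>e. F e \<partial>?P) = (\<integral>e. F e \<partial>distr ?P ?P (\<lambda>e. \<lambda>i\<in>I. e (\<sigma> i)))" unfolding d ..
  also have "\<dots> = (\<integral>e. F (\<lambda>i\<in>I. e (\<sigma> i)) \<partial>?P)" by (rule integral_distr[OF m assms(3)])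
  finally show ?thesis by simp
qed

text \<open>Meant for a single factor outside the chain, the edge that closes the cycle or one
  leftover observation: with \<open>s\<close> of order 1 / n and \<open>\<theta>\<close> of order 1
  / sqrt n, it is close to 1.\<close>

lemma exp_wrap_bound:
  assumes "0 \<le> s" "s \<le> S"
  shows "cmod (exp (\<i> * complex_of_real \<theta> + complex_of_real s) - 1) \<le> S * exp S + \<bar>\<theta>\<bar>"
proof -
  have e: "exp (\<i> * complex_of_real \<theta> + complex_of_real s) - 1
    = exp (\<i> * complex_of_real \<theta>) * complex_of_real (exp s - 1) + (exp (\<i> * complex_of_real \<theta>) - exp (\<i> * complex_of_real 0))"
    by (simp add: exp_add algebra_simps exp_of_real)
  have "exp s - 1 \<le> s * exp s"
  proof -
    have "1 - s \<le> exp (- s)" using exp_ge_add_one_self[of "- s"] by simp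
    then have "(1 - s) * exp s \<le> exp (- s) * exp s" by (rule mult_right_mono) simp
    then show ?thesis by (simp add: exp_minus algebra_simps)
  qed
  also have "\<dots> \<le> S * exp S" using assms by (intro mult_mono) auto
  finally have "\<bar>exp s - 1\<bar> \<le> S * exp S" using assms by simp
  moreover have "cmod (exp (\<i> * complex_of_real \<theta>) - exp (\<i> * complex_of_real 0)) \<le> \<bar>\<theta>\<bar>"
    using exp_i_lipschitz[of \<theta> 0] by simp
  ultimately show ?thesis unfolding e
    by (intro order_trans[OF norm_triangle_ineq] add_mono) (simp_all add: norm_mult del: of_real_diff)
qed

lemma exp_diff_le:
  fixes a b S :: real
  assumes "0 \<le> a" "a \<le> S" "0 \<le> b" "b \<le> S"
  shows "\<bar>exp a - exp b\<bar> \<le> exp S * \<bar>a - b\<bar>"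
proof -
  have *: "exp v - exp u \<le> exp S * (v - u)" if "u \<le> v" "v \<le> S" for u v :: real
  proof -
    have "1 + (u - v) \<le> exp (u - v)" by (rule exp_ge_add_one_self)
    then have "exp v * (1 + (u - v)) \<le> exp v * exp (u - v)" by (rule mult_left_mono) simp
    then have "exp v - exp u \<le> exp v * (v - u)" by (simp add: exp_diff algebra_simps)
    also have "\<dots> \<le> exp S * (v - u)" using that by (intro mult_right_mono) auto
    finally show ?thesis .
  qed
  show ?thesis using *[of a b] *[of b a] assms by (cases "a \<le> b") auto
qed

context rank_model
begin

lemma fst_nu: "fst \<in> borel_measurable (\<nu> \<Otimes>\<^sub>M \<nu>)"
  using measurable_fst[of \<nu> \<nu>] measurable_cong_sets[OF refl sets_nu] by blast

lemma snd_nu: "snd \<in> borel_measurable (\<nu> \<Otimes>\<^sub>M \<nu>)"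
  using measurable_snd[of \<nu> \<nu>] measurable_cong_sets[OF refl sets_nu] by blast

text \<open>The space \<open>joint n\<close> varies with \<open>n\<close>, so this is not
  convergence in one L2 space. A uniform bound is built in so that sums and multiples are integrable
  at once.\<close>

definition L2conv :: "(nat \<Rightarrow> (nat \<Rightarrow> real) \<times> (nat \<Rightarrow> real) \<Rightarrow> real) \<Rightarrow> real \<Rightarrow> bool" where
  "L2conv F m \<longleftrightarrow> (\<forall>n. F n \<in> borel_measurable (joint n)) \<and> (\<exists>B. \<forall>n z. \<bar>F n z\<bar> \<le> B)
     \<and> (\<lambda>n. \<integral>z. (F n z - m)\<^sup>2 \<partial>joint n) \<longlonglongrightarrow> 0"

lemma L2convI:
  assumes "\<And>n. F n \<in> borel_measurable (joint n)" "\<And>n z. \<bar>F n z\<bar> \<le> B"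
    "(\<lambda>n. \<integral>z. (F n z - m)\<^sup>2 \<partial>joint n) \<longlonglongrightarrow> 0"
  shows "L2conv F m"
  unfolding L2conv_def using assms by blast

lemma L2conv_const: "L2conv (\<lambda>n z. c) c"
  by (rule L2convI[where B="\<bar>c\<bar>"]) auto

lemma square_integrable_joint:
  fixes F :: "_ \<Rightarrow> real"
  assumes "F \<in> borel_measurable (joint n)" "\<And>z. \<bar>F z\<bar> \<le> B"
  shows "integrable (joint n) (\<lambda>z. (F z)\<^sup>2)"
proof (rule integrable_bdd[OF prob_joint, where B="B\<^sup>2"])
  show "(\<lambda>z. (F z)\<^sup>2) \<in> borel_measurable (joint n)" by (intro borel_measurable_power assms)
  show "norm ((F z)\<^sup>2) \<le> B\<^sup>2" for z using square_le_of_abs_le[OF assms(2)] by simp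
qed

lemma integral_sq_add_le:
  fixes F G :: "_ \<Rightarrow> real"
  assumes "F \<in> borel_measurable (joint n)" "\<And>z. \<bar>F z\<bar> \<le> B" "G \<in> borel_measurable (joint n)" "\<And>z. \<bar>G z\<bar> \<le> C"
  shows "(\<integral>z. (F z + G z)\<^sup>2 \<partial>joint n) \<le> 2 * (\<integral>z. (F z)\<^sup>2 \<partial>joint n) + 2 * (\<integral>z. (G z)\<^sup>2 \<partial>joint n)"
proof -
  have i: "integrable (joint n) (\<lambda>z. (F z)\<^sup>2)" "integrable (joint n) (\<lambda>z. (G z)\<^sup>2)"
    by (rule square_integrable_joint[OF assms(1,2)], rule square_integrable_joint[OF assms(3,4)])
  have "(\<integral>z. (F z + G z)\<^sup>2 \<partial>joint n) \<le> (\<integral>z. 2 * (F z)\<^sup>2 + 2 * (G z)\<^sup>2 \<partial>joint n)"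
  proof (rule integral_mono[OF _ _ square_add_le])
    show "integrable (joint n) (\<lambda>z. (F z + G z)\<^sup>2)"
    proof (rule square_integrable_joint)
      show "\<bar>F z + G z\<bar> \<le> B + C" for z using assms(2)[of z] assms(4)[of z] by linarith
    qed (intro borel_measurable_add assms)
  qed (use i in simp)
  also have "\<dots> = 2 * (\<integral>z. (F z)\<^sup>2 \<partial>joint n) + 2 * (\<integral>z. (G z)\<^sup>2 \<partial>joint n)" using i by simp
  finally show ?thesis .
qed

lemma L2conv_add:
  assumes "L2conv F a" "L2conv G b"
  shows "L2conv (\<lambda>n z. F n z + G n z) (a + b)"
proof -
  obtain B where F: "\<And>n. F n \<in> borel_measurable (joint n)" "\<And>n z. \<bar>F n z\<bar> \<le> B" "(\<lambda>n. \<integral>z. (F n z - a)\<^sup>2 \<partial>joint n) \<longlonglongrightarrow> 0"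
    using assms(1) unfolding L2conv_def by blast
  obtain C where G: "\<And>n. G n \<in> borel_measurable (joint n)" "\<And>n z. \<bar>G n z\<bar> \<le> C" "(\<lambda>n. \<integral>z. (G n z - b)\<^sup>2 \<partial>joint n) \<longlonglongrightarrow> 0"
    using assms(2) unfolding L2conv_def by blast
  show ?thesis
  proof (rule L2convI)
    show "\<bar>F n z + G n z\<bar> \<le> B + C" for n z using F(2)[of n z] G(2)[of n z] by linarith
    show "(\<lambda>z. F n z + G n z) \<in> borel_measurable (joint n)" for n by (intro borel_measurable_add F G)
    show "(\<lambda>n. \<integral>z. (F n z + G n z - (a + b))\<^sup>2 \<partial>joint n) \<longlonglongrightarrow> 0"
    proof (rule tendsto_sandwich[OF _ _ tendsto_const])
      show "\<forall>\<^sub>F n in sequentially. 0 \<le> (\<integral>z. (F n z + G n z - (a + b))\<^sup>2 \<partial>joint n)" by simp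
      show "\<forall>\<^sub>F n in sequentially. (\<integral>z. (F n z + G n z - (a + b))\<^sup>2 \<partial>joint n)
        \<le> 2 * (\<integral>z. (F n z - a)\<^sup>2 \<partial>joint n) + 2 * (\<integral>z. (G n z - b)\<^sup>2 \<partial>joint n)"
      proof (rule always_eventually, rule allI)
        fix n
        have "(\<integral>z. ((F n z - a) + (G n z - b))\<^sup>2 \<partial>joint n) \<le> 2 * (\<integral>z. (F n z - a)\<^sup>2 \<partial>joint n) + 2 * (\<integral>z. (G n z - b)\<^sup>2 \<partial>joint n)"
        proof (rule integral_sq_add_le)
          show "\<bar>F n z - a\<bar> \<le> B + \<bar>a\<bar>" for z using F(2)[of n z] by linarith
          show "\<bar>G n z - b\<bar> \<le> C + \<bar>b\<bar>" for z using G(2)[of n z] by linarith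
        qed (intro borel_measurable_diff F G borel_measurable_const)+
        moreover have "F n z + G n z - (a + b) = (F n z - a) + (G n z - b)" for z by simp
        ultimately show "(\<integral>z. (F n z + G n z - (a + b))\<^sup>2 \<partial>joint n)
          \<le> 2 * (\<integral>z. (F n z - a)\<^sup>2 \<partial>joint n) + 2 * (\<integral>z. (G n z - b)\<^sup>2 \<partial>joint n)" by (simp only:)
      qed
      show "(\<lambda>n. 2 * (\<integral>z. (F n z - a)\<^sup>2 \<partial>joint n) + 2 * (\<integral>z. (G n z - b)\<^sup>2 \<partial>joint n)) \<longlonglongrightarrow> 0"
        using tendsto_add[OF tendsto_mult_left[OF F(3), of 2] tendsto_mult_left[OF G(3), of 2]] by simp
    qed
  qed
qed

lemma L2conv_scale:
  assumes "L2conv F a" shows "L2conv (\<lambda>n z. c * F n z) (c * a)"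
proof -
  obtain B where F: "\<And>n. F n \<in> borel_measurable (joint n)" "\<And>n z. \<bar>F n z\<bar> \<le> B" "(\<lambda>n. \<integral>z. (F n z - a)\<^sup>2 \<partial>joint n) \<longlonglongrightarrow> 0"
    using assms(1) unfolding L2conv_def by blast
  show ?thesis
  proof (rule L2convI)
    show "\<bar>c * F n z\<bar> \<le> \<bar>c\<bar> * B" for n z unfolding abs_mult by (intro mult_left_mono F) simp
    show "(\<lambda>z. c * F n z) \<in> borel_measurable (joint n)" for n by (intro borel_measurable_times F borel_measurable_const)
    have "(\<integral>z. (c * F n z - c * a)\<^sup>2 \<partial>joint n) = c\<^sup>2 * (\<integral>z. (F n z - a)\<^sup>2 \<partial>joint n)" for n
      by (simp add: power_mult_distrib flip: right_diff_distrib)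
    then show "(\<lambda>n. \<integral>z. (c * F n z - c * a)\<^sup>2 \<partial>joint n) \<longlonglongrightarrow> 0"
      using tendsto_mult_left[OF F(3), of "c\<^sup>2"] by simp
  qed
qed

lemma L2conv_sum:
  assumes "finite K" "\<And>k. k \<in> K \<Longrightarrow> L2conv (F k) (a k)"
  shows "L2conv (\<lambda>n z. \<Sum>k\<in>K. F k n z) (\<Sum>k\<in>K. a k)"
  using assms
proof (induction K rule: finite_induct)
  case empty then show ?case using L2conv_const[of 0] by simp
next
  case (insert k K)
  have "L2conv (\<lambda>n z. F k n z + (\<Sum>k\<in>K. F k n z)) (a k + (\<Sum>k\<in>K. a k))"
    by (rule L2conv_add) (use insert in blast)+
  then show ?case using insert.hyps by simp
qed

end

text \<open>One setting for all sums: an additive part \<open>\<zeta>\<close> of mean 0 and weighted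
  products of neighbouring centred noises. An empty \<open>K\<close> gives plain sums, a singleton
  one estimator, and the index type of the components all linear combinations of estimators.\<close>

locale clt_setup = rank_model +
  fixes K :: "'k set" and \<alpha> :: "'k \<Rightarrow> real" and c :: "'k \<Rightarrow> real \<Rightarrow> real \<Rightarrow> real" and \<zeta> :: "real \<Rightarrow> real \<Rightarrow> real"
  assumes finite_K: "finite K" and c: "\<And>k. bdd2 (c k)" and c0: "\<And>k x. cmean (c k) x = 0"
    and \<zeta>: "bdd2 \<zeta>" and \<zeta>0: "(\<integral>x. cmean \<zeta> x \<partial>\<mu>) = 0"
begin

definition lin :: "nat \<Rightarrow> (nat \<Rightarrow> real) \<Rightarrow> (nat \<Rightarrow> real) \<Rightarrow> real" where
  "lin n x e = (\<Sum>i=1..n. \<zeta> (x i) (e i) + (\<Sum>k\<in>K. \<alpha> k * (c k (x i) (e i) * c k (x (right_nb n x i)) (e (right_nb n x i)))))"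

definition \<eta> :: "real \<Rightarrow> real \<Rightarrow> real" where "\<eta> x e = \<zeta> x e - cmean \<zeta> x"

definition pt :: "real \<Rightarrow> real \<Rightarrow> real \<Rightarrow> real \<Rightarrow> real" where
  "pt x a x' a' = (\<Sum>k\<in>K. \<alpha> k * (c k x a * c k x' a'))"

lemma \<eta>2: "bdd2 \<eta>" unfolding \<eta>_def by (intro bdd2_diff \<zeta> bdd2_cmean)
lemma \<eta>0: "cmean \<eta> x = 0" unfolding \<eta>_def by (rule cmean_centered[OF \<zeta>])
lemma \<psi>2: "bdd2 (\<lambda>x e. cmean \<zeta> x)" by (rule bdd2_cmean[OF \<zeta>])
lemma \<psi>m: "cmean \<zeta> \<in> borel_measurable borel" by (rule bdd2_fst_meas[OF \<psi>2])

lemma pt_meas: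
  assumes "u \<in> borel_measurable N" "a \<in> borel_measurable N" "u' \<in> borel_measurable N" "a' \<in> borel_measurable N"
  shows "(\<lambda>\<omega>. pt (u \<omega>) (a \<omega>) (u' \<omega>) (a' \<omega>)) \<in> borel_measurable N"
  unfolding pt_def by (intro borel_measurable_sum borel_measurable_times borel_measurable_const bdd2_meas[OF c] assms)

lemma pt_bound: "\<exists>B\<ge>0. \<forall>x a x' a'. \<bar>pt x a x' a'\<bar> \<le> B"
proof -
  have "\<exists>B. \<forall>k. 0 \<le> B k \<and> (\<forall>x e. \<bar>c k x e\<bar> \<le> B k)" using bdd2_bound[OF c] by (intro choice) blast
  then obtain B where B: "\<And>k. 0 \<le> B k" "\<And>k x e. \<bar>c k x e\<bar> \<le> B k" by blast
  have "\<bar>pt x a x' a'\<bar> \<le> (\<Sum>k\<in>K. \<bar>\<alpha> k\<bar> * (B k * B k))" for x a x' a'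
    unfolding pt_def
    by (rule order_trans[OF sum_abs], rule sum_mono, unfold abs_mult, intro mult_left_mono mult_mono B) (simp_all add: B)
  moreover have "0 \<le> (\<Sum>k\<in>K. \<bar>\<alpha> k\<bar> * (B k * B k))" by (intro sum_nonneg mult_nonneg_nonneg B) simp
  ultimately show ?thesis by blast
qed

lemma lin_alt: "lin n x e = (\<Sum>i=1..n. cmean \<zeta> (x i)) + (\<Sum>i=1..n. \<eta> (x i) (e i) + pt (x i) (e i) (x (right_nb n x i)) (e (right_nb n x i)))"
  unfolding lin_def \<eta>_def pt_def sum.distrib[symmetric] by (rule sum.cong) auto

lemma lin_measurable: "(\<lambda>z. lin n (fst z) (snd z)) \<in> borel_measurable (joint n)"
  unfolding lin_alt
  by (intro borel_measurable_add borel_measurable_sum bdd2_meas[OF \<eta>2] pt_meas measurable_compose[OF _ \<psi>m] joint_measurable)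

lemma lin_bound: "\<exists>B\<ge>0. \<forall>n x e. \<bar>lin n x e\<bar> \<le> real n * B"
proof -
  obtain B where B: "0 \<le> B" "\<And>x e. \<bar>\<zeta> x e\<bar> \<le> B" using bdd2_bound[OF \<zeta>] by blast
  obtain C where C: "0 \<le> C" "\<And>x a x' a'. \<bar>pt x a x' a'\<bar> \<le> C" using pt_bound by blast
  have "\<bar>\<zeta> (x i) (e i) + pt (x i) (e i) (x j) (e j)\<bar> \<le> B + C" for x e :: "nat \<Rightarrow> real" and i j
    using B(2)[of "x i" "e i"] C(2)[of "x i" "e i" "x j" "e j"] by linarith
  then have "\<bar>lin n x e\<bar> \<le> real (card {1..n}) * (B + C)" for n x e
    unfolding lin_def pt_def[symmetric] by (intro sum_abs_bound)
  then have "\<forall>n x e. \<bar>lin n x e\<bar> \<le> real n * (B + C)" by simp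
  moreover have "0 \<le> B + C" using B(1) C(1) by simp
  ultimately show ?thesis by blast
qed

lemma noise_pair_mean_zero:
  assumes "i \<in> {1..n}" "j \<in> {1..n}" "i \<noteq> j"
  shows "(\<integral>e. \<eta> x (e i) + pt x (e i) x' (e j) \<partial>noise n) = 0"
proof -
  obtain Be where Be: "\<And>x e. \<bar>\<eta> x e\<bar> \<le> Be" using bdd2_bound[OF \<eta>2] by blast
  have i1: "integrable (noise n) (\<lambda>e. \<eta> x (e i))"
    by (rule integrable_bdd[OF prob_noise, where B=Be])
      (intro bdd2_meas[OF \<eta>2] borel_measurable_const noise_component assms, simp only: real_norm_def Be)
  have ck: "integrable (noise n) (\<lambda>e. \<alpha> k * (c k x (e i) * c k x' (e j)))"
    "(\<integral>e. \<alpha> k * (c k x (e i) * c k x' (e j)) \<partial>noise n) = 0" for k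
  proof -
    obtain B where B: "0 \<le> B" "\<And>x e. \<bar>c k x e\<bar> \<le> B" using bdd2_bound[OF c[of k]] by blast
    have "integrable (noise n) (\<lambda>e. c k x (e i) * c k x' (e j))"
    proof (rule integrable_bdd[OF prob_noise, where B="B * B"])
      show "(\<lambda>e. c k x (e i) * c k x' (e j)) \<in> borel_measurable (noise n)"
        by (intro borel_measurable_times bdd2_meas[OF c] borel_measurable_const noise_component assms)
      show "norm (c k x (e i) * c k x' (e j)) \<le> B * B" for e
        unfolding real_norm_def abs_mult by (intro mult_mono B) simp
    qed
    then show "integrable (noise n) (\<lambda>e. \<alpha> k * (c k x (e i) * c k x' (e j)))" by simp
    have "(\<integral>e. c k x (e i) * c k x' (e j) \<partial>noise n) = 0" unfolding noise_def
      by (rule integral_PiM_cross[OF prob_nu _ assms bdd2_section[OF c] bdd2_section[OF c] B(2) B(2)])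
        (simp, rule c0[unfolded cmean_def])
    then show "(\<integral>e. \<alpha> k * (c k x (e i) * c k x' (e j)) \<partial>noise n) = 0" by simp
  qed
  have "(\<integral>e. \<eta> x (e i) \<partial>noise n) = 0"
    unfolding noise_def integral_PiM_component[OF prob_nu assms(1) bdd2_section[OF \<eta>2]] by (rule \<eta>0[unfolded cmean_def])
  moreover have "(\<integral>e. pt x (e i) x' (e j) \<partial>noise n) = 0"
    unfolding pt_def by (subst Bochner_Integration.integral_sum) (simp_all only: ck sum.neutral_const)
  moreover have "integrable (noise n) (\<lambda>e. pt x (e i) x' (e j))"
    unfolding pt_def by (intro Bochner_Integration.integrable_sum ck)
  ultimately show ?thesis using i1 by simp
qed

text \<open>The conditional means form an i.i.d. centred sum. The rest is centred given the inputs
  and local along the cycle, so its conditional variance is of order n by the deletion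
  bound.\<close>

lemma lin_second_moment:
  "\<exists>C. \<forall>n. (\<integral>z. (lin n (fst z) (snd z))\<^sup>2 \<partial>joint n) \<le> C * real n"
proof -
  obtain L where L: "0 \<le> L" "\<And>n x e. \<bar>lin n x e\<bar> \<le> real n * L" using lin_bound by blast
  obtain Be where Be: "0 \<le> Be" "\<And>x e. \<bar>\<eta> x e\<bar> \<le> Be" using bdd2_bound[OF \<eta>2] by blast
  obtain Bp where Bp: "0 \<le> Bp" "\<And>x a x' a'. \<bar>pt x a x' a'\<bar> \<le> Bp" using pt_bound by blast
  obtain Bz where Bz: "0 \<le> Bz" "\<And>x e::real. \<bar>cmean \<zeta> x\<bar> \<le> Bz" using bdd2_bound[OF \<psi>2] by blast
  define B where "B = Be + Bp"
  define C where "C = L\<^sup>2 + 2 * Bz\<^sup>2 + 2 * (2 * B)\<^sup>2"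
  have "(\<integral>z. (lin n (fst z) (snd z))\<^sup>2 \<partial>joint n) \<le> C * real n" for n
  proof (cases "n \<ge> 2")
    \<comment> \<open>A single point is its own neighbour, and the product of its noise with itself
      need not be centred; for \<open>n \<le> 1\<close> the crude bound is already linear, as n^2 =
      n.\<close>
    case False
    have "norm (\<integral>z. (lin n (fst z) (snd z))\<^sup>2 \<partial>joint n) \<le> (real n * L)\<^sup>2"
    proof (rule integral_abs_le[OF prob_joint])
      show "norm ((lin n (fst z) (snd z))\<^sup>2) \<le> (real n * L)\<^sup>2" for z
        using square_le_of_abs_le[OF L(2)] by simp
    qed
    also have "(real n * L)\<^sup>2 = L\<^sup>2 * real n" 
    proof -
      have "n = 0 \<or> n = 1" using False by linarith
      then show ?thesis by (auto simp: power_mult_distrib)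
    qed
    also have "\<dots> \<le> C * real n" unfolding C_def by (intro mult_right_mono) auto
    finally show ?thesis by simp
  next
    case True
    define A where "A = (\<lambda>x :: nat \<Rightarrow> real. \<Sum>i=1..n. cmean \<zeta> (x i))"
    define h where "h = (\<lambda>x i a b. \<eta> (x i) a + pt (x i) a (x (right_nb n x i)) b)"
    define F where "F = (\<lambda>x e :: nat \<Rightarrow> real. \<Sum>i=1..n. h x i (e i) (e (right_nb n x i)))"
    have lAF: "lin n x e = A x + F x e" for x e unfolding lin_alt A_def F_def h_def ..
    have hB: "\<bar>h x i a b\<bar> \<le> B" for x i a b
      unfolding h_def B_def using Be(2)[of "x i" a] Bp(2)[of "x i" a "x (right_nb n x i)" b] by linarith
    have hm: "case_prod (h x i) \<in> borel_measurable (\<nu> \<Otimes>\<^sub>M \<nu>)" for x i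
      unfolding case_prod_beta' h_def
      by (intro borel_measurable_add bdd2_meas[OF \<eta>2] pt_meas borel_measurable_const fst_nu snd_nu)
    have he: "(\<lambda>e. h x i (e i) (e (right_nb n x i))) \<in> borel_measurable (noise n)" if "i \<in> {1..n}" for x i
      unfolding noise_def by (rule measurable_pair_component[OF hm that right_nb_in[OF that]])
    have Fm: "F x \<in> borel_measurable (noise n)" for x unfolding F_def by (intro borel_measurable_sum he)
    have FB: "\<bar>F x e\<bar> \<le> real n * B" for x e
    proof -
      have "\<bar>F x e\<bar> \<le> real (card {1..n}) * B" unfolding F_def by (rule sum_abs_bound) (rule hB)
      then show ?thesis by simp
    qed
    have F0: "(\<integral>e. F x e \<partial>noise n) = 0" for x
    proof -
      have "(\<integral>e. F x e \<partial>noise n) = (\<Sum>i=1..n. \<integral>e. h x i (e i) (e (right_nb n x i)) \<partial>noise n)"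
        unfolding F_def
        by (rule Bochner_Integration.integral_sum, rule integrable_bdd[OF prob_noise he, where B=B]) (simp_all add: hB)
      also have "\<dots> = 0"
      proof (rule sum.neutral, rule ballI)
        fix i assume i: "i \<in> {1..n}"
        show "(\<integral>e. h x i (e i) (e (right_nb n x i)) \<partial>noise n) = 0" unfolding h_def
          by (rule noise_pair_mean_zero[OF i right_nb_in[OF i] right_nb_neq[OF True i, symmetric]])
      qed
      finally show ?thesis .
    qed
    have F2: "(\<integral>e. (F x e)\<^sup>2 \<partial>noise n) \<le> real n * (2 * B)\<^sup>2" for x
    proof -
      have "(\<integral>e. (F x e)\<^sup>2 \<partial>noise n) \<le> real (card {1..n}) * (2 * B)\<^sup>2"
        using F0[of x] unfolding F_def noise_def
        by (intro second_moment_neighbour[OF prob_nu finite_atLeastAtMost hm hB right_nb_bij])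
      then show ?thesis by simp
    qed
    interpret W: prob_space "noise n" by (rule prob_noise)
    have AB: "\<bar>A x\<bar> \<le> real n * Bz" for x
    proof -
      have "\<bar>A x\<bar> \<le> real (card {1..n}) * Bz" unfolding A_def by (rule sum_abs_bound) (rule Bz(2))
      then show ?thesis by simp
    qed
    have Am: "A \<in> borel_measurable (sample n)" unfolding A_def
      by (intro borel_measurable_sum measurable_compose[OF _ \<psi>m] sample_component)
    have A2i: "integrable (sample n) (\<lambda>x. (A x)\<^sup>2)"
      by (rule integrable_bdd[OF prob_sample, where B="(real n * Bz)\<^sup>2"])
        (use Am square_le_of_abs_le[OF AB] in simp_all)
    have b: "(\<integral>e. (lin n x e)\<^sup>2 \<partial>noise n) \<le> 2 * (A x)\<^sup>2 + 2 * (real n * (2 * B)\<^sup>2)" for x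
    proof -
      have i: "integrable (noise n) (\<lambda>e. (F x e)\<^sup>2)"
        by (rule integrable_bdd[OF prob_noise, where B="(real n * B)\<^sup>2"]) (use Fm square_le_of_abs_le[OF FB] in simp_all)
      have "(\<integral>e. (lin n x e)\<^sup>2 \<partial>noise n) \<le> (\<integral>e. 2 * (A x)\<^sup>2 + 2 * (F x e)\<^sup>2 \<partial>noise n)"
      proof (rule integral_mono)
        show "integrable (noise n) (\<lambda>e. (lin n x e)\<^sup>2)"
        proof (rule integrable_bdd[OF prob_noise, where B="(real n * L)\<^sup>2"])
          show "(\<lambda>e. (lin n x e)\<^sup>2) \<in> borel_measurable (noise n)" unfolding lAF
            by (intro borel_measurable_power borel_measurable_add borel_measurable_const Fm)
          show "norm ((lin n x e)\<^sup>2) \<le> (real n * L)\<^sup>2" for e using square_le_of_abs_le[OF L(2)] by simp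
        qed
        show "integrable (noise n) (\<lambda>e. 2 * (A x)\<^sup>2 + 2 * (F x e)\<^sup>2)" using i by simp
        show "(lin n x e)\<^sup>2 \<le> 2 * (A x)\<^sup>2 + 2 * (F x e)\<^sup>2" for e unfolding lAF by (rule square_add_le)
      qed
      also have "\<dots> = 2 * (A x)\<^sup>2 + 2 * (\<integral>e. (F x e)\<^sup>2 \<partial>noise n)" using i by (simp add: W.prob_space)
      finally show ?thesis using F2[of x] by linarith
    qed
    interpret S: prob_space "sample n" by (rule prob_sample)
    have "(\<integral>z. (lin n (fst z) (snd z))\<^sup>2 \<partial>joint n) \<le> (\<integral>x. 2 * (A x)\<^sup>2 + 2 * (real n * (2 * B)\<^sup>2) \<partial>sample n)"
      by (rule joint_square_le[OF lin_measurable L(2) b]) (use A2i in simp)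
    also have "\<dots> = 2 * (\<integral>x. (A x)\<^sup>2 \<partial>sample n) + 2 * (real n * (2 * B)\<^sup>2)" using A2i by (simp add: S.prob_space)
    also have "(\<integral>x. (A x)\<^sup>2 \<partial>sample n) \<le> (\<Sum>i=1..n. \<integral>a. (cmean \<zeta> a)\<^sup>2 \<partial>\<mu>)"
      unfolding A_def sample_def
      by (rule second_moment_additive[OF prob _ _ Bz(2) \<zeta>0]) (simp_all only: finite_atLeastAtMost borel_measurable_mu \<psi>m)
    also have "\<dots> \<le> of_nat (card {1..n}) * Bz\<^sup>2"
    proof (rule sum_bounded_above)
      have "norm (\<integral>a. (cmean \<zeta> a)\<^sup>2 \<partial>\<mu>) \<le> Bz\<^sup>2"
        by (rule integral_abs_le[OF prob]) (use square_le_of_abs_le[OF Bz(2)] in simp)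
      then show "(\<integral>a. (cmean \<zeta> a)\<^sup>2 \<partial>\<mu>) \<le> Bz\<^sup>2" by simp
    qed
    finally have "(\<integral>z. (lin n (fst z) (snd z))\<^sup>2 \<partial>joint n) \<le> (2 * Bz\<^sup>2 + 2 * (2 * B)\<^sup>2) * real n"
      by (simp add: algebra_simps)
    also have "\<dots> \<le> C * real n" unfolding C_def by (intro mult_right_mono) auto
    finally show ?thesis .
  qed
  then show ?thesis by blast
qed

end

section \<open>Laws of large numbers\<close>

context rank_model
begin

text \<open>The second moment bound for an empty \<open>K\<close>, divided by n^2.\<close>

lemma law_of_large_numbers:
  assumes g: "bdd2 g"
  shows "L2conv (\<lambda>n z. (\<Sum>i=1..n. g (fst z i) (snd z i)) / real n) (\<integral>x. cmean g x \<partial>\<mu>)"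
proof -
  define m where "m = (\<integral>x. cmean g x \<partial>\<mu>)"
  obtain B where B: "0 \<le> B" "\<And>x e. \<bar>g x e\<bar> \<le> B" using bdd2_bound[OF g] by blast
  have gm: "cmean g \<in> borel_measurable borel" by (rule bdd2_fst_meas[OF bdd2_cmean[OF g]])
  have gi: "integrable \<mu> (cmean g)"
    by (rule integrable_bdd[OF prob, where B=B]) (simp_all only: borel_measurable_mu gm real_norm_def cmean_bound[OF B(2)])
  have cm: "cmean (\<lambda>x e. g x e - m) x = cmean g x - m" for x
    unfolding cmean_def using bdd2_integrable[OF g, of x] nu.prob_space by simp
  interpret L: clt_setup \<mu> \<nu> "{} :: nat set" "\<lambda>_. 0" "\<lambda>_ _ _. 0" "\<lambda>x e. g x e - m"
  proof
    show "bdd2 (\<lambda>x e. g x e - m)" by (intro bdd2_diff g bdd2_const)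
    show "(\<integral>x. cmean (\<lambda>x e. g x e - m) x \<partial>\<mu>) = 0"
      unfolding cm using gi prob_space by (simp add: m_def)
    show "cmean (\<lambda>_ _. 0) x = 0" for x by (simp add: cmean_def)
  qed (simp_all add: bdd2_const)
  obtain C where C: "\<And>n. (\<integral>z. (L.lin n (fst z) (snd z))\<^sup>2 \<partial>joint n) \<le> C * real n"
    using L.lin_second_moment by blast
  show ?thesis
  proof (rule L2convI[where B=B])
    show "(\<lambda>z. (\<Sum>i=1..n. g (fst z i) (snd z i)) / real n) \<in> borel_measurable (joint n)" for n
      by (intro borel_measurable_divide borel_measurable_sum bdd2_meas[OF g] joint_measurable borel_measurable_const)
    show "\<bar>(\<Sum>i=1..n. g (fst z i) (snd z i)) / real n\<bar> \<le> B" for n z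
    proof (cases "n = 0")
      case False
      have "\<bar>\<Sum>i=1..n. g (fst z i) (snd z i)\<bar> \<le> real (card {1..n}) * B" by (rule sum_abs_bound) (rule B(2))
      then show ?thesis using False by (simp add: abs_divide divide_le_eq mult.commute)
    qed (use B in simp)
    show "(\<lambda>n. \<integral>z. ((\<Sum>i=1..n. g (fst z i) (snd z i)) / real n - (\<integral>x. cmean g x \<partial>\<mu>))\<^sup>2 \<partial>joint n) \<longlonglongrightarrow> 0"
    proof (rule tendsto_sandwich[OF _ _ tendsto_const lim_const_over_n[of C]])
      show "\<forall>\<^sub>F n in sequentially. (\<integral>z. ((\<Sum>i=1..n. g (fst z i) (snd z i)) / real n - (\<integral>x. cmean g x \<partial>\<mu>))\<^sup>2 \<partial>joint n) \<le> C / real n"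
        using eventually_gt_at_top[of 0]
      proof eventually_elim
        case (elim n)
        have "(\<Sum>i=1..n. g (fst z i) (snd z i)) / real n - m = (1 / real n) * L.lin n (fst z) (snd z)" for z
          unfolding L.lin_def using elim by (simp add: sum_subtractf field_simps)
        then have "(\<integral>z. ((\<Sum>i=1..n. g (fst z i) (snd z i)) / real n - m)\<^sup>2 \<partial>joint n)
           = (1 / real n)\<^sup>2 * (\<integral>z. (L.lin n (fst z) (snd z))\<^sup>2 \<partial>joint n)"
          by (simp only: power_mult_distrib) simp
        also have "\<dots> \<le> (1 / real n)\<^sup>2 * (C * real n)" by (intro mult_left_mono C) simp
        also have "\<dots> = C / real n" using elim by (simp add: power2_eq_square)
        finally show ?case unfolding m_def .
      qed
    qed simp
  qed
qed

text \<open>Moving \<open>q\<close> from the neighbour back to the point costs, by Cauchy-Schwarz, a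
  mean square of order \<open>nb_gap q\<close>, which vanishes; what is left is the ordinary law of
  large numbers for the product of \<open>p\<close> and \<open>q\<close>.\<close>

lemma law_of_large_numbers_neighbour:
  assumes p: "bdd2 p" and q: "bdd2 (\<lambda>x e. q x)"
  shows "L2conv (\<lambda>n z. (\<Sum>i=1..n. p (fst z i) (snd z i) * q (fst z (right_nb n (fst z) i))) / real n)
     (\<integral>x. cmean (\<lambda>x e. p x e * q x) x \<partial>\<mu>)"
proof -
  obtain B where B: "0 \<le> B" "\<And>x e. \<bar>p x e\<bar> \<le> B" using bdd2_bound[OF p] by blast
  obtain C where C: "0 \<le> C" "\<And>x e::real. \<bar>q x\<bar> \<le> C" using bdd2_bound[OF q] by blast
  have qm: "q \<in> borel_measurable borel" by (rule bdd2_fst_meas[OF q])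
  let ?d = "\<lambda>n x i. q (x (right_nb n x i)) - q (x i)"
  define F where "F = (\<lambda>n x e. (\<Sum>i=1..n. p (x i) (e i) * ?d n x i) / real n)"
  have Fm: "(\<lambda>z. F n (fst z) (snd z)) \<in> borel_measurable (joint n)" for n
    unfolding F_def by (intro borel_measurable_divide borel_measurable_sum borel_measurable_times borel_measurable_diff
        bdd2_meas[OF p] measurable_compose[OF _ qm] joint_measurable borel_measurable_const)
  have FB: "\<bar>F n x e\<bar> \<le> B * (2 * C)" for n x e
  proof (cases "n = 0")
    case False
    have t: "\<bar>p (x i) (e i) * ?d n x i\<bar> \<le> B * (2 * C)" for i
    proof -
      have "\<bar>?d n x i\<bar> \<le> 2 * C" using C(2)[of "x i"] C(2)[of "x (right_nb n x i)"] by linarith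
      then show ?thesis unfolding abs_mult by (intro mult_mono B) simp_all
    qed
    have "\<bar>\<Sum>i=1..n. p (x i) (e i) * ?d n x i\<bar> \<le> real (card {1..n}) * (B * (2 * C))" by (rule sum_abs_bound) (rule t)
    then show ?thesis using False unfolding F_def by (simp add: abs_divide divide_le_eq mult.commute)
  qed (use B C in \<open>simp add: F_def\<close>)
  have F2: "(F n x e)\<^sup>2 \<le> B\<^sup>2 * (nb_sq n q x / real n)" for n x e
  proof (cases "n = 0")
    case False
    have cs: "(\<Sum>i=1..n. p (x i) (e i) * ?d n x i)\<^sup>2 \<le> real (card {1..n}) * (\<Sum>i=1..n. (p (x i) (e i) * ?d n x i)\<^sup>2)"
      by (rule sum_sq_le) simp
    have "(\<Sum>i=1..n. (p (x i) (e i) * ?d n x i)\<^sup>2) \<le> (\<Sum>i=1..n. B\<^sup>2 * (q (x i) - q (x (right_nb n x i)))\<^sup>2)"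
    proof (rule sum_mono)
      fix i
      have "(p (x i) (e i) * ?d n x i)\<^sup>2 = (p (x i) (e i))\<^sup>2 * (q (x i) - q (x (right_nb n x i)))\<^sup>2"
        by (simp add: power_mult_distrib power2_commute)
      also have "\<dots> \<le> B\<^sup>2 * (q (x i) - q (x (right_nb n x i)))\<^sup>2" by (intro mult_right_mono square_le_of_abs_le B) simp
      finally show "(p (x i) (e i) * ?d n x i)\<^sup>2 \<le> B\<^sup>2 * (q (x i) - q (x (right_nb n x i)))\<^sup>2" .
    qed
    also have "\<dots> = B\<^sup>2 * nb_sq n q x" unfolding nb_sq_def sum_distrib_left ..
    finally have "real (card {1..n}) * (\<Sum>i=1..n. (p (x i) (e i) * ?d n x i)\<^sup>2) \<le> real (card {1..n}) * (B\<^sup>2 * nb_sq n q x)"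
      by (rule mult_left_mono) simp
    with cs have "(\<Sum>i=1..n. p (x i) (e i) * ?d n x i)\<^sup>2 \<le> real n * (B\<^sup>2 * nb_sq n q x)" by simp
    then have "(\<Sum>i=1..n. p (x i) (e i) * ?d n x i)\<^sup>2 / (real n)\<^sup>2 \<le> real n * (B\<^sup>2 * nb_sq n q x) / (real n)\<^sup>2"
      by (rule divide_right_mono) simp
    then show ?thesis using False unfolding F_def power_divide by (simp add: power2_eq_square)
  qed (simp add: F_def)
  have "L2conv (\<lambda>n z. F n (fst z) (snd z)) 0"
  proof (rule L2convI[OF Fm FB])
    show "(\<lambda>n. \<integral>z. (F n (fst z) (snd z) - 0)\<^sup>2 \<partial>joint n) \<longlonglongrightarrow> 0"
    proof (rule tendsto_sandwich[OF _ _ tendsto_const])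
      show "\<forall>\<^sub>F n in sequentially. (\<integral>z. (F n (fst z) (snd z) - 0)\<^sup>2 \<partial>joint n) \<le> B\<^sup>2 * nb_gap q n"
      proof (rule always_eventually, rule allI)
        fix n
        have b: "(\<integral>e. (F n x e)\<^sup>2 \<partial>noise n) \<le> B\<^sup>2 * (nb_sq n q x / real n)" for x
        proof -
          have "norm (\<integral>e. (F n x e)\<^sup>2 \<partial>noise n) \<le> B\<^sup>2 * (nb_sq n q x / real n)"
            by (rule integral_abs_le[OF prob_noise]) (simp only: real_norm_def abs_power2 F2)
          then show ?thesis by simp
        qed
        have "(\<integral>z. (F n (fst z) (snd z))\<^sup>2 \<partial>joint n) \<le> (\<integral>x. B\<^sup>2 * (nb_sq n q x / real n) \<partial>sample n)"
          by (rule joint_square_le[OF Fm FB b]) (use integrable_nb_sq[OF qm C(2)] in simp)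
        then show "(\<integral>z. (F n (fst z) (snd z) - 0)\<^sup>2 \<partial>joint n) \<le> B\<^sup>2 * nb_gap q n"
          by (simp add: nb_gap_def)
      qed
      show "(\<lambda>n. B\<^sup>2 * nb_gap q n) \<longlonglongrightarrow> 0" using tendsto_mult_left[OF nb_gap_tendsto_0[OF qm C(2)], of "B\<^sup>2"] by simp
    qed simp
  qed
  from L2conv_add[OF this law_of_large_numbers[OF bdd2_mult[OF p q]]]
  have "L2conv (\<lambda>n z. F n (fst z) (snd z) + (\<Sum>i=1..n. p (fst z i) (snd z i) * q (fst z i)) / real n)
     (\<integral>x. cmean (\<lambda>x e. p x e * q x) x \<partial>\<mu>)" by simp
  moreover have "F n x e + (\<Sum>i=1..n. p (x i) (e i) * q (x i)) / real n
     = (\<Sum>i=1..n. p (x i) (e i) * q (x (right_nb n x i))) / real n" for n x e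
    unfolding F_def add_divide_distrib[symmetric] sum.distrib[symmetric]
    by (intro arg_cong[where f="\<lambda>s. s / real n"] sum.cong) (simp_all add: algebra_simps)
  ultimately show ?thesis by (simp only:)
qed

end

context clt_setup
begin

text \<open>The step of the martingale along the cycle. The additive noise is charged to the point
  being entered, so that for any noise \<open>a\<close> on the left the step is centred in
  \<open>e\<close>.\<close>

definition W :: "real \<Rightarrow> real \<Rightarrow> real \<Rightarrow> real \<Rightarrow> real" where
  "W x a x' e = \<eta> x' e + pt x a x' e"

definition Hv :: "real \<Rightarrow> real \<Rightarrow> real \<Rightarrow> real" where
  "Hv x a x' = (\<integral>e. (W x a x' e)\<^sup>2 \<partial>\<nu>)"

text \<open>The limit of the averaged conditional variances. The mixed terms carry a single noise of
  the left point and average out; the products give the conditional covariance once from each end,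
  hence its square when the two inputs merge.\<close>

definition \<sigma>2 :: real where
  "\<sigma>2 = (\<integral>x. cmean (\<lambda>x e. (\<eta> x e)\<^sup>2) x \<partial>\<mu>)
     + (\<Sum>k\<in>K. \<Sum>l\<in>K. \<alpha> k * \<alpha> l * (\<integral>x. (cmean (\<lambda>x e. c k x e * c l x e) x)\<^sup>2 \<partial>\<mu>))"

lemma W_meas:
  assumes "u \<in> borel_measurable N" "a \<in> borel_measurable N" "u' \<in> borel_measurable N" "a' \<in> borel_measurable N"
  shows "(\<lambda>\<omega>. W (u \<omega>) (a \<omega>) (u' \<omega>) (a' \<omega>)) \<in> borel_measurable N"
  unfolding W_def by (intro borel_measurable_add bdd2_meas[OF \<eta>2] pt_meas assms)

lemma W_bound: "\<exists>B\<ge>0. \<forall>x a x' e. \<bar>W x a x' e\<bar> \<le> B"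
proof -
  obtain Be where Be: "0 \<le> Be" "\<And>x e. \<bar>\<eta> x e\<bar> \<le> Be" using bdd2_bound[OF \<eta>2] by blast
  obtain Bp where Bp: "0 \<le> Bp" "\<And>x a x' a'. \<bar>pt x a x' a'\<bar> \<le> Bp" using pt_bound by blast
  have "\<bar>W x a x' e\<bar> \<le> Be + Bp" for x a x' e
    unfolding W_def using Be(2)[of x' e] Bp(2)[of x a x' e] by linarith
  then show ?thesis using Be(1) Bp(1) by (intro exI[of _ "Be + Bp"]) simp
qed

lemma W_mean: "(\<integral>e. W x a x' e \<partial>\<nu>) = 0"
proof -
  have ck: "integrable \<nu> (\<lambda>e. \<alpha> k * (c k x a * c k x' e))" "(\<integral>e. \<alpha> k * (c k x a * c k x' e) \<partial>\<nu>) = 0" for k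
    using bdd2_integrable[OF c[of k], of x'] c0[of k x'] by (simp_all add: cmean_def)
  have "(\<integral>e. pt x a x' e \<partial>\<nu>) = 0"
    unfolding pt_def by (subst Bochner_Integration.integral_sum) (simp_all only: ck sum.neutral_const)
  moreover have "integrable \<nu> (\<lambda>e. pt x a x' e)" unfolding pt_def by (intro Bochner_Integration.integrable_sum ck)
  ultimately show ?thesis unfolding W_def
    using bdd2_integrable[OF \<eta>2, of x'] \<eta>0[of x'] by (simp add: cmean_def)
qed

text \<open>Each summand is a function of the left point times a function of the right input, the
  form that the neighbour law of large numbers accepts.\<close>

lemma Hv_expand: "Hv x a x' = cmean (\<lambda>x e. (\<eta> x e)\<^sup>2) x'
    + (\<Sum>k\<in>K. (2 * \<alpha> k) * (c k x a * cmean (\<lambda>x e. \<eta> x e * c k x e) x'))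
    + (\<Sum>k\<in>K. \<Sum>l\<in>K. (\<alpha> k * \<alpha> l) * ((c k x a * c l x a) * cmean (\<lambda>x e. c k x e * c l x e) x'))"
proof -
  have i1: "integrable \<nu> (\<lambda>e. (\<eta> x' e)\<^sup>2)" by (rule bdd2_integrable[OF bdd2_square[OF \<eta>2]])
  have i2: "integrable \<nu> (\<lambda>e. (2 * \<alpha> k) * (c k x a * (\<eta> x' e * c k x' e)))" for k
    using bdd2_integrable[OF bdd2_mult[OF \<eta>2 c[of k]], of x'] by simp
  have i3: "integrable \<nu> (\<lambda>e. (\<alpha> k * \<alpha> l) * ((c k x a * c l x a) * (c k x' e * c l x' e)))" for k l
    using bdd2_integrable[OF bdd2_mult[OF c[of k] c[of l]], of x'] by simp
  have e: "(W x a x' e)\<^sup>2 = (\<eta> x' e)\<^sup>2 + (\<Sum>k\<in>K. (2 * \<alpha> k) * (c k x a * (\<eta> x' e * c k x' e)))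
     + (\<Sum>k\<in>K. \<Sum>l\<in>K. (\<alpha> k * \<alpha> l) * ((c k x a * c l x a) * (c k x' e * c l x' e)))" for e
  proof -
    have "(pt x a x' e)\<^sup>2 = (\<Sum>k\<in>K. \<Sum>l\<in>K. (\<alpha> k * \<alpha> l) * ((c k x a * c l x a) * (c k x' e * c l x' e)))"
      unfolding pt_def power2_eq_square sum_product by (intro sum.cong refl) (simp add: mult_ac)
    moreover have "2 * \<eta> x' e * pt x a x' e = (\<Sum>k\<in>K. (2 * \<alpha> k) * (c k x a * (\<eta> x' e * c k x' e)))"
      unfolding pt_def sum_distrib_left by (intro sum.cong refl) (simp add: mult_ac)
    ultimately show ?thesis unfolding W_def power2_sum by linarith
  qed
  have "Hv x a x' = (\<integral>e. (\<eta> x' e)\<^sup>2 \<partial>\<nu>) + (\<integral>e. (\<Sum>k\<in>K. (2 * \<alpha> k) * (c k x a * (\<eta> x' e * c k x' e))) \<partial>\<nu>)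
     + (\<integral>e. (\<Sum>k\<in>K. \<Sum>l\<in>K. (\<alpha> k * \<alpha> l) * ((c k x a * c l x a) * (c k x' e * c l x' e))) \<partial>\<nu>)"
    unfolding Hv_def e
    by (subst Bochner_Integration.integral_add Bochner_Integration.integral_add,
        (intro Bochner_Integration.integrable_add Bochner_Integration.integrable_sum i1 i2 i3)+)+ (rule refl)
  also have "(\<integral>e. (\<Sum>k\<in>K. (2 * \<alpha> k) * (c k x a * (\<eta> x' e * c k x' e))) \<partial>\<nu>)
     = (\<Sum>k\<in>K. (2 * \<alpha> k) * (c k x a * cmean (\<lambda>x e. \<eta> x e * c k x e) x'))"
    by (subst Bochner_Integration.integral_sum[OF i2]) (simp add: cmean_def)
  also have "(\<integral>e. (\<Sum>k\<in>K. \<Sum>l\<in>K. (\<alpha> k * \<alpha> l) * ((c k x a * c l x a) * (c k x' e * c l x' e))) \<partial>\<nu>)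
     = (\<Sum>k\<in>K. \<Sum>l\<in>K. (\<alpha> k * \<alpha> l) * ((c k x a * c l x a) * cmean (\<lambda>x e. c k x e * c l x e) x'))"
    by (subst Bochner_Integration.integral_sum, intro Bochner_Integration.integrable_sum i3,
        subst Bochner_Integration.integral_sum[OF i3]) (simp add: cmean_def)
  finally show ?thesis unfolding cmean_def .
qed

lemma Hv_nonneg: "0 \<le> Hv x a x'" unfolding Hv_def by simp

lemma Hv_bound:
  assumes "\<And>x a x' e. \<bar>W x a x' e\<bar> \<le> B" shows "Hv x a x' \<le> B\<^sup>2"
proof -
  have "norm (\<integral>e. (W x a x' e)\<^sup>2 \<partial>\<nu>) \<le> B\<^sup>2"
    by (rule integral_abs_le[OF prob_nu]) (simp add: square_le_of_abs_le[OF assms])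
  then show ?thesis unfolding Hv_def by simp
qed

lemma Hv_meas:
  assumes "u \<in> borel_measurable N" "a \<in> borel_measurable N" "u' \<in> borel_measurable N"
  shows "(\<lambda>\<omega>. Hv (u \<omega>) (a \<omega>) (u' \<omega>)) \<in> borel_measurable N"
  unfolding Hv_expand
  by (intro borel_measurable_add borel_measurable_sum borel_measurable_times borel_measurable_const bdd2_meas[OF c] assms
      measurable_compose[OF assms(3) bdd2_fst_meas[OF bdd2_cmean]] bdd2_mult bdd2_square \<eta>2 c)

definition Vn :: "nat \<Rightarrow> (nat \<Rightarrow> real) \<Rightarrow> (nat \<Rightarrow> real) \<Rightarrow> real" where
  "Vn n x e = (\<Sum>i=1..n. Hv (x i) (e i) (x (right_nb n x i))) / real n"

text \<open>Term by term from \<open>Hv_expand\<close>: the averages of the first and third kind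
  have the limits collected in \<open>\<sigma>2\<close>, those of the second kind tend to 0 because
  the left noise is centred.\<close>

lemma Vn_L2conv: "L2conv (\<lambda>n z. Vn n (fst z) (snd z)) \<sigma>2"
proof -
  let ?q0 = "cmean (\<lambda>x e. (\<eta> x e)\<^sup>2)"
  let ?r = "\<lambda>k. cmean (\<lambda>x e. \<eta> x e * c k x e)"
  let ?C = "\<lambda>k l. cmean (\<lambda>x e. c k x e * c l x e)"
  let ?A = "\<lambda>p q n z. (\<Sum>i=1..n. p (fst z i) (snd z i) * q (fst z (right_nb n (fst z) i))) / real n"
  have 0: "L2conv (?A (\<lambda>_ _. 1) ?q0) (\<integral>x. cmean (\<lambda>x e. 1 * ?q0 x) x \<partial>\<mu>)"
    by (intro law_of_large_numbers_neighbour bdd2_const bdd2_cmean bdd2_square \<eta>2)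
  have 1: "L2conv (?A (c k) (?r k)) (\<integral>x. cmean (\<lambda>x e. c k x e * ?r k x) x \<partial>\<mu>)" for k
    by (intro law_of_large_numbers_neighbour c bdd2_cmean bdd2_mult \<eta>2)
  have 2: "L2conv (?A (\<lambda>x e. c k x e * c l x e) (?C k l)) (\<integral>x. cmean (\<lambda>x e. c k x e * c l x e * ?C k l x) x \<partial>\<mu>)" for k l
    by (intro law_of_large_numbers_neighbour c bdd2_cmean bdd2_mult)
  have m0: "cmean (\<lambda>x e. 1 * ?q0 x) x = ?q0 x" for x
    using nu.prob_space by (simp add: cmean_def[of "\<lambda>x e. ?q0 x"])
  have m1: "cmean (\<lambda>x e. c k x e * ?r k x) x = 0" for k x
    using c0[of k x] by (simp add: cmean_def[of "\<lambda>x e. c k x e * ?r k x"] cmean_def[of "c k"])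
  have m2: "cmean (\<lambda>x e. c k x e * c l x e * ?C k l x) x = (?C k l x)\<^sup>2" for k l x
    by (simp add: cmean_def[of "\<lambda>x e. c k x e * c l x e * ?C k l x"] power2_eq_square) (simp add: cmean_def)
  have "L2conv (\<lambda>n z. ?A (\<lambda>_ _. 1) ?q0 n z + (\<Sum>k\<in>K. (2 * \<alpha> k) * ?A (c k) (?r k) n z)
      + (\<Sum>k\<in>K. \<Sum>l\<in>K. (\<alpha> k * \<alpha> l) * ?A (\<lambda>x e. c k x e * c l x e) (?C k l) n z))
      ((\<integral>x. ?q0 x \<partial>\<mu>) + (\<Sum>k\<in>K. (2 * \<alpha> k) * 0) + (\<Sum>k\<in>K. \<Sum>l\<in>K. (\<alpha> k * \<alpha> l) * (\<integral>x. (?C k l x)\<^sup>2 \<partial>\<mu>)))"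
    using 0[unfolded m0] 1[unfolded m1 Bochner_Integration.integral_zero] 2[unfolded m2]
    by (intro L2conv_add L2conv_sum finite_K L2conv_scale)
  moreover have "(\<integral>x. ?q0 x \<partial>\<mu>) + (\<Sum>k\<in>K. (2 * \<alpha> k) * 0) + (\<Sum>k\<in>K. \<Sum>l\<in>K. (\<alpha> k * \<alpha> l) * (\<integral>x. (?C k l x)\<^sup>2 \<partial>\<mu>)) = \<sigma>2"
    unfolding \<sigma>2_def by simp
  moreover have "?A (\<lambda>_ _. 1) ?q0 n z + (\<Sum>k\<in>K. (2 * \<alpha> k) * ?A (c k) (?r k) n z)
      + (\<Sum>k\<in>K. \<Sum>l\<in>K. (\<alpha> k * \<alpha> l) * ?A (\<lambda>x e. c k x e * c l x e) (?C k l) n z) = Vn n (fst z) (snd z)" for n z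
  proof -
    have s1: "(\<Sum>k\<in>K. (2 * \<alpha> k) * ?A (c k) (?r k) n z)
      = (\<Sum>i=1..n. \<Sum>k\<in>K. (2 * \<alpha> k) * (c k (fst z i) (snd z i) * ?r k (fst z (right_nb n (fst z) i)))) / real n"
      unfolding sum_divide_distrib sum_distrib_left by (subst sum.swap) simp
    have s2: "(\<Sum>k\<in>K. \<Sum>l\<in>K. (\<alpha> k * \<alpha> l) * ?A (\<lambda>x e. c k x e * c l x e) (?C k l) n z)
      = (\<Sum>i=1..n. \<Sum>k\<in>K. \<Sum>l\<in>K. (\<alpha> k * \<alpha> l) * (c k (fst z i) (snd z i) * c l (fst z i) (snd z i) * ?C k l (fst z (right_nb n (fst z) i)))) / real n"
    proof -
      have "(\<Sum>k\<in>K. \<Sum>l\<in>K. (\<alpha> k * \<alpha> l) * ?A (\<lambda>x e. c k x e * c l x e) (?C k l) n z)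
        = (\<Sum>k\<in>K. \<Sum>i=1..n. \<Sum>l\<in>K. (\<alpha> k * \<alpha> l) * (c k (fst z i) (snd z i) * c l (fst z i) (snd z i) * ?C k l (fst z (right_nb n (fst z) i))) / real n)"
        unfolding sum_divide_distrib sum_distrib_left by (intro sum.cong[OF refl], subst sum.swap) simp
      also have "\<dots> = (\<Sum>i=1..n. \<Sum>k\<in>K. \<Sum>l\<in>K. (\<alpha> k * \<alpha> l) * (c k (fst z i) (snd z i) * c l (fst z i) (snd z i) * ?C k l (fst z (right_nb n (fst z) i))) / real n)"
        by (rule sum.swap)
      finally show ?thesis by (simp only: sum_divide_distrib)
    qed
    show ?thesis
      unfolding s1 s2 Vn_def Hv_expand sum.distrib add_divide_distrib by simp
  qed
  ultimately show ?thesis by (simp only:)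
qed

end

section \<open>A central limit theorem for neighbour sums\<close>

context clt_setup
begin

text \<open>For fixed inputs the noises are relabelled along the sorted order, which does not change
  their law; \<open>exp_martingale\<close> handles the path of \<open>n - 1\<close> steps, and the
  closing edge is a factor \<open>U\<close> within a multiple of 1 / sqrt n of 1.\<close>

lemma conditional_char:
  "\<exists>C. \<forall>n\<ge>1. \<forall>x. cmod ((\<integral>e. exp (\<i> * complex_of_real (1 / sqrt (real n) * (\<Sum>i=1..n. W (x i) (e i) (x (right_nb n x i)) (e (right_nb n x i))))
      + complex_of_real (Vn n x e / 2)) \<partial>noise n) - 1) \<le> C / sqrt (real n)"
proof -
  obtain B where B: "0 \<le> B" "\<And>x a x' e. \<bar>W x a x' e\<bar> \<le> B" using W_bound by blast
  have HB: "Hv x a x' \<le> B\<^sup>2" for x a x' by (rule Hv_bound) (rule B)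
  define E where "E = exp (B\<^sup>2 / 2)"
  define C0 where "C0 = exp (B\<^sup>2 / 2) * (exp (B\<^sup>2 / 2) * (B^3 + B^4))"
  \<comment> \<open>\<open>E\<close> bounds the path factor, the bracket is the deviation of the
    closing factor, and \<open>C0\<close> is the error of the chain.\<close>
  define C where "C = E * (B\<^sup>2 / 2 * E + B) + C0"
  have E1: "1 \<le> E" unfolding E_def by simp
  have "cmod ((\<integral>e. exp (\<i> * complex_of_real (1 / sqrt (real n) * (\<Sum>i=1..n. W (x i) (e i) (x (right_nb n x i)) (e (right_nb n x i))))
      + complex_of_real (Vn n x e / 2)) \<partial>noise n) - 1) \<le> C / sqrt (real n)" if n: "n \<ge> 1" for n x
  proof -
    define \<tau> where "\<tau> = 1 / sqrt (real n)"
    have \<tau>: "0 < \<tau>" "\<tau> \<le> 1" "\<tau>\<^sup>2 = 1 / real n" using n unfolding \<tau>_def by (auto simp: power_divide)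
    define \<sigma> where "\<sigma> = rank_perm n x"
    have p: "\<sigma> permutes {1..n}" unfolding \<sigma>_def by (rule rank_perm_permutes)
    define z where "z = (\<lambda>j. x (\<sigma> j))"
    define w where "w = (\<lambda>j a e. W (z j) a (z (Suc j)) e)"
    define v where "v = (\<lambda>j a. Hv (z j) a (z (Suc j)))"
    define G where "G = (\<lambda>e :: nat \<Rightarrow> real. exp (\<i> * complex_of_real (\<tau> * (\<Sum>j=1..<n. w j (e j) (e (Suc j))))
       + complex_of_real (\<tau>\<^sup>2 / 2 * (\<Sum>j=1..<n. v j (e j)))))"
    define U where "U = (\<lambda>e :: nat \<Rightarrow> real. exp (\<i> * complex_of_real (\<tau> * W (z n) (e n) (z 1) (e 1))
       + complex_of_real (\<tau>\<^sup>2 / 2 * Hv (z n) (e n) (z 1))))"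
    have cm: "i \<in> {1..n} \<Longrightarrow> (\<lambda>e. e i) \<in> borel_measurable (noise n)" for i by (rule noise_component)
    have Gm: "G \<in> borel_measurable (noise n)"
    proof -
      have [measurable]: "(\<lambda>e. \<Sum>j=1..<n. w j (e j) (e (Suc j))) \<in> borel_measurable (noise n)"
        unfolding w_def by (intro borel_measurable_sum W_meas borel_measurable_const cm) auto
      have [measurable]: "(\<lambda>e. \<Sum>j=1..<n. v j (e j)) \<in> borel_measurable (noise n)"
        unfolding v_def by (intro borel_measurable_sum Hv_meas borel_measurable_const cm) auto
      show ?thesis unfolding G_def by measurable
    qed
    have Um: "U \<in> borel_measurable (noise n)"
    proof -
      have [measurable]: "(\<lambda>e. W (z n) (e n) (z 1) (e 1)) \<in> borel_measurable (noise n)"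
        by (intro W_meas borel_measurable_const cm) (use n in auto)
      have [measurable]: "(\<lambda>e. Hv (z n) (e n) (z 1)) \<in> borel_measurable (noise n)"
        by (intro Hv_meas borel_measurable_const cm) (use n in auto)
      show ?thesis unfolding U_def by measurable
    qed
    have GB: "cmod (G e) \<le> E" for e
    proof -
      have "(\<Sum>j=1..<n. v j (e j)) \<le> of_nat (card {1..<n}) * B\<^sup>2" unfolding v_def by (rule sum_bounded_above) (rule HB)
      also have "\<dots> \<le> real n * B\<^sup>2" by (intro mult_right_mono) auto
      finally have "\<tau>\<^sup>2 / 2 * (\<Sum>j=1..<n. v j (e j)) \<le> \<tau>\<^sup>2 / 2 * (real n * B\<^sup>2)" by (rule mult_left_mono) simp
      also have "\<dots> = B\<^sup>2 / 2" using \<tau>(3) n by simp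
      finally show ?thesis unfolding G_def E_def by (simp add: norm_exp_eq_Re)
    qed
    have U1: "cmod (U e - 1) \<le> (B\<^sup>2 / 2 * E + B) * \<tau>" for e
    proof -
      have h: "0 \<le> \<tau>\<^sup>2 / 2 * Hv (z n) (e n) (z 1)" using Hv_nonneg by simp
      have h2: "\<tau>\<^sup>2 / 2 * Hv (z n) (e n) (z 1) \<le> \<tau>\<^sup>2 / 2 * B\<^sup>2" by (intro mult_left_mono HB) simp
      have "cmod (U e - 1) \<le> \<tau>\<^sup>2 / 2 * B\<^sup>2 * exp (\<tau>\<^sup>2 / 2 * B\<^sup>2) + \<bar>\<tau> * W (z n) (e n) (z 1) (e 1)\<bar>"
        unfolding U_def by (rule exp_wrap_bound[OF h h2])
      also have "\<tau>\<^sup>2 / 2 * B\<^sup>2 * exp (\<tau>\<^sup>2 / 2 * B\<^sup>2) \<le> (\<tau> * (B\<^sup>2 / 2)) * E"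
      proof (rule mult_mono)
        have "\<tau>\<^sup>2 \<le> \<tau>" using \<tau>(1,2) by (simp add: power2_eq_square mult_left_le)
        then show "\<tau>\<^sup>2 / 2 * B\<^sup>2 \<le> \<tau> * (B\<^sup>2 / 2)" using mult_right_mono[of "\<tau>\<^sup>2" \<tau> "B\<^sup>2 / 2"] by simp
        have "\<tau>\<^sup>2 \<le> 1" using \<tau>(1,2) by (simp add: power_le_one)
        then show "exp (\<tau>\<^sup>2 / 2 * B\<^sup>2) \<le> E" unfolding E_def using mult_right_mono[of "\<tau>\<^sup>2" 1 "B\<^sup>2 / 2"] by simp
      qed (use \<tau>(1) in auto)
      also have "\<bar>\<tau> * W (z n) (e n) (z 1) (e 1)\<bar> \<le> \<tau> * B"
        unfolding abs_mult using \<tau>(1) B(2)[of "z n" "e n" "z 1" "e 1"] by (simp add: mult_left_mono)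
      finally show ?thesis by (simp add: algebra_simps)
    qed
    have UB: "cmod (U e) \<le> (B\<^sup>2 / 2 * E + B) * \<tau> + 1" for e
      using U1[of e] norm_triangle_ineq2[of "U e" 1] by simp
    have Wsum: "(\<Sum>i=1..n. W (x i) (e i) (x (right_nb n x i)) (e (right_nb n x i)))
      = (\<Sum>j=1..<n. w j (e (\<sigma> j)) (e (\<sigma> (Suc j)))) + W (z n) (e (\<sigma> n)) (z 1) (e (\<sigma> 1))" for e :: "nat \<Rightarrow> real"
      using sum_right_nb_sorted[OF n, of "\<lambda>i j. W (x i) (e i) (x j) (e j)" x] unfolding \<sigma>_def[symmetric] w_def z_def .
    have Vsum: "Vn n x e / 2 = \<tau>\<^sup>2 / 2 * (\<Sum>j=1..<n. v j (e (\<sigma> j))) + \<tau>\<^sup>2 / 2 * Hv (z n) (e (\<sigma> n)) (z 1)" for e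
    proof -
      have "(\<Sum>i=1..n. Hv (x i) (e i) (x (right_nb n x i))) = (\<Sum>j=1..<n. v j (e (\<sigma> j))) + Hv (z n) (e (\<sigma> n)) (z 1)"
        using sum_right_nb_sorted[OF n, of "\<lambda>i j. Hv (x i) (e i) (x j)" x] unfolding \<sigma>_def[symmetric] v_def z_def .
      then show ?thesis unfolding Vn_def \<tau>(3) by (simp add: add_divide_distrib)
    qed
    \<comment> \<open>In the original labels the integrand is path factor times closing factor at
      the relabelled noises; restriction keeps these in the product space.\<close>
    have GU: "exp (\<i> * complex_of_real (\<tau> * (\<Sum>i=1..n. W (x i) (e i) (x (right_nb n x i)) (e (right_nb n x i))))
      + complex_of_real (Vn n x e / 2)) = G (\<lambda>i\<in>{1..n}. e (\<sigma> i)) * U (\<lambda>i\<in>{1..n}. e (\<sigma> i))" for e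
    proof -
      let ?e = "\<lambda>i\<in>{1..n}. e (\<sigma> i)"
      have 1: "(\<Sum>j=1..<n. w j (?e j) (?e (Suc j))) = (\<Sum>j=1..<n. w j (e (\<sigma> j)) (e (\<sigma> (Suc j))))"
        by (rule sum.cong) auto
      have 2: "(\<Sum>j=1..<n. v j (?e j)) = (\<Sum>j=1..<n. v j (e (\<sigma> j)))" by (rule sum.cong) auto
      have 3: "?e n = e (\<sigma> n)" "?e 1 = e (\<sigma> 1)" using n by auto
      show ?thesis unfolding G_def U_def 1 2 3 Wsum Vsum exp_add[symmetric]
        by (rule arg_cong[where f=exp]) (simp add: distrib_left)
    qed
    have GUm: "(\<lambda>e. G e * U e) \<in> borel_measurable (noise n)" using Gm Um by simp
    have "(\<integral>e. exp (\<i> * complex_of_real (\<tau> * (\<Sum>i=1..n. W (x i) (e i) (x (right_nb n x i)) (e (right_nb n x i))))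
      + complex_of_real (Vn n x e / 2)) \<partial>noise n) = (\<integral>e. G e * U e \<partial>noise n)"
      unfolding GU noise_def by (rule integral_PiM_permute[OF prob_nu p GUm[unfolded noise_def]])
    also have "\<dots> - 1 = (\<integral>e. G e * (U e - 1) \<partial>noise n) + ((\<integral>e. G e \<partial>noise n) - 1)"
    proof -
      have Gi: "integrable (noise n) G" by (rule integrable_bdd[OF prob_noise Gm GB])
      have GUi: "integrable (noise n) (\<lambda>e. G e * U e)"
      proof (rule integrable_bdd[OF prob_noise GUm])
        show "cmod (G e * U e) \<le> E * ((B\<^sup>2 / 2 * E + B) * \<tau> + 1)" for e
          unfolding norm_mult by (intro mult_mono GB UB) (use E1 in auto)
      qed
      show ?thesis using Gi GUi by (simp add: right_diff_distrib)
    qed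
    finally have "cmod ((\<integral>e. exp (\<i> * complex_of_real (\<tau> * (\<Sum>i=1..n. W (x i) (e i) (x (right_nb n x i)) (e (right_nb n x i))))
      + complex_of_real (Vn n x e / 2)) \<partial>noise n) - 1)
      \<le> cmod (\<integral>e. G e * (U e - 1) \<partial>noise n) + cmod ((\<integral>e. G e \<partial>noise n) - 1)"
      by (simp only: norm_triangle_ineq)
    also have "cmod (\<integral>e. G e * (U e - 1) \<partial>noise n) \<le> E * ((B\<^sup>2 / 2 * E + B) * \<tau>)"
    proof (rule integral_abs_le[OF prob_noise])
      show "cmod (G e * (U e - 1)) \<le> E * ((B\<^sup>2 / 2 * E + B) * \<tau>)" for e
        unfolding norm_mult by (intro mult_mono GB U1) (use E1 in auto)
    qed
    also have "cmod ((\<integral>e. G e \<partial>noise n) - 1) \<le> real n * (C0 * \<tau>^3)"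
      unfolding G_def noise_def
    proof (rule exp_martingale[OF prob_nu space_nu, where K=B])
      show "(\<lambda>(a, e). w j a e) \<in> borel_measurable (\<nu> \<Otimes>\<^sub>M \<nu>)" for j
        unfolding w_def case_prod_beta' by (intro W_meas borel_measurable_const fst_nu snd_nu)
      show "\<bar>w j a e\<bar> \<le> B" for j a e unfolding w_def by (rule B)
      show "(\<integral>e. w j a e \<partial>\<nu>) = 0" for j a unfolding w_def by (rule W_mean)
      show "v j a = (\<integral>e. (w j a e)\<^sup>2 \<partial>\<nu>)" for j a unfolding v_def w_def Hv_def ..
      show "C0 = exp (B\<^sup>2 / 2) * (exp (B\<^sup>2 / 2) * (B ^ 3 + B ^ 4))" by (rule C0_def)
      show "\<tau> = 1 / sqrt (real n)" by (rule \<tau>_def)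
    qed (use n in auto)
    also have "real n * (C0 * \<tau>^3) = C0 * \<tau>"
    proof -
      have "real n * \<tau>\<^sup>2 = 1" using \<tau>(3) n by simp
      then have "real n * (C0 * \<tau>^3) = C0 * \<tau> * (real n * \<tau>\<^sup>2)" by (simp add: power3_eq_cube power2_eq_square mult_ac)
      also have "\<dots> = C0 * \<tau>" using \<open>real n * \<tau>\<^sup>2 = 1\<close> by simp
      finally show ?thesis .
    qed
    finally show ?thesis unfolding \<tau>_def[symmetric] C_def by (simp add: \<tau>_def algebra_simps add_divide_distrib)
  qed
  then show ?thesis by blast
qed

definition s2 :: real where "s2 = (\<integral>x. (cmean \<zeta> x)\<^sup>2 \<partial>\<mu>)"

text \<open>The chain estimate with steps that ignore the previous coordinate and with constant
  conditional variance \<open>s2\<close>. Its \<open>n - 1\<close> steps cover the observations from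
  the second on; the first one is the extra factor \<open>U\<close>.\<close>

lemma char_mean_part:
  "(\<lambda>n. \<integral>x. exp (\<i> * complex_of_real (1 / sqrt (real n) * (\<Sum>i=1..n. cmean \<zeta> (x i)))) \<partial>sample n) \<longlonglongrightarrow> complex_of_real (exp (- s2 / 2))"
proof -
  let ?\<psi> = "cmean \<zeta>"
  obtain B where B: "0 \<le> B" "\<And>x e::real. \<bar>?\<psi> x\<bar> \<le> B" using bdd2_bound[OF \<psi>2] by blast
  define C0 where "C0 = exp (B\<^sup>2 / 2) * (exp (B\<^sup>2 / 2) * (B^3 + B^4))"
  define E where "E = exp (B\<^sup>2 / 2)"
  have s20: "0 \<le> s2" unfolding s2_def by simp
  have s2B: "s2 \<le> B\<^sup>2"
  proof -
    have "norm (\<integral>x. (?\<psi> x)\<^sup>2 \<partial>\<mu>) \<le> B\<^sup>2"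
      by (rule integral_abs_le[OF prob]) (simp add: square_le_of_abs_le[OF B(2)])
    then show ?thesis unfolding s2_def by simp
  qed
  define C where "C = C0 + E * (s2 / 2 * exp (s2 / 2) + B)"
  let ?T = "\<lambda>n. \<integral>x. exp (\<i> * complex_of_real (1 / sqrt (real n) * (\<Sum>i=1..n. ?\<psi> (x i)))) \<partial>sample n"
  have key: "cmod (?T n * complex_of_real (exp (s2 / 2)) - 1) \<le> C / sqrt (real n)" if n: "n \<ge> 1" for n
  proof -
    define \<tau> where "\<tau> = 1 / sqrt (real n)"
    have \<tau>: "0 < \<tau>" "\<tau> \<le> 1" "\<tau>\<^sup>2 = 1 / real n" using n unfolding \<tau>_def by (auto simp: power_divide)
    define G where "G = (\<lambda>x :: nat \<Rightarrow> real. exp (\<i> * complex_of_real (\<tau> * (\<Sum>j=1..<n. ?\<psi> (x (Suc j))))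
       + complex_of_real (\<tau>\<^sup>2 / 2 * (\<Sum>j=1..<n. s2))))"
    define U where "U = (\<lambda>x :: nat \<Rightarrow> real. exp (\<i> * complex_of_real (\<tau> * ?\<psi> (x 1)) + complex_of_real (\<tau>\<^sup>2 / 2 * s2)))"
    have Gm: "G \<in> borel_measurable (sample n)"
    proof -
      have [measurable]: "(\<lambda>x. \<Sum>j=1..<n. ?\<psi> (x (Suc j))) \<in> borel_measurable (sample n)"
        by (intro borel_measurable_sum measurable_compose[OF sample_component \<psi>m]) auto
      show ?thesis unfolding G_def by measurable
    qed
    have Um: "U \<in> borel_measurable (sample n)"
    proof -
      have [measurable]: "(\<lambda>x. ?\<psi> (x 1)) \<in> borel_measurable (sample n)"
        by (intro measurable_compose[OF sample_component \<psi>m]) (use n in auto)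
      show ?thesis unfolding U_def by measurable
    qed
    have GB: "cmod (G x) \<le> E" for x
    proof -
      have "(\<Sum>j=1..<n. s2) \<le> real n * B\<^sup>2" using s20 s2B n by (simp add: mult_mono)
      then have "\<tau>\<^sup>2 / 2 * (\<Sum>j=1..<n. s2) \<le> \<tau>\<^sup>2 / 2 * (real n * B\<^sup>2)" by (rule mult_left_mono) simp
      also have "\<dots> = B\<^sup>2 / 2" using \<tau>(3) n by simp
      finally show ?thesis unfolding G_def E_def by (simp add: norm_exp_eq_Re)
    qed
    have U1: "cmod (U x - 1) \<le> (s2 / 2 * exp (s2 / 2) + B) * \<tau>" for x
    proof -
      have h: "0 \<le> \<tau>\<^sup>2 / 2 * s2" using s20 by simp
      have "cmod (U x - 1) \<le> \<tau>\<^sup>2 / 2 * s2 * exp (\<tau>\<^sup>2 / 2 * s2) + \<bar>\<tau> * ?\<psi> (x 1)\<bar>"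
        unfolding U_def by (rule exp_wrap_bound[OF h order_refl])
      also have "\<tau>\<^sup>2 / 2 * s2 * exp (\<tau>\<^sup>2 / 2 * s2) \<le> (\<tau> * (s2 / 2)) * exp (s2 / 2)"
      proof (rule mult_mono)
        have "\<tau>\<^sup>2 \<le> \<tau>" using \<tau>(1,2) by (simp add: power2_eq_square mult_left_le)
        then show "\<tau>\<^sup>2 / 2 * s2 \<le> \<tau> * (s2 / 2)" using mult_right_mono[of "\<tau>\<^sup>2" \<tau> "s2 / 2"] s20 by simp
        have "\<tau>\<^sup>2 \<le> 1" using \<tau>(1,2) by (simp add: power_le_one)
        then show "exp (\<tau>\<^sup>2 / 2 * s2) \<le> exp (s2 / 2)" using mult_right_mono[of "\<tau>\<^sup>2" 1 "s2 / 2"] s20 by simp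
      qed (use \<tau>(1) s20 in auto)
      also have "\<bar>\<tau> * ?\<psi> (x 1)\<bar> \<le> \<tau> * B"
        unfolding abs_mult using \<tau>(1) B(2)[of "x 1"] by (simp add: mult_left_mono)
      finally show ?thesis by (simp add: algebra_simps)
    qed
    have UB: "cmod (U x) \<le> (s2 / 2 * exp (s2 / 2) + B) * \<tau> + 1" for x
      using U1[of x] norm_triangle_ineq2[of "U x" 1] by simp
    have GU: "exp (\<i> * complex_of_real (\<tau> * (\<Sum>i=1..n. ?\<psi> (x i)))) * complex_of_real (exp (s2 / 2)) = G x * U x" for x
    proof -
      have "(\<Sum>i=1..n. ?\<psi> (x i)) = ?\<psi> (x 1) + (\<Sum>i=Suc 1..n. ?\<psi> (x i))"
        using n by (rule sum.atLeast_Suc_atMost)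
      also have "(\<Sum>i=Suc 1..n. ?\<psi> (x i)) = (\<Sum>j=1..<n. ?\<psi> (x (Suc j)))"
        using sum.shift_bounds_Suc_ivl[of "\<lambda>i. ?\<psi> (x i)" 1 n] by (simp add: atLeastLessThanSuc_atLeastAtMost)
      finally have 1: "(\<Sum>i=1..n. ?\<psi> (x i)) = ?\<psi> (x 1) + (\<Sum>j=1..<n. ?\<psi> (x (Suc j)))" .
      have 2: "\<tau>\<^sup>2 / 2 * (\<Sum>j=1..<n. s2) + \<tau>\<^sup>2 / 2 * s2 = s2 / 2"
        unfolding \<tau>(3) using n by (simp add: of_nat_diff field_simps)
      have "exp (\<i> * complex_of_real (\<tau> * (\<Sum>i=1..n. ?\<psi> (x i)))) * complex_of_real (exp (s2 / 2))
        = exp (\<i> * complex_of_real (\<tau> * (\<Sum>i=1..n. ?\<psi> (x i))) + complex_of_real (s2 / 2))"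
        by (simp only: exp_add exp_of_real)
      also have "\<dots> = G x * U x" unfolding G_def U_def 1 2[symmetric] exp_add[symmetric]
        by (rule arg_cong[where f=exp]) (simp add: distrib_left)
      finally show ?thesis .
    qed
    have GUm: "(\<lambda>x. G x * U x) \<in> borel_measurable (sample n)" using Gm Um by simp
    have "?T n * complex_of_real (exp (s2 / 2)) = (\<integral>x. G x * U x \<partial>sample n)"
      unfolding GU[symmetric] \<tau>_def by simp
    also have "\<dots> - 1 = (\<integral>x. G x * (U x - 1) \<partial>sample n) + ((\<integral>x. G x \<partial>sample n) - 1)"
    proof -
      have Gi: "integrable (sample n) G" by (rule integrable_bdd[OF prob_sample Gm GB])
      have GUi: "integrable (sample n) (\<lambda>x. G x * U x)"
      proof (rule integrable_bdd[OF prob_sample GUm])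
        show "cmod (G x * U x) \<le> E * ((s2 / 2 * exp (s2 / 2) + B) * \<tau> + 1)" for x
          unfolding norm_mult by (intro mult_mono GB UB) (auto simp: E_def)
      qed
      show ?thesis using Gi GUi by (simp add: right_diff_distrib)
    qed
    finally have "cmod (?T n * complex_of_real (exp (s2 / 2)) - 1)
      \<le> cmod (\<integral>x. G x * (U x - 1) \<partial>sample n) + cmod ((\<integral>x. G x \<partial>sample n) - 1)"
      by (simp only: norm_triangle_ineq)
    also have "cmod (\<integral>x. G x * (U x - 1) \<partial>sample n) \<le> E * ((s2 / 2 * exp (s2 / 2) + B) * \<tau>)"
    proof (rule integral_abs_le[OF prob_sample])
      show "cmod (G x * (U x - 1)) \<le> E * ((s2 / 2 * exp (s2 / 2) + B) * \<tau>)" for x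
        unfolding norm_mult by (intro mult_mono GB U1) (auto simp: E_def)
    qed
    also have "cmod ((\<integral>x. G x \<partial>sample n) - 1) \<le> real n * (C0 * \<tau>^3)"
      unfolding G_def sample_def
    proof (rule exp_martingale[OF prob space_UNIV, where K=B and w="\<lambda>j a e. ?\<psi> e" and v="\<lambda>j a. s2"])
      show "(\<lambda>(a, e). ?\<psi> e) \<in> borel_measurable (\<mu> \<Otimes>\<^sub>M \<mu>)"
        using measurable_compose[OF measurable_snd[of \<mu> \<mu>], of ?\<psi> borel] \<psi>m unfolding borel_measurable_mu[symmetric] case_prod_beta' by blast
      show "\<bar>?\<psi> e\<bar> \<le> B" for e by (rule B)
      show "(\<integral>e. ?\<psi> e \<partial>\<mu>) = 0" by (rule \<zeta>0)
      show "s2 = (\<integral>e. (?\<psi> e)\<^sup>2 \<partial>\<mu>)" by (rule s2_def)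
      show "C0 = exp (B\<^sup>2 / 2) * (exp (B\<^sup>2 / 2) * (B ^ 3 + B ^ 4))" by (rule C0_def)
      show "\<tau> = 1 / sqrt (real n)" by (rule \<tau>_def)
    qed (use n in auto)
    also have "real n * (C0 * \<tau>^3) = C0 * \<tau>"
    proof -
      have "real n * \<tau>\<^sup>2 = 1" using \<tau>(3) n by simp
      then have "real n * (C0 * \<tau>^3) = C0 * \<tau> * (real n * \<tau>\<^sup>2)" by (simp add: power3_eq_cube power2_eq_square mult_ac)
      also have "\<dots> = C0 * \<tau>" using \<open>real n * \<tau>\<^sup>2 = 1\<close> by simp
      finally show ?thesis .
    qed
    finally show ?thesis unfolding C_def by (simp add: \<tau>_def algebra_simps add_divide_distrib)
  qed
  have "(\<lambda>n. ?T n * complex_of_real (exp (s2 / 2)) - 1) \<longlonglongrightarrow> 0"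
  proof (rule Lim_null_comparison)
    show "\<forall>\<^sub>F n in sequentially. norm (?T n * complex_of_real (exp (s2 / 2)) - 1) \<le> C / sqrt (real n)"
      using eventually_ge_at_top[of 1] by eventually_elim (rule key)
    show "(\<lambda>n. C / sqrt (real n)) \<longlonglongrightarrow> 0"
      by (intro real_tendsto_divide_at_top[OF tendsto_const] filterlim_compose[OF sqrt_at_top filterlim_real_sequentially])
  qed
  from tendsto_mult_right[OF tendsto_add[OF this tendsto_const[of 1]], of "complex_of_real (exp (- s2 / 2))"]
  show ?thesis by (simp add: mult.assoc flip: of_real_mult exp_add)
qed

text \<open>The random compensator exp (Vn / 2) is exchanged for the constant exp
  (\<open>\<sigma>2\<close> / 2) at the price of an L2 distance. Integrating out the noises given
  the inputs then leaves the characteristic function of the conditional means.\<close>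

theorem char_lin:
  "(\<lambda>n. \<integral>z. exp (\<i> * complex_of_real (1 / sqrt (real n) * lin n (fst z) (snd z))) \<partial>joint n)
     \<longlonglongrightarrow> complex_of_real (exp (- (s2 + \<sigma>2) / 2))"
proof -
  let ?\<psi> = "cmean \<zeta>"
  obtain B where B: "0 \<le> B" "\<And>x a x' e. \<bar>W x a x' e\<bar> \<le> B" using W_bound by blast
  have HB: "Hv x a x' \<le> B\<^sup>2" for x a x' by (rule Hv_bound) (rule B)
  obtain C where C: "\<And>n x. n \<ge> 1 \<Longrightarrow> cmod ((\<integral>e. exp (\<i> * complex_of_real (1 / sqrt (real n) * (\<Sum>i=1..n. W (x i) (e i) (x (right_nb n x i)) (e (right_nb n x i))))
      + complex_of_real (Vn n x e / 2)) \<partial>noise n) - 1) \<le> C / sqrt (real n)"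
    using conditional_char by blast
  define P where "P = (\<lambda>n x. 1 / sqrt (real n) * (\<Sum>i=1..n. ?\<psi> (x i)))"
  define S where "S = (\<lambda>n x e. 1 / sqrt (real n) * (\<Sum>i=1..n. W (x i) (e i) (x (right_nb n x i)) (e (right_nb n x i))))"
  have V0: "0 \<le> Vn n x e" for n x e unfolding Vn_def by (intro divide_nonneg_nonneg sum_nonneg Hv_nonneg) simp
  have VB: "Vn n x e \<le> B\<^sup>2" for n x e
  proof (cases "n = 0")
    case False
    have "(\<Sum>i=1..n. Hv (x i) (e i) (x (right_nb n x i))) \<le> of_nat (card {1..n}) * B\<^sup>2"
      by (rule sum_bounded_above) (rule HB)
    then show ?thesis using False unfolding Vn_def by (simp add: divide_le_eq mult.commute)
  qed (simp add: Vn_def)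
  have \<sigma>V: "(\<lambda>n. \<integral>z. (Vn n (fst z) (snd z) - \<sigma>2)\<^sup>2 \<partial>joint n) \<longlonglongrightarrow> 0"
    and Vm: "\<And>n. (\<lambda>z. Vn n (fst z) (snd z)) \<in> borel_measurable (joint n)"
    using Vn_L2conv unfolding L2conv_def by auto
  have \<sigma>20: "0 \<le> \<sigma>2"
  proof -
    interpret J: prob_space "joint n" for n by (rule prob_joint)
    have "L2conv (\<lambda>n z. Vn n (fst z) (snd z)) \<sigma>2" by (rule Vn_L2conv)
    \<comment> \<open>A limit of nonnegative averages: a negative \<open>\<sigma>2\<close> would
      keep the mean square distance above its square.\<close>
    show ?thesis
    proof (rule ccontr)
      assume "\<not> 0 \<le> \<sigma>2"
      then have neg: "\<sigma>2 < 0" by simp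
      have "\<sigma>2\<^sup>2 \<le> (\<integral>z. (Vn n (fst z) (snd z) - \<sigma>2)\<^sup>2 \<partial>joint n)" for n
      proof -
        have "(\<integral>z. \<sigma>2\<^sup>2 \<partial>joint n) \<le> (\<integral>z. (Vn n (fst z) (snd z) - \<sigma>2)\<^sup>2 \<partial>joint n)"
        proof (rule integral_mono)
          show "integrable (joint n) (\<lambda>z. (Vn n (fst z) (snd z) - \<sigma>2)\<^sup>2)"
          proof (rule square_integrable_joint)
            show "(\<lambda>z. Vn n (fst z) (snd z) - \<sigma>2) \<in> borel_measurable (joint n)" using Vm by simp
            show "\<bar>Vn n (fst z) (snd z) - \<sigma>2\<bar> \<le> B\<^sup>2 + \<bar>\<sigma>2\<bar>" for z
              using V0[of n "fst z" "snd z"] VB[of n "fst z" "snd z"] by linarith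
          qed
          show "\<sigma>2\<^sup>2 \<le> (Vn n (fst z) (snd z) - \<sigma>2)\<^sup>2" for z
            using neg V0[of n "fst z" "snd z"] by (intro abs_le_square_iff[THEN iffD1]) simp
        qed simp
        then show ?thesis by (simp add: J.prob_space)
      qed
      then have "\<sigma>2\<^sup>2 \<le> 0" using LIMSEQ_le_const[OF \<sigma>V] by blast
      then show False using neg by simp
    qed
  qed
  have \<sigma>2B: "\<sigma>2 \<le> \<bar>\<sigma>2\<bar> + B\<^sup>2" by (simp add: abs_ge_self add_increasing2)
  define S0 where "S0 = \<bar>\<sigma>2\<bar> + B\<^sup>2"
  have split: "1 / sqrt (real n) * lin n x e = P n x + S n x e" for n x e
  proof -
    \<comment> \<open>Charging the additive noise to the right neighbour does not change its
      sum.\<close>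
    have 1: "(\<Sum>i=1..n. \<eta> (x (right_nb n x i)) (e (right_nb n x i))) = (\<Sum>i=1..n. \<eta> (x i) (e i))"
      using sum_right_nb_component[of "\<lambda>i. \<eta> (x i) (e i)" n x] .
    show ?thesis unfolding P_def S_def W_def lin_alt sum.distrib 1 by (simp only: distrib_left)
  qed
  have Sm: "(\<lambda>z. S n (fst z) (snd z)) \<in> borel_measurable (joint n)" for n
    unfolding S_def by (intro borel_measurable_times borel_measurable_const borel_measurable_sum W_meas joint_measurable)
  have Pm: "(\<lambda>x. P n x) \<in> borel_measurable (sample n)" for n
    unfolding P_def by (intro borel_measurable_times borel_measurable_const borel_measurable_sum measurable_compose[OF sample_component \<psi>m])
  have Pm': "(\<lambda>z. P n (fst z)) \<in> borel_measurable (joint n)" for n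
    unfolding joint_def by (rule measurable_compose[OF measurable_fst Pm])
  define G where "G = (\<lambda>n x e. exp (\<i> * complex_of_real (P n x)) * exp (\<i> * complex_of_real (S n x e) + complex_of_real (Vn n x e / 2)))"
  define T where "T = (\<lambda>n x e. exp (\<i> * complex_of_real (P n x + S n x e)))"
  have Gm: "(\<lambda>z. G n (fst z) (snd z)) \<in> borel_measurable (joint n)" for n
    unfolding G_def using Sm[of n] Pm'[of n] Vm[of n] by measurable
  have Tm: "(\<lambda>z. T n (fst z) (snd z)) \<in> borel_measurable (joint n)" for n
    unfolding T_def using Sm[of n] Pm'[of n] by measurable
  have GB: "cmod (G n x e) \<le> exp (B\<^sup>2 / 2)" for n x e
    unfolding G_def using VB[of n x e] by (simp add: norm_mult norm_exp_eq_Re)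
  have TB: "cmod (T n x e) \<le> 1" for n x e unfolding T_def by simp
  have Ti: "integrable (joint n) (\<lambda>z. T n (fst z) (snd z))" for n by (rule integrable_bdd[OF prob_joint Tm TB])
  have Gi: "integrable (joint n) (\<lambda>z. G n (fst z) (snd z))" for n by (rule integrable_bdd[OF prob_joint Gm GB])
  have step1: "(\<lambda>n. (\<integral>z. T n (fst z) (snd z) \<partial>joint n) * complex_of_real (exp (\<sigma>2 / 2)) - (\<integral>z. G n (fst z) (snd z) \<partial>joint n)) \<longlonglongrightarrow> 0"
  proof (rule Lim_null_comparison)
    show "(\<lambda>n. exp (S0 / 2) * sqrt (\<integral>z. (Vn n (fst z) (snd z) - \<sigma>2)\<^sup>2 \<partial>joint n)) \<longlonglongrightarrow> 0"
      using tendsto_mult_left[OF tendsto_real_sqrt[OF \<sigma>V], of "exp (S0 / 2)"] by simp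
    show "\<forall>\<^sub>F n in sequentially. norm ((\<integral>z. T n (fst z) (snd z) \<partial>joint n) * complex_of_real (exp (\<sigma>2 / 2)) - (\<integral>z. G n (fst z) (snd z) \<partial>joint n))
       \<le> exp (S0 / 2) * sqrt (\<integral>z. (Vn n (fst z) (snd z) - \<sigma>2)\<^sup>2 \<partial>joint n)"
    proof (rule always_eventually, rule allI)
      fix n
      let ?V = "\<lambda>z. Vn n (fst z) (snd z)"
      have pt: "cmod (T n x e * complex_of_real (exp (\<sigma>2 / 2)) - G n x e) \<le> exp (S0 / 2) * \<bar>Vn n x e - \<sigma>2\<bar>" for x e
      proof -
        have "T n x e * complex_of_real (exp (\<sigma>2 / 2)) - G n x e = T n x e * complex_of_real (exp (\<sigma>2 / 2) - exp (Vn n x e / 2))"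
          unfolding T_def G_def by (simp only: exp_add distrib_left right_diff_distrib exp_of_real of_real_add of_real_diff mult.assoc)
        then have "cmod (T n x e * complex_of_real (exp (\<sigma>2 / 2)) - G n x e) = \<bar>exp (\<sigma>2 / 2) - exp (Vn n x e / 2)\<bar>"
          unfolding T_def by (simp only: norm_mult norm_of_real norm_exp_i_times) simp
        also have "\<dots> \<le> exp (S0 / 2) * \<bar>\<sigma>2 / 2 - Vn n x e / 2\<bar>"
          by (rule exp_diff_le) (use \<sigma>20 \<sigma>2B V0[of n x e] VB[of n x e] in \<open>auto simp: S0_def\<close>)
        also have "\<dots> \<le> exp (S0 / 2) * \<bar>Vn n x e - \<sigma>2\<bar>" by (intro mult_left_mono) auto
        finally show ?thesis .
      qed
      have Vd: "\<bar>?V z - \<sigma>2\<bar> \<le> B\<^sup>2 + \<bar>\<sigma>2\<bar>" for z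
        using V0[of n "fst z" "snd z"] VB[of n "fst z" "snd z"] by linarith
      have Vdm: "(\<lambda>z. \<bar>?V z - \<sigma>2\<bar>) \<in> borel_measurable (joint n)" using Vm[of n] by simp
      have Vdi: "integrable (joint n) (\<lambda>z. \<bar>?V z - \<sigma>2\<bar>)"
        by (rule integrable_bdd[OF prob_joint Vdm, where B="B\<^sup>2 + \<bar>\<sigma>2\<bar>"]) (use Vd in simp)
      have "(\<integral>z. T n (fst z) (snd z) \<partial>joint n) * complex_of_real (exp (\<sigma>2 / 2)) - (\<integral>z. G n (fst z) (snd z) \<partial>joint n)
        = (\<integral>z. T n (fst z) (snd z) * complex_of_real (exp (\<sigma>2 / 2)) - G n (fst z) (snd z) \<partial>joint n)"
        using Ti[of n] Gi[of n] by simp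
      then have "norm ((\<integral>z. T n (fst z) (snd z) \<partial>joint n) * complex_of_real (exp (\<sigma>2 / 2)) - (\<integral>z. G n (fst z) (snd z) \<partial>joint n))
        = norm (\<integral>z. T n (fst z) (snd z) * complex_of_real (exp (\<sigma>2 / 2)) - G n (fst z) (snd z) \<partial>joint n)"
        by (rule arg_cong)
      also have "\<dots> \<le> (\<integral>z. norm (T n (fst z) (snd z) * complex_of_real (exp (\<sigma>2 / 2)) - G n (fst z) (snd z)) \<partial>joint n)"
        by (rule integral_norm_bound)
      also have "\<dots> \<le> (\<integral>z. exp (S0 / 2) * \<bar>?V z - \<sigma>2\<bar> \<partial>joint n)"
      proof (rule integral_mono)
        show "integrable (joint n) (\<lambda>z. norm (T n (fst z) (snd z) * complex_of_real (exp (\<sigma>2 / 2)) - G n (fst z) (snd z)))"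
          by (rule integrable_norm, rule Bochner_Integration.integrable_diff, rule integrable_mult_left, rule Ti, rule Gi)
        show "integrable (joint n) (\<lambda>z. exp (S0 / 2) * \<bar>?V z - \<sigma>2\<bar>)" by (rule integrable_mult_right, rule Vdi)
        show "norm (T n (fst z) (snd z) * complex_of_real (exp (\<sigma>2 / 2)) - G n (fst z) (snd z)) \<le> exp (S0 / 2) * \<bar>?V z - \<sigma>2\<bar>" for z
          by (rule pt)
      qed
      also have "\<dots> = exp (S0 / 2) * (\<integral>z. \<bar>?V z - \<sigma>2\<bar> \<partial>joint n)" by simp
      also have "\<dots> \<le> exp (S0 / 2) * sqrt (\<integral>z. (?V z - \<sigma>2)\<^sup>2 \<partial>joint n)"
      proof (intro mult_left_mono)
        have "(\<integral>z. \<bar>?V z - \<sigma>2\<bar> \<partial>joint n)\<^sup>2 \<le> (\<integral>z. \<bar>?V z - \<sigma>2\<bar>\<^sup>2 \<partial>joint n)"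
          by (rule square_integral_le[OF prob_joint Vdm, where B="B\<^sup>2 + \<bar>\<sigma>2\<bar>"]) (use Vd in simp)
        then show "(\<integral>z. \<bar>?V z - \<sigma>2\<bar> \<partial>joint n) \<le> sqrt (\<integral>z. (?V z - \<sigma>2)\<^sup>2 \<partial>joint n)"
          by (intro real_le_rsqrt) simp
      qed simp
      finally show "norm ((\<integral>z. T n (fst z) (snd z) \<partial>joint n) * complex_of_real (exp (\<sigma>2 / 2)) - (\<integral>z. G n (fst z) (snd z) \<partial>joint n))
       \<le> exp (S0 / 2) * sqrt (\<integral>z. (?V z - \<sigma>2)\<^sup>2 \<partial>joint n)" .
    qed
  qed
  let ?Q = "\<lambda>n. \<integral>x. exp (\<i> * complex_of_real (P n x)) \<partial>sample n"
  have step2: "(\<lambda>n. (\<integral>z. G n (fst z) (snd z) \<partial>joint n) - ?Q n) \<longlonglongrightarrow> 0"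
  proof (rule Lim_null_comparison)
    show "(\<lambda>n. C / sqrt (real n)) \<longlonglongrightarrow> 0"
      by (intro real_tendsto_divide_at_top[OF tendsto_const] filterlim_compose[OF sqrt_at_top filterlim_real_sequentially])
    show "\<forall>\<^sub>F n in sequentially. norm ((\<integral>z. G n (fst z) (snd z) \<partial>joint n) - ?Q n) \<le> C / sqrt (real n)"
      using eventually_ge_at_top[of 1]
    proof eventually_elim
      case (elim n)
      let ?D = "\<lambda>x. \<integral>e. exp (\<i> * complex_of_real (S n x e) + complex_of_real (Vn n x e / 2)) \<partial>noise n"
      have Gx: "(\<integral>e. G n x e \<partial>noise n) = exp (\<i> * complex_of_real (P n x)) * ?D x" for x
        unfolding G_def by simp
      note js = joint_sections[of "G n", OF Gm GB]
      have Qi: "integrable (sample n) (\<lambda>x. exp (\<i> * complex_of_real (P n x)))"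
        by (rule integrable_bdd[OF prob_sample, where B=1]) (use Pm[of n] in simp_all)
      have "(\<integral>z. G n (fst z) (snd z) \<partial>joint n) - ?Q n
        = (\<integral>x. (\<integral>e. G n x e \<partial>noise n) - exp (\<i> * complex_of_real (P n x)) \<partial>sample n)"
        unfolding js(1) using js(2) Qi by simp
      then have "norm ((\<integral>z. G n (fst z) (snd z) \<partial>joint n) - ?Q n)
        = norm (\<integral>x. (\<integral>e. G n x e \<partial>noise n) - exp (\<i> * complex_of_real (P n x)) \<partial>sample n)"
        by (rule arg_cong)
      also have "\<dots> \<le> C / sqrt (real n)"
      proof (rule integral_abs_le[OF prob_sample])
        fix x
        have "(\<integral>e. G n x e \<partial>noise n) - exp (\<i> * complex_of_real (P n x)) = exp (\<i> * complex_of_real (P n x)) * (?D x - 1)"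
          unfolding Gx by (simp add: right_diff_distrib)
        then have "norm ((\<integral>e. G n x e \<partial>noise n) - exp (\<i> * complex_of_real (P n x))) = norm (?D x - 1)"
          by (simp only: norm_mult norm_exp_i_times)
        also have "\<dots> \<le> C / sqrt (real n)" using C[OF elim] unfolding S_def .
        finally show "norm ((\<integral>e. G n x e \<partial>noise n) - exp (\<i> * complex_of_real (P n x))) \<le> C / sqrt (real n)" .
      qed
      finally show ?case .
    qed
  qed
  have "(\<lambda>n. (\<integral>z. T n (fst z) (snd z) \<partial>joint n) * complex_of_real (exp (\<sigma>2 / 2))) \<longlonglongrightarrow> complex_of_real (exp (- s2 / 2))"
    using tendsto_add[OF tendsto_add[OF step1 step2] char_mean_part] unfolding P_def by simp
  from tendsto_mult_right[OF this, of "complex_of_real (exp (- \<sigma>2 / 2))"]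
  have "(\<lambda>n. \<integral>z. T n (fst z) (snd z) \<partial>joint n) \<longlonglongrightarrow> complex_of_real (exp (- s2 / 2) * exp (- \<sigma>2 / 2))"
    by (simp add: mult.assoc flip: of_real_mult exp_add)
  moreover have "exp (- s2 / 2) * exp (- \<sigma>2 / 2) = exp (- (s2 + \<sigma>2) / 2)"
    by (simp add: add_divide_distrib flip: exp_add)
  ultimately show ?thesis unfolding split T_def by (simp only:)
qed

end

section \<open>Linearisation of the estimator\<close>

text \<open>A quantitative delta method. The coefficients 1, 2 m (\<rho> - 1) and -\<rho>, divided
  by V, are the gradient of (A - Y^2) / (Q - Y^2) at (p, m, m2). The bias is subtracted from the
  first argument beforehand, so it enters the error without a factor s. Truncation at 1 covers the
  event that the empirical variance is far from V.\<close>

lemma ratio_linearization: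
  fixes V B m m2 p :: real
  assumes V: "V > 0" "V = m2 - m\<^sup>2" and B: "\<bar>m\<bar> \<le> B"
  defines "\<rho> \<equiv> (p - m\<^sup>2) / V"
  obtains C where "0 \<le> C" "\<And>s A Y Q \<Delta>. s > 0 \<Longrightarrow> \<bar>Y\<bar> \<le> B \<Longrightarrow> 0 \<le> \<Delta> \<Longrightarrow>
    min 1 \<bar>s * ((A - Y\<^sup>2) / (Q - Y\<^sup>2) - (\<rho> - \<Delta> / (2 * V)))
       - (s * (A - (p - \<Delta> / 2)) + 2 * m * (\<rho> - 1) * (s * (Y - m)) - \<rho> * (s * (Q - m2))) / V\<bar>
    \<le> C * (1 / s + \<Delta>) * (1 + (s * (A - (p - \<Delta> / 2)))\<^sup>2 + (s * (Y - m))\<^sup>2 + (s * (Q - m2))\<^sup>2)"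
proof -
  \<comment> \<open>Bounds |s (Vn - V)| by D S, since Vn - V contains Y^2 - m^2 and |Y + m| is at
    most 2 B.\<close>
  define D where "D = 1 + 2 * B"
  define L1 where "L1 = (1 + 2 * \<bar>m\<bar> * \<bar>\<rho> - 1\<bar> + \<bar>\<rho>\<bar>) / V"
  define C where "C = 4 / V * D + (6 * L1 / V * D + 6 * \<bar>1 - \<rho>\<bar> / V) + 2 * D / V\<^sup>2"
  have B0: "0 \<le> B" using B by linarith
  have D1: "1 \<le> D" unfolding D_def using B0 by simp
  have L10: "0 \<le> L1" unfolding L1_def using V by simp
  have C0: "0 \<le> C" unfolding C_def using V D1 L10 by simp
  show thesis
  proof (rule that[OF C0])
    fix s A Y Q \<Delta> :: real assume s: "s > 0" and Y: "\<bar>Y\<bar> \<le> B" and \<Delta>: "0 \<le> \<Delta>"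
    define a where "a = s * (A - (p - \<Delta> / 2))"
    define y where "y = s * (Y - m)"
    define q where "q = s * (Q - m2)"
    define Vn where "Vn = Q - Y\<^sup>2"
    define L where "L = (a + 2 * m * (\<rho> - 1) * y - \<rho> * q) / V"
    define Z where "Z = s * ((A - Y\<^sup>2) / Vn - (\<rho> - \<Delta> / (2 * V)))"
    define S where "S = \<bar>a\<bar> + \<bar>y\<bar> + \<bar>q\<bar>"
    define G where "G = 1 + a\<^sup>2 + y\<^sup>2 + q\<^sup>2"
    have S0: "0 \<le> S" unfolding S_def by simp
    have S2: "S\<^sup>2 \<le> 3 * G"
    proof -
      have "S\<^sup>2 \<le> 3 * \<bar>a\<bar>\<^sup>2 + 3 * \<bar>y\<bar>\<^sup>2 + 3 * \<bar>q\<bar>\<^sup>2" unfolding S_def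
        using sum_squares_bound[of "\<bar>a\<bar>" "\<bar>y\<bar>"] sum_squares_bound[of "\<bar>a\<bar>" "\<bar>q\<bar>"] sum_squares_bound[of "\<bar>y\<bar>" "\<bar>q\<bar>"]
        by (simp add: power2_sum algebra_simps)
      then show ?thesis unfolding G_def by simp
    qed
    have G0: "1 \<le> G" unfolding G_def by simp
    have SG: "S \<le> 2 * G"
    proof -
      have "0 \<le> (S - 1)\<^sup>2" by simp
      then have "2 * S \<le> 1 + S\<^sup>2" by (simp add: power2_eq_square algebra_simps)
      then show ?thesis using S2 G0 by linarith
    qed
    have Yd: "\<bar>Y + m\<bar> \<le> 2 * B" using Y B by linarith
    have dV: "s * (Vn - V) = q - y * (Y + m)"
      unfolding Vn_def q_def y_def V(2) by (simp add: power2_eq_square algebra_simps)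
    have e: "\<bar>s * (Vn - V)\<bar> \<le> D * S"
    proof -
      have "\<bar>y * (Y + m)\<bar> \<le> \<bar>y\<bar> * (2 * B)" unfolding abs_mult by (intro mult_left_mono Yd) simp
      then have "\<bar>s * (Vn - V)\<bar> \<le> \<bar>q\<bar> + 2 * B * \<bar>y\<bar>" unfolding dV by (simp add: mult.commute)
      also have "\<dots> \<le> D * S"
      proof -
        have "0 \<le> B * \<bar>a\<bar>" "0 \<le> B * \<bar>q\<bar>" using B0 by simp_all
        then show ?thesis unfolding D_def S_def by (simp add: algebra_simps)
      qed
      finally show ?thesis .
    qed
    have dVn: "\<bar>Vn - V\<bar> \<le> D * S / s"
      using e s by (simp add: abs_mult pos_le_divide_eq mult.commute)
    have sG: "0 \<le> 1 / s * G" "0 \<le> \<Delta> * G" using s \<Delta> G0 by simp_all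
    have "min 1 \<bar>Z - L\<bar> \<le> C * (1 / s + \<Delta>) * G"
    proof (cases "\<bar>Vn - V\<bar> \<le> V / 2")
      \<comment> \<open>The empirical variance is off by more than V / 2, so S / s is bounded below
        and absorbs the truncated left side, which is at most 1.\<close>
      case False
      then have "V / 2 \<le> D * S / s" using dVn by linarith
      then have "1 \<le> 2 / V * D * S / s" using V(1) s by (simp add: field_simps)
      also have "\<dots> \<le> 2 / V * D * (2 * G) / s"
        using s V(1) D1 by (intro divide_right_mono mult_left_mono SG) auto
      also have "\<dots> = (4 / V * D) * (1 / s * G)" by simp
      also have "\<dots> \<le> C * (1 / s * G)"
        by (intro mult_right_mono sG) (use V D1 L10 in \<open>auto simp: C_def\<close>)
      also have "\<dots> \<le> C * (1 / s + \<Delta>) * G" using C0 sG by (simp add: distrib_left distrib_right mult_ac)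
      finally show ?thesis by simp
    next
      case True
      then have Vn: "V / 2 \<le> Vn" unfolding abs_le_iff by linarith
      then have Vn0: "0 < Vn" using V(1) by linarith
      have pm: "p - m\<^sup>2 = \<rho> * V" unfolding \<rho>_def using V(1) by simp
      \<comment> \<open>By p - m^2 = \<rho> V the constant terms cancel; what is left is the linear
        part, a quadratic remainder in y and the bias.\<close>
      have N: "s * (A - Y\<^sup>2 - \<rho> * Vn) = V * L - (1 - \<rho>) * y * (Y - m) - s * \<Delta> / 2"
      proof -
        have "V * L = a + 2 * m * (\<rho> - 1) * y - \<rho> * q" unfolding L_def using V(1) by simp
        then have "V * L - (1 - \<rho>) * y * (Y - m) - s * \<Delta> / 2 - s * (A - Y\<^sup>2 - \<rho> * Vn)
          = s * (- (p - m\<^sup>2) + \<rho> * (m2 - m\<^sup>2))"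
          unfolding a_def y_def q_def Vn_def by (simp add: power2_eq_square algebra_simps)
        also have "\<dots> = 0" using pm V(2) by simp
        finally show ?thesis by simp
      qed
      have "Z = s * (A - Y\<^sup>2 - \<rho> * Vn) / Vn + s * \<Delta> / (2 * V)"
        unfolding Z_def using Vn0 by (simp add: field_simps)
      then have Z: "Z = L * (V / Vn) - (1 - \<rho>) * y * (Y - m) / Vn - s * \<Delta> / 2 / Vn + s * \<Delta> / (2 * V)"
        unfolding N by (simp add: diff_divide_distrib mult.commute)
      \<comment> \<open>Each of the three terms is of second order: a product of two deviations
        divided by s, or \<open>\<Delta>\<close> times one deviation.\<close>
      have "Z - L = - L * (Vn - V) / Vn - (1 - \<rho>) * y * (Y - m) / Vn + s * \<Delta> / 2 * ((Vn - V) / (Vn * V))"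
      proof -
        have "L * (V / Vn) - L = - L * (Vn - V) / Vn" using Vn0 by (simp add: field_simps)
        moreover have "- (s * \<Delta> / 2 / Vn) + s * \<Delta> / (2 * V) = s * \<Delta> / 2 * ((Vn - V) / (Vn * V))"
        proof -
          have "(Vn - V) / (Vn * V) = 1 / V - 1 / Vn" using Vn0 V(1) by (simp add: diff_divide_distrib)
          then show ?thesis by (simp add: right_diff_distrib)
        qed
        ultimately show ?thesis using Z by linarith
      qed
      moreover have "\<bar>- L * (Vn - V) / Vn\<bar> \<le> (6 * L1 / V * D) * (1 / s * G)"
      proof -
        have "\<bar>L\<bar> \<le> L1 * S"
        proof -
          have t: "\<bar>a + 2 * m * (\<rho> - 1) * y - \<rho> * q\<bar> \<le> \<bar>a\<bar> + 2 * \<bar>m\<bar> * \<bar>\<rho> - 1\<bar> * \<bar>y\<bar> + \<bar>\<rho>\<bar> * \<bar>q\<bar>"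
            by (rule order_trans[OF abs_triangle_ineq4], rule add_mono, rule order_trans[OF abs_triangle_ineq]) (simp_all add: abs_mult)
          have "\<bar>a\<bar> + 2 * \<bar>m\<bar> * \<bar>\<rho> - 1\<bar> * \<bar>y\<bar> + \<bar>\<rho>\<bar> * \<bar>q\<bar> \<le> (1 + 2 * \<bar>m\<bar> * \<bar>\<rho> - 1\<bar> + \<bar>\<rho>\<bar>) * S"
          proof -
            have "\<bar>a\<bar> \<le> S" "\<bar>y\<bar> \<le> S" "\<bar>q\<bar> \<le> S" unfolding S_def by simp_all
            then have "\<bar>a\<bar> + 2 * \<bar>m\<bar> * \<bar>\<rho> - 1\<bar> * \<bar>y\<bar> + \<bar>\<rho>\<bar> * \<bar>q\<bar> \<le> S + 2 * \<bar>m\<bar> * \<bar>\<rho> - 1\<bar> * S + \<bar>\<rho>\<bar> * S"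
              by (intro add_mono mult_left_mono) auto
            then show ?thesis by (simp add: distrib_right)
          qed
          with t have "\<bar>a + 2 * m * (\<rho> - 1) * y - \<rho> * q\<bar> \<le> (1 + 2 * \<bar>m\<bar> * \<bar>\<rho> - 1\<bar> + \<bar>\<rho>\<bar>) * S" by linarith
          then show ?thesis unfolding L_def L1_def using V(1) by (simp add: abs_divide divide_right_mono)
        qed
        then have "\<bar>- L * (Vn - V) / Vn\<bar> \<le> (L1 * S) * (D * S / s) / (V / 2)"
          unfolding abs_divide abs_mult abs_minus_cancel using Vn V(1) Vn0 dVn L10 S0 D1 s
          by (intro frac_le mult_mono) auto
        also have "\<dots> = (2 * L1 / V * D / s) * S\<^sup>2" by (simp add: power2_eq_square mult_ac)
        also have "\<dots> \<le> (2 * L1 / V * D / s) * (3 * G)" using L10 V(1) D1 s by (intro mult_left_mono S2) auto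
        also have "\<dots> = (6 * L1 / V * D) * (1 / s * G)" by simp
        finally show ?thesis .
      qed
      moreover have "\<bar>(1 - \<rho>) * y * (Y - m) / Vn\<bar> \<le> (6 * \<bar>1 - \<rho>\<bar> / V) * (1 / s * G)"
      proof -
        have "y * (Y - m) = y\<^sup>2 / s" unfolding y_def using s by (simp add: power2_eq_square)
        then have "\<bar>(1 - \<rho>) * y * (Y - m) / Vn\<bar> = \<bar>1 - \<rho>\<bar> * (y\<^sup>2 / s) / Vn"
          using s Vn0 by (simp add: abs_mult mult.assoc)
        also have "\<dots> \<le> \<bar>1 - \<rho>\<bar> * (3 * G / s) / (V / 2)"
        proof (rule frac_le)
          have "y\<^sup>2 \<le> 3 * G" unfolding G_def by (simp add: add_increasing)
          then show "\<bar>1 - \<rho>\<bar> * (y\<^sup>2 / s) \<le> \<bar>1 - \<rho>\<bar> * (3 * G / s)" using s by (intro mult_left_mono divide_right_mono) auto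
        qed (use Vn V(1) G0 s in auto)
        finally show ?thesis by (simp add: mult_ac)
      qed
      moreover have "\<bar>s * \<Delta> / 2 * ((Vn - V) / (Vn * V))\<bar> \<le> (2 * D / V\<^sup>2) * (\<Delta> * G)"
      proof -
        have "\<bar>s * \<Delta> / 2 * ((Vn - V) / (Vn * V))\<bar> = \<Delta> / 2 * (\<bar>s * (Vn - V)\<bar> / (Vn * V))"
          using s \<Delta> Vn0 V(1) by (simp add: abs_mult abs_divide)
        also have "\<dots> \<le> \<Delta> / 2 * ((D * (2 * G)) / (V / 2 * V))"
        proof (intro mult_left_mono frac_le)
          show "\<bar>s * (Vn - V)\<bar> \<le> D * (2 * G)" using e mult_left_mono[OF SG, of D] D1 by linarith
          show "V / 2 * V \<le> Vn * V" using Vn V(1) by (intro mult_right_mono) auto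
        qed (use \<Delta> V(1) D1 G0 in auto)
        also have "\<dots> = (2 * D / V\<^sup>2) * (\<Delta> * G)" by (simp add: power2_eq_square)
        finally show ?thesis .
      qed
      moreover have abs3: "\<bar>d\<bar> \<le> a + b + c" if "d = u - v + w" "\<bar>u\<bar> \<le> a" "\<bar>v\<bar> \<le> b" "\<bar>w\<bar> \<le> c" for a b c d u v w :: real
        using that by linarith
      ultimately have "\<bar>Z - L\<bar> \<le> (6 * L1 / V * D) * (1 / s * G) + (6 * \<bar>1 - \<rho>\<bar> / V) * (1 / s * G) + (2 * D / V\<^sup>2) * (\<Delta> * G)"
        by (intro abs3)
      also have "\<dots> = (6 * L1 / V * D + 6 * \<bar>1 - \<rho>\<bar> / V) * (1 / s * G) + (2 * D / V\<^sup>2) * (\<Delta> * G)" by (simp only: distrib_right)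
      also have "\<dots> \<le> C * (1 / s * G) + C * (\<Delta> * G)"
        by (intro add_mono mult_right_mono sG) (use V D1 L10 in \<open>auto simp: C_def\<close>)
      also have "\<dots> = C * (1 / s + \<Delta>) * G" by (simp add: distrib_left distrib_right mult_ac)
      finally show ?thesis by simp
    qed
    then show "min 1 \<bar>s * ((A - Y\<^sup>2) / (Q - Y\<^sup>2) - (\<rho> - \<Delta> / (2 * V)))
       - (s * (A - (p - \<Delta> / 2)) + 2 * m * (\<rho> - 1) * (s * (Y - m)) - \<rho> * (s * (Q - m2))) / V\<bar>
    \<le> C * (1 / s + \<Delta>) * (1 + (s * (A - (p - \<Delta> / 2)))\<^sup>2 + (s * (Y - m))\<^sup>2 + (s * (Q - m2))\<^sup>2)"
      unfolding Z_def L_def G_def Vn_def a_def y_def q_def .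
  qed
qed

section \<open>The influence function and bounded statistics of the sample\<close>

context rank_model
begin

text \<open>\<open>mY\<close>, \<open>pY\<close>, \<open>vY\<close> and \<open>rho\<close> are the
  mean of Y, the second moment of its conditional mean, its variance and its Sobol' index, written
  through the two laws alone so that the linearisation lives in the product model.\<close>

definition mY :: "(real \<Rightarrow> real \<Rightarrow> real) \<Rightarrow> real" where "mY f = (\<integral>x. cmean f x \<partial>\<mu>)"
definition pY :: "(real \<Rightarrow> real \<Rightarrow> real) \<Rightarrow> real" where "pY f = (\<integral>x. (cmean f x)\<^sup>2 \<partial>\<mu>)"
definition vY :: "(real \<Rightarrow> real \<Rightarrow> real) \<Rightarrow> real" where "vY f = mY (\<lambda>x e. (f x e)\<^sup>2) - (mY f)\<^sup>2"
definition rho :: "(real \<Rightarrow> real \<Rightarrow> real) \<Rightarrow> real" where "rho f = (pY f - (mY f)\<^sup>2) / vY f"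

definition centre :: "(real \<Rightarrow> real \<Rightarrow> real) \<Rightarrow> real \<Rightarrow> real \<Rightarrow> real" where
  "centre f x e = f x e - cmean f x"

text \<open>The influence function of the estimator, that is \<open>v(f)\<close> applied to the centred linear parts of the
  three averages; the quadratic part is the product of neighbouring noises in \<open>lin1\<close>.\<close>

definition infl :: "(real \<Rightarrow> real \<Rightarrow> real) \<Rightarrow> real \<Rightarrow> real \<Rightarrow> real" where
  "infl f x e = (1 / vY f) * ((2 * cmean f x * f x e - (cmean f x)\<^sup>2 - pY f)
     + 2 * mY f * (rho f - 1) * (f x e - mY f) - rho f * ((f x e)\<^sup>2 - mY (\<lambda>x e. (f x e)\<^sup>2)))"

definition lin1 :: "(real \<Rightarrow> real \<Rightarrow> real) \<Rightarrow> nat \<Rightarrow> (nat \<Rightarrow> real) \<Rightarrow> (nat \<Rightarrow> real) \<Rightarrow> real" where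
  "lin1 f n x e = (\<Sum>i=1..n. infl f (x i) (e i) + 1 / vY f * (centre f (x i) (e i) * centre f (x (right_nb n x i)) (e (right_nb n x i))))"

lemma mu_integrable: assumes "bdd2 (\<lambda>x e. h x)" shows "integrable \<mu> h"
proof -
  obtain B where B: "\<And>x e :: real. \<bar>h x\<bar> \<le> B" using bdd2_bound[OF assms] by blast
  show ?thesis
    by (rule integrable_bdd[OF prob, where B=B]) (simp_all only: borel_measurable_mu bdd2_fst_meas[OF assms] real_norm_def B)
qed

lemma bdd2_centre: "bdd2 f \<Longrightarrow> bdd2 (centre f)"
  unfolding centre_def by (intro bdd2_diff bdd2_cmean)

lemma cmean_centre: "bdd2 f \<Longrightarrow> cmean (centre f) x = 0"
  unfolding centre_def by (rule cmean_centered)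

lemma cmean_diff: "bdd2 f \<Longrightarrow> bdd2 g \<Longrightarrow> cmean (\<lambda>x e. f x e - g x e) x = cmean f x - cmean g x"
  unfolding cmean_def using bdd2_integrable[of f x] bdd2_integrable[of g x] by simp

lemma cmean_mult: "cmean (\<lambda>x e. h x * f x e) x = h x * cmean f x"
  unfolding cmean_def by simp

lemma cmean_fst: "cmean (\<lambda>x e. h x) x = h x"
  unfolding cmean_def using nu.prob_space by simp

lemma moment_bound:
  assumes "bdd2 g" "mY g = 0"
  shows "\<exists>C. \<forall>n. (\<integral>z. (\<Sum>i=1..n. g (fst z i) (snd z i))\<^sup>2 \<partial>joint n) \<le> C * real n"
proof -
  interpret L: clt_setup \<mu> \<nu> "{} :: nat set" "\<lambda>_. 0" "\<lambda>_ _ _. 0" g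
    by unfold_locales (use assms in \<open>simp_all add: bdd2_const mY_def cmean_def\<close>)
  show ?thesis using L.lin_second_moment unfolding L.lin_def by simp
qed

text \<open>Measurability and boundedness at a fixed \<open>n\<close>, with a bound that may grow
  with \<open>n\<close>: the class is closed under arithmetic and supplies the integrability of
  composite statistics.\<close>

definition jbdd :: "nat \<Rightarrow> ((nat \<Rightarrow> real) \<times> (nat \<Rightarrow> real) \<Rightarrow> real) \<Rightarrow> bool" where
  "jbdd n F \<longleftrightarrow> F \<in> borel_measurable (joint n) \<and> (\<exists>B. \<forall>z. \<bar>F z\<bar> \<le> B)"

lemma jbddI: "F \<in> borel_measurable (joint n) \<Longrightarrow> (\<And>z. \<bar>F z\<bar> \<le> B) \<Longrightarrow> jbdd n F"
  unfolding jbdd_def by blast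

lemma jbdd_const: "jbdd n (\<lambda>z. c)" by (rule jbddI[of _ _ "\<bar>c\<bar>"]) auto

lemma jbdd_add: assumes "jbdd n F" "jbdd n G" shows "jbdd n (\<lambda>z. F z + G z)"
proof -
  obtain B C where "\<And>z. \<bar>F z\<bar> \<le> B" "\<And>z. \<bar>G z\<bar> \<le> C" using assms unfolding jbdd_def by metis
  then have "\<bar>F z + G z\<bar> \<le> B + C" for z using abs_triangle_ineq[of "F z" "G z"] add_mono order_trans by blast
  then show ?thesis using assms by (intro jbddI borel_measurable_add) (auto simp: jbdd_def)
qed

lemma jbdd_mult: assumes "jbdd n F" "jbdd n G" shows "jbdd n (\<lambda>z. F z * G z)"
proof -
  obtain B C where b: "\<And>z. \<bar>F z\<bar> \<le> B" "\<And>z. \<bar>G z\<bar> \<le> C" using assms unfolding jbdd_def by metis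
  have "\<bar>F z * G z\<bar> \<le> B * C" for z
    unfolding abs_mult using b(1)[of z] by (intro mult_mono b) auto
  then show ?thesis using assms by (intro jbddI borel_measurable_times) (auto simp: jbdd_def)
qed

lemma jbdd_scale: "jbdd n F \<Longrightarrow> jbdd n (\<lambda>z. c * F z)" by (rule jbdd_mult[OF jbdd_const])

lemma jbdd_diff: assumes "jbdd n F" "jbdd n G" shows "jbdd n (\<lambda>z. F z - G z)"
  using jbdd_add[OF assms(1) jbdd_scale[OF assms(2), of "-1"]] by simp

lemma jbdd_square: "jbdd n F \<Longrightarrow> jbdd n (\<lambda>z. (F z)\<^sup>2)"
  unfolding power2_eq_square by (rule jbdd_mult)

lemma jbdd_sum: "finite I \<Longrightarrow> (\<And>i. i \<in> I \<Longrightarrow> jbdd n (F i)) \<Longrightarrow> jbdd n (\<lambda>z. \<Sum>i\<in>I. F i z)"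
proof (induction I rule: finite_induct)
  case empty then show ?case by (simp add: jbdd_const)
next
  case (insert k I)
  have "jbdd n (\<lambda>z. F k z + (\<Sum>i\<in>I. F i z))" by (rule jbdd_add) (use insert in blast)+
  then show ?case using insert.hyps by simp
qed

lemma jbdd_at: assumes "bdd2 g" "i \<in> {1..n}" shows "jbdd n (\<lambda>z. g (fst z i) (snd z i))"
proof -
  obtain B where B: "\<And>x e. \<bar>g x e\<bar> \<le> B" using bdd2_bound[OF assms(1)] by blast
  show ?thesis by (rule jbddI[OF _ B]) (intro bdd2_meas[OF assms(1)] joint_measurable assms(2))
qed

lemma jbdd_at_nb:
  assumes "bdd2 g" "i \<in> {1..n}" shows "jbdd n (\<lambda>z. g (fst z (right_nb n (fst z) i)) (snd z (right_nb n (fst z) i)))"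
proof -
  obtain B where B: "\<And>x e. \<bar>g x e\<bar> \<le> B" using bdd2_bound[OF assms(1)] by blast
  show ?thesis by (rule jbddI[OF _ B]) (intro bdd2_meas[OF assms(1)] joint_measurable assms(2))
qed

lemma jbdd_integrable: assumes "jbdd n F" shows "integrable (joint n) F"
proof -
  obtain B where "F \<in> borel_measurable (joint n)" "\<And>z. \<bar>F z\<bar> \<le> B" using assms unfolding jbdd_def by blast
  then show ?thesis by (intro integrable_bdd[OF prob_joint, where B=B]) (simp_all only: real_norm_def)
qed

lemma abs_integral_le_sqrt:
  assumes "jbdd n F" "(\<integral>z. (F z)\<^sup>2 \<partial>joint n) \<le> C"
  shows "(\<integral>z. \<bar>F z\<bar> \<partial>joint n) \<le> sqrt C"
proof -
  obtain B where B: "F \<in> borel_measurable (joint n)" "\<And>z. \<bar>F z\<bar> \<le> B" using assms unfolding jbdd_def by blast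
  have "(\<integral>z. \<bar>F z\<bar> \<partial>joint n)\<^sup>2 \<le> (\<integral>z. \<bar>F z\<bar>\<^sup>2 \<partial>joint n)"
    by (rule square_integral_le[OF prob_joint, where B=B]) (use B in auto)
  also have "\<dots> \<le> C" using assms(2) by simp
  finally show ?thesis using real_le_rsqrt by blast
qed


end

lemma min1_triangle: "min 1 \<bar>a - c\<bar> \<le> min 1 \<bar>a - b\<bar> + \<bar>b - c\<bar>" for a b c :: real
  by (auto simp: min_def)

context rank_model
begin

lemma jbdd_sum_at: "bdd2 g \<Longrightarrow> jbdd n (\<lambda>z. \<Sum>i=1..n. g (fst z i) (snd z i))"
  by (intro jbdd_sum jbdd_at) auto

lemma jbdd_sum_prod:
  "bdd2 g \<Longrightarrow> bdd2 h \<Longrightarrow> jbdd n (\<lambda>z. \<Sum>i=1..n. g (fst z i) (snd z i) * h (fst z (right_nb n (fst z) i)) (snd z (right_nb n (fst z) i)))"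
  by (intro jbdd_sum jbdd_mult jbdd_at jbdd_at_nb) auto

lemma sobol_hat_measurable:
  assumes "bdd2 f" shows "(\<lambda>z. sobol_hat n f (fst z) (snd z)) \<in> borel_measurable (joint n)"
proof -
  have "(\<lambda>z. \<Sum>i=1..n. f (fst z i) (snd z i) * f (fst z (right_nb n (fst z) i)) (snd z (right_nb n (fst z) i))) \<in> borel_measurable (joint n)"
    using jbdd_sum_prod[OF assms assms] unfolding jbdd_def by blast
  moreover have "(\<lambda>z. \<Sum>i=1..n. f (fst z i) (snd z i)) \<in> borel_measurable (joint n)"
    using jbdd_sum_at[OF assms] unfolding jbdd_def by blast
  moreover have "(\<lambda>z. \<Sum>i=1..n. (f (fst z i) (snd z i))\<^sup>2) \<in> borel_measurable (joint n)"
    using jbdd_sum_at[OF bdd2_square[OF assms]] unfolding jbdd_def by blast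
  ultimately show ?thesis unfolding sobol_hat_def Let_def by measurable
qed

lemma bdd2_infl: assumes "bdd2 f" shows "bdd2 (infl f)"
  unfolding infl_def
  by (intro bdd2_scale bdd2_add bdd2_diff bdd2_const bdd2_mult bdd2_square bdd2_cmean assms)

lemma cmean_const: "cmean (\<lambda>x e. k) x = k" by (rule cmean_fst)

lemma cmean_scale: "cmean (\<lambda>x e. k * f x e) x = k * cmean f x"
  by (rule cmean_mult)

lemma mY_centred:
  assumes f: "bdd2 f" shows "mY (\<lambda>x e. f x e - mY f) = 0"
proof -
  have e: "cmean (\<lambda>x e. f x e - m) = (\<lambda>x. cmean f x - m)" for m
    using cmean_diff[OF f bdd2_const[of m]] by (simp add: cmean_const fun_eq_iff)
  have "integrable \<mu> (cmean f)" by (intro mu_integrable bdd2_cmean f)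
  then show ?thesis unfolding mY_def[of "\<lambda>x e. f x e - mY f"] e
    using prob_space by (simp add: mY_def)
qed

lemma cmean_product_part:
  assumes "bdd2 f" shows "cmean (\<lambda>x e. 2 * cmean f x * f x e - (cmean f x)\<^sup>2 - p) x = (cmean f x)\<^sup>2 - p"
proof -
  have "cmean (\<lambda>x e. 2 * cmean f x * f x e - (cmean f x)\<^sup>2 - p) x
      = 2 * cmean f x * cmean f x - (cmean f x)\<^sup>2 - p"
    unfolding cmean_def[of "\<lambda>x e. 2 * cmean f x * f x e - (cmean f x)\<^sup>2 - p"]
    using bdd2_integrable[OF assms, of x] nu.prob_space by (simp add: cmean_def[of f])
  then show ?thesis by (simp add: power2_eq_square)
qed

lemma cmean_infl:
  assumes f: "bdd2 f"
  shows "cmean (infl f) x = (1 / vY f) * (((cmean f x)\<^sup>2 - pY f) + 2 * mY f * (rho f - 1) * (cmean f x - mY f)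
     - rho f * (cmean (\<lambda>x e. (f x e)\<^sup>2) x - mY (\<lambda>x e. (f x e)\<^sup>2)))"
proof -
  let ?q = "\<lambda>x e. (f x e)\<^sup>2"
  have i: "integrable \<nu> (f x)" "integrable \<nu> (\<lambda>e. (f x e)\<^sup>2)"
    using bdd2_integrable[OF f, of x] bdd2_integrable[OF bdd2_square[OF f], of x] by simp_all
  have "cmean (infl f) x = (1 / vY f) * ((2 * cmean f x * cmean f x - (cmean f x)\<^sup>2 - pY f)
     + 2 * mY f * (rho f - 1) * (cmean f x - mY f) - rho f * (cmean ?q x - mY ?q))"
    unfolding cmean_def[of "infl f"] infl_def
    using i nu.prob_space by (simp add: cmean_def[of f] cmean_def[of ?q])
  then show ?thesis by (simp add: power2_eq_square)
qed

lemma mY_infl: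
  assumes f: "bdd2 f" shows "mY (infl f) = 0"
proof -
  let ?q = "\<lambda>x e. (f x e)\<^sup>2"
  have i: "integrable \<mu> (cmean f)" "integrable \<mu> (cmean ?q)" "integrable \<mu> (\<lambda>x. (cmean f x)\<^sup>2)"
    by (intro mu_integrable bdd2_cmean bdd2_square f)+
  have "mY (infl f) = (1 / vY f) * ((pY f - pY f) + 2 * mY f * (rho f - 1) * (mY f - mY f) - rho f * (mY ?q - mY ?q))"
    unfolding mY_def[of "infl f"] cmean_infl[OF f]
    using i prob_space by (simp add: mY_def[of f] mY_def[of ?q] pY_def)
  then show ?thesis by simp
qed

lemma lin1_lin:
  assumes f: "bdd2 f"
  shows "clt_setup \<mu> \<nu> {()} (\<lambda>_. centre f) (infl f)"
    and "lin1 f n x e = clt_setup.lin {()} (\<lambda>_. 1 / vY f) (\<lambda>_. centre f) (infl f) n x e"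
proof -
  show L: "clt_setup \<mu> \<nu> {()} (\<lambda>_. centre f) (infl f)"
    by unfold_locales (use f mY_infl[OF f] in \<open>simp_all add: bdd2_centre cmean_centre bdd2_infl mY_def\<close>)
  show "lin1 f n x e = clt_setup.lin {()} (\<lambda>_. 1 / vY f) (\<lambda>_. centre f) (infl f) n x e"
    unfolding lin1_def clt_setup.lin_def[OF L] by simp
qed

lemma lin1_jbdd: "bdd2 f \<Longrightarrow> jbdd n (\<lambda>z. lin1 f n (fst z) (snd z))"
  unfolding lin1_def
  by (intro jbdd_sum jbdd_add jbdd_scale jbdd_mult jbdd_at jbdd_at_nb bdd2_infl bdd2_centre) auto

lemma lin1_second_moment:
  assumes f: "bdd2 f" shows "\<exists>C. \<forall>n. (\<integral>z. (lin1 f n (fst z) (snd z))\<^sup>2 \<partial>joint n) \<le> C * real n"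
  unfolding lin1_lin(2)[OF f] by (rule clt_setup.lin_second_moment[OF lin1_lin(1)[OF f]])

text \<open>Integrated, the deterministic expansion has an error of (1 / s + gap) times a quantity
  of bounded mean. The linear term that it produces differs from the scaled \<open>lin1\<close> by a
  multiple of the reduction error, whose mean square before scaling is of order n times the gap.
  Both contributions vanish because the gap does.\<close>

theorem estimator_linearization:
  assumes f: "bdd2 f" and V0: "vY f > 0"
  shows "(\<lambda>n. \<integral>z. min 1 \<bar>sqrt (real n) * (sobol_hat n f (fst z) (snd z) - (rho f - nb_gap (cmean f) n / (2 * vY f)))
    - 1 / sqrt (real n) * lin1 f n (fst z) (snd z)\<bar> \<partial>joint n) \<longlonglongrightarrow> 0"
proof -
  obtain B where B: "\<And>x e. \<bar>f x e\<bar> \<le> B" and B0: "0 \<le> B" using bdd2_bound[OF f] by blast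
  define m where "m = mY f"
  define V where "V = vY f"
  define m2 where "m2 = mY (\<lambda>x e. (f x e)\<^sup>2)"
  define p where "p = pY f"
  define \<rho> where "\<rho> = rho f"
  define G where "G = nb_gap (cmean f)"
  define N where "N = right_nb"
  let ?\<phi> = "cmean f" and ?c = "centre f"
  have V: "V > 0" "V = m2 - m\<^sup>2" unfolding V_def m2_def m_def using V0 by (simp_all add: vY_def)
  have \<rho>: "\<rho> = (p - m\<^sup>2) / V" unfolding \<rho>_def p_def m_def V_def rho_def ..
  have mB: "\<bar>m\<bar> \<le> B"
  proof -
    have "norm (\<integral>x. cmean f x \<partial>\<mu>) \<le> B"
      by (rule integral_abs_le[OF prob]) (simp only: real_norm_def cmean_bound[OF B])
    then show ?thesis unfolding m_def mY_def real_norm_def .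
  qed
  obtain C where C0: "0 \<le> C" and C: "\<And>s A Y Q \<Delta>. s > 0 \<Longrightarrow> \<bar>Y\<bar> \<le> B \<Longrightarrow> 0 \<le> \<Delta> \<Longrightarrow>
    min 1 \<bar>s * ((A - Y\<^sup>2) / (Q - Y\<^sup>2) - (\<rho> - \<Delta> / (2 * V)))
       - (s * (A - (p - \<Delta> / 2)) + 2 * m * (\<rho> - 1) * (s * (Y - m)) - \<rho> * (s * (Q - m2))) / V\<bar>
    \<le> C * (1 / s + \<Delta>) * (1 + (s * (A - (p - \<Delta> / 2)))\<^sup>2 + (s * (Y - m))\<^sup>2 + (s * (Q - m2))\<^sup>2)"
    by (rule ratio_linearization[OF V mB, where p=p]) (unfold \<rho>[symmetric], blast)
  define S where "S n z = (\<Sum>i=1..n. f (fst z i) (snd z i))" for n :: nat and z :: "(nat \<Rightarrow> real) \<times> (nat \<Rightarrow> real)"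
  define R where "R n z = (\<Sum>i=1..n. (f (fst z i) (snd z i))\<^sup>2)" for n :: nat and z :: "(nat \<Rightarrow> real) \<times> (nat \<Rightarrow> real)"
  define T where "T n z = (\<Sum>i=1..n. f (fst z i) (snd z i) * f (fst z (N n (fst z) i)) (snd z (N n (fst z) i)))" for n :: nat and z :: "(nat \<Rightarrow> real) \<times> (nat \<Rightarrow> real)"
  define U where "U n z = (\<Sum>i=1..n. 2 * ?\<phi> (fst z i) * f (fst z i) (snd z i) - (?\<phi> (fst z i))\<^sup>2
           + ?c (fst z i) (snd z i) * ?c (fst z (N n (fst z) i)) (snd z (N n (fst z) i)))" for n :: nat and z :: "(nat \<Rightarrow> real) \<times> (nat \<Rightarrow> real)"
  \<comment> \<open>\<open>D\<close> is the error of \<open>neighbour_product_reduction\<close>,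
    with the bias n G / 2 added back; \<open>E\<close> is a centred sum of the general form.
    Together they make up n times the centred first average.\<close>
  define D where "D n z = T n z - U n z + real n * G n / 2" for n z
  define E where "E n z = U n z - real n * p" for n z
  have jb: "jbdd n (S n)" "jbdd n (R n)" "jbdd n (T n)" "jbdd n (U n)" for n
    unfolding S_def R_def T_def U_def N_def
    by (intro jbdd_sum jbdd_add jbdd_diff jbdd_scale jbdd_mult jbdd_const jbdd_square jbdd_at jbdd_at_nb f bdd2_centre
      jbdd_at[of "\<lambda>x e. ?\<phi> x"] bdd2_cmean; simp)+
  have jD: "jbdd n (D n)" "jbdd n (E n)" for n
    unfolding D_def E_def by (intro jbdd_add jbdd_diff jb jbdd_const)+
  have nG: "real n * G n = (\<integral>x. nb_sq n ?\<phi> x \<partial>sample n)" for n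
    by (cases "n = 0") (simp_all add: G_def nb_gap_def nb_sq_def)
  have G0: "0 \<le> G n" for n unfolding G_def by (rule nb_gap_nonneg)
  have Gl: "G \<longlonglongrightarrow> 0" unfolding G_def
    by (rule nb_gap_tendsto_0[OF bdd2_fst_meas[OF bdd2_cmean[OF f]] cmean_bound[OF B]])
  obtain C1 where "\<And>n. (\<integral>z. (D n z)\<^sup>2 \<partial>joint n) \<le> C1 * (real n * G n)"
    using neighbour_product_reduction[OF f] unfolding D_def T_def U_def N_def nG centre_def by blast
  then have C1: "(\<integral>z. (D n z)\<^sup>2 \<partial>joint n) \<le> \<bar>C1\<bar> * (real n * G n)" for n
    by (rule order_trans) (simp add: mult_right_mono G0)
  obtain C2 where C2: "\<And>n. (\<integral>z. (E n z)\<^sup>2 \<partial>joint n) \<le> C2 * real n"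
  proof -
    let ?\<zeta> = "\<lambda>x e. 2 * ?\<phi> x * f x e - (?\<phi> x)\<^sup>2 - p"
    interpret L: clt_setup \<mu> \<nu> "{()}" "\<lambda>_. 1" "\<lambda>_. ?c" ?\<zeta>
    proof unfold_locales
      show "bdd2 ?\<zeta>" by (intro bdd2_scale bdd2_add bdd2_diff bdd2_const bdd2_mult bdd2_square bdd2_cmean f)
      have "integrable \<mu> (\<lambda>x. (?\<phi> x)\<^sup>2)" by (intro mu_integrable bdd2_cmean bdd2_square f)
      then show "(\<integral>x. cmean ?\<zeta> x \<partial>\<mu>) = 0"
        unfolding cmean_product_part[OF f] using prob_space by (simp add: p_def pY_def)
    qed (simp_all add: bdd2_centre cmean_centre f)
    have "E n z = L.lin n (fst z) (snd z)" for n z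
      unfolding E_def U_def L.lin_def N_def by (simp add: sum.distrib sum_subtractf)
    then show ?thesis using L.lin_second_moment that by auto
  qed
  obtain C3 where C3: "\<And>n. (\<integral>z. (S n z - real n * m)\<^sup>2 \<partial>joint n) \<le> C3 * real n"
  proof -
    have "mY (\<lambda>x e. f x e - m) = 0" unfolding m_def by (rule mY_centred[OF f])
    from moment_bound[OF bdd2_diff[OF f bdd2_const] this] show ?thesis
      using that unfolding S_def by (auto simp: sum_subtractf)
  qed
  obtain C4 where C4: "\<And>n. (\<integral>z. (R n z - real n * m2)\<^sup>2 \<partial>joint n) \<le> C4 * real n"
  proof -
    let ?q = "\<lambda>x e. (f x e)\<^sup>2"
    note q = bdd2_square[OF f]
    have "mY (\<lambda>x e. ?q x e - m2) = 0" unfolding m2_def by (rule mY_centred[OF q])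
    from moment_bound[OF bdd2_diff[OF q bdd2_const] this] show ?thesis
      using that unfolding R_def by (auto simp: sum_subtractf)
  qed
  define H where "H n z = min 1 \<bar>sqrt (real n) * (sobol_hat n f (fst z) (snd z) - (\<rho> - G n / (2 * V)))
    - 1 / sqrt (real n) * lin1 f n (fst z) (snd z)\<bar>" for n z
  \<comment> \<open>The last term bounds the L1 norm of \<open>D\<close> / (s V), by Jensen's
    inequality from its second moment.\<close>
  define b where "b n = C * (1 / sqrt (real n) + G n) * (1 + 2 * \<bar>C1\<bar> * G n + 2 * C2 + C3 + C4) + sqrt (\<bar>C1\<bar> * G n) / V" for n
  have le: "(\<integral>z. H n z \<partial>joint n) \<le> b n" if n: "n \<ge> 1" for n
  proof -
    define s where "s = sqrt (real n)"
    have s: "s > 0" "s * s = real n" "1 / s * real n = s" using n by (simp_all add: s_def real_div_sqrt)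
    have s2: "s\<^sup>2 = real n" by (simp add: s_def)
    define a where "a z = 1 / s * (D n z + E n z)" for z
    define y where "y z = 1 / s * (S n z - real n * m)" for z
    define q where "q z = 1 / s * (R n z - real n * m2)" for z
    have sn: "s * (1 / real n * u - v) = 1 / s * (u - real n * v)" for u v
      using s by (simp add: field_simps flip: s(2))
    have j: "jbdd n a" "jbdd n y" "jbdd n q" unfolding a_def y_def q_def
      by (intro jbdd_scale jbdd_add jbdd_diff jb jD jbdd_const)+
    have pt: "H n z \<le> C * (1 / s + G n) * (1 + (a z)\<^sup>2 + (y z)\<^sup>2 + (q z)\<^sup>2) + 1 / (s * V) * \<bar>D n z\<bar>" for z
    proof -
      define L where "L = (a z + 2 * m * (\<rho> - 1) * y z - \<rho> * q z) / V"
      define Z where "Z = s * (sobol_hat n f (fst z) (snd z) - (\<rho> - G n / (2 * V)))"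
      define W where "W = 1 / s * lin1 f n (fst z) (snd z)"
      have hat: "sobol_hat n f (fst z) (snd z) = (1 / real n * T n z - (1 / real n * S n z)\<^sup>2) / (1 / real n * R n z - (1 / real n * S n z)\<^sup>2)"
        unfolding sobol_hat_def Let_def T_def S_def R_def N_def ..
      have SB: "\<bar>1 / real n * S n z\<bar> \<le> B"
      proof -
        have "\<bar>S n z\<bar> \<le> real (card {1..n}) * B" unfolding S_def by (rule sum_abs_bound) (rule B)
        then show ?thesis using n by (simp add: field_simps)
      qed
      have ae: "s * (1 / real n * T n z - (p - G n / 2)) = a z"
      proof -
        have "T n z - real n * (p - G n / 2) = D n z + E n z" unfolding D_def E_def by (simp add: right_diff_distrib)
        then show ?thesis unfolding sn a_def by simp
      qed
      have h1: "min 1 \<bar>Z - L\<bar> \<le> C * (1 / s + G n) * (1 + (a z)\<^sup>2 + (y z)\<^sup>2 + (q z)\<^sup>2)"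
        using C[OF s(1) SB G0[of n], of "1 / real n * T n z" "1 / real n * R n z"]
        unfolding hat[symmetric] ae unfolding sn y_def[symmetric] q_def[symmetric] L_def[symmetric] Z_def[symmetric] .
      have "L - W = 1 / (s * V) * D n z"
      proof -
        have "lin1 f n (fst z) (snd z) = (E n z + 2 * m * (\<rho> - 1) * (S n z - real n * m) - \<rho> * (R n z - real n * m2)) / V"
          unfolding lin1_def infl_def V_def[symmetric] m_def[symmetric] \<rho>_def[symmetric] p_def[symmetric] m2_def[symmetric]
            E_def U_def S_def R_def N_def
          by (simp add: sum.distrib sum_subtractf sum_distrib_left[symmetric] sum_divide_distrib[symmetric] add_divide_distrib diff_divide_distrib)
        moreover have "(r * (d + e) + 2 * m * (\<rho> - 1) * (r * u) - \<rho> * (r * w)) / V - r * ((e + 2 * m * (\<rho> - 1) * u - \<rho> * w) / V) = r / V * d"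
          for r d e u w using V(1) by (simp add: field_simps)
        ultimately show ?thesis unfolding L_def W_def a_def y_def q_def by (simp only:) simp
      qed
      then have h2: "\<bar>L - W\<bar> = 1 / (s * V) * \<bar>D n z\<bar>" using s(1) V(1) by (simp add: abs_mult)
      have h3: "H n z \<le> min 1 \<bar>Z - L\<bar> + \<bar>L - W\<bar>"
        unfolding H_def Z_def W_def s_def[symmetric] by (rule min1_triangle)
      show ?thesis using order_trans[OF h3 add_right_mono[OF h1]] unfolding h2 .
    qed
    have jH: "integrable (joint n) (H n)"
    proof -
      have "H n \<in> borel_measurable (joint n)" unfolding H_def
        by (intro borel_measurable_min borel_measurable_const borel_measurable_abs borel_measurable_diff borel_measurable_times
          sobol_hat_measurable[OF f]) (use lin1_jbdd[OF f, of n] in \<open>simp add: jbdd_def\<close>)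
      then show ?thesis by (rule integrable_bdd[OF prob_joint, where B=1]) (simp add: H_def min_def)
    qed
    have i: "integrable (joint n) (\<lambda>z. (a z)\<^sup>2)" "integrable (joint n) (\<lambda>z. (y z)\<^sup>2)" "integrable (joint n) (\<lambda>z. (q z)\<^sup>2)"
      by (intro jbdd_integrable jbdd_square j)+
    have iD: "integrable (joint n) (\<lambda>z. \<bar>D n z\<bar>)" using jbdd_integrable[OF jD(1)] by simp
    interpret J: prob_space "joint n" by (rule prob_joint)
    have sc: "(\<integral>z. (1 / s * F z)\<^sup>2 \<partial>joint n) \<le> c" if "(\<integral>z. (F z)\<^sup>2 \<partial>joint n) \<le> c * real n" for F c
    proof -
      have "(\<integral>z. (1 / s * F z)\<^sup>2 \<partial>joint n) = (\<integral>z. (F z)\<^sup>2 \<partial>joint n) / real n"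
        using s2 by (simp add: power_divide)
      then show ?thesis using that n by (simp add: divide_le_eq)
    qed
    have "(\<integral>z. (D n z + E n z)\<^sup>2 \<partial>joint n) \<le> 2 * (\<integral>z. (D n z)\<^sup>2 \<partial>joint n) + 2 * (\<integral>z. (E n z)\<^sup>2 \<partial>joint n)"
    proof -
      obtain b1 b2 where "\<And>z. \<bar>D n z\<bar> \<le> b1" "\<And>z. \<bar>E n z\<bar> \<le> b2" using jD[of n] unfolding jbdd_def by blast
      then show ?thesis using jD[of n] unfolding jbdd_def by (intro integral_sq_add_le) auto
    qed
    also have "\<dots> \<le> (2 * \<bar>C1\<bar> * G n + 2 * C2) * real n" using C1[of n] C2[of n] by (simp add: algebra_simps)
    finally have Ea: "(\<integral>z. (a z)\<^sup>2 \<partial>joint n) \<le> 2 * \<bar>C1\<bar> * G n + 2 * C2" unfolding a_def by (rule sc)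
    have Ey: "(\<integral>z. (y z)\<^sup>2 \<partial>joint n) \<le> C3" unfolding y_def by (rule sc[OF C3])
    have Eq: "(\<integral>z. (q z)\<^sup>2 \<partial>joint n) \<le> C4" unfolding q_def by (rule sc[OF C4])
    have ED: "1 / (s * V) * (\<integral>z. \<bar>D n z\<bar> \<partial>joint n) \<le> sqrt (\<bar>C1\<bar> * G n) / V"
    proof -
      have "(\<integral>z. \<bar>D n z\<bar> \<partial>joint n) \<le> s * sqrt (\<bar>C1\<bar> * G n)"
        using abs_integral_le_sqrt[OF jD(1) C1[of n]] by (simp add: s_def real_sqrt_mult mult_ac)
      then have "1 / (s * V) * (\<integral>z. \<bar>D n z\<bar> \<partial>joint n) \<le> 1 / (s * V) * (s * sqrt (\<bar>C1\<bar> * G n))"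
        using s(1) V(1) by (intro mult_left_mono) auto
      then show ?thesis using s(1) by simp
    qed
    have "(\<integral>z. H n z \<partial>joint n) \<le> (\<integral>z. C * (1 / s + G n) * (1 + (a z)\<^sup>2 + (y z)\<^sup>2 + (q z)\<^sup>2) + 1 / (s * V) * \<bar>D n z\<bar> \<partial>joint n)"
      by (rule integral_mono[OF jH]) (use i iD pt in \<open>auto intro!: Bochner_Integration.integrable_add\<close>)
    also have "\<dots> = C * (1 / s + G n) * (1 + (\<integral>z. (a z)\<^sup>2 \<partial>joint n) + (\<integral>z. (y z)\<^sup>2 \<partial>joint n) + (\<integral>z. (q z)\<^sup>2 \<partial>joint n))
        + 1 / (s * V) * (\<integral>z. \<bar>D n z\<bar> \<partial>joint n)"
      using i iD J.prob_space by simp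
    also have "\<dots> \<le> C * (1 / s + G n) * (1 + (2 * \<bar>C1\<bar> * G n + 2 * C2) + C3 + C4) + sqrt (\<bar>C1\<bar> * G n) / V"
      using C0 s(1) G0[of n] by (intro add_mono mult_left_mono Ea Ey Eq ED order_refl) auto
    finally show ?thesis unfolding b_def s_def by (simp add: add.assoc)
  qed
  have H0: "0 \<le> (\<integral>z. H n z \<partial>joint n)" for n
    by (rule Bochner_Integration.integral_nonneg) (simp add: H_def)
  have "b \<longlonglongrightarrow> C * (0 + 0) * (1 + 2 * \<bar>C1\<bar> * 0 + 2 * C2 + C3 + C4) + sqrt (\<bar>C1\<bar> * 0) / V"
    unfolding b_def
  proof (intro tendsto_intros Gl)
    show "(\<lambda>n. 1 / sqrt (real n)) \<longlonglongrightarrow> 0" using tendsto_real_sqrt[OF lim_1_over_n] by (simp add: real_sqrt_divide)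
  qed (use V in simp)
  then have "b \<longlonglongrightarrow> 0" by simp
  then have "(\<lambda>n. \<integral>z. H n z \<partial>joint n) \<longlonglongrightarrow> 0"
    by (rule tendsto_sandwich[OF _ _ tendsto_const, rotated 2])
      (auto intro!: always_eventually H0 eventually_sequentiallyI[of 1] le)
  then show ?thesis unfolding H_def \<rho>_def G_def V_def .
qed

end

section \<open>The limiting covariance\<close>

lemma inner_matrix_vector:
  fixes A :: "real ^ 'n ^ 'm" shows "x \<bullet> (A *v y) = (\<Sum>i\<in>UNIV. \<Sum>j\<in>UNIV. x $ i * y $ j * A $ i $ j)"
  by (simp add: inner_vec_def matrix_vector_mult_def sum_distrib_left mult_ac)

lemma cov_sum:
  fixes U :: "'i::finite \<Rightarrow> 'a \<Rightarrow> real" and W :: "'j::finite \<Rightarrow> 'a \<Rightarrow> real"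
  assumes M: "prob_space M" and U: "\<And>i. integrable M (U i)" and W: "\<And>j. integrable M (W j)"
    and UW: "\<And>i j. integrable M (\<lambda>\<omega>. U i \<omega> * W j \<omega>)"
  shows "cov M (\<lambda>\<omega>. \<Sum>i\<in>UNIV. a i * U i \<omega>) (\<lambda>\<omega>. \<Sum>j\<in>UNIV. b j * W j \<omega>)
    = (\<Sum>i\<in>UNIV. \<Sum>j\<in>UNIV. a i * b j * cov M (U i) (W j))"
proof -
  interpret prob_space M by fact
  have i: "integrable M (\<lambda>\<omega>. (U i \<omega> - u) * (W j \<omega> - w))" for i j u w
  proof -
    have "integrable M (\<lambda>\<omega>. U i \<omega> * W j \<omega> - w * U i \<omega> - u * W j \<omega> + u * w)"
      by (intro Bochner_Integration.integrable_add Bochner_Integration.integrable_diff UW integrable_mult_right U W integrable_const)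
    then show ?thesis by (simp add: algebra_simps)
  qed
  define EU where "EU i = (\<integral>\<omega>. U i \<omega> \<partial>M)" for i
  define EW where "EW j = (\<integral>\<omega>. W j \<omega> \<partial>M)" for j
  have eU: "(\<integral>\<omega>. (\<Sum>i\<in>UNIV. a i * U i \<omega>) \<partial>M) = (\<Sum>i\<in>UNIV. a i * EU i)"
    using U by (simp add: EU_def)
  have eW: "(\<integral>\<omega>. (\<Sum>j\<in>UNIV. b j * W j \<omega>) \<partial>M) = (\<Sum>j\<in>UNIV. b j * EW j)"
    using W by (simp add: EW_def)
  have "cov M (\<lambda>\<omega>. \<Sum>i\<in>UNIV. a i * U i \<omega>) (\<lambda>\<omega>. \<Sum>j\<in>UNIV. b j * W j \<omega>)
    = (\<integral>\<omega>. (\<Sum>i\<in>UNIV. \<Sum>j\<in>UNIV. a i * b j * ((U i \<omega> - EU i) * (W j \<omega> - EW j))) \<partial>M)"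
    unfolding cov_def eU eW
    by (simp only: sum_subtractf[symmetric] right_diff_distrib[symmetric] sum_product) (simp only: mult_ac)
  also have "\<dots> = (\<Sum>i\<in>UNIV. \<Sum>j\<in>UNIV. a i * b j * (\<integral>\<omega>. (U i \<omega> - EU i) * (W j \<omega> - EW j) \<partial>M))"
    using i by simp
  finally show ?thesis unfolding cov_def EU_def EW_def .
qed

lemma cov_shift:
  assumes "prob_space M" "integrable M U" "integrable M W"
  shows "cov M (\<lambda>\<omega>. U \<omega> + a) (\<lambda>\<omega>. W \<omega> + b) = cov M U W"
proof -
  interpret prob_space M by fact
  show ?thesis unfolding cov_def using assms(2,3) prob_space by simp
qed

lemma cov_matrix_bilinear:
  fixes U :: "'a \<Rightarrow> real ^ 'm" and W :: "'a \<Rightarrow> real ^ 'n"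
  assumes "prob_space M" "\<And>i. integrable M (\<lambda>\<omega>. U \<omega> $ i)" "\<And>j. integrable M (\<lambda>\<omega>. W \<omega> $ j)"
    "\<And>i j. integrable M (\<lambda>\<omega>. U \<omega> $ i * W \<omega> $ j)"
  shows "v \<bullet> (cov_matrix M U W *v w) = cov M (\<lambda>\<omega>. v \<bullet> U \<omega>) (\<lambda>\<omega>. w \<bullet> W \<omega>)"
proof -
  have "cov M (\<lambda>\<omega>. v \<bullet> U \<omega>) (\<lambda>\<omega>. w \<bullet> W \<omega>) = (\<Sum>i\<in>UNIV. \<Sum>j\<in>UNIV. v $ i * w $ j * cov M (\<lambda>\<omega>. U \<omega> $ i) (\<lambda>\<omega>. W \<omega> $ j))"
    unfolding inner_vec_def inner_real_def by (rule cov_sum) (use assms in auto)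
  then show ?thesis unfolding inner_matrix_vector cov_matrix_def by simp
qed

section \<open>The limiting quadratic form in the product model\<close>

context rank_model
begin

definition covn :: "(real \<Rightarrow> real \<Rightarrow> real) \<Rightarrow> (real \<Rightarrow> real \<Rightarrow> real) \<Rightarrow> real \<Rightarrow> real" where
  "covn f g x = cov \<nu> (f x) (g x)"

lemma covn_alt: "covn f g x = cmean (\<lambda>x e. centre f x e * centre g x e) x"
  unfolding covn_def cov_def centre_def cmean_def ..

lemma bdd2_covn: "bdd2 f \<Longrightarrow> bdd2 g \<Longrightarrow> bdd2 (\<lambda>x e. covn f g x)"
  unfolding covn_alt by (intro bdd2_cmean bdd2_mult bdd2_centre)

text \<open>The quadratic form \<open>v(f)\<^sup>T (\<Sigma>\<^sub>0 + \<Sigma>\<^sub>1) v(g)\<close>, split into the fluctuation of the conditional means, that of the noises,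
  and that of the products of neighbouring noises.\<close>

definition gam :: "(real \<Rightarrow> real \<Rightarrow> real) \<Rightarrow> (real \<Rightarrow> real \<Rightarrow> real) \<Rightarrow> real" where
  "gam f g = cov \<mu> (cmean (infl f)) (cmean (infl g)) + (\<integral>x. covn (infl f) (infl g) x \<partial>\<mu>)
     + 1 / vY f * (1 / vY g) * (\<integral>x. (covn f g x)\<^sup>2 \<partial>\<mu>)"

lemma covn_sym: "covn f g x = covn g f x" unfolding covn_def cov_def by (simp add: mult.commute)

lemma gam_sym: "gam f g = gam g f"
  unfolding gam_def covn_sym[of f g] covn_sym[of "infl f"] by (simp add: cov_def mult.commute)

text \<open>\<open>vvec\<close>, \<open>Uv\<close>, \<open>Wv\<close>, \<open>Pv\<close>,
  \<open>Sa\<close> and \<open>S1\<close> mirror the vectors and matrices that make up Gamma, with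
  expectations taken under \<open>\<mu>\<close> and \<open>\<nu>\<close>.\<close>

definition vvec :: "(real \<Rightarrow> real \<Rightarrow> real) \<Rightarrow> real ^ 3" where
  "vvec f = (1 / vY f) *\<^sub>R vector [1, 2 * mY f * (rho f - 1), - rho f]"
definition Uv :: "(real \<Rightarrow> real \<Rightarrow> real) \<Rightarrow> real \<Rightarrow> real ^ 3" where
  "Uv f x = vector [(cmean f x)\<^sup>2, cmean f x, cmean (\<lambda>x e. (f x e)\<^sup>2) x]"
definition Wv :: "(real \<Rightarrow> real \<Rightarrow> real) \<Rightarrow> real \<Rightarrow> real \<Rightarrow> real ^ 3" where
  "Wv f x e = vector [f x e, f x e, (f x e)\<^sup>2]"
definition Pv :: "(real \<Rightarrow> real \<Rightarrow> real) \<Rightarrow> real \<Rightarrow> real ^ 3" where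
  "Pv f x = vector [2 * cmean f x, 1, 1]"
definition Sa :: "(real \<Rightarrow> real \<Rightarrow> real) \<Rightarrow> (real \<Rightarrow> real \<Rightarrow> real) \<Rightarrow> real \<Rightarrow> real ^ 3 ^ 3" where
  "Sa f g x = outer (Pv f x) (Pv g x) + covn f g x *\<^sub>R outer (vector [1, 0, 0]) (vector [1, 0, 0])"
definition S1 :: "(real \<Rightarrow> real \<Rightarrow> real) \<Rightarrow> (real \<Rightarrow> real \<Rightarrow> real) \<Rightarrow> real ^ 3 ^ 3" where
  "S1 f g = (\<chi> i j. \<integral>x. hadamard (Sa f g x) (cov_matrix \<nu> (Wv f x) (Wv g x)) $ i $ j \<partial>\<mu>)"

lemma bdd2_Uv: "bdd2 f \<Longrightarrow> bdd2 (\<lambda>x e. Uv f x $ i)"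
  using exhaust_3[of i] by (elim disjE) (simp_all add: Uv_def bdd2_square bdd2_cmean)

lemma bdd2_Wv: "bdd2 f \<Longrightarrow> bdd2 (\<lambda>x e. Wv f x e $ i)"
  using exhaust_3[of i] by (elim disjE) (simp_all add: Wv_def bdd2_square)

lemma bdd2_Pv: "bdd2 f \<Longrightarrow> bdd2 (\<lambda>x e. Pv f x $ i)"
  using exhaust_3[of i] by (elim disjE) (simp_all add: Pv_def bdd2_scale bdd2_cmean bdd2_const)

text \<open>The component of \<open>Uv\<close> along \<open>vvec\<close> is the conditional mean of
  the influence function up to a constant, and covariances ignore constants.\<close>

lemma vvec_S0:
  assumes f: "bdd2 f" and g: "bdd2 g"
  shows "vvec f \<bullet> (cov_matrix \<mu> (Uv f) (Uv g) *v vvec g) = cov \<mu> (cmean (infl f)) (cmean (infl g))"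
proof -
  have "vvec f \<bullet> (cov_matrix \<mu> (Uv f) (Uv g) *v vvec g) = cov \<mu> (\<lambda>x. vvec f \<bullet> Uv f x) (\<lambda>x. vvec g \<bullet> Uv g x)"
    by (rule cov_matrix_bilinear[OF prob]; rule mu_integrable; intro bdd2_mult bdd2_Uv f g)
  moreover have "\<exists>a. \<forall>x. vvec h \<bullet> Uv h x = cmean (infl h) x + a" if "bdd2 h" for h
    unfolding cmean_infl[OF that] vvec_def Uv_def inner_vec_def sum_3
    by (rule exI[of _ "(1 / vY h) * (pY h + 2 * mY h * (rho h - 1) * mY h - rho h * mY (\<lambda>x e. (h x e)\<^sup>2))"]) (simp add: algebra_simps)
  then obtain a b where "\<And>x. vvec f \<bullet> Uv f x = cmean (infl f) x + a" "\<And>x. vvec g \<bullet> Uv g x = cmean (infl g) x + b"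
    using f g by metis
  ultimately show ?thesis
    using cov_shift[OF prob mu_integrable[OF bdd2_cmean[OF bdd2_infl[OF f]]] mu_integrable[OF bdd2_cmean[OF bdd2_infl[OF g]]]] by simp
qed

text \<open>The outer product in \<open>Sa\<close> multiplies entry (i, j) by a product of weights,
  so its Hadamard product with a covariance matrix is the covariance matrix of reweighted vectors.
  Weighted by \<open>Pv\<close> and \<open>vvec\<close>, the entries of \<open>Wv\<close> add up to
  the influence function plus a term in x alone. The corner entry adds the square of the conditional
  covariance.\<close>

lemma vvec_S1:
  assumes f: "bdd2 f" and g: "bdd2 g"
  shows "vvec f \<bullet> (S1 f g *v vvec g) = (\<integral>x. covn (infl f) (infl g) x \<partial>\<mu>) + 1 / vY f * (1 / vY g) * (\<integral>x. (covn f g x)\<^sup>2 \<partial>\<mu>)"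
proof -
  let ?v = "vvec f" and ?w = "vvec g"
  define B where "B i j x = cov \<nu> (\<lambda>e. Wv f x e $ i) (\<lambda>e. Wv g x e $ j)" for i j x
  have B2: "bdd2 (\<lambda>x e. B i j x)" for i j
    using bdd2_covn[OF bdd2_Wv[OF f, of i] bdd2_Wv[OF g, of j]] unfolding covn_def B_def .
  define e1 where "e1 = (vector [1, 0, 0] :: real ^ 3)"
  have ent: "hadamard (Sa f g x) (cov_matrix \<nu> (Wv f x) (Wv g x)) $ i $ j
      = Pv f x $ i * Pv g x $ j * B i j x + e1 $ i * e1 $ j * (covn f g x * B i j x)" for i j x
    unfolding hadamard_def Sa_def outer_def cov_matrix_def B_def e1_def by (simp add: algebra_simps)
  have i1: "integrable \<mu> (\<lambda>x. Pv f x $ i * Pv g x $ j * B i j x)" "integrable \<mu> (\<lambda>x. covn f g x * B i j x)" for i j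
    by (intro mu_integrable bdd2_mult bdd2_Pv bdd2_covn B2 f g)+
  have "?v \<bullet> (S1 f g *v ?w)
    = (\<Sum>i\<in>UNIV. \<Sum>j\<in>UNIV. ?v $ i * ?w $ j * ((\<integral>x. Pv f x $ i * Pv g x $ j * B i j x \<partial>\<mu>) + e1 $ i * e1 $ j * (\<integral>x. covn f g x * B i j x \<partial>\<mu>)))"
    unfolding inner_matrix_vector S1_def ent using i1 by simp
  also have "\<dots> = (\<Sum>i\<in>UNIV. \<Sum>j\<in>UNIV. ?v $ i * ?w $ j * (\<integral>x. Pv f x $ i * Pv g x $ j * B i j x \<partial>\<mu>)) + ?v $ 1 * ?w $ 1 * (\<integral>x. covn f g x * B 1 1 x \<partial>\<mu>)"
    by (simp add: distrib_left sum.distrib) (simp add: sum_3 e1_def)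
  also have "?v $ 1 * ?w $ 1 * (\<integral>x. covn f g x * B 1 1 x \<partial>\<mu>) = 1 / vY f * (1 / vY g) * (\<integral>x. (covn f g x)\<^sup>2 \<partial>\<mu>)"
    by (simp add: vvec_def B_def Wv_def covn_def power2_eq_square)
  also have "(\<Sum>i\<in>UNIV. \<Sum>j\<in>UNIV. ?v $ i * ?w $ j * (\<integral>x. Pv f x $ i * Pv g x $ j * B i j x \<partial>\<mu>))
    = (\<integral>x. (\<Sum>i\<in>UNIV. \<Sum>j\<in>UNIV. (?v $ i * Pv f x $ i) * (?w $ j * Pv g x $ j) * B i j x) \<partial>\<mu>)"
  proof -
    have e: "(?v $ i * Pv f x $ i) * (?w $ j * Pv g x $ j) * B i j x = ?v $ i * ?w $ j * (Pv f x $ i * Pv g x $ j * B i j x)" for i j x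
      by simp
    show ?thesis unfolding e using i1 by simp
  qed
  also have "\<dots> = (\<integral>x. covn (infl f) (infl g) x \<partial>\<mu>)"
  proof (rule Bochner_Integration.integral_cong[OF refl])
    fix x
    have "(\<Sum>i\<in>UNIV. \<Sum>j\<in>UNIV. (?v $ i * Pv f x $ i) * (?w $ j * Pv g x $ j) * B i j x)
      = cov \<nu> (\<lambda>e. \<Sum>i\<in>UNIV. (?v $ i * Pv f x $ i) * Wv f x e $ i) (\<lambda>e. \<Sum>j\<in>UNIV. (?w $ j * Pv g x $ j) * Wv g x e $ j)"
      unfolding B_def
      by (rule cov_sum[symmetric, OF prob_nu])
        (intro bdd2_integrable[OF bdd2_Wv] bdd2_integrable[OF bdd2_mult[OF bdd2_Wv bdd2_Wv]] f g)+
    also have "\<dots> = covn (infl f) (infl g) x"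
    proof -
      have "\<exists>a. \<forall>e. (\<Sum>i\<in>UNIV. (vvec h $ i * Pv h x $ i) * Wv h x e $ i) = infl h x e + a" for h
        unfolding infl_def vvec_def Pv_def Wv_def sum_3
        by (rule exI[of _ "(1 / vY h) * ((cmean h x)\<^sup>2 + pY h + 2 * mY h * (rho h - 1) * mY h - rho h * mY (\<lambda>x e. (h x e)\<^sup>2))"]) (simp add: algebra_simps)
      then obtain a b where "\<And>e. (\<Sum>i\<in>UNIV. (?v $ i * Pv f x $ i) * Wv f x e $ i) = infl f x e + a"
        "\<And>e. (\<Sum>i\<in>UNIV. (?w $ i * Pv g x $ i) * Wv g x e $ i) = infl g x e + b" by metis
      then show ?thesis unfolding covn_def
        using cov_shift[OF prob_nu bdd2_integrable[OF bdd2_infl[OF f]] bdd2_integrable[OF bdd2_infl[OF g]]] by simp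
    qed
    finally show "(\<Sum>i\<in>UNIV. \<Sum>j\<in>UNIV. (?v $ i * Pv f x $ i) * (?w $ j * Pv g x $ j) * B i j x) = covn (infl f) (infl g) x" .
  qed
  finally show ?thesis .
qed

theorem gam_matrix:
  assumes "bdd2 f" "bdd2 g"
  shows "vvec f \<bullet> ((cov_matrix \<mu> (Uv f) (Uv g) + S1 f g) *v vvec g) = gam f g"
  using vvec_S0[OF assms] vvec_S1[OF assms]
  by (simp add: matrix_vector_mult_add_rdistrib inner_add_right gam_def)

lemma cmean_sum:
  assumes "finite K" "\<And>k. k \<in> K \<Longrightarrow> bdd2 (F k)"
  shows "cmean (\<lambda>x e. \<Sum>k\<in>K. F k x e) x = (\<Sum>k\<in>K. cmean (F k) x)"
  unfolding cmean_def by (rule Bochner_Integration.integral_sum) (rule bdd2_integrable[OF assms(2)])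

text \<open>Cramer-Wold: a linear combination of the statistics is again of the general form, with
  the influence functions combined in \<open>\<zeta>\<close> and weights t_k / Var(Y^k) on the noise
  products. The scalar limit variance is then expanded as a quadratic form in t.\<close>

theorem char_vector:
  fixes f :: "'d::finite \<Rightarrow> real \<Rightarrow> real \<Rightarrow> real"
  assumes f: "\<And>k. bdd2 (f k)"
  shows "(\<lambda>n. \<integral>z. exp (\<i> * complex_of_real (\<Sum>k\<in>UNIV. t k * (1 / sqrt (real n) * lin1 (f k) n (fst z) (snd z)))) \<partial>joint n)
     \<longlonglongrightarrow> complex_of_real (exp (- (\<Sum>k\<in>UNIV. \<Sum>l\<in>UNIV. t k * t l * gam (f k) (f l)) / 2))"
proof -
  define \<zeta> where "\<zeta> x e = (\<Sum>k\<in>UNIV. t k * infl (f k) x e)" for x e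
  have I2: "bdd2 (infl (f k))" for k by (rule bdd2_infl[OF f])
  have cz: "cmean \<zeta> x = (\<Sum>k\<in>UNIV. t k * cmean (infl (f k)) x)" for x
    unfolding \<zeta>_def[abs_def] using cmean_sum[of UNIV "\<lambda>k x e. t k * infl (f k) x e" x] I2
    by (simp add: bdd2_scale cmean_scale)
  have iI: "integrable \<mu> (cmean (infl (f k)))" for k by (intro mu_integrable bdd2_cmean I2)
  have mI: "(\<integral>x. cmean (infl (f k)) x \<partial>\<mu>) = 0" for k using mY_infl[OF f, of k] unfolding mY_def .
  interpret L: clt_setup \<mu> \<nu> UNIV "\<lambda>k. t k * (1 / vY (f k))" "\<lambda>k. centre (f k)" \<zeta>
  proof unfold_locales
    show "bdd2 \<zeta>" unfolding \<zeta>_def[abs_def] by (intro bdd2_sum bdd2_scale I2) simp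
    show "(\<integral>x. cmean \<zeta> x \<partial>\<mu>) = 0" unfolding cz using iI by (simp add: mI)
  qed (simp_all add: bdd2_centre cmean_centre f)
  have lin: "1 / sqrt (real n) * L.lin n x e = (\<Sum>k\<in>UNIV. t k * (1 / sqrt (real n) * lin1 (f k) n x e))" for n x e
  proof -
    have "L.lin n x e = (\<Sum>k\<in>UNIV. t k * lin1 (f k) n x e)"
      unfolding L.lin_def lin1_def \<zeta>_def sum.distrib[symmetric] sum_distrib_left
      by (subst sum.swap) (simp add: distrib_left mult_ac)
    then show ?thesis by (simp add: sum_distrib_left mult_ac)
  qed
  have s2: "L.s2 = (\<Sum>k\<in>UNIV. \<Sum>l\<in>UNIV. t k * t l * cov \<mu> (cmean (infl (f k))) (cmean (infl (f l))))"
  proof -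
    have "L.s2 = (\<integral>x. (\<Sum>k\<in>UNIV. \<Sum>l\<in>UNIV. t k * t l * (cmean (infl (f k)) x * cmean (infl (f l)) x)) \<partial>\<mu>)"
      unfolding L.s2_def cz power2_eq_square sum_product by (simp add: mult_ac)
    moreover have "integrable \<mu> (\<lambda>x. cmean (infl (f k)) x * cmean (infl (f l)) x)" for k l
      by (intro mu_integrable bdd2_mult bdd2_cmean I2)
    ultimately show ?thesis unfolding cov_def mI by simp
  qed
  have eta: "(\<integral>x. cmean (\<lambda>x e. (L.\<eta> x e)\<^sup>2) x \<partial>\<mu>) = (\<Sum>k\<in>UNIV. \<Sum>l\<in>UNIV. t k * t l * (\<integral>x. covn (infl (f k)) (infl (f l)) x \<partial>\<mu>))"
  proof -
    have c: "bdd2 (\<lambda>x e. centre (infl (f k)) x e * centre (infl (f l)) x e)" for k l by (intro bdd2_mult bdd2_centre I2)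
    have "L.\<eta> x e = (\<Sum>k\<in>UNIV. t k * centre (infl (f k)) x e)" for x e
      unfolding L.\<eta>_def cz \<zeta>_def centre_def by (simp add: right_diff_distrib sum_subtractf)
    then have "(L.\<eta> x e)\<^sup>2 = (\<Sum>k\<in>UNIV. \<Sum>l\<in>UNIV. t k * t l * (centre (infl (f k)) x e * centre (infl (f l)) x e))" for x e
      unfolding power2_eq_square by (simp add: sum_product mult_ac)
    then have "cmean (\<lambda>x e. (L.\<eta> x e)\<^sup>2) x = (\<Sum>k\<in>UNIV. \<Sum>l\<in>UNIV. t k * t l * covn (infl (f k)) (infl (f l)) x)" for x
      unfolding covn_alt using c
      by (simp add: cmean_sum bdd2_sum bdd2_scale cmean_scale)
    moreover have "integrable \<mu> (\<lambda>x. covn (infl (f k)) (infl (f l)) x)" for k l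
      by (intro mu_integrable bdd2_covn I2)
    ultimately show ?thesis by simp
  qed
  have sg: "L.\<sigma>2 = (\<Sum>k\<in>UNIV. \<Sum>l\<in>UNIV. t k * t l * (\<integral>x. covn (infl (f k)) (infl (f l)) x \<partial>\<mu>))
    + (\<Sum>k\<in>UNIV. \<Sum>l\<in>UNIV. t k * t l * (1 / vY (f k) * (1 / vY (f l)) * (\<integral>x. (covn (f k) (f l) x)\<^sup>2 \<partial>\<mu>)))"
    unfolding L.\<sigma>2_def eta covn_alt[of "f _" "f _"] by (simp add: mult_ac)
  have "L.s2 + L.\<sigma>2 = (\<Sum>k\<in>UNIV. \<Sum>l\<in>UNIV. t k * t l * gam (f k) (f l))"
    unfolding s2 sg gam_def distrib_left sum.distrib by simp
  then show ?thesis using L.char_lin unfolding lin by simp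
qed

text \<open>The exponential of minus half the form is a limit of characteristic functions, so its
  modulus is at most 1. This supplies the semidefiniteness on which the limit law is built.\<close>

lemma gam_psd:
  fixes f :: "'d::finite \<Rightarrow> real \<Rightarrow> real \<Rightarrow> real"
  assumes f: "\<And>k. bdd2 (f k)"
  shows "0 \<le> (\<Sum>k\<in>UNIV. \<Sum>l\<in>UNIV. t k * t l * gam (f k) (f l))"
proof -
  have b: "norm (\<integral>z. exp (\<i> * complex_of_real (F z)) \<partial>joint n) \<le> 1" for F n
    by (rule integral_abs_le[OF prob_joint]) simp
  have "norm (complex_of_real (exp (- (\<Sum>k\<in>UNIV. \<Sum>l\<in>UNIV. t k * t l * gam (f k) (f l)) / 2))) \<le> 1"
    by (intro Lim_norm_ubound[OF _ char_vector[of f t, OF f]] always_eventually allI b) simp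
  then show ?thesis by simp
qed

end

section \<open>Transfer to the given sample\<close>

lemma sobol_hat_cong:
  assumes "\<And>i. i \<in> {1..n} \<Longrightarrow> x i = x' i" "\<And>i. i \<in> {1..n} \<Longrightarrow> e i = e' i"
  shows "sobol_hat n f x e = sobol_hat n f x' e'"
proof -
  have nb: "right_nb n x = right_nb n x'" by (rule right_nb_cong[OF assms(1)])
  have y: "f (x i) (e i) = f (x' i) (e' i)" if "i \<in> {1..n}" for i using assms that by simp
  have z: "f (x (right_nb n x i)) (e (right_nb n x i)) = f (x' (right_nb n x' i)) (e' (right_nb n x' i))" if "i \<in> {1..n}" for i
    unfolding nb by (rule y[OF right_nb_in[OF that]])
  have "(\<Sum>i=1..n. f (x i) (e i) * f (x (right_nb n x i)) (e (right_nb n x i)))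
      = (\<Sum>i=1..n. f (x' i) (e' i) * f (x' (right_nb n x' i)) (e' (right_nb n x' i)))"
    "(\<Sum>i=1..n. f (x i) (e i)) = (\<Sum>i=1..n. f (x' i) (e' i))"
    "(\<Sum>i=1..n. (f (x i) (e i))\<^sup>2) = (\<Sum>i=1..n. (f (x' i) (e' i))\<^sup>2)"
    by (rule sum.cong[OF refl], simp only: y z)+
  then show ?thesis unfolding sobol_hat_def Let_def by (simp only:)
qed

context rank_model
begin

lemma nb_sq_cong:
  assumes "\<And>i. i \<in> {1..n} \<Longrightarrow> x i = x' i"
  shows "nb_sq n h x = nb_sq n h x'"
proof -
  have nb: "right_nb n x = right_nb n x'" by (rule right_nb_cong[OF assms])
  have z: "x (right_nb n x i) = x' (right_nb n x' i)" if "i \<in> {1..n}" for i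
    unfolding nb by (rule assms[OF right_nb_in[OF that]])
  show ?thesis unfolding nb_sq_def by (rule sum.cong[OF refl], simp only: assms z)
qed

text \<open>Exchanging observations 1 and i leaves the law of the sample unchanged and, off ties,
  carries neighbours to neighbours; all summands therefore have the same mean.\<close>

lemma nb_gap_exchangeable:
  assumes h: "h \<in> borel_measurable borel" and B: "\<And>a. \<bar>h a\<bar> \<le> B" and n: "n \<ge> 1"
  shows "nb_gap h n = (\<integral>x. (h (x 1) - h (x (right_nb n x 1)))\<^sup>2 \<partial>sample n)"
proof -
  define G where "G i x = (h (x i) - h (x (right_nb n x i)))\<^sup>2" for i :: nat and x :: "nat \<Rightarrow> real"
  have Gm: "G i \<in> borel_measurable (sample n)" if "i \<in> {1..n}" for i
    unfolding G_def
    by (intro borel_measurable_power borel_measurable_diff measurable_compose[OF _ h] sample_component measurable_at_nb that)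
  have GB: "norm (G i x) \<le> (2 * B)\<^sup>2" for i x unfolding G_def using square_diff_le[OF B B] by simp
  have Gi: "integrable (sample n) (G i)" if "i \<in> {1..n}" for i
    by (rule integrable_bdd[OF prob_sample Gm[OF that] GB])
  have eq: "(\<integral>x. G i x \<partial>sample n) = (\<integral>x. G 1 x \<partial>sample n)" if i: "i \<in> {1..n}" for i
  proof -
    let ?\<pi> = "Transposition.transpose 1 i"
    have one: "1 \<in> {1..n}" using n by simp
    have \<pi>: "?\<pi> permutes {1..n}" by (rule permutes_swap_id[OF one i])
    \<comment> \<open>With ties the default identity ranking need not follow a relabelling, hence
      the restriction to injective samples.\<close>
    have g: "G 1 (\<lambda>j\<in>{1..n}. x (?\<pi> j)) = G i x" if inj: "inj_on x {1..n}" for x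
    proof -
      let ?y = "\<lambda>j\<in>{1..n}. x (?\<pi> j)"
      have "right_nb n ?y = right_nb n (x \<circ> ?\<pi>)" by (rule right_nb_cong) simp
      moreover have "?y (right_nb n ?y 1) = x (?\<pi> (right_nb n ?y 1))" "?y 1 = x i"
        using right_nb_in[OF one, of ?y] one by simp_all
      ultimately show ?thesis unfolding G_def using right_nb_permute[OF inj \<pi>, of 1] by simp
    qed
    have ae: "AE x in sample n. G i x = G 1 (\<lambda>j\<in>{1..n}. x (?\<pi> j))"
      by (rule AE_mp[OF AE_sample_inj[of n]], intro AE_I2 impI, rule g[symmetric])
    have "(\<lambda>x. \<lambda>j\<in>{1..n}. x (?\<pi> j)) \<in> measurable (sample n) (sample n)"
      unfolding sample_def
      by (rule measurable_restrict) (use permutes_in_image[OF \<pi>] in \<open>auto intro: measurable_component_singleton\<close>)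
    then have "(\<integral>x. G i x \<partial>sample n) = (\<integral>x. G 1 (\<lambda>j\<in>{1..n}. x (?\<pi> j)) \<partial>sample n)"
      by (rule integral_cong_AE[OF Gm[OF i] measurable_compose[OF _ Gm[OF one]] ae])
    also have "\<dots> = (\<integral>x. G 1 x \<partial>sample n)"
      unfolding sample_def by (rule integral_PiM_permute[OF prob \<pi> Gm[OF one, unfolded sample_def]])
    finally show ?thesis .
  qed
  have "(\<integral>x. nb_sq n h x \<partial>sample n) = (\<Sum>i=1..n. \<integral>x. G i x \<partial>sample n)"
    unfolding nb_sq_def G_def[symmetric] by (rule Bochner_Integration.integral_sum) (rule Gi)
  also have "\<dots> = (\<Sum>i=1..n. \<integral>x. G 1 x \<partial>sample n)" by (rule sum.cong[OF refl eq])
  also have "\<dots> = real n * (\<integral>x. G 1 x \<partial>sample n)" by simp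
  finally show ?thesis unfolding nb_gap_def G_def using n by simp
qed

lemma bdd2_Sa_Wv:
  assumes f: "bdd2 f" and g: "bdd2 g"
  shows "bdd2 (\<lambda>x e. hadamard (Sa f g x) (cov_matrix \<nu> (Wv f x) (Wv g x)) $ i $ j)"
proof -
  have "bdd2 (\<lambda>x e. cov \<nu> (\<lambda>e. Wv f x e $ i) (\<lambda>e. Wv g x e $ j))"
    using bdd2_covn[OF bdd2_Wv[OF f, of i] bdd2_Wv[OF g, of j]] unfolding covn_def .
  moreover have "bdd2 (\<lambda>x e. Sa f g x $ i $ j)"
    unfolding Sa_def outer_def by simp (intro bdd2_add bdd2_mult bdd2_Pv bdd2_covn bdd2_const f g)
  ultimately show ?thesis unfolding hadamard_def cov_matrix_def by (simp add: bdd2_mult)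
qed

end

section \<open>The given sample as a sample of the product model\<close>

locale iid_inputs =
  fixes M :: "'a measure" and X \<epsilon> :: "'a \<Rightarrow> real" and Xs \<epsilon>s :: "nat \<Rightarrow> 'a \<Rightarrow> real"
  assumes prob: "prob_space M"
    and X_eps_indep: "prob_space.indep_var M borel X borel \<epsilon>"
    and Xs_indep: "prob_space.indep_vars M (\<lambda>_. borel) Xs {1..}"
    and Xs_copies: "\<forall>i\<ge>1. distr M borel (Xs i) = distr M borel X"
    and eps_indep: "prob_space.indep_vars M (\<lambda>_. borel) \<epsilon>s {1..}"
    and eps_copies: "\<forall>i\<ge>1. distr M borel (\<epsilon>s i) = distr M borel \<epsilon>"
    and seqs_indep: "prob_space.indep_var M
          (\<Pi>\<^sub>M i\<in>{1..}. borel) (\<lambda>\<omega>. \<lambda>i\<in>{1..}. Xs i \<omega>)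
          (\<Pi>\<^sub>M i\<in>{1..}. borel) (\<lambda>\<omega>. \<lambda>i\<in>{1..}. \<epsilon>s i \<omega>)"
    and X_no_atoms: "\<forall>x. measure (distr M borel X) {x} = 0"
begin

sublocale M: prob_space M by (rule prob)

abbreviation "\<mu> \<equiv> distr M borel X"
abbreviation "\<nu> \<equiv> distr M borel \<epsilon>"

lemma X_rv: "X \<in> borel_measurable M" and eps_rv: "\<epsilon> \<in> borel_measurable M"
  by (rule M.indep_var_rv1[OF X_eps_indep], rule M.indep_var_rv2[OF X_eps_indep])

lemma indep_vars_rv: "M.indep_vars N U I \<Longrightarrow> i \<in> I \<Longrightarrow> U i \<in> measurable M (N i)"
  unfolding M.indep_vars_def by blast

lemma Xs_rv: "i \<ge> 1 \<Longrightarrow> Xs i \<in> borel_measurable M"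
  by (rule indep_vars_rv[OF Xs_indep]) simp

lemma eps_s_rv: "i \<ge> 1 \<Longrightarrow> \<epsilon>s i \<in> borel_measurable M"
  by (rule indep_vars_rv[OF eps_indep]) simp

sublocale R: rank_model \<mu> \<nu>
  by (intro rank_model.intro atomless_law.intro rank_model_axioms.intro M.prob_space_distr X_rv eps_rv sets_distr X_no_atoms[rule_format])

text \<open>Restriction to \<open>{1..n}\<close> makes the sample a point of the product space, so
  that its law can be compared with \<open>joint n\<close>.\<close>

definition T :: "nat \<Rightarrow> 'a \<Rightarrow> (nat \<Rightarrow> real) \<times> (nat \<Rightarrow> real)" where
  "T n \<omega> = (\<lambda>i\<in>{1..n}. Xs i \<omega>, \<lambda>i\<in>{1..n}. \<epsilon>s i \<omega>)"

lemma sets_PiM_distr: "sets (PiM I (\<lambda>_. distr M borel u)) = sets (PiM I (\<lambda>_. borel))" for I :: "nat set"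
  by (rule sets_PiM_cong) auto

lemma iid_vector_law:
  fixes U :: "nat \<Rightarrow> 'a \<Rightarrow> real"
  assumes ind: "prob_space.indep_vars M (\<lambda>_. borel) U {1..}" and c: "\<forall>i\<ge>1. distr M borel (U i) = distr M borel u" and n: "n \<ge> 1"
  shows "distr M (PiM {1..n} (\<lambda>_. borel)) (\<lambda>\<omega>. \<lambda>i\<in>{1..n}. U i \<omega>) = PiM {1..n} (\<lambda>_. distr M borel u)"
proof -
  have "M.indep_vars (\<lambda>_. borel) U {1..n}" by (rule M.indep_vars_subset[OF ind]) auto
  moreover have rv: "U i \<in> borel_measurable M" if "i \<in> {1..n}" for i
    by (rule indep_vars_rv[OF ind]) (use that in simp)
  moreover have ne: "{1..n} \<noteq> {}" using n by simp
  ultimately have "distr M (PiM {1..n} (\<lambda>_. borel)) (\<lambda>\<omega>. \<lambda>i\<in>{1..n}. U i \<omega>) = PiM {1..n} (\<lambda>i. distr M borel (U i))"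
    using M.indep_vars_iff_distr_eq_PiM'[where I="{1..n}" and M'="\<lambda>_. borel" and X=U, OF ne rv] by (simp only:)
  also have "\<dots> = PiM {1..n} (\<lambda>_. distr M borel u)" by (rule PiM_cong) (use c in auto)
  finally show ?thesis .
qed

lemma T_measurable: "T n \<in> measurable M (R.joint n)"
  unfolding T_def R.joint_def R.sample_def R.noise_def
  by (intro measurable_Pair measurable_restrict) (auto simp: Xs_rv eps_s_rv)

text \<open>Independence of the two whole sequences passes to their first \<open>n\<close> terms,
  and independence within each sequence turns either half into a product law.\<close>

lemma T_law:
  assumes n: "n \<ge> 1" shows "distr M (R.joint n) (T n) = R.joint n"
proof -
  let ?P = "PiM {1..n} (\<lambda>_. borel) :: (nat \<Rightarrow> real) measure"
  have r: "(\<lambda>g. restrict g {1..n}) \<in> measurable (PiM {1..} (\<lambda>_. borel)) ?P"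
    by (rule measurable_restrict_subset) auto
  have "M.indep_var ?P ((\<lambda>g. restrict g {1..n}) \<circ> (\<lambda>\<omega>. \<lambda>i\<in>{1..}. Xs i \<omega>)) ?P ((\<lambda>g. restrict g {1..n}) \<circ> (\<lambda>\<omega>. \<lambda>i\<in>{1..}. \<epsilon>s i \<omega>))"
    by (rule M.indep_var_compose[OF seqs_indep r r])
  moreover have "((\<lambda>g. restrict g {1..n}) \<circ> (\<lambda>\<omega>. \<lambda>i\<in>{1..}. U i \<omega>)) = (\<lambda>\<omega>. \<lambda>i\<in>{1..n}. U i \<omega>)" for U :: "nat \<Rightarrow> 'a \<Rightarrow> real"
    by (auto simp: fun_eq_iff restrict_def)
  ultimately have "M.indep_var ?P (\<lambda>\<omega>. \<lambda>i\<in>{1..n}. Xs i \<omega>) ?P (\<lambda>\<omega>. \<lambda>i\<in>{1..n}. \<epsilon>s i \<omega>)" by simp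
  then have "distr M ?P (\<lambda>\<omega>. \<lambda>i\<in>{1..n}. Xs i \<omega>) \<Otimes>\<^sub>M distr M ?P (\<lambda>\<omega>. \<lambda>i\<in>{1..n}. \<epsilon>s i \<omega>) = distr M (?P \<Otimes>\<^sub>M ?P) (T n)"
    unfolding M.indep_var_distribution_eq T_def by blast
  then have "R.joint n = distr M (?P \<Otimes>\<^sub>M ?P) (T n)"
    unfolding iid_vector_law[OF Xs_indep Xs_copies n] iid_vector_law[OF eps_indep eps_copies n]
      R.joint_def R.sample_def R.noise_def .
  also have "\<dots> = distr M (R.joint n) (T n)"
    by (rule distr_cong) (auto simp: R.joint_def R.sample_def R.noise_def intro!: sets_pair_measure_cong sets_PiM_distr[symmetric])
  finally show ?thesis ..
qed

lemma integral_T: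
  fixes F :: "_ \<Rightarrow> 'b::{banach,second_countable_topology}"
  assumes "n \<ge> 1" "F \<in> borel_measurable (R.joint n)"
  shows "(\<integral>\<omega>. F (T n \<omega>) \<partial>M) = (\<integral>z. F z \<partial>R.joint n)"
proof -
  have "(\<integral>z. F z \<partial>distr M (R.joint n) (T n)) = (\<integral>\<omega>. F (T n \<omega>) \<partial>M)"
    by (rule integral_distr[OF T_measurable assms(2)])
  then show ?thesis unfolding T_law[OF assms(1)] by simp
qed

lemma integral_T_fst:
  fixes F :: "_ \<Rightarrow> real"
  assumes "n \<ge> 1" "F \<in> borel_measurable (R.sample n)" "\<And>x. \<bar>F x\<bar> \<le> B"
  shows "(\<integral>\<omega>. F (fst (T n \<omega>)) \<partial>M) = (\<integral>x. F x \<partial>R.sample n)"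
proof -
  have m: "(\<lambda>z. F (fst z)) \<in> borel_measurable (R.joint n)"
    unfolding R.joint_def by (rule measurable_compose[OF measurable_fst assms(2)])
  have "(\<integral>\<omega>. F (fst (T n \<omega>)) \<partial>M) = (\<integral>z. F (fst z) \<partial>R.joint n)" by (rule integral_T[OF assms(1) m])
  also have "\<dots> = (\<integral>x. (\<integral>e. F x \<partial>R.noise n) \<partial>R.sample n)"
    by (rule R.joint_sections(1)[where F="\<lambda>x e. F x" and B=B, OF m]) (simp add: assms(3))
  also have "\<dots> = (\<integral>x. F x \<partial>R.sample n)"
    using prob_space.prob_space[OF R.prob_noise, of n] by simp
  finally show ?thesis .
qed

lemma mean_eps_eq: assumes "bdd2 f" shows "mean_eps M \<epsilon> f x = R.cmean f x"
  unfolding mean_eps_def R.cmean_def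
  by (rule integral_distr[symmetric, OF eps_rv]) (use R.bdd2_section[OF assms, of x] in simp)

end

section \<open>Identification of moments, conditional means and covariances\<close>

context iid_inputs
begin

lemma integral_XE:
  assumes f: "bdd2 f"
  shows "(\<integral>\<omega>. f (X \<omega>) (\<epsilon> \<omega>) \<partial>M) = R.mY f"
    and "integrable M (\<lambda>\<omega>. f (X \<omega>) (\<epsilon> \<omega>))"
proof -
  obtain B where B: "\<And>x e. \<bar>f x e\<bar> \<le> B" using bdd2_bound[OF f] by blast
  show "integrable M (\<lambda>\<omega>. f (X \<omega>) (\<epsilon> \<omega>))"
    by (rule integrable_bdd[OF prob bdd2_meas[OF f X_rv eps_rv], where B=B]) (simp add: B)
  interpret P: pair_prob_space \<mu> \<nu>
    using R.prob R.prob_nu by (simp add: pair_prob_space_def pair_sigma_finite_def prob_space_imp_sigma_finite)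
  have law: "\<mu> \<Otimes>\<^sub>M \<nu> = distr M (borel \<Otimes>\<^sub>M borel) (\<lambda>\<omega>. (X \<omega>, \<epsilon> \<omega>))"
    using X_eps_indep unfolding M.indep_var_distribution_eq by blast
  have m: "case_prod f \<in> borel_measurable (borel \<Otimes>\<^sub>M borel)" using f unfolding bdd2_def by blast
  have "borel_measurable (\<mu> \<Otimes>\<^sub>M \<nu>) = borel_measurable (borel \<Otimes>\<^sub>M borel)"
    by (rule measurable_cong_sets[OF sets_pair_measure_cong refl]) auto
  then have m': "case_prod f \<in> borel_measurable (\<mu> \<Otimes>\<^sub>M \<nu>)" using m by blast
  have i: "integrable (\<mu> \<Otimes>\<^sub>M \<nu>) (case_prod f)"
    by (rule integrable_bdd[OF P.prob_space_axioms m', where B=B]) (simp add: case_prod_beta B)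
  have "(\<integral>\<omega>. f (X \<omega>) (\<epsilon> \<omega>) \<partial>M) = (\<integral>p. case_prod f p \<partial>(\<mu> \<Otimes>\<^sub>M \<nu>))"
    unfolding law using integral_distr[OF measurable_Pair[OF X_rv eps_rv] m] by simp
  also have "\<dots> = (\<integral>x. (\<integral>e. f x e \<partial>\<nu>) \<partial>\<mu>)" using P.integral_fst[OF i] by (simp add: case_prod_beta')
  finally show "(\<integral>\<omega>. f (X \<omega>) (\<epsilon> \<omega>) \<partial>M) = R.mY f" unfolding R.mY_def R.cmean_def .
qed

lemma var_eq:
  assumes f: "bdd2 f" shows "var M (\<lambda>\<omega>. f (X \<omega>) (\<epsilon> \<omega>)) = R.vY f"
proof -
  let ?m = "R.mY f"
  note i = integral_XE(2)[OF f] integral_XE(2)[OF bdd2_square[OF f]]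
  have "var M (\<lambda>\<omega>. f (X \<omega>) (\<epsilon> \<omega>)) = (\<integral>\<omega>. (f (X \<omega>) (\<epsilon> \<omega>))\<^sup>2 - 2 * ?m * f (X \<omega>) (\<epsilon> \<omega>) + ?m\<^sup>2 \<partial>M)"
    unfolding var_def integral_XE(1)[OF f] by (simp add: power2_diff algebra_simps)
  also have "\<dots> = R.mY (\<lambda>x e. (f x e)\<^sup>2) - 2 * ?m * ?m + ?m\<^sup>2"
    using i M.prob_space by (simp add: integral_XE(1)[OF f] integral_XE(1)[OF bdd2_square[OF f]])
  finally show ?thesis unfolding R.vY_def by (simp add: power2_eq_square)
qed

lemma integral_X: "g \<in> borel_measurable borel \<Longrightarrow> (\<integral>\<omega>. g (X \<omega>) \<partial>M) = (\<integral>x. g x \<partial>\<mu>)" for g :: "real \<Rightarrow> real"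
  by (rule integral_distr[symmetric, OF X_rv])

text \<open>The candidate is a function of X, and on an event that X lies in S both integrals reduce
  by Fubini's theorem to the integral of \<open>indicator S\<close> times the partial mean.\<close>

lemma conditional_mean:
  assumes f: "bdd2 f"
  shows "AE \<omega> in M. real_cond_exp M (vimage_algebra (space M) X borel) (\<lambda>\<omega>. f (X \<omega>) (\<epsilon> \<omega>)) \<omega> = R.cmean f (X \<omega>)"
proof -
  let ?F = "vimage_algebra (space M) X borel"
  have sub: "subalgebra M ?F"
    unfolding subalgebra_def using sets_image_in_sets[of M "space M" X borel] X_rv by simp
  interpret F: sigma_finite_subalgebra M ?F
    by (rule finite_measure_subalgebra_is_sigma_finite)
      (intro finite_measure_subalgebra.intro finite_measure_subalgebra_axioms.intro M.finite_measure_axioms sub)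
  note c2 = R.bdd2_cmean[OF f]
  show ?thesis
  proof (rule F.real_cond_exp_charact)
    show "integrable M (\<lambda>\<omega>. f (X \<omega>) (\<epsilon> \<omega>))" by (rule integral_XE(2)[OF f])
    show "integrable M (\<lambda>\<omega>. R.cmean f (X \<omega>))" by (rule integral_XE(2)[OF c2])
    have "X \<in> measurable ?F borel" by (rule measurable_vimage_algebra1) simp
    then show "(\<lambda>\<omega>. R.cmean f (X \<omega>)) \<in> borel_measurable ?F"
      by (rule measurable_compose[OF _ bdd2_fst_meas[OF c2]])
    fix A assume "A \<in> sets ?F"
    then obtain S where S: "S \<in> sets borel" "A = X -` S \<inter> space M" by (auto simp: sets_vimage_algebra2)
    have i2: "bdd2 (\<lambda>x e. indicator S x :: real)"
    proof (rule bdd2I[where B=1])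
      show "(\<lambda>p. indicator S (fst p) :: real) \<in> borel_measurable (borel \<Otimes>\<^sub>M borel)"
        by (rule measurable_compose[OF measurable_fst]) (use S in simp)
    qed (simp add: indicator_def)
    have ind: "set_lebesgue_integral M A h = (\<integral>\<omega>. indicator S (X \<omega>) * h \<omega> \<partial>M)" for h :: "'a \<Rightarrow> real"
      unfolding set_lebesgue_integral_def
      by (rule Bochner_Integration.integral_cong[OF refl]) (simp add: S indicator_def)
    have "set_lebesgue_integral M A (\<lambda>\<omega>. f (X \<omega>) (\<epsilon> \<omega>)) = R.mY (\<lambda>x e. indicator S x * f x e)"
      unfolding ind by (rule integral_XE(1)[OF bdd2_mult[OF i2 f]])
    also have "\<dots> = R.mY (\<lambda>x e. indicator S x * R.cmean f x)"
      unfolding R.mY_def R.cmean_mult R.cmean_fst ..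
    also have "\<dots> = set_lebesgue_integral M A (\<lambda>\<omega>. R.cmean f (X \<omega>))"
      unfolding ind by (rule integral_XE(1)[OF bdd2_mult[OF i2 c2], symmetric])
    finally show "set_lebesgue_integral M A (\<lambda>\<omega>. f (X \<omega>) (\<epsilon> \<omega>)) = set_lebesgue_integral M A (\<lambda>\<omega>. R.cmean f (X \<omega>))" .
  qed
qed

lemma sobol_eq:
  assumes f: "bdd2 f" shows "sobol M X \<epsilon> f = R.rho f"
proof -
  note c2 = R.bdd2_cmean[OF f]
  have "(\<integral>\<omega>. (real_cond_exp M (vimage_algebra (space M) X borel) (\<lambda>\<omega>. f (X \<omega>) (\<epsilon> \<omega>)) \<omega>)\<^sup>2 \<partial>M)
    = (\<integral>\<omega>. (R.cmean f (X \<omega>))\<^sup>2 \<partial>M)"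
  proof (rule integral_cong_AE)
    show "(\<lambda>\<omega>. (R.cmean f (X \<omega>))\<^sup>2) \<in> borel_measurable M"
      by (intro borel_measurable_power measurable_compose[OF X_rv bdd2_fst_meas[OF c2]])
    show "AE \<omega> in M. (real_cond_exp M (vimage_algebra (space M) X borel) (\<lambda>\<omega>. f (X \<omega>) (\<epsilon> \<omega>)) \<omega>)\<^sup>2 = (R.cmean f (X \<omega>))\<^sup>2"
      by (rule AE_mp[OF conditional_mean[OF f]]) simp
  qed simp
  also have "\<dots> = R.pY f" unfolding R.pY_def
    by (rule integral_X) (intro borel_measurable_power bdd2_fst_meas[OF c2])
  finally show ?thesis
    unfolding sobol_def R.rho_def R.vY_def integral_XE(1)[OF f] integral_XE(1)[OF bdd2_square[OF f]] by simp
qed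

lemma cov_X:
  assumes "g \<in> borel_measurable borel" "h \<in> borel_measurable borel"
  shows "cov M (\<lambda>\<omega>. g (X \<omega>)) (\<lambda>\<omega>. h (X \<omega>)) = cov \<mu> g h"
  unfolding cov_def integral_X[OF assms(1)] integral_X[OF assms(2)]
  by (rule integral_X) (intro borel_measurable_times borel_measurable_diff assms borel_measurable_const)

lemma cov_eps:
  assumes "g \<in> borel_measurable borel" "h \<in> borel_measurable borel"
  shows "cov M (\<lambda>\<omega>. g (\<epsilon> \<omega>)) (\<lambda>\<omega>. h (\<epsilon> \<omega>)) = cov \<nu> g h"
proof -
  have i: "(\<integral>\<omega>. u (\<epsilon> \<omega>) \<partial>M) = (\<integral>e. u e \<partial>\<nu>)" if "u \<in> borel_measurable borel" for u :: "real \<Rightarrow> real"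
    by (rule integral_distr[symmetric, OF eps_rv that])
  show ?thesis unfolding cov_def i[OF assms(1)] i[OF assms(2)]
    by (rule i) (intro borel_measurable_times borel_measurable_diff assms borel_measurable_const)
qed

lemma section_borel: "bdd2 f \<Longrightarrow> f x \<in> borel_measurable borel"
  using R.bdd2_section[of f x] by (simp add: R.borel_measurable_nu)

lemma v_vec_eq: "bdd2 f \<Longrightarrow> v_vec M X \<epsilon> f = R.vvec f"
  unfolding v_vec_def R.vvec_def by (simp add: var_eq sobol_eq integral_XE(1))

lemma Sigma0_eq:
  assumes f: "bdd2 f" and g: "bdd2 g"
  shows "Sigma0 M X \<epsilon> f g = cov_matrix \<mu> (R.Uv f) (R.Uv g)"
proof -
  have "Sigma0 M X \<epsilon> f g = cov_matrix M (\<lambda>\<omega>. R.Uv f (X \<omega>)) (\<lambda>\<omega>. R.Uv g (X \<omega>))"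
    unfolding Sigma0_def R.Uv_def Let_def using f g by (simp only: mean_eps_eq bdd2_square)
  then show ?thesis unfolding cov_matrix_def
    using cov_X[OF bdd2_fst_meas[OF R.bdd2_Uv[OF f]] bdd2_fst_meas[OF R.bdd2_Uv[OF g]]] by simp
qed

lemma Sigma1_eq:
  assumes f: "bdd2 f" and g: "bdd2 g"
  shows "Sigma1 M X \<epsilon> f g = R.S1 f g"
proof -
  have a: "Sigma_a M \<epsilon> x f g = R.Sa f g x" for x
    unfolding Sigma_a_def R.Sa_def R.Pv_def mean_eps_eq[OF f] mean_eps_eq[OF g] R.covn_def
      cov_eps[OF section_borel[OF f] section_borel[OF g]] ..
  have b: "Sigma_b M \<epsilon> x f g = cov_matrix \<nu> (R.Wv f x) (R.Wv g x)" for x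
  proof -
    have "Sigma_b M \<epsilon> x f g = cov_matrix M (\<lambda>\<omega>. R.Wv f x (\<epsilon> \<omega>)) (\<lambda>\<omega>. R.Wv g x (\<epsilon> \<omega>))"
      unfolding Sigma_b_def R.Wv_def Let_def ..
    then show ?thesis unfolding cov_matrix_def
      using cov_eps[OF section_borel[OF R.bdd2_Wv[OF f]] section_borel[OF R.bdd2_Wv[OF g]]] by simp
  qed
  show ?thesis unfolding Sigma1_def R.S1_def a b
    using integral_X[OF bdd2_fst_meas[OF R.bdd2_Sa_Wv[OF f g]]] by simp
qed

lemma Gamma_eq: "(\<And>k. bdd2 (f k)) \<Longrightarrow> Gamma_mat M X \<epsilon> f $ k $ l = R.gam (f k) (f l)"
  unfolding Gamma_mat_def by (simp add: v_vec_eq Sigma0_eq Sigma1_eq R.gam_matrix)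

text \<open>Both forms depend on the first \<open>n\<close> inputs only, so they may be computed
  under the product law, where exchangeability identifies the one-neighbour form with the
  average.\<close>

lemma Delta_eq:
  assumes h: "h \<in> borel_measurable borel" and B: "\<And>a. \<bar>h a\<bar> \<le> B" and n: "n \<ge> 1"
  shows "Delta M Xs h n = R.nb_gap h n"
    and "(\<integral>\<omega>. R.nb_sq n h (\<lambda>i. Xs i \<omega>) \<partial>M) = real n * R.nb_gap h n"
proof -
  have one: "1 \<in> {1..n}" using n by simp
  define G where "G x = (h (x 1) - h (x (right_nb n x 1)))\<^sup>2" for x :: "nat \<Rightarrow> real"
  have G: "G \<in> borel_measurable (R.sample n)"
    unfolding G_def
    by (intro borel_measurable_power borel_measurable_diff measurable_compose[OF _ h] R.sample_component R.measurable_at_nb one)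
  have nb: "right_nb n (\<lambda>i\<in>{1..n}. x i) = right_nb n x" for x by (rule right_nb_cong) simp
  have e: "G (fst (T n \<omega>)) = G (\<lambda>i. Xs i \<omega>)" for \<omega>
    unfolding G_def T_def fst_conv nb using one right_nb_in[OF one, of "\<lambda>i. Xs i \<omega>"] by simp
  have GB: "\<bar>G x\<bar> \<le> (2 * B)\<^sup>2" for x unfolding G_def using square_diff_le[OF B B] by simp
  show "Delta M Xs h n = R.nb_gap h n"
    unfolding R.nb_gap_exchangeable[OF h B n] Delta_def using integral_T_fst[OF n G GB] unfolding e unfolding G_def .
  have e': "R.nb_sq n h (fst (T n \<omega>)) = R.nb_sq n h (\<lambda>i. Xs i \<omega>)" for \<omega>
    by (rule R.nb_sq_cong) (simp add: T_def)
  have nB: "\<bar>R.nb_sq n h x\<bar> \<le> real n * (2 * B)\<^sup>2" for x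
    using R.nb_sq_bound[OF B] R.nb_sq_nonneg[of n h x] by simp
  show "(\<integral>\<omega>. R.nb_sq n h (\<lambda>i. Xs i \<omega>) \<partial>M) = real n * R.nb_gap h n"
    using integral_T_fst[OF n R.nb_sq_measurable[OF h] nB] n unfolding e' R.nb_gap_def by simp
qed

text \<open>The centring \<open>d\<close> has to agree with the gap over twice the variance only up
  to o(1 / sqrt n), so the version with the bias and the version without it are two instances with
  the same limit law.\<close>

theorem rank_estimator_clt:
  fixes f :: "'d::finite \<Rightarrow> real \<Rightarrow> real \<Rightarrow> real"
  assumes f: "\<And>k. bdd2 (f k)" and V: "\<And>k. R.vY (f k) > 0"
    and N: "gaussian_law N 0 (Gamma_mat M X \<epsilon> f)"
    and d: "\<And>k. (\<lambda>n. sqrt (real n) * (d n k - R.nb_gap (R.cmean (f k)) n / (2 * R.vY (f k)))) \<longlonglongrightarrow> 0"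
  shows "conv_in_law M (\<lambda>n \<omega>. \<chi> k. sqrt (real n) *
     (sobol_hat n (f k) (\<lambda>i. Xs i \<omega>) (\<lambda>i. \<epsilon>s i \<omega>) - (R.rho (f k) - d n k))) N"
proof -
  define Lk where "Lk n k z = 1 / sqrt (real n) * R.lin1 (f k) n (fst z) (snd z)" for n k z
  define Zk where "Zk n k z = sqrt (real n) * (sobol_hat n (f k) (fst z) (snd z) - (R.rho (f k) - d n k))" for n k z
  define W where "W n \<omega> = (\<chi> k. Lk n k (T n \<omega>))" for n \<omega>
  have Lj: "R.jbdd n (Lk n k)" for n k unfolding Lk_def by (intro R.jbdd_scale R.lin1_jbdd f)
  have Lm: "Lk n k \<in> borel_measurable (R.joint n)" for n k using Lj unfolding R.jbdd_def by blast
  have hm: "(\<lambda>z. sobol_hat n (f k) (fst z) (snd z)) \<in> borel_measurable (R.joint n)" for n k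
    by (rule R.sobol_hat_measurable[OF f])
  have Zm: "Zk n k \<in> borel_measurable (R.joint n)" for n k
    unfolding Zk_def by (intro borel_measurable_times borel_measurable_diff borel_measurable_const hm)
  have Zeq: "(\<chi> k. sqrt (real n) * (sobol_hat n (f k) (\<lambda>i. Xs i \<omega>) (\<lambda>i. \<epsilon>s i \<omega>) - (R.rho (f k) - d n k))) = (\<chi> k. Zk n k (T n \<omega>))" for n \<omega>
  proof -
    have "sobol_hat n (f k) (\<lambda>i. Xs i \<omega>) (\<lambda>i. \<epsilon>s i \<omega>) = sobol_hat n (f k) (fst (T n \<omega>)) (snd (T n \<omega>))" for k
      by (rule sobol_hat_cong) (simp_all add: T_def)
    then show ?thesis unfolding Zk_def by simp
  qed
  have comp: "(\<lambda>\<omega>. F (T n \<omega>)) \<in> borel_measurable M" if "F \<in> borel_measurable (R.joint n)" for F :: "_ \<Rightarrow> real" and n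
    by (rule measurable_compose[OF T_measurable that])
  obtain C where C: "\<And>k n. (\<integral>z. (R.lin1 (f k) n (fst z) (snd z))\<^sup>2 \<partial>R.joint n) \<le> C k * real n"
  proof -
    have "\<forall>k. \<exists>C. \<forall>n. (\<integral>z. (R.lin1 (f k) n (fst z) (snd z))\<^sup>2 \<partial>R.joint n) \<le> C * real n"
      by (intro allI R.lin1_second_moment f)
    from choice[OF this] show thesis using that by blast
  qed
  show ?thesis unfolding Zeq
  \<comment> \<open>The bound on the second moments must not depend on the component, hence the sum
    over all of them.\<close>
  proof (rule conv_in_law_slutsky[where W=W and C="\<Sum>k\<in>UNIV. \<bar>C k\<bar>"])
    show "prob_space N" "sets N = sets borel" using N unfolding gaussian_law_def by blast+
    show "(\<lambda>\<omega>. \<chi> k. Zk n k (T n \<omega>)) \<in> borel_measurable M" for n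
      by (rule borel_measurable_vec) (simp add: comp[OF Zm])
    show "W n \<in> borel_measurable M" for n
      by (rule borel_measurable_vec) (simp add: W_def comp[OF Lm])
    show "integrable M (\<lambda>\<omega>. (W n \<omega> $ k)\<^sup>2)" for n k
    proof -
      obtain B where B: "\<And>z. \<bar>Lk n k z\<bar> \<le> B" using Lj[of n k] unfolding R.jbdd_def by blast
      have "norm ((W n \<omega> $ k)\<^sup>2) \<le> B\<^sup>2" for \<omega> unfolding W_def using square_le_of_abs_le[OF B] by simp
      then show ?thesis
        by (rule integrable_bdd[OF prob, rotated]) (simp add: W_def borel_measurable_power comp[OF Lm])
    qed
    show "(\<integral>\<omega>. (W n \<omega> $ k)\<^sup>2 \<partial>M) \<le> (\<Sum>k\<in>UNIV. \<bar>C k\<bar>)" for n k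
    proof -
      have Ck: "\<bar>C k\<bar> \<le> (\<Sum>k\<in>UNIV. \<bar>C k\<bar>)" by (rule member_le_sum) auto
      show ?thesis
      proof (cases "n = 0")
        case True
        then have "(\<integral>\<omega>. (W n \<omega> $ k)\<^sup>2 \<partial>M) = 0" by (simp add: W_def Lk_def)
        then show ?thesis using Ck by linarith
      next
        case False
        have "(\<integral>\<omega>. (W n \<omega> $ k)\<^sup>2 \<partial>M) = (\<integral>z. (Lk n k z)\<^sup>2 \<partial>R.joint n)"
          unfolding W_def vec_lambda_beta
          by (rule integral_T[where F="\<lambda>z. (Lk n k z)\<^sup>2"]) (use False Lm in auto)
        also have "\<dots> = (\<integral>z. (R.lin1 (f k) n (fst z) (snd z))\<^sup>2 \<partial>R.joint n) / real n"
          unfolding Lk_def by (simp add: power_divide)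
        also have "\<dots> \<le> C k" using C[of n k] False by (simp add: divide_le_eq)
        finally show ?thesis using Ck by linarith
      qed
    qed
    show "(\<lambda>n. \<integral>\<omega>. min 1 \<bar>(\<chi> k. Zk n k (T n \<omega>)) $ k - W n \<omega> $ k\<bar> \<partial>M) \<longlonglongrightarrow> 0" for k
    proof -
      define G where "G n = R.nb_gap (R.cmean (f k)) n / (2 * R.vY (f k))" for n
      define Z0 where "Z0 n z = sqrt (real n) * (sobol_hat n (f k) (fst z) (snd z) - (R.rho (f k) - G n))" for n z
      have Z0m: "Z0 n \<in> borel_measurable (R.joint n)" for n
        unfolding Z0_def by (intro borel_measurable_times borel_measurable_diff borel_measurable_const hm)
      have mi: "integrable (R.joint n) (\<lambda>z. min 1 \<bar>F z - Lk n k z\<bar>)" if "F \<in> borel_measurable (R.joint n)" for F n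
        by (rule integrable_bdd[OF R.prob_joint, where B=1])
          (intro borel_measurable_min borel_measurable_const borel_measurable_abs borel_measurable_diff that Lm, simp add: min_def)
      have le: "(\<integral>z. min 1 \<bar>Zk n k z - Lk n k z\<bar> \<partial>R.joint n)
        \<le> (\<integral>z. min 1 \<bar>Z0 n z - Lk n k z\<bar> \<partial>R.joint n) + \<bar>sqrt (real n) * (d n k - G n)\<bar>" for n
      proof -
        interpret J: prob_space "R.joint n" by (rule R.prob_joint)
        have pt: "min 1 \<bar>Zk n k z - Lk n k z\<bar> \<le> min 1 \<bar>Z0 n z - Lk n k z\<bar> + \<bar>sqrt (real n) * (d n k - G n)\<bar>" for z
        proof -
          have "Zk n k z - Lk n k z = (Z0 n z - Lk n k z) + sqrt (real n) * (d n k - G n)"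
            unfolding Zk_def Z0_def by (simp add: algebra_simps)
          then show ?thesis by (simp only:)
        qed
        have "(\<integral>z. min 1 \<bar>Zk n k z - Lk n k z\<bar> \<partial>R.joint n)
          \<le> (\<integral>z. min 1 \<bar>Z0 n z - Lk n k z\<bar> + \<bar>sqrt (real n) * (d n k - G n)\<bar> \<partial>R.joint n)"
          by (rule integral_mono[OF mi[OF Zm] Bochner_Integration.integrable_add[OF mi[OF Z0m] J.integrable_const] pt])
        also have "\<dots> = (\<integral>z. min 1 \<bar>Z0 n z - Lk n k z\<bar> \<partial>R.joint n) + \<bar>sqrt (real n) * (d n k - G n)\<bar>"
          using Bochner_Integration.integral_add[OF mi[OF Z0m[of n]] J.integrable_const] J.prob_space by simp
        finally show ?thesis .
      qed
      have l0: "(\<lambda>n. \<integral>z. min 1 \<bar>Z0 n z - Lk n k z\<bar> \<partial>R.joint n) \<longlonglongrightarrow> 0"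
        using R.estimator_linearization[OF f[of k] V[of k]] unfolding Z0_def Lk_def G_def .
      have l1: "(\<lambda>n. \<bar>sqrt (real n) * (d n k - G n)\<bar>) \<longlonglongrightarrow> 0"
        using tendsto_rabs_zero[OF d[of k]] unfolding G_def .
      have l2: "(\<lambda>n. \<integral>z. min 1 \<bar>Zk n k z - Lk n k z\<bar> \<partial>R.joint n) \<longlonglongrightarrow> 0"
      proof (rule tendsto_sandwich[OF _ _ tendsto_const])
        show "(\<lambda>n. (\<integral>z. min 1 \<bar>Z0 n z - Lk n k z\<bar> \<partial>R.joint n) + \<bar>sqrt (real n) * (d n k - G n)\<bar>) \<longlonglongrightarrow> 0"
          using tendsto_add[OF l0 l1] by simp
        show "\<forall>\<^sub>F n in sequentially. 0 \<le> (\<integral>z. min 1 \<bar>Zk n k z - Lk n k z\<bar> \<partial>R.joint n)"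
          by (intro always_eventually allI Bochner_Integration.integral_nonneg) simp
        show "\<forall>\<^sub>F n in sequentially. (\<integral>z. min 1 \<bar>Zk n k z - Lk n k z\<bar> \<partial>R.joint n)
          \<le> (\<integral>z. min 1 \<bar>Z0 n z - Lk n k z\<bar> \<partial>R.joint n) + \<bar>sqrt (real n) * (d n k - G n)\<bar>"
          by (intro always_eventually allI le)
      qed
      \<comment> \<open>The law of the sample is identified with \<open>joint n\<close> from
        \<open>n = 1\<close> on; a limit ignores the first index.\<close>
      have eqn: "(\<integral>\<omega>. min 1 \<bar>(\<chi> k. Zk n k (T n \<omega>)) $ k - W n \<omega> $ k\<bar> \<partial>M) = (\<integral>z. min 1 \<bar>Zk n k z - Lk n k z\<bar> \<partial>R.joint n)" if "n \<ge> 1" for n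
        unfolding W_def vec_lambda_beta
        by (rule integral_T[where F="\<lambda>z. min 1 \<bar>Zk n k z - Lk n k z\<bar>", OF that])
          (intro borel_measurable_min borel_measurable_const borel_measurable_abs borel_measurable_diff Zm Lm)
      show ?thesis
        by (rule Lim_transform_eventually[OF l2 eventually_sequentiallyI[of 1]]) (rule eqn[symmetric])
    qed
    show "(\<lambda>n. \<integral>\<omega>. exp (\<i> * complex_of_real (t \<bullet> W n \<omega>)) \<partial>M) \<longlonglongrightarrow> (\<integral>y. exp (\<i> * complex_of_real (t \<bullet> y)) \<partial>N)" for t
    proof -
      have NN: "(\<integral>y. exp (\<i> * complex_of_real (t \<bullet> y)) \<partial>N)
        = complex_of_real (exp (- (\<Sum>k\<in>UNIV. \<Sum>l\<in>UNIV. t $ k * t $ l * R.gam (f k) (f l)) / 2))"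
      proof -
        have "exp (\<i> * complex_of_real (t \<bullet> 0) - complex_of_real S / 2) = complex_of_real (exp (- S / 2))" for S
          using exp_of_real[of "- S / 2", where 'a=complex] by simp
        then show ?thesis
          using N unfolding gaussian_law_def inner_matrix_vector Gamma_eq[OF f] by (simp only:)
      qed
      have eqn: "(\<integral>\<omega>. exp (\<i> * complex_of_real (t \<bullet> W n \<omega>)) \<partial>M)
        = (\<integral>z. exp (\<i> * complex_of_real (\<Sum>k\<in>UNIV. t $ k * Lk n k z)) \<partial>R.joint n)" if "n \<ge> 1" for n
      proof -
        have "(\<lambda>z. \<Sum>k\<in>UNIV. t $ k * Lk n k z) \<in> borel_measurable (R.joint n)"
          by (intro borel_measurable_sum borel_measurable_times borel_measurable_const Lm)
        then have "(\<lambda>z. exp (\<i> * complex_of_real (\<Sum>k\<in>UNIV. t $ k * Lk n k z))) \<in> borel_measurable (R.joint n)"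
          by measurable
        from integral_T[OF that this] show ?thesis unfolding W_def inner_vec_def inner_real_def vec_lambda_beta .
      qed
      show ?thesis unfolding NN
        by (rule Lim_transform_eventually[OF R.char_vector[of f "\<lambda>k. t $ k", OF f, folded Lk_def] eventually_sequentiallyI[of 1]])
          (rule eqn[symmetric])
    qed
  qed (rule prob)
qed

end

theorem theorem2p2:
  fixes M :: "'a measure"
    and X \<epsilon> :: "'a \<Rightarrow> real"
    and Xs \<epsilon>s :: "nat \<Rightarrow> 'a \<Rightarrow> real"
    and f :: "'d::finite \<Rightarrow> real \<Rightarrow> real \<Rightarrow> real"
  defines "\<phi> \<equiv> \<lambda>k. mean_eps M \<epsilon> (f k)"
    and "Y \<equiv> \<lambda>k \<omega>. f k (X \<omega>) (\<epsilon> \<omega>)"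
    and "\<rho>hat \<equiv> \<lambda>n k \<omega>. sobol_hat n (f k) (\<lambda>i. Xs i \<omega>) (\<lambda>i. \<epsilon>s i \<omega>)"
    and "\<rho> \<equiv> \<lambda>k. sobol M X \<epsilon> (f k)"
  assumes prob: "prob_space M"
    and X_eps_indep: "prob_space.indep_var M borel X borel \<epsilon>"
    and Xs_indep: "prob_space.indep_vars M (\<lambda>_. borel) Xs {1..}"
    and Xs_copies: "\<forall>i\<ge>1. distr M borel (Xs i) = distr M borel X"
    and eps_indep: "prob_space.indep_vars M (\<lambda>_. borel) \<epsilon>s {1..}"
    and eps_copies: "\<forall>i\<ge>1. distr M borel (\<epsilon>s i) = distr M borel \<epsilon>"
    and seqs_indep: "prob_space.indep_var M
          (\<Pi>\<^sub>M i\<in>{1..}. borel) (\<lambda>\<omega>. \<lambda>i\<in>{1..}. Xs i \<omega>)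
          (\<Pi>\<^sub>M i\<in>{1..}. borel) (\<lambda>\<omega>. \<lambda>i\<in>{1..}. \<epsilon>s i \<omega>)"
    and f_measurable: "\<forall>k. (\<lambda>(x, e). f k x e) \<in> borel_measurable (borel \<Otimes>\<^sub>M borel)"
    and X_no_atoms: "\<forall>x. measure (distr M borel X) {x} = 0"
    and f_bounded: "\<forall>k. \<exists>B. \<forall>x e. \<bar>f k x e\<bar> \<le> B"
    and var_pos: "\<forall>k. var M (Y k) > 0"
  shows "(\<forall>k. \<forall>n\<ge>1. Delta M Xs (\<phi> k) n =
            1 / real n * (\<integral>\<omega>. (let \<sigma> = periodic_ext n (rank_perm n (\<lambda>i. Xs i \<omega>)) in
               \<Sum>i=1..n. (\<phi> k (Xs (\<sigma> (i - 1)) \<omega>) - \<phi> k (Xs (\<sigma> i) \<omega>))\<^sup>2) \<partial>M))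
    \<and> (\<exists>N. gaussian_law N 0 (Gamma_mat M X \<epsilon> f) \<and>
          conv_in_law M
            (\<lambda>n \<omega>. \<chi> k. sqrt (real n) *
               (\<rho>hat n k \<omega> - (\<rho> k - Delta M Xs (\<phi> k) n / (2 * var M (Y k))))) N \<and>
          ((\<forall>k. (\<lambda>n. sqrt (real n) * Delta M Xs (\<phi> k) n) \<longlonglongrightarrow> 0) \<longrightarrow>
             conv_in_law M (\<lambda>n \<omega>. \<chi> k. sqrt (real n) * (\<rho>hat n k \<omega> - \<rho> k)) N))
    \<and> ((\<forall>k. bounded_2_variation (\<phi> k)) \<longrightarrow>
         (\<forall>k. (\<lambda>n. sqrt (real n) * Delta M Xs (\<phi> k) n) \<longlonglongrightarrow> 0))"
proof -
  interpret I: iid_inputs M X \<epsilon> Xs \<epsilon>s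
    by (rule iid_inputs.intro) (fact prob X_eps_indep Xs_indep Xs_copies eps_indep eps_copies seqs_indep X_no_atoms)+
  have f: "bdd2 (f k)" for k using f_measurable f_bounded unfolding bdd2_def by simp
  have \<phi>: "\<phi> k = I.R.cmean (f k)" for k unfolding \<phi>_def by (rule ext) (rule I.mean_eps_eq[OF f])
  have \<rho>: "\<rho> k = I.R.rho (f k)" for k unfolding \<rho>_def by (rule I.sobol_eq[OF f])
  have vY: "var M (Y k) = I.R.vY (f k)" for k unfolding Y_def by (rule I.var_eq[OF f])
  have V: "I.R.vY (f k) > 0" for k using var_pos vY by simp
  have m: "\<phi> k \<in> borel_measurable borel" for k unfolding \<phi> by (rule bdd2_fst_meas[OF I.R.bdd2_cmean[OF f]])
  have "\<forall>k. \<exists>B. \<forall>a. \<bar>\<phi> k a\<bar> \<le> B"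
    unfolding \<phi> using bdd2_bound[OF I.R.bdd2_cmean[OF f]] by blast
  then obtain B where B: "\<And>k a. \<bar>\<phi> k a\<bar> \<le> B k" using choice[of "\<lambda>k b. \<forall>a. \<bar>\<phi> k a\<bar> \<le> b"] by blast
  note D = I.Delta_eq[OF m B]
  have 1: "Delta M Xs (\<phi> k) n = 1 / real n * (\<integral>\<omega>. (let \<sigma> = periodic_ext n (rank_perm n (\<lambda>i. Xs i \<omega>)) in
               \<Sum>i=1..n. (\<phi> k (Xs (\<sigma> (i - 1)) \<omega>) - \<phi> k (Xs (\<sigma> i) \<omega>))\<^sup>2) \<partial>M)" if n: "n \<ge> 1" for k n
  proof -
    have e: "(let \<sigma> = periodic_ext n (rank_perm n (\<lambda>i. Xs i \<omega>)) in
               \<Sum>i=1..n. (\<phi> k (Xs (\<sigma> (i - 1)) \<omega>) - \<phi> k (Xs (\<sigma> i) \<omega>))\<^sup>2) = I.R.nb_sq n (\<phi> k) (\<lambda>i. Xs i \<omega>)" for \<omega>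
      unfolding Let_def I.R.nb_sq_def
      by (rule sum_periodic_ext[where F="\<lambda>i j. (\<phi> k (Xs i \<omega>) - \<phi> k (Xs j \<omega>))\<^sup>2"])
    show ?thesis unfolding e D(1)[OF n] D(2)[OF n] using n by simp
  qed
  \<comment> \<open>At \<open>n = 0\<close> the neighbour of observation 1 lies outside the empty
    sample and the two quantities may differ.\<close>
  have ev: "\<forall>\<^sub>F n in sequentially. Delta M Xs (\<phi> k) n = I.R.nb_gap (\<phi> k) n" for k
    by (rule eventually_sequentiallyI[of 1]) (rule D(1))
  obtain N where N: "gaussian_law N 0 (Gamma_mat M X \<epsilon> f)"
  proof -
    have "\<exists>N. gaussian_law N 0 (Gamma_mat M X \<epsilon> f)"
      by (rule gaussian_law_exists; unfold I.Gamma_eq[OF f]) (rule I.R.gam_sym, rule I.R.gam_psd[OF f])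
    then show thesis using that by blast
  qed
  \<comment> \<open>Used twice with the same \<open>N\<close>: with \<open>d\<close> the stated
    bias, and with \<open>d = 0\<close> when sqrt n Delta_n vanishes.\<close>
  note clt = I.rank_estimator_clt[OF f V N]
  have 2: "conv_in_law M (\<lambda>n \<omega>. \<chi> k. sqrt (real n) *
               (\<rho>hat n k \<omega> - (\<rho> k - Delta M Xs (\<phi> k) n / (2 * var M (Y k))))) N"
    unfolding \<rho>hat_def \<rho>
  proof (rule clt)
    show "(\<lambda>n. sqrt (real n) * (Delta M Xs (\<phi> k) n / (2 * var M (Y k)) - I.R.nb_gap (I.R.cmean (f k)) n / (2 * I.R.vY (f k)))) \<longlonglongrightarrow> 0" for k
      by (rule Lim_transform_eventually[OF tendsto_const]) (use ev[of k] in eventually_elim, simp add: vY flip: \<phi>)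
  qed
  have 3: "conv_in_law M (\<lambda>n \<omega>. \<chi> k. sqrt (real n) * (\<rho>hat n k \<omega> - \<rho> k)) N"
    if z: "\<forall>k. (\<lambda>n. sqrt (real n) * Delta M Xs (\<phi> k) n) \<longlonglongrightarrow> 0"
  proof -
    have "(\<lambda>n. sqrt (real n) * (0 - I.R.nb_gap (I.R.cmean (f k)) n / (2 * I.R.vY (f k)))) \<longlonglongrightarrow> 0" for k
    proof (rule Lim_transform_eventually)
      show "(\<lambda>n. - 1 / (2 * I.R.vY (f k)) * (sqrt (real n) * Delta M Xs (\<phi> k) n)) \<longlonglongrightarrow> 0"
        using tendsto_mult_right_zero[OF z[rule_format, of k]] .
      show "\<forall>\<^sub>F n in sequentially. - 1 / (2 * I.R.vY (f k)) * (sqrt (real n) * Delta M Xs (\<phi> k) n)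
          = sqrt (real n) * (0 - I.R.nb_gap (I.R.cmean (f k)) n / (2 * I.R.vY (f k)))"
        using ev[of k] by eventually_elim (simp flip: \<phi>)
    qed
    from clt[of "\<lambda>n k. 0", OF this] show ?thesis unfolding \<rho>hat_def \<rho> by simp
  qed
  \<comment> \<open>Bounded 2-variation gives a gap of order 1 / n, and sqrt n / n vanishes.\<close>
  have 4: "(\<lambda>n. sqrt (real n) * Delta M Xs (\<phi> k) n) \<longlonglongrightarrow> 0" if bv: "bounded_2_variation (\<phi> k)" for k
  proof -
    obtain C where C: "\<And>n. I.R.nb_gap (\<phi> k) n \<le> C / real n" using I.R.nb_gap_two_variation[OF m B bv] by blast
    have "(\<lambda>n. sqrt (real n) * I.R.nb_gap (\<phi> k) n) \<longlonglongrightarrow> 0"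
    proof (rule tendsto_sandwich[OF _ _ tendsto_const])
      have "(\<lambda>n. C * sqrt (1 / real n)) \<longlonglongrightarrow> C * sqrt 0" by (intro tendsto_intros lim_1_over_n)
      then show "(\<lambda>n. C * sqrt (1 / real n)) \<longlonglongrightarrow> 0" by simp
      show "\<forall>\<^sub>F n in sequentially. 0 \<le> sqrt (real n) * I.R.nb_gap (\<phi> k) n"
        by (intro always_eventually allI mult_nonneg_nonneg I.R.nb_gap_nonneg) simp
      show "\<forall>\<^sub>F n in sequentially. sqrt (real n) * I.R.nb_gap (\<phi> k) n \<le> C * sqrt (1 / real n)"
      proof (intro always_eventually allI)
        fix n
        have "sqrt (real n) * I.R.nb_gap (\<phi> k) n \<le> sqrt (real n) * (C / real n)" by (intro mult_left_mono C) simp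
        also have "\<dots> = C * (sqrt (real n) / real n)" by simp
        also have "\<dots> = C * sqrt (1 / real n)"
          by (simp only: sqrt_divide_self_eq[OF of_nat_0_le_iff] inverse_eq_divide real_sqrt_divide real_sqrt_one)
        finally show "sqrt (real n) * I.R.nb_gap (\<phi> k) n \<le> C * sqrt (1 / real n)" .
      qed
    qed
    then show ?thesis
      by (rule Lim_transform_eventually) (use ev[of k] in eventually_elim, simp)
  qed
  show ?thesis using 1 2 3 4 N by blast
qed

end
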